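(* Let $\Psi:\mathbb{R}\to\mathbb{R}$ and $J>0$ satisfy the standing assumptions (1)--(5) listed in the context, let $\mathcal{F}$ be the associated free energy functional, and let $\mu^-,\mu^0,\mu^+$ be the three measures defined in the context. Let $\mu\in\mathcal{P}_2(\mathbb{R})$ be such that $\int_{\mathbb{R}}z\,d\mu(z)\ne0$ and $\mathcal{F}(\mu)\le\mathcal{F}(\mu^0)$, and let $(S[\mu](t))_{t\in[0,\infty)}$ be the Wasserstein gradient flow for $\mathcal{F}$ with initial value $\mu$. Then $$\lim_{t\to\infty}\mathcal{F}(S[\mu](t))=\mathcal{F}(\mu^-)=\mathcal{F}(\mu^+),$$ and $$\lim_{t\to\infty}W_2(S[\mu](t),\mu^-)=0\ \text{ if }\int_{\mathbb{R}}z\,d\mu(z)<0,\qquad\lim_{t\to\infty}W_2(S[\mu](t),\mu^+)=0\ \text{ if }\int_{\mathbb{R}}z\,d\mu(z)>0.$$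
   Context: Standing assumptions on $\Psi:\mathbb{R}\to\mathbb{R}$ and $J>0$: (1) $\Psi=\Psi_c+\Psi_b$ with $\Psi_c,\Psi_b\in C^2(\mathbb{R})$, and there are constants $0<c,c'<\infty$ with $\Psi_c''\ge c$ and $|\Psi_b|+|\Psi_b'|+|\Psi_b''|\le c'$ on $\mathbb{R}$. (2) There exist $\epsilon,c''\in(0,\infty)$ with $\Psi(z)\ge c''(|z|^{2+\epsilon}-1)$ for all $z\in\mathbb{R}$. (3) $\Psi(z)=\Psi(-z)$ for all $z$. (4) $1/J<\int_{\mathbb{R}}z^2e^{-\Psi(z)}dz\big/\int_{\mathbb{R}}e^{-\Psi(z)}dz$. (5) $z\mapsto\Psi'(z)$ is convex on $[0,\infty)$. Wasserstein space: $\mathcal{P}_2(\mathbb{R})$ is the set of Borel probability measures on $\mathbb{R}$ with finite second moment, with the distance $W_2(\mu,\nu)^2=\inf_{\gamma}\int_{\mathbb{R}^2}|y-y'|^2\,d\gamma(y,y')$, the infimum over all couplings $\gamma$ of $\mu$ and $\nu$. Functional: $\mathcal{F}:\mathcal{P}_2(\mathbb{R})\to(-\infty,\infty]$ is $\mathcal{F}(\mu)=\int\log(\rho)\,d\mu+\int\Psi\,d\mu-\frac J2\left(\int z\,d\mu(z)\right)^2$ if $\mu$ has Lebesgue density $\rho$, and $\mathcal{F}(\mu)=\infty$ otherwise. $D(\mathcal{F})=\{\mathcal{F}<\infty\}$. Gradient flow: A curve $(\mu_t)_{t\in[0,\infty)}$ in $\mathcal{P}_2(\mathbb{R})$ is absolutely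 continuous if there is $m\in L^2_{\mathrm{loc}}((0,\infty))$ with $W_2(\mu_s,\mu_t)\le\int_s^tm(r)\,dr$ for all $0<s<t<\infty$; its metric derivative is $|\mu'|(t)=\lim_{s\to t}W_2(\mu_s,\mu_t)/|s-t|$, which exists for a.e. $t$. The metric slope is $|\partial\mathcal{F}|(\mu)=\limsup_{\nu\to\mu}\left(\frac{\mathcal{F}(\mu)-\mathcal{F}(\nu)}{W_2(\mu,\nu)}\right)^+$ for $\mu\in D(\mathcal{F})$ and $+\infty$ otherwise. The gradient flow for $\mathcal{F}$ with initial value $\mu\in\mathcal{P}_2(\mathbb{R})$ is the absolutely continuous curve $(S[\mu](t))_{t\in[0,\infty)}$ such that $\lim_{t\downarrow0}W_2(S[\mu](t),\mu)=0$, $t\mapsto\mathcal{F}(S[\mu](t))$ is locally absolutely continuous on $(0,\infty)$, and $\frac{d}{dt}\mathcal{F}(S[\mu](t))=-|\partial\mathcal{F}|^2(S[\mu](t))=-|(S[\mu])'|^2(t)$ for a.e. $t>0$. It is known that for every $\mu\in\mathcal{P}_2(\mathbb{R})$ it exists and is unique. The measures $\mu^-,\mu^0,\mu^+$: Let $\varphi^*(\sigma)=\log\int_{\mathbb{R}}e^{\sigma z-\Psi(z)}dz$ for $\sigma\in\mathbb{R}$, let $\varphi(m)=\sup_{\sigma\in\mathbb{R}}(\sigma m-\varphi^*(\sigma))$ be its Legendre transform, let $d\mu^\sigma(z)=e^{-\varphi^*(\sigma)+\sigma z-\Psi(z)}dz$, and let $\bar H(m)=\varphi(m)-\frac J2m^2$.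 It is known that $\bar H$ has exactly three critical points $-m^\star,0,m^\star$ for some $m^\star>0$. Set $\mu^-=\mu^{\varphi'(-m^\star)}$, $\mu^0=\mu^{\varphi'(0)}$, $\mu^+=\mu^{\varphi'(m^\star)}$. *)

theory Defs
  imports "HOL-Probability.Probability"
begin

definition C2 :: "(real \<Rightarrow> real) \<Rightarrow> bool" where
  "C2 f \<longleftrightarrow> (\<forall>x. f field_differentiable at x) \<and> (\<forall>x. deriv f field_differentiable at x) \<and>
     continuous_on UNIV (deriv (deriv f))"

definition standing_assumptions :: "(real \<Rightarrow> real) \<Rightarrow> real \<Rightarrow> bool" where
  "standing_assumptions \<Psi> J \<longleftrightarrow>
     J > 0 \<and>
     (\<exists>\<Psi>c \<Psi>b c c'. \<Psi> = (\<lambda>z. \<Psi>c z + \<Psi>b z) \<and> C2 \<Psi>c \<and> C2 \<Psi>b \<and> 0 < c \<and> 0 < c' \<and>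
        (\<forall>z. deriv (deriv \<Psi>c) z \<ge> c) \<and>
        (\<forall>z. \<bar>\<Psi>b z\<bar> + \<bar>deriv \<Psi>b z\<bar> + \<bar>deriv (deriv \<Psi>b) z\<bar> \<le> c')) \<and>
     (\<exists>\<epsilon> c''. 0 < \<epsilon> \<and> 0 < c'' \<and> (\<forall>z. \<Psi> z \<ge> c'' * (\<bar>z\<bar> powr (2 + \<epsilon>) - 1))) \<and>
     (\<forall>z. \<Psi> z = \<Psi> (- z)) \<and>
     1 / J < (\<integral>z. z\<^sup>2 * exp (- \<Psi> z) \<partial>lborel) / (\<integral>z. exp (- \<Psi> z) \<partial>lborel) \<and>
     convex_on {0..} (deriv \<Psi>)"

definition P2 :: "real measure set" where
  "P2 = {\<mu>. prob_space \<mu> \<and> sets \<mu> = sets borel \<and> integrable \<mu> (\<lambda>z. z\<^sup>2)}"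

definition couplings :: "real measure \<Rightarrow> real measure \<Rightarrow> (real \<times> real) measure set" where
  "couplings \<mu> \<nu> = {\<gamma>. prob_space \<gamma> \<and> sets \<gamma> = sets borel \<and>
     distr \<gamma> borel fst = \<mu> \<and> distr \<gamma> borel snd = \<nu>}"

text \<open>On \<^const>\<open>P2\<close> the infimum is finite, so the truncation by \<^const>\<open>enn2real\<close> has no effect.\<close>

definition W2 :: "real measure \<Rightarrow> real measure \<Rightarrow> real" where
  "W2 \<mu> \<nu> = sqrt (enn2real (INF \<gamma>\<in>couplings \<mu> \<nu>. \<integral>\<^sup>+(y, y'). ennreal (\<bar>y - y'\<bar>\<^sup>2) \<partial>\<gamma>))"

text \<open>The filter of \<open>\<nu> \<rightarrow> \<mu>\<close>, \<open>\<nu> \<noteq> \<mu>\<close>, in the metric space \<open>(P2, W2)\<close>.\<close>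

definition at_W2 :: "real measure \<Rightarrow> real measure filter" where
  "at_W2 \<mu> = inf (filtercomap (W2 \<mu>) (at_right 0)) (principal P2)"

lemma eventually_at_W2:
  "eventually P (at_W2 \<mu>) \<longleftrightarrow> (\<exists>r>0. \<forall>\<nu>\<in>P2. 0 < W2 \<mu> \<nu> \<and> W2 \<mu> \<nu> < r \<longrightarrow> P \<nu>)"
proof
  assume "eventually P (at_W2 \<mu>)"
  then obtain Q where Q: "eventually Q (at_right (0::real))"
    and QP: "\<And>\<nu>. Q (W2 \<mu> \<nu>) \<Longrightarrow> \<nu> \<in> P2 \<Longrightarrow> P \<nu>"
    unfolding at_W2_def eventually_inf_principal eventually_filtercomap by blast
  from Q obtain r where "r > 0" "\<And>y. 0 < y \<Longrightarrow> y < r \<Longrightarrow> Q y"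
    unfolding eventually_at_right_field by auto
  with QP show "\<exists>r>0. \<forall>\<nu>\<in>P2. 0 < W2 \<mu> \<nu> \<and> W2 \<mu> \<nu> < r \<longrightarrow> P \<nu>" by blast
next
  assume "\<exists>r>0. \<forall>\<nu>\<in>P2. 0 < W2 \<mu> \<nu> \<and> W2 \<mu> \<nu> < r \<longrightarrow> P \<nu>"
  then obtain r where r: "r > 0" "\<And>\<nu>. \<nu> \<in> P2 \<Longrightarrow> 0 < W2 \<mu> \<nu> \<Longrightarrow> W2 \<mu> \<nu> < r \<Longrightarrow> P \<nu>" by blast
  have "eventually (\<lambda>y. 0 < y \<and> y < r) (at_right (0::real))"
    unfolding eventually_at_right_field using r(1) by auto
  then show "eventually P (at_W2 \<mu>)"
    unfolding at_W2_def eventually_inf_principal eventually_filtercomap using r(2) by blast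
qed

text \<open>The integral with values in \<open>[-\<infinity>, \<infinity>]\<close>. Below it is only used for integrands whose negative
  part is integrable, so that \<open>\<infinity> - \<infinity>\<close> does not occur.\<close>

definition ext_integral :: "'a measure \<Rightarrow> ('a \<Rightarrow> real) \<Rightarrow> ereal" where
  "ext_integral M f =
     enn2ereal (\<integral>\<^sup>+x. ennreal (f x) \<partial>M) - enn2ereal (\<integral>\<^sup>+x. ennreal (- f x) \<partial>M)"

text \<open>The values \<open>ln 0 = 0\<close> and \<open>enn2real \<infinity> = 0\<close> only enter on \<open>\<mu>\<close>-null sets.\<close>

definition free_energy :: "(real \<Rightarrow> real) \<Rightarrow> real \<Rightarrow> real measure \<Rightarrow> ereal" where
  "free_energy \<Psi> J \<mu> =
     (if \<exists>\<rho>\<in>borel_measurable lborel. density lborel \<rho> = \<mu>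
      then ext_integral \<mu> (\<lambda>z. ln (enn2real (RN_deriv lborel \<mu> z))) + ext_integral \<mu> \<Psi>
             - ereal (J / 2 * (\<integral>z. z \<partial>\<mu>)\<^sup>2)
      else \<infinity>)"

definition L2_loc :: "(real \<Rightarrow> real) \<Rightarrow> bool" where
  "L2_loc m \<longleftrightarrow> set_borel_measurable lborel {0<..} m \<and>
     (\<forall>a b. 0 < a \<and> a < b \<longrightarrow> set_integrable lborel {a..b} (\<lambda>r. (m r)\<^sup>2))"

definition ac_curve :: "(real \<Rightarrow> real measure) \<Rightarrow> bool" where
  "ac_curve S \<longleftrightarrow> (\<forall>t\<ge>0. S t \<in> P2) \<and>
     (\<exists>m. L2_loc m \<and>
        (\<forall>s t. 0 < s \<and> s < t \<longrightarrow> W2 (S s) (S t) \<le> set_lebesgue_integral lborel {s..t} m))"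

definition has_metric_derivative :: "(real \<Rightarrow> real measure) \<Rightarrow> real \<Rightarrow> real \<Rightarrow> bool" where
  "has_metric_derivative S v t \<longleftrightarrow> ((\<lambda>s. W2 (S s) (S t) / \<bar>s - t\<bar>) \<longlongrightarrow> v) (at t)"

definition metric_slope :: "(real measure \<Rightarrow> ereal) \<Rightarrow> real measure \<Rightarrow> ereal" where
  "metric_slope F \<mu> =
     (if F \<mu> < \<infinity> then Limsup (at_W2 \<mu>) (\<lambda>\<nu>. max 0 ((F \<mu> - F \<nu>) / ereal (W2 \<mu> \<nu>))) else \<infinity>)"

definition abs_cont_on :: "real set \<Rightarrow> (real \<Rightarrow> real) \<Rightarrow> bool" where
  "abs_cont_on A f \<longleftrightarrow>
     (\<forall>e>0. \<exists>d>0. \<forall>I. finite I \<and> (\<forall>(a, b)\<in>I. a < b \<and> {a..b} \<subseteq> A) \<and>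
        pairwise (\<lambda>p q. {fst p<..<snd p} \<inter> {fst q<..<snd q} = {}) I \<and>
        (\<Sum>(a, b)\<in>I. b - a) < d \<longrightarrow> (\<Sum>(a, b)\<in>I. \<bar>f b - f a\<bar>) < e)"

definition locally_abs_cont :: "(real \<Rightarrow> real) \<Rightarrow> bool" where
  "locally_abs_cont f \<longleftrightarrow> (\<forall>a b. 0 < a \<and> a < b \<longrightarrow> abs_cont_on {a..b} f)"

text \<open>Local absolute continuity of \<open>t \<mapsto> F (S t)\<close> includes that it is real-valued on \<open>(0, \<infinity>)\<close>.
  The last conjunct reads \<open>(F \<circ> S)'(t) = -|\<partial>F|\<^sup>2(S t) = -|S'|\<^sup>2(t)\<close> for almost every \<open>t > 0\<close>,
  including the existence of the two derivatives.\<close>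

definition gradient_flow ::
    "(real measure \<Rightarrow> ereal) \<Rightarrow> real measure \<Rightarrow> (real \<Rightarrow> real measure) \<Rightarrow> bool" where
  "gradient_flow F \<mu> S \<longleftrightarrow>
     ac_curve S \<and>
     ((\<lambda>t. W2 (S t) \<mu>) \<longlongrightarrow> 0) (at_right 0) \<and>
     (\<forall>t>0. \<bar>F (S t)\<bar> \<noteq> \<infinity>) \<and>
     locally_abs_cont (\<lambda>t. real_of_ereal (F (S t))) \<and>
     (AE t in lborel. t > 0 \<longrightarrow>
        (\<exists>d v. ((\<lambda>t. real_of_ereal (F (S t))) has_real_derivative d) (at t) \<and>
           has_metric_derivative S v t \<and>
           ereal d = - (metric_slope F (S t))\<^sup>2 \<and> d = - v\<^sup>2))"

definition phi_star :: "(real \<Rightarrow> real) \<Rightarrow> real \<Rightarrow> real" where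
  "phi_star \<Psi> \<sigma> = ln (\<integral>z. exp (\<sigma> * z - \<Psi> z) \<partial>lborel)"

text \<open>Under the standing assumptions the supremum is finite for every \<open>m\<close>.\<close>

definition phi :: "(real \<Rightarrow> real) \<Rightarrow> real \<Rightarrow> real" where
  "phi \<Psi> m = (SUP \<sigma>. \<sigma> * m - phi_star \<Psi> \<sigma>)"

definition gibbs :: "(real \<Rightarrow> real) \<Rightarrow> real \<Rightarrow> real measure" where
  "gibbs \<Psi> \<sigma> = density lborel (\<lambda>z. ennreal (exp (- phi_star \<Psi> \<sigma> + \<sigma> * z - \<Psi> z)))"

definition H_bar :: "(real \<Rightarrow> real) \<Rightarrow> real \<Rightarrow> real \<Rightarrow> real" where
  "H_bar \<Psi> J m = phi \<Psi> m - J / 2 * m\<^sup>2"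

definition m_star :: "(real \<Rightarrow> real) \<Rightarrow> real \<Rightarrow> real" where
  "m_star \<Psi> J =
     (THE m. 0 < m \<and> {x. (H_bar \<Psi> J has_real_derivative 0) (at x)} = {- m, 0, m})"

definition mu_minus :: "(real \<Rightarrow> real) \<Rightarrow> real \<Rightarrow> real measure" where
  "mu_minus \<Psi> J = gibbs \<Psi> (deriv (phi \<Psi>) (- m_star \<Psi> J))"

definition mu_zero :: "(real \<Rightarrow> real) \<Rightarrow> real measure" where
  "mu_zero \<Psi> = gibbs \<Psi> (deriv (phi \<Psi>) 0)"

definition mu_plus :: "(real \<Rightarrow> real) \<Rightarrow> real \<Rightarrow> real measure" where
  "mu_plus \<Psi> J = gibbs \<Psi> (deriv (phi \<Psi>) (m_star \<Psi> J))"

end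

theory Submission
  imports Defs
begin

text \<open>
  On the line, quantile functions embed \<open>(P2, W2)\<close> isometrically into \<open>L\<^sup>2(0, 1)\<close>, and interpolating
  quantiles linearly makes the energy \<open>F\<close> convex up to a quadratic error. Hence the metric slope bounds
  \<open>F\<close> from below globally, and the flow satisfies an evolution variational inequality, which yields
  \<open>F (S t) \<le> F \<mu>\<close> for all \<open>t > 0\<close>.

  Since the slope is square integrable in time, it tends to \<open>0\<close> along some times \<open>t\<^sub>n\<close>. By first variations
  any weak limit of \<open>S t\<^sub>n\<close> solves the Stein equation of a Gibbs measure whose mean is a critical point of
  \<open>H_bar\<close>; the superquadratic growth of \<open>\<Psi>\<close> upgrades this to convergence in \<open>W2\<close> and of the energy. The
  critical value at \<open>0\<close> is excluded because \<open>F (S t) \<le> F \<mu> \<le> H_bar 0\<close>, with equality only if the flow is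
  constant. The same bound together with \<open>H_bar (mean \<nu>) \<le> F \<nu>\<close> keeps the mean away from \<open>0\<close>, so it
  keeps its sign and tends to the minimiser of \<open>H_bar\<close> of that sign. The relative entropy with respect to
  the corresponding Gibbs measure then tends to \<open>0\<close>, which forces convergence in \<open>W2\<close>.

  That \<open>H_bar\<close> has exactly three critical points is seen from the identity
  \<open>\<sigma> / \<phi>*'(\<sigma>) = \<integral> \<Psi>' sinh(\<sigma> z) exp(-\<Psi>) / \<integral> z sinh(\<sigma> z) exp(-\<Psi>)\<close> (integration by parts): the right-hand
  side averages the nondecreasing function \<open>\<Psi>'(z) / z\<close> against weights that are monotone in the likelihood
  ratio order.
\<close>

section \<open>The Wasserstein distance on the line\<close>

text \<open>A flow is only required to approach \<open>\<mu>\<close> in \<open>W2\<close> as time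
  tends to \<open>0\<close>; its definition does not relate the energy at positive times to the
  energy of \<open>\<mu>\<close>. The evolution inequality is therefore proved in the form that
  closes this gap: while the energy of \<open>S t\<close> exceeds that of \<open>y\<close> by more
  than \<open>(L + J) / 2 * (W2 (S t) y)\<^sup>2\<close>, the distance to \<open>y\<close> does not
  increase to the right of \<open>t\<close>. The constant is the sum of two defects of convexity:
  \<open>L\<close> bounds the concavity of \<open>\<Psi>\<close>, and \<open>J\<close> is the
  concavity of the interaction, since the mean is 1-Lipschitz for \<open>W2\<close>. Differential
  information about a flow holds only almost everywhere, so each monotonicity claim needs absolute
  continuity to cross an exceptional null set. Interpolation and first variation both need only an
  upper bound for the entropy of an image measure, which is why a single domination criterion serves
  both. Comparisons with Gibbs measures likewise rest on one inequality,
  \<open>gibbs_variational\<close>: linear test functions give \<open>H_bar\<close>, powers give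
  moments, indicators give weak convergence.\<close>

abbreviation U01 :: "real measure" where "U01 \<equiv> restrict_space lborel {0<..<1}"

text \<open>The generalised inverse of the distribution function, in the form of \<open>I\<close>
  from the locale \<open>cdf_distribution\<close>; measurability, the equivalence with
  \<open>cdf\<close> and the image of the uniform law are inherited from there.\<close>

definition quantile :: "real measure \<Rightarrow> real \<Rightarrow> real" where
  "quantile \<mu> r = Inf {x. r \<le> cdf \<mu> x}"

lemma prob_space_U01: "prob_space U01"
  by (auto simp: space_restrict_space emeasure_restrict_space intro!: prob_spaceI)

lemma space_U01 [simp]: "space U01 = {0<..<1}"
  by (simp add: space_restrict_space)

lemma P2D:
  assumes "\<mu> \<in> P2"
  shows "prob_space \<mu>" "sets \<mu> = sets borel" "space \<mu> = UNIV" "integrable \<mu> (\<lambda>z. z\<^sup>2)"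
    "real_distribution \<mu>" "finite_measure \<mu>" "cdf_distribution \<mu>"
proof -
  show 1: "prob_space \<mu>" "sets \<mu> = sets borel" "integrable \<mu> (\<lambda>z. z\<^sup>2)"
    using assms by (auto simp: P2_def)
  show "space \<mu> = UNIV" using sets_eq_imp_space_eq[OF 1(2)] by simp
  show "real_distribution \<mu>" using 1 by (simp add: real_distribution_def real_distribution_axioms_def)
  then show "cdf_distribution \<mu>" by (simp add: cdf_distribution_def)
  show "finite_measure \<mu>" using 1 by (simp add: prob_space.finite_measure)
qed

lemma P2_integrable_quad:
  assumes "\<mu> \<in> P2" "g \<in> borel_measurable borel" "\<And>z. \<bar>g z\<bar> \<le> a + b * z\<^sup>2"
  shows "integrable \<mu> (g :: real \<Rightarrow> real)"
proof -
  interpret finite_measure \<mu> using P2D(6)[OF assms(1)] .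
  note [measurable_cong] = P2D(2)[OF assms(1)]
  show ?thesis
  proof (rule Bochner_Integration.integrable_bound[where f="\<lambda>z. a + b * z\<^sup>2"])
    show "integrable \<mu> (\<lambda>z. a + b * z\<^sup>2)" using P2D(4)[OF assms(1)] by auto
    show "g \<in> borel_measurable \<mu>" using assms(2) by measurable
    show "AE x in \<mu>. norm (g x) \<le> norm (a + b * x\<^sup>2)" using assms(3) by (auto intro!: AE_I2 order_trans[OF assms(3)])
  qed
qed

lemma abs_le_1_plus_square: "\<bar>z\<bar> \<le> 1 + 1 * (z::real)\<^sup>2"
proof (cases "\<bar>z\<bar> \<le> 1")
  case False
  then have "\<bar>z\<bar> * 1 \<le> \<bar>z\<bar> * \<bar>z\<bar>" by (intro mult_left_mono) auto
  then show ?thesis by (simp add: power2_eq_square)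
qed (simp add: order_trans[of _ 1])

lemma P2_integrable_id: "\<mu> \<in> P2 \<Longrightarrow> integrable \<mu> (\<lambda>z. z)"
  by (rule P2_integrable_quad[where a=1 and b=1]) (auto intro: abs_le_1_plus_square[simplified])

lemma quantile_measurable [measurable]:
  assumes "\<mu> \<in> P2" shows "quantile \<mu> \<in> borel_measurable U01"
proof -
  interpret cdf_distribution \<mu> using P2D(7)[OF assms] .
  have "quantile \<mu> = I" by (simp add: fun_eq_iff quantile_def)
  moreover have "measurable U01 (borel :: real measure) = measurable (restrict_space borel {0<..<1}) borel"
    by (intro measurable_cong_sets sets_restrict_space_cong) auto
  ultimately show ?thesis using measurable_CI by simp
qed

lemma distr_quantile:
  assumes "\<mu> \<in> P2" shows "distr U01 borel (quantile \<mu>) = \<mu>"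
proof -
  interpret cdf_distribution \<mu> using P2D(7)[OF assms] .
  have "quantile \<mu> = I" by (simp add: fun_eq_iff quantile_def)
  then show ?thesis using distr_I_eq_M by simp
qed

lemma quantile_le_iff:
  assumes "\<mu> \<in> P2" "0 < r" "r < 1"
  shows "quantile \<mu> r \<le> x \<longleftrightarrow> r \<le> cdf \<mu> x"
proof -
  interpret cdf_distribution \<mu> using P2D(7)[OF assms(1)] .
  show ?thesis unfolding quantile_def by (rule pseudoinverse[OF assms(2,3), symmetric])
qed

lemma quantile_mono:
  assumes "\<mu> \<in> P2" "0 < r" "r \<le> s" "s < 1"
  shows "quantile \<mu> r \<le> quantile \<mu> s"
  using quantile_le_iff[OF assms(1), of r "quantile \<mu> s"] quantile_le_iff[OF assms(1), of s "quantile \<mu> s"] assms by auto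

lemma quantile_P2_distr:
  fixes f :: "real \<Rightarrow> real"
  assumes "\<mu> \<in> P2" "f \<in> borel_measurable borel"
  shows "integrable \<mu> f \<longleftrightarrow> integrable U01 (\<lambda>r. f (quantile \<mu> r))" (is ?A)
    and "integral\<^sup>L \<mu> f = (\<integral>r. f (quantile \<mu> r) \<partial>U01)" (is ?B)
proof -
  note [measurable] = quantile_measurable[OF assms(1)] assms(2)
  show ?A using integrable_distr_eq[of "quantile \<mu>" U01 borel f] distr_quantile[OF assms(1)] by simp
  show ?B using integral_distr[of "quantile \<mu>" U01 borel f] distr_quantile[OF assms(1)] by simp
qed

lemma P2_distrI:
  assumes "prob_space M" "X \<in> borel_measurable M" "integrable M (\<lambda>w. (X w)\<^sup>2)"
  shows "distr M borel X \<in> P2"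
proof -
  interpret prob_space M by fact
  show ?thesis unfolding P2_def using assms
    by (auto simp: prob_space_distr integrable_distr_eq)
qed

section \<open>Optimality of the quantile coupling\<close>

text \<open>The set is a right triangle with both legs of length \<open>b - a\<close>, empty if
  \<open>b \<le> a\<close>; hence the \<open>max\<close>.\<close>

lemma kernel_area:
  fixes a b :: real
  shows "(\<integral>\<^sup>+p. indicator {p. a \<le> fst p \<and> fst p < snd p \<and> snd p < b} p \<partial>(lborel \<Otimes>\<^sub>M lborel))
     = ennreal ((max 0 (b - a))\<^sup>2 / 2)"
proof -
  let ?f = "indicator {p :: real \<times> real. a \<le> fst p \<and> fst p < snd p \<and> snd p < b} :: real \<times> real \<Rightarrow> ennreal"
  have "(\<integral>\<^sup>+p. ?f p \<partial>(lborel \<Otimes>\<^sub>M lborel)) = (\<integral>\<^sup>+u. \<integral>\<^sup>+w. ?f (u, w) \<partial>lborel \<partial>lborel)"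
    by (rule lborel.nn_integral_fst[symmetric]) measurable
  also have "\<dots> = (\<integral>\<^sup>+u. ennreal (b - u) * indicator {a..b} u \<partial>lborel)"
  proof (rule nn_integral_cong)
    fix u :: real
    have "(\<integral>\<^sup>+w. ?f (u, w) \<partial>lborel) = (\<integral>\<^sup>+w. indicator {a..} u * indicator {u<..<b} w \<partial>lborel)"
      by (intro nn_integral_cong) (auto split: split_indicator)
    also have "\<dots> = indicator {a..} u * emeasure lborel {u<..<b}"
      by (simp add: nn_integral_cmult)
    also have "\<dots> = ennreal (b - u) * indicator {a..b} u"
      by (cases "u \<le> b") (auto split: split_indicator)
    finally show "(\<integral>\<^sup>+w. ?f (u, w) \<partial>lborel) = ennreal (b - u) * indicator {a..b} u" .
  qed
  also have "\<dots> = ennreal ((max 0 (b - a))\<^sup>2 / 2)"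
  proof (cases "a \<le> b")
    case True
    have "(\<integral>\<^sup>+u. ennreal (b - u) * indicator {a..b} u \<partial>lborel) = ennreal (- (b - b)\<^sup>2/2 - (- (b - a)\<^sup>2/2))"
      by (rule nn_integral_FTC_Icc[where F="\<lambda>u. - (b - u)\<^sup>2/2"])
         (use True in \<open>auto intro!: derivative_eq_intros simp: field_simps\<close>)
    with True show ?thesis by simp
  next
    case False
    then have "{a..b} = {}" by auto
    then show ?thesis using False by simp
  qed
  finally show ?thesis .
qed

text \<open>Representing the cost by the events that one coordinate lies below \<open>u\<close> and the other above \<open>w\<close>
  reduces optimality of the quantile coupling to the bound \<open>P(X \<le> u, Y > w) \<ge> P(X \<le> u) - P(Y \<le> w)\<close>.\<close>

lemma square_diff_kernel:
  fixes y y' :: real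
  shows "ennreal ((y - y')\<^sup>2) = 2 * (\<integral>\<^sup>+p. indicator {p. y \<le> fst p \<and> fst p < snd p \<and> snd p < y'} p
     + indicator {p. y' \<le> fst p \<and> fst p < snd p \<and> snd p < y} p \<partial>(lborel \<Otimes>\<^sub>M lborel))"
proof -
  have m: "(\<lambda>p. indicator {p :: real \<times> real. a \<le> fst p \<and> fst p < snd p \<and> snd p < b} p :: ennreal)
     \<in> borel_measurable (lborel \<Otimes>\<^sub>M lborel)" for a b :: real by measurable
  show ?thesis
  proof -
    let ?A = "(max 0 (y' - y))\<^sup>2 / 2" and ?B = "(max 0 (y - y'))\<^sup>2 / 2"
    have "ennreal ((y - y')\<^sup>2) = ennreal (2 * (?A + ?B))"
      by (rule arg_cong[where f=ennreal]) (auto simp: max_def power2_commute)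
    also have "\<dots> = ennreal 2 * (ennreal ?A + ennreal ?B)"
      by (subst ennreal_mult) auto
    finally show ?thesis by (subst nn_integral_add[OF m m]) (simp only: kernel_area ennreal_numeral)
  qed
qed

text \<open>The kernel formula integrated over \<open>M\<close>, with Fubini. The cost depends on
  the pair only through crossing probabilities, which can be compared separately for each
  \<open>u < w\<close>.\<close>

lemma transport_cost:
  fixes X Y :: "'a \<Rightarrow> real"
  assumes "prob_space M" and [measurable]: "X \<in> borel_measurable M" "Y \<in> borel_measurable M"
  shows "(\<integral>\<^sup>+x. ennreal ((X x - Y x)\<^sup>2) \<partial>M) = 2 * (\<integral>\<^sup>+p.
     emeasure M {x \<in> space M. X x \<le> fst p \<and> fst p < snd p \<and> snd p < Y x} +
     emeasure M {x \<in> space M. Y x \<le> fst p \<and> fst p < snd p \<and> snd p < X x} \<partial>(lborel \<Otimes>\<^sub>M lborel))"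
proof -
  interpret prob_space M by fact
  interpret L: pair_sigma_finite "lborel :: real measure" "lborel :: real measure" ..
  interpret L2: sigma_finite_measure "lborel \<Otimes>\<^sub>M lborel :: (real \<times> real) measure"
    by (rule sigma_finite_pair_measure) (rule lborel.sigma_finite_measure_axioms)+
  interpret P: pair_sigma_finite M "lborel \<Otimes>\<^sub>M lborel :: (real \<times> real) measure" ..
  let ?K = "\<lambda>x p. indicator {p :: real \<times> real. X x \<le> fst p \<and> fst p < snd p \<and> snd p < Y x} p
     + indicator {p. Y x \<le> fst p \<and> fst p < snd p \<and> snd p < X x} p :: ennreal"
  have "(\<integral>\<^sup>+x. ennreal ((X x - Y x)\<^sup>2) \<partial>M) = (\<integral>\<^sup>+x. 2 * (\<integral>\<^sup>+p. ?K x p \<partial>(lborel \<Otimes>\<^sub>M lborel)) \<partial>M)"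
    by (simp only: square_diff_kernel)
  also have "\<dots> = 2 * (\<integral>\<^sup>+x. (\<integral>\<^sup>+p. ?K x p \<partial>(lborel \<Otimes>\<^sub>M lborel)) \<partial>M)"
    by (rule nn_integral_cmult) measurable
  also have "(\<integral>\<^sup>+x. (\<integral>\<^sup>+p. ?K x p \<partial>(lborel \<Otimes>\<^sub>M lborel)) \<partial>M) = (\<integral>\<^sup>+p. (\<integral>\<^sup>+x. ?K x p \<partial>M) \<partial>(lborel \<Otimes>\<^sub>M lborel))"
    using P.Fubini[of "\<lambda>(x,p). ?K x p"] by simp
  also have "\<dots> = (\<integral>\<^sup>+p.
     emeasure M {x \<in> space M. X x \<le> fst p \<and> fst p < snd p \<and> snd p < Y x} +
     emeasure M {x \<in> space M. Y x \<le> fst p \<and> fst p < snd p \<and> snd p < X x} \<partial>(lborel \<Otimes>\<^sub>M lborel))"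
  proof (rule nn_integral_cong)
    fix p :: "real \<times> real"
    have "(\<integral>\<^sup>+x. ?K x p \<partial>M) = (\<integral>\<^sup>+x. indicator {x \<in> space M. X x \<le> fst p \<and> fst p < snd p \<and> snd p < Y x} x
      + indicator {x \<in> space M. Y x \<le> fst p \<and> fst p < snd p \<and> snd p < X x} x \<partial>M)"
      by (rule nn_integral_cong) (auto split: split_indicator)
    also have "\<dots> = emeasure M {x \<in> space M. X x \<le> fst p \<and> fst p < snd p \<and> snd p < Y x} +
     emeasure M {x \<in> space M. Y x \<le> fst p \<and> fst p < snd p \<and> snd p < X x}"
      by (subst nn_integral_add) auto
    finally show "(\<integral>\<^sup>+x. ?K x p \<partial>M) = emeasure M {x \<in> space M. X x \<le> fst p \<and> fst p < snd p \<and> snd p < Y x} +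
     emeasure M {x \<in> space M. Y x \<le> fst p \<and> fst p < snd p \<and> snd p < X x}" .
  qed
  finally show ?thesis .
qed

text \<open>For quantiles the crossing event lies in the interval from \<open>cdf \<nu> w\<close> to
  \<open>cdf \<mu> u\<close>, so its probability stays below the lower bound valid for every
  coupling.\<close>

lemma emeasure_quantile_crossing:
  assumes "\<mu> \<in> P2" "\<nu> \<in> P2"
  shows "emeasure U01 {r \<in> space U01. quantile \<mu> r \<le> u \<and> u < w \<and> w < quantile \<nu> r} \<le> ennreal (cdf \<mu> u - cdf \<nu> w)"
proof -
  have n: "0 \<le> cdf \<nu> w" by (simp add: cdf_def)
  have "{r \<in> space U01. quantile \<mu> r \<le> u \<and> u < w \<and> w < quantile \<nu> r} \<subseteq> {cdf \<nu> w<..cdf \<mu> u} \<inter> {0<..<1}"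
  proof
    fix r assume r: "r \<in> {r \<in> space U01. quantile \<mu> r \<le> u \<and> u < w \<and> w < quantile \<nu> r}"
    then have "r \<le> cdf \<mu> u" using quantile_le_iff[OF assms(1), of r u] by simp
    moreover have "\<not> r \<le> cdf \<nu> w" using r quantile_le_iff[OF assms(2), of r w] by simp
    ultimately show "r \<in> {cdf \<nu> w<..cdf \<mu> u} \<inter> {0<..<1}" using r by simp
  qed
  then have "emeasure U01 {r \<in> space U01. quantile \<mu> r \<le> u \<and> u < w \<and> w < quantile \<nu> r} \<le> emeasure U01 ({cdf \<nu> w<..cdf \<mu> u} \<inter> {0<..<1})"
    by (rule emeasure_mono) (simp add: sets_restrict_space_iff)
  also have "\<dots> \<le> emeasure lborel {cdf \<nu> w<..cdf \<mu> u}"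
    by (subst emeasure_restrict_space) (auto intro!: emeasure_mono)
  also have "\<dots> \<le> ennreal (cdf \<mu> u - cdf \<nu> w)" by (cases "cdf \<nu> w \<le> cdf \<mu> u") (auto simp: )
  finally show ?thesis .
qed

text \<open>Union bound: where \<open>X \<le> u\<close>, either the crossing occurs or
  \<open>Y \<le> w\<close>.\<close>

lemma emeasure_coupling_crossing:
  assumes "prob_space M" and [measurable]: "X \<in> borel_measurable M" "Y \<in> borel_measurable M" and "(u::real) < w"
  shows "ennreal (cdf (distr M borel X) u - cdf (distr M borel Y) w) \<le>
    emeasure M {x \<in> space M. X x \<le> u \<and> u < w \<and> w < Y x}"
proof -
  interpret prob_space M by fact
  have "cdf (distr M borel X) u = prob {x \<in> space M. X x \<le> u}"
    unfolding cdf_def by (subst measure_distr) (auto intro!: arg_cong[where f=prob])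
  also have "\<dots> \<le> prob ({x \<in> space M. X x \<le> u \<and> u < w \<and> w < Y x} \<union> {x \<in> space M. Y x \<le> w})"
    by (rule finite_measure_mono) (use assms in auto)
  also have "\<dots> \<le> prob {x \<in> space M. X x \<le> u \<and> u < w \<and> w < Y x} + prob {x \<in> space M. Y x \<le> w}"
    by (rule measure_subadditive) auto
  also have "prob {x \<in> space M. Y x \<le> w} = cdf (distr M borel Y) w"
    unfolding cdf_def by (subst measure_distr) (auto intro!: arg_cong[where f=prob])
  finally show ?thesis by (simp add: emeasure_eq_measure ennreal_leI)
qed

text \<open>The quantile pair minimises all crossing probabilities simultaneously and in both
  directions, so the integrands of \<open>transport_cost\<close> compare pointwise.\<close>

lemma quantile_coupling_optimal:
  assumes "prob_space M" and X[measurable]: "X \<in> borel_measurable M" and Y[measurable]: "Y \<in> borel_measurable M"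
    and dX: "distr M borel X = \<mu>" and dY: "distr M borel Y = \<nu>" and "\<mu> \<in> P2" "\<nu> \<in> P2"
  shows "(\<integral>\<^sup>+r. ennreal ((quantile \<mu> r - quantile \<nu> r)\<^sup>2) \<partial>U01) \<le> (\<integral>\<^sup>+x. ennreal ((X x - Y x)\<^sup>2) \<partial>M)"
proof -
  have 1: "emeasure U01 {r \<in> space U01. quantile \<mu> r \<le> u \<and> u < w \<and> w < quantile \<nu> r} \<le> emeasure M {x \<in> space M. X x \<le> u \<and> u < w \<and> w < Y x}"
    if "u < w" for u w
    using emeasure_quantile_crossing[OF assms(6,7), of u w] emeasure_coupling_crossing[OF assms(1) X Y that]
    unfolding dX dY by (rule order_trans)
  have 2: "emeasure U01 {r \<in> space U01. quantile \<nu> r \<le> u \<and> u < w \<and> w < quantile \<mu> r} \<le> emeasure M {x \<in> space M. Y x \<le> u \<and> u < w \<and> w < X x}"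
    if "u < w" for u w
    using emeasure_quantile_crossing[OF assms(7,6), of u w] emeasure_coupling_crossing[OF assms(1) Y X that]
    unfolding dX dY by (rule order_trans)
  show ?thesis
    unfolding transport_cost[OF assms(1) X Y] transport_cost[OF prob_space_U01 quantile_measurable[OF assms(6)] quantile_measurable[OF assms(7)]]
  proof (intro mult_left_mono nn_integral_mono add_mono)
    fix p :: "real \<times> real"
    show "emeasure U01 {r \<in> space U01. quantile \<mu> r \<le> fst p \<and> fst p < snd p \<and> snd p < quantile \<nu> r} \<le> emeasure M {x \<in> space M. X x \<le> fst p \<and> fst p < snd p \<and> snd p < Y x}"
      using 1[of "fst p" "snd p"] by (cases "fst p < snd p") auto
    show "emeasure U01 {r \<in> space U01. quantile \<nu> r \<le> fst p \<and> fst p < snd p \<and> snd p < quantile \<mu> r} \<le> emeasure M {x \<in> space M. Y x \<le> fst p \<and> fst p < snd p \<and> snd p < X x}"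
      using 2[of "fst p" "snd p"] by (cases "fst p < snd p") auto
  qed auto
qed

lemma coupling_distr_pair:
  fixes X Y :: "'a \<Rightarrow> real"
  assumes "prob_space M" and [measurable]: "X \<in> borel_measurable M" "Y \<in> borel_measurable M"
  shows "distr M borel (\<lambda>x. (X x, Y x)) \<in> couplings (distr M borel X) (distr M borel Y)"
    and "(\<integral>\<^sup>+(y, y'). ennreal (\<bar>y - y'\<bar>\<^sup>2) \<partial>distr M borel (\<lambda>x. (X x, Y x))) = (\<integral>\<^sup>+x. ennreal ((X x - Y x)\<^sup>2) \<partial>M)"
proof -
  interpret prob_space M by fact
  have [measurable]: "(fst :: real \<times> real \<Rightarrow> real) \<in> borel_measurable borel" "(snd :: real \<times> real \<Rightarrow> real) \<in> borel_measurable borel"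
    by (auto simp: borel_prod[symmetric])
  show "distr M borel (\<lambda>x. (X x, Y x)) \<in> couplings (distr M borel X) (distr M borel Y)"
    unfolding couplings_def by (auto simp: prob_space_distr distr_distr comp_def)
  show "(\<integral>\<^sup>+(y, y'). ennreal (\<bar>y - y'\<bar>\<^sup>2) \<partial>distr M borel (\<lambda>x. (X x, Y x))) = (\<integral>\<^sup>+x. ennreal ((X x - Y x)\<^sup>2) \<partial>M)"
    by (subst nn_integral_distr) (auto simp: split_beta)
qed

text \<open>Kept in \<open>ennreal\<close> so that finiteness is a separate matter;
  \<open>W2_square\<close> then removes the truncation.\<close>

lemma W2_cost_eq:
  assumes "\<mu> \<in> P2" "\<nu> \<in> P2"
  shows "(INF \<gamma>\<in>couplings \<mu> \<nu>. \<integral>\<^sup>+(y, y'). ennreal (\<bar>y - y'\<bar>\<^sup>2) \<partial>\<gamma>) = (\<integral>\<^sup>+r. ennreal ((quantile \<mu> r - quantile \<nu> r)\<^sup>2) \<partial>U01)"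
proof (rule antisym)
  show "(INF \<gamma>\<in>couplings \<mu> \<nu>. \<integral>\<^sup>+(y, y'). ennreal (\<bar>y - y'\<bar>\<^sup>2) \<partial>\<gamma>) \<le> (\<integral>\<^sup>+r. ennreal ((quantile \<mu> r - quantile \<nu> r)\<^sup>2) \<partial>U01)"
    using coupling_distr_pair[OF prob_space_U01 quantile_measurable[OF assms(1)] quantile_measurable[OF assms(2)]]
    by (intro INF_lower2) (auto simp: distr_quantile[OF assms(1)] distr_quantile[OF assms(2)])
  show "(\<integral>\<^sup>+r. ennreal ((quantile \<mu> r - quantile \<nu> r)\<^sup>2) \<partial>U01) \<le> (INF \<gamma>\<in>couplings \<mu> \<nu>. \<integral>\<^sup>+(y, y'). ennreal (\<bar>y - y'\<bar>\<^sup>2) \<partial>\<gamma>)"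
  proof (rule INF_greatest)
    fix \<gamma> assume g: "\<gamma> \<in> couplings \<mu> \<nu>"
    then have [measurable_cong]: "sets \<gamma> = sets borel" by (simp add: couplings_def)
    have m: "(fst :: real \<times> real \<Rightarrow> real) \<in> borel_measurable \<gamma>" "(snd :: real \<times> real \<Rightarrow> real) \<in> borel_measurable \<gamma>"
      by (auto simp: borel_prod[symmetric] measurable_cong_sets[OF \<open>sets \<gamma> = sets borel\<close> refl])
    show "(\<integral>\<^sup>+r. ennreal ((quantile \<mu> r - quantile \<nu> r)\<^sup>2) \<partial>U01) \<le> (\<integral>\<^sup>+(y, y'). ennreal (\<bar>y - y'\<bar>\<^sup>2) \<partial>\<gamma>)"
      using quantile_coupling_optimal[OF _ m _ _ assms] g by (auto simp: couplings_def case_prod_unfold)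
  qed
qed

lemma quantile_square_integrable: "\<mu> \<in> P2 \<Longrightarrow> integrable U01 (\<lambda>r. (quantile \<mu> r)\<^sup>2)"
  using quantile_P2_distr(1)[of \<mu> "\<lambda>z. z\<^sup>2"] P2D(4) by simp

lemma integrable_mult_L2:
  fixes X Y :: "'a \<Rightarrow> real"
  assumes "integrable M (\<lambda>w. (X w)\<^sup>2)" "integrable M (\<lambda>w. (Y w)\<^sup>2)"
   and [measurable]: "X \<in> borel_measurable M" "Y \<in> borel_measurable M"
  shows "integrable M (\<lambda>w. X w * Y w)"
proof (rule Bochner_Integration.integrable_bound[where f="\<lambda>w. (X w)\<^sup>2 + (Y w)\<^sup>2"])
  show "AE x in M. norm (X x * Y x) \<le> norm ((X x)\<^sup>2 + (Y x)\<^sup>2)"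
  proof (rule AE_I2)
    fix x
    have "0 \<le> (\<bar>X x\<bar> - \<bar>Y x\<bar>)\<^sup>2" by simp
    then have "2 * \<bar>X x * Y x\<bar> \<le> (X x)\<^sup>2 + (Y x)\<^sup>2" by (simp add: power2_diff abs_mult)
    then show "norm (X x * Y x) \<le> norm ((X x)\<^sup>2 + (Y x)\<^sup>2)" by simp
  qed
qed (use assms in auto)

lemma integrable_square_lincomb:
  fixes X Y :: "'a \<Rightarrow> real"
  assumes "integrable M (\<lambda>w. (X w)\<^sup>2)" "integrable M (\<lambda>w. (Y w)\<^sup>2)"
   and [measurable]: "X \<in> borel_measurable M" "Y \<in> borel_measurable M"
  shows "integrable M (\<lambda>w. (a * X w + b * Y w)\<^sup>2)"
proof -
  have "(\<lambda>w. (a * X w + b * Y w)\<^sup>2) = (\<lambda>w. a\<^sup>2 * (X w)\<^sup>2 + b\<^sup>2 * (Y w)\<^sup>2 + 2 * a * b * (X w * Y w))"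
    by (auto simp: power2_eq_square algebra_simps)
  then show ?thesis using integrable_mult_L2[OF assms] assms by auto
qed

lemma integrable_square_diff:
  fixes X Y :: "'a \<Rightarrow> real"
  assumes "integrable M (\<lambda>w. (X w)\<^sup>2)" "integrable M (\<lambda>w. (Y w)\<^sup>2)"
   and "X \<in> borel_measurable M" "Y \<in> borel_measurable M"
  shows "integrable M (\<lambda>w. (X w - Y w)\<^sup>2)"
  using integrable_square_lincomb[OF assms, of 1 "-1"] by simp

section \<open>Metric properties of the distance\<close>

lemma W2_square:
  assumes "\<mu> \<in> P2" "\<nu> \<in> P2"
  shows "(W2 \<mu> \<nu>)\<^sup>2 = (\<integral>r. (quantile \<mu> r - quantile \<nu> r)\<^sup>2 \<partial>U01)"
proof -
  note [measurable] = quantile_measurable[OF assms(1)] quantile_measurable[OF assms(2)]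
  have "integrable U01 (\<lambda>r. (quantile \<mu> r - quantile \<nu> r)\<^sup>2)"
    by (intro integrable_square_diff quantile_square_integrable assms) measurable
  then show ?thesis
    unfolding W2_def W2_cost_eq[OF assms] by (subst nn_integral_eq_integral) auto
qed

lemma W2_nonneg [simp]: "0 \<le> W2 \<mu> \<nu>"
  by (simp add: W2_def)

lemma W2_sym: "\<mu> \<in> P2 \<Longrightarrow> \<nu> \<in> P2 \<Longrightarrow> W2 \<mu> \<nu> = W2 \<nu> \<mu>"
  using W2_square[of \<mu> \<nu>] W2_square[of \<nu> \<mu>] power2_commute[of "quantile \<mu> _" "quantile \<nu> _"]
    power2_eq_iff_nonneg[OF W2_nonneg[of \<mu> \<nu>] W2_nonneg[of \<nu> \<mu>]] by presburger

lemma W2_self [simp]: "\<mu> \<in> P2 \<Longrightarrow> W2 \<mu> \<mu> = 0"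
  using W2_square[of \<mu> \<mu>] by simp

text \<open>Turns any two random variables on a common space into an upper bound for
  \<open>W2\<close>, without computing the quantiles of their laws.\<close>

lemma W2_square_le_coupling:
  fixes X Y :: "'a \<Rightarrow> real"
  assumes "prob_space M" and [measurable]: "X \<in> borel_measurable M" "Y \<in> borel_measurable M"
    and "integrable M (\<lambda>w. (X w)\<^sup>2)" "integrable M (\<lambda>w. (Y w)\<^sup>2)"
  shows "(W2 (distr M borel X) (distr M borel Y))\<^sup>2 \<le> (\<integral>x. (X x - Y x)\<^sup>2 \<partial>M)"
proof -
  have P: "distr M borel X \<in> P2" "distr M borel Y \<in> P2" using assms by (auto intro: P2_distrI)
  note [measurable] = quantile_measurable[OF P(1)] quantile_measurable[OF P(2)]
  have i: "integrable M (\<lambda>w. (X w - Y w)\<^sup>2)"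
    by (intro integrable_square_diff assms)
  have i2: "integrable U01 (\<lambda>r. (quantile (distr M borel X) r - quantile (distr M borel Y) r)\<^sup>2)"
    by (intro integrable_square_diff quantile_square_integrable P) measurable
  have "ennreal (\<integral>r. (quantile (distr M borel X) r - quantile (distr M borel Y) r)\<^sup>2 \<partial>U01) \<le> ennreal (\<integral>x. (X x - Y x)\<^sup>2 \<partial>M)"
    using quantile_coupling_optimal[OF assms(1-3) refl refl P] i i2 by (simp add: nn_integral_eq_integral)
  then show ?thesis unfolding W2_square[OF P] by (simp add: integral_nonneg_AE)
qed

lemma L2_minkowski:
  fixes X Y :: "'a \<Rightarrow> real"
  assumes "integrable M (\<lambda>w. (X w)\<^sup>2)" "integrable M (\<lambda>w. (Y w)\<^sup>2)"
   and m[measurable]: "X \<in> borel_measurable M" "Y \<in> borel_measurable M"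
  shows "sqrt (\<integral>w. (X w + Y w)\<^sup>2 \<partial>M) \<le> sqrt (\<integral>w. (X w)\<^sup>2 \<partial>M) + sqrt (\<integral>w. (Y w)\<^sup>2 \<partial>M)"
proof -
  let ?a = "\<integral>w. (X w)\<^sup>2 \<partial>M" and ?b = "\<integral>w. (Y w)\<^sup>2 \<partial>M" and ?c = "\<integral>w. X w * Y w \<partial>M"
  have ab: "0 \<le> ?a" "0 \<le> ?b" by auto
  have i: "integrable M (\<lambda>w. X w * Y w)" by (rule integrable_mult_L2[OF assms])
  have q: "0 \<le> s\<^sup>2 * ?a - 2 * s * t * ?c + t\<^sup>2 * ?b" for s t
  proof -
    have "0 \<le> (\<integral>w. (s * X w - t * Y w)\<^sup>2 \<partial>M)" by simp
    also have "(\<integral>w. (s * X w - t * Y w)\<^sup>2 \<partial>M) = (\<integral>w. s\<^sup>2 * (X w)\<^sup>2 - 2 * s * t * (X w * Y w) + t\<^sup>2 * (Y w)\<^sup>2 \<partial>M)"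
      by (intro Bochner_Integration.integral_cong) (auto simp: power2_eq_square algebra_simps)
    also have "\<dots> = s\<^sup>2 * ?a - 2 * s * t * ?c + t\<^sup>2 * ?b" using i assms by simp
    finally show ?thesis .
  qed
  have "?c \<le> sqrt ?a * sqrt ?b"
  proof (cases "?a = 0 \<or> ?b = 0")
    case False
    then have "0 < ?a" "0 < ?b" using ab by linarith+
    \<comment> \<open>The norms are swapped as parameters, so that the form becomes
      \<open>2 * ?a * ?b - 2 * sqrt ?a * sqrt ?b * ?c\<close>.\<close>
    have "0 \<le> (sqrt ?b)\<^sup>2 * ?a - 2 * sqrt ?b * sqrt ?a * ?c + (sqrt ?a)\<^sup>2 * ?b" by (rule q)
    then have "2 * ((sqrt ?b * sqrt ?a) * ?c) \<le> 2 * ((sqrt ?b * sqrt ?a) * (sqrt ?b * sqrt ?a))" using ab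
      by (simp add: power2_eq_square) (simp add: algebra_simps)
    then have "(sqrt ?b * sqrt ?a) * ?c \<le> (sqrt ?b * sqrt ?a) * (sqrt ?b * sqrt ?a)" by linarith
    then show ?thesis using \<open>0 < ?a\<close> \<open>0 < ?b\<close> by (simp add: mult.commute)
  next
    case True
    \<comment> \<open>With one norm zero the form is affine in the corresponding parameter, so a
      positive \<open>?c\<close> would make it negative for a large value of that parameter.\<close>
    have "?c \<le> 0"
    proof (rule ccontr)
      assume c: "\<not> ?c \<le> 0"
      have "?a = 0 \<or> ?b = 0" by fact
      then show False
      proof
        assume "?a = 0"
        with q[of "(1 + ?b) / ?c" 1] c ab show False by simp
      next
        assume "?b = 0"
        with q[of 1 "(1 + ?a) / ?c"] c ab show False by simp
      qed
    qed
    then show ?thesis using ab by (meson mult_nonneg_nonneg order_trans real_sqrt_ge_zero)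
  qed
  have "(\<integral>w. (X w + Y w)\<^sup>2 \<partial>M) = (\<integral>w. (X w)\<^sup>2 + 2 * (X w * Y w) + (Y w)\<^sup>2 \<partial>M)"
    by (intro Bochner_Integration.integral_cong) (auto simp: power2_eq_square algebra_simps)
  also have "\<dots> = ?a + 2 * ?c + ?b" using i assms by simp
  also have "\<dots> \<le> (sqrt ?a + sqrt ?b)\<^sup>2" using \<open>?c \<le> _\<close> ab by (simp add: power2_sum)
  finally show ?thesis using ab by (intro real_le_lsqrt) auto
qed

lemma W2_triangle:
  assumes P: "\<mu> \<in> P2" "\<nu> \<in> P2" "\<xi> \<in> P2"
  shows "W2 \<mu> \<xi> \<le> W2 \<mu> \<nu> + W2 \<nu> \<xi>"
proof -
  note [measurable] = quantile_measurable[OF P(1)] quantile_measurable[OF P(2)] quantile_measurable[OF P(3)]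
  have W: "W2 \<mu> \<nu> = sqrt (\<integral>r. (quantile \<mu> r - quantile \<nu> r)\<^sup>2 \<partial>U01)" if "\<mu> \<in> P2" "\<nu> \<in> P2" for \<mu> \<nu>
    using W2_square[OF that] W2_nonneg by (metis real_sqrt_unique)
  show ?thesis
    unfolding W[OF P(1,3)] W[OF P(1,2)] W[OF P(2,3)]
    using L2_minkowski[of U01 "\<lambda>r. quantile \<mu> r - quantile \<nu> r" "\<lambda>r. quantile \<nu> r - quantile \<xi> r"]
    by (simp add: integrable_square_diff quantile_square_integrable P)
qed

lemma W2_eq_0D:
  assumes P: "\<mu> \<in> P2" "\<nu> \<in> P2" and "W2 \<mu> \<nu> = 0"
  shows "\<mu> = \<nu>"
proof -
  note [measurable] = quantile_measurable[OF P(1)] quantile_measurable[OF P(2)]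
  have "(\<integral>r. (quantile \<mu> r - quantile \<nu> r)\<^sup>2 \<partial>U01) = 0" using W2_square[OF P] assms(3) by simp
  then have "AE r in U01. (quantile \<mu> r - quantile \<nu> r)\<^sup>2 = 0"
    by (subst (asm) integral_nonneg_eq_0_iff_AE) (auto intro!: integrable_square_diff quantile_square_integrable P)
  then have "distr U01 borel (quantile \<mu>) = distr U01 borel (quantile \<nu>)"
    by (intro distr_cong_AE) auto
  then show ?thesis using distr_quantile P by metis
qed

text \<open>Jensen's inequality for the difference of the quantiles, read off from nonnegativity of
  its variance. It controls the interaction term and the sign of the mean along the flow.\<close>

lemma mean_diff_le_W2:
  assumes P: "\<mu> \<in> P2" "\<nu> \<in> P2"
  shows "\<bar>(\<integral>z. z \<partial>\<mu>) - (\<integral>z. z \<partial>\<nu>)\<bar> \<le> W2 \<mu> \<nu>"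
proof -
  interpret prob_space U01 by (rule prob_space_U01)
  note [measurable] = quantile_measurable[OF P(1)] quantile_measurable[OF P(2)]
  have i: "integrable U01 (quantile \<mu>)" "integrable U01 (quantile \<nu>)"
    using quantile_P2_distr(1)[OF P(1) measurable_ident_sets[OF refl], THEN iffD1, OF P2_integrable_id[OF P(1)]]
      quantile_P2_distr(1)[OF P(2) measurable_ident_sets[OF refl], THEN iffD1, OF P2_integrable_id[OF P(2)]]
    by blast+
  let ?D = "\<lambda>r. quantile \<mu> r - quantile \<nu> r"
  have e: "(\<integral>z. z \<partial>\<mu>) - (\<integral>z. z \<partial>\<nu>) = expectation ?D"
    using quantile_P2_distr(2)[of \<mu> "\<lambda>z. z"] quantile_P2_distr(2)[of \<nu> "\<lambda>z. z"] P i by simp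
  have "0 \<le> variance ?D" by simp
  also have "variance ?D = expectation (\<lambda>r. (?D r)\<^sup>2) - (expectation ?D)\<^sup>2"
    by (rule variance_eq) (use i integrable_square_diff[OF quantile_square_integrable quantile_square_integrable] P in auto)
  finally have "(expectation ?D)\<^sup>2 \<le> (W2 \<mu> \<nu>)\<^sup>2" using W2_square[OF P] by simp
  then show ?thesis unfolding e by (simp add: abs_le_square_iff[symmetric])
qed

section \<open>Entropy and displacement convexity\<close>

text \<open>Real-valued, so that \<open>ln (rho \<mu> z)\<close> unfolds literally to the integrand
  in \<open>free_energy\<close>.\<close>

definition rho :: "real measure \<Rightarrow> real \<Rightarrow> real" where
  "rho \<mu> z = enn2real (RN_deriv lborel \<mu> z)"

definition has_lebesgue_density :: "real measure \<Rightarrow> bool" where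
  "has_lebesgue_density \<mu> \<longleftrightarrow> (\<exists>\<rho>\<in>borel_measurable lborel. density lborel \<rho> = \<mu>)"

lemma rho_measurable [measurable]: "rho \<mu> \<in> borel_measurable borel"
  unfolding rho_def by measurable

lemma rho_nonneg [simp]: "0 \<le> rho \<mu> z"
  by (simp add: rho_def)

lemma has_lebesgue_density_iff:
  assumes "sets \<mu> = sets borel"
  shows "has_lebesgue_density \<mu> \<longleftrightarrow> absolutely_continuous lborel \<mu>"
proof
  assume "has_lebesgue_density \<mu>"
  then show "absolutely_continuous lborel \<mu>"
    unfolding has_lebesgue_density_def using absolutely_continuousI_density by blast
next
  assume "absolutely_continuous lborel \<mu>"
  then have "density lborel (RN_deriv lborel \<mu>) = \<mu>"
    using assms by (intro sigma_finite_measure.density_RN_deriv[OF sigma_finite_lborel]) auto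
  then show "has_lebesgue_density \<mu>" unfolding has_lebesgue_density_def
    using borel_measurable_RN_deriv by blast
qed

lemma density_rho:
  assumes "prob_space \<mu>" "sets \<mu> = sets borel" "has_lebesgue_density \<mu>"
  shows "density lborel (\<lambda>z. ennreal (rho \<mu> z)) = \<mu>"
proof -
  interpret prob_space \<mu> by fact
  have ac: "absolutely_continuous lborel \<mu>" using assms has_lebesgue_density_iff by blast
  have d: "density lborel (RN_deriv lborel \<mu>) = \<mu>"
    using assms ac by (intro sigma_finite_measure.density_RN_deriv[OF sigma_finite_lborel]) auto
  have "AE z in lborel. RN_deriv lborel \<mu> z \<noteq> \<infinity>"
    using assms ac by (intro sigma_finite_measure.RN_deriv_finite[OF sigma_finite_lborel]) (auto intro: sigma_finite_measure_axioms)
  then have "AE z in lborel. ennreal (rho \<mu> z) = RN_deriv lborel \<mu> z"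
    by eventually_elim (simp add: rho_def less_top)
  then show ?thesis using d
    by (subst density_cong[where f'="RN_deriv lborel \<mu>"]) auto
qed

lemma nn_integral_rho:
  assumes "prob_space \<mu>" "sets \<mu> = sets borel" "has_lebesgue_density \<mu>" and "f \<in> borel_measurable borel"
  shows "(\<integral>\<^sup>+z. f z \<partial>\<mu>) = (\<integral>\<^sup>+z. ennreal (rho \<mu> z) * f z \<partial>lborel)"
  using nn_integral_density[of "\<lambda>z. ennreal (rho \<mu> z)" lborel f] density_rho[OF assms(1-3)] assms(4) by simp

lemma rho_pos_AE:
  assumes "prob_space \<mu>" "sets \<mu> = sets borel" "has_lebesgue_density \<mu>"
  shows "AE z in \<mu>. 0 < rho \<mu> z"
proof -
  have "AE z in density lborel (\<lambda>z. ennreal (rho \<mu> z)). 0 < rho \<mu> z"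
    by (subst AE_density) (auto simp: ennreal_less_zero_iff)
  then show ?thesis unfolding density_rho[OF assms] .
qed

lemma rho_unique_AE:
  assumes "prob_space \<mu>" "\<mu> = density lborel (\<lambda>z. ennreal (f z))" "f \<in> borel_measurable borel" "\<And>z. 0 \<le> f z"
  shows "has_lebesgue_density \<mu>" "AE z in lborel. rho \<mu> z = f z" "AE z in \<mu>. rho \<mu> z = f z"
proof -
  show a: "has_lebesgue_density \<mu>" unfolding has_lebesgue_density_def using assms by auto
  have "density lborel (\<lambda>z. ennreal (rho \<mu> z)) = density lborel (\<lambda>z. ennreal (f z))"
    using density_rho[OF assms(1) _ a] assms(2) by simp
  then have "AE z in lborel. ennreal (rho \<mu> z) = ennreal (f z)"
    using assms(3) by (subst (asm) sigma_finite_measure.density_unique_iff[OF sigma_finite_lborel]) auto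
  then show b: "AE z in lborel. rho \<mu> z = f z"
    by eventually_elim (use assms(4) in simp)
  then show "AE z in \<mu>. rho \<mu> z = f z"
    unfolding assms(2) using assms(3) by (subst AE_density) auto
qed

text \<open>Against \<open>\<mu>\<close> the quotient integrates \<open>f\<close> over the set where
  the density is positive, hence an inequality. Combined with \<open>ln x \<le> x - 1\<close> it
  yields lower bounds for entropies.\<close>

lemma integrable_over_rho:
  assumes "prob_space \<mu>" "sets \<mu> = sets borel" "has_lebesgue_density \<mu>"
    and [measurable]: "f \<in> borel_measurable borel" and f0: "\<And>z. 0 \<le> f z" and "integrable lborel f"
  shows "integrable \<mu> (\<lambda>z. f z / rho \<mu> z)" "(\<integral>z. f z / rho \<mu> z \<partial>\<mu>) \<le> (\<integral>z. f z \<partial>lborel)"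
proof -
  note [measurable_cong] = assms(2)
  have "(\<integral>\<^sup>+z. ennreal (f z / rho \<mu> z) \<partial>\<mu>) = (\<integral>\<^sup>+z. ennreal (rho \<mu> z) * ennreal (f z / rho \<mu> z) \<partial>lborel)"
    by (rule nn_integral_rho[OF assms(1-3)]) measurable
  also have "\<dots> \<le> (\<integral>\<^sup>+z. ennreal (f z) \<partial>lborel)"
    by (rule nn_integral_mono) (auto simp: ennreal_mult'[symmetric] f0)
  also have "\<dots> = ennreal (\<integral>z. f z \<partial>lborel)"
    using assms(6) f0 by (intro nn_integral_eq_integral) auto
  finally have le: "(\<integral>\<^sup>+z. ennreal (f z / rho \<mu> z) \<partial>\<mu>) \<le> ennreal (\<integral>z. f z \<partial>lborel)" .
  show i: "integrable \<mu> (\<lambda>z. f z / rho \<mu> z)"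
    by (rule integrableI_nonneg) (use le f0 in \<open>auto simp: le_less_trans[OF _ ennreal_less_top]\<close>)
  show "(\<integral>z. f z / rho \<mu> z \<partial>\<mu>) \<le> (\<integral>z. f z \<partial>lborel)"
    using le f0 i by (subst (asm) nn_integral_eq_integral) (auto simp: ennreal_le_iff integral_nonneg_AE)
qed

lemma integrable_gauss: "integrable lborel (\<lambda>z::real. exp (- z\<^sup>2))"
proof -
  have "integrable lborel (\<lambda>z. sqrt (2 * pi * (1 / sqrt 2)\<^sup>2) * normal_density 0 (1 / sqrt 2) z)"
    by (intro integrable_mult_right integrable_normal_density) auto
  then show ?thesis by (simp add: normal_density_def power_divide)
qed

text \<open>The inequality \<open>ln x \<le> x - 1\<close> for the quotient of a Gaussian weight by
  the density. The bound is integrable as soon as second moments are finite, so the negative part of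
  the logarithm never causes trouble on \<open>P2\<close>.\<close>

lemma neg_ln_rho_le: "0 < rho \<mu> z \<Longrightarrow> - ln (rho \<mu> z) \<le> exp (- z\<^sup>2) / rho \<mu> z + z\<^sup>2"
proof -
  assume r: "0 < rho \<mu> z"
  have "ln (exp (- z\<^sup>2) / rho \<mu> z) \<le> exp (- z\<^sup>2) / rho \<mu> z - 1"
    by (rule ln_le_minus_one) (use r in simp)
  then show ?thesis using r by (simp add: ln_div)
qed

lemma P2_entropy_minorant:
  assumes "\<mu> \<in> P2" "has_lebesgue_density \<mu>"
  shows "integrable \<mu> (\<lambda>z. exp (- z\<^sup>2) / rho \<mu> z + z\<^sup>2)"
  using integrable_over_rho(1)[OF P2D(1,2)[OF assms(1)] assms(2) _ _ integrable_gauss] P2D(4)[OF assms(1)]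
  by auto

lemma ext_integral_integrable:
  assumes "integrable M f" shows "ext_integral M f = ereal (integral\<^sup>L M f)"
proof -
  have "(\<integral>\<^sup>+x. ennreal (f x) \<partial>M) < \<infinity>" "(\<integral>\<^sup>+x. ennreal (- f x) \<partial>M) < \<infinity>"
    using assms by (auto simp: real_integrable_def less_top)
  then show ?thesis unfolding ext_integral_def real_lebesgue_integral_def[OF assms]
    by (cases "\<integral>\<^sup>+x. ennreal (f x) \<partial>M"; cases "\<integral>\<^sup>+x. ennreal (- f x) \<partial>M") auto
qed

lemma ext_integral_dichotomy:
  assumes [measurable]: "f \<in> borel_measurable M" and g: "integrable M g" and le: "AE x in M. - f x \<le> g x"
  shows "integrable M f \<or> ext_integral M f = \<infinity>"
proof -
  have n: "(\<integral>\<^sup>+x. ennreal (- f x) \<partial>M) < \<infinity>"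
  proof -
    have "(\<integral>\<^sup>+x. ennreal (- f x) \<partial>M) \<le> (\<integral>\<^sup>+x. ennreal (g x) \<partial>M)"
      using le by (intro nn_integral_mono_AE) (auto intro: ennreal_leI)
    also have "\<dots> < \<infinity>" using g by (auto simp: real_integrable_def less_top)
    finally show ?thesis .
  qed
  show ?thesis
  proof (cases "(\<integral>\<^sup>+x. ennreal (f x) \<partial>M) < \<infinity>")
    case True
    then show ?thesis using n by (auto simp: real_integrable_def less_top)
  next
    case False
    then have "(\<integral>\<^sup>+x. ennreal (f x) \<partial>M) = \<infinity>" by (simp add: less_top[symmetric])
    then show ?thesis using n unfolding ext_integral_def
      by (cases "\<integral>\<^sup>+x. ennreal (- f x) \<partial>M") auto
  qed
qed

definition finite_energy :: "(real \<Rightarrow> real) \<Rightarrow> real measure \<Rightarrow> bool" where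
  "finite_energy \<Psi> \<mu> \<longleftrightarrow> \<mu> \<in> P2 \<and> has_lebesgue_density \<mu> \<and> integrable \<mu> (\<lambda>z. ln (rho \<mu> z)) \<and> integrable \<mu> \<Psi>"

text \<open>The free energy without the interaction. Up to an affine function of the mean it is the
  relative entropy with respect to any \<open>gibbs \<Psi> \<sigma>\<close>.\<close>

definition energy :: "(real \<Rightarrow> real) \<Rightarrow> real measure \<Rightarrow> real" where
  "energy \<Psi> \<mu> = (\<integral>z. ln (rho \<mu> z) \<partial>\<mu>) + (\<integral>z. \<Psi> z \<partial>\<mu>)"

abbreviation (input) mean :: "real measure \<Rightarrow> real" where
  "mean \<mu> \<equiv> (\<integral>z. z \<partial>\<mu>)"

lemma free_energy_eq:
  assumes "finite_energy \<Psi> \<mu>"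
  shows "free_energy \<Psi> J \<mu> = ereal (energy \<Psi> \<mu> - J / 2 * (mean \<mu>)\<^sup>2)"
proof -
  have "(\<exists>\<rho>\<in>borel_measurable lborel. density lborel \<rho> = \<mu>)"
    using assms by (simp add: finite_energy_def has_lebesgue_density_def)
  then have "free_energy \<Psi> J \<mu> = ext_integral \<mu> (\<lambda>z. ln (rho \<mu> z)) + ext_integral \<mu> \<Psi> - ereal (J / 2 * (mean \<mu>)\<^sup>2)"
    unfolding free_energy_def rho_def by simp
  also have "\<dots> = ereal (energy \<Psi> \<mu> - J / 2 * (mean \<mu>)\<^sup>2)"
    using assms by (simp add: finite_energy_def ext_integral_integrable energy_def)
  finally show ?thesis .
qed

text \<open>Neither integral can be \<open>- \<infinity>\<close>: the logarithm is bounded below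
  through \<open>P2_entropy_minorant\<close> and \<open>\<Psi>\<close> by a constant. A value below
  \<open>\<infinity>\<close> thus forces both integrands to be integrable.\<close>

lemma free_energy_finiteD:
  assumes "\<mu> \<in> P2" "\<Psi> \<in> borel_measurable borel" "\<And>z. - C \<le> \<Psi> z" "free_energy \<Psi> J \<mu> < \<infinity>"
  shows "finite_energy \<Psi> \<mu>"
proof -
  interpret prob_space \<mu> using P2D(1)[OF assms(1)] .
  note [measurable_cong] = P2D(2)[OF assms(1)]
  note [measurable] = assms(2)
  have d: "has_lebesgue_density \<mu>"
    using assms(4) unfolding free_energy_def has_lebesgue_density_def by (auto split: if_splits)
  then have F: "free_energy \<Psi> J \<mu> = ext_integral \<mu> (\<lambda>z. ln (rho \<mu> z)) + ext_integral \<mu> \<Psi> - ereal (J / 2 * (mean \<mu>)\<^sup>2)"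
    unfolding free_energy_def has_lebesgue_density_def rho_def by simp
  have 1: "integrable \<mu> (\<lambda>z. ln (rho \<mu> z)) \<or> ext_integral \<mu> (\<lambda>z. ln (rho \<mu> z)) = \<infinity>"
  proof (rule ext_integral_dichotomy[OF _ P2_entropy_minorant[OF assms(1) d]])
    show "AE z in \<mu>. - ln (rho \<mu> z) \<le> exp (- z\<^sup>2) / rho \<mu> z + z\<^sup>2"
      using rho_pos_AE[OF P2D(1,2)[OF assms(1)] d] by eventually_elim (rule neg_ln_rho_le)
  qed measurable
  have 2: "integrable \<mu> \<Psi> \<or> ext_integral \<mu> \<Psi> = \<infinity>"
  proof (rule ext_integral_dichotomy[where g="\<lambda>_. C"])
    show "AE z in \<mu>. - \<Psi> z \<le> C"
    proof (rule AE_I2)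
      fix z show "- \<Psi> z \<le> C" using assms(3)[of z] by linarith
    qed
  qed auto
  have "ext_integral \<mu> (\<lambda>z. ln (rho \<mu> z)) \<noteq> \<infinity>" "ext_integral \<mu> \<Psi> \<noteq> \<infinity>"
    using assms(4) 1 2 unfolding F by (auto simp: ext_integral_integrable)
  then show ?thesis using 1 2 d assms(1) by (auto simp: finite_energy_def)
qed

section \<open>Entropy of an image measure\<close>

text \<open>An inequality between measures does not survive complements, so a generator argument
  fails. Instead an open set is cut into countably many nonoverlapping intervals, and outer
  regularity of Lebesgue measure reaches Borel sets.\<close>

lemma emeasure_le_lborel:
  assumes [measurable_cong]: "sets M = sets borel"
    and le: "\<And>a b. a < b \<Longrightarrow> emeasure M {a<..<b} \<le> ennreal (b - a)"
    and [measurable]: "B \<in> sets borel"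
  shows "emeasure M B \<le> emeasure lborel B"
proof -
  have sing: "emeasure M {x} = 0" for x :: real
  proof -
    have "emeasure M {x} \<le> 0 + ennreal e" if "0 < e" for e
    proof -
      have "emeasure M {x} \<le> emeasure M {x - e/2<..<x + e/2}" by (rule emeasure_mono) (use that assms(1) in auto)
      also have "\<dots> \<le> ennreal e" using le[of "x - e/2" "x + e/2"] that by simp
      finally show ?thesis by simp
    qed
    then have "emeasure M {x} \<le> 0" using ennreal_le_epsilon[of 0 "emeasure M {x}"] by blast
    then show ?thesis by simp
  qed
  have bdd: "emeasure M (U \<inter> cbox (- real n) (real n)) \<le> emeasure lborel U" if U: "open U" and n: "0 < n" for U n
  proof -
    \<comment> \<open>The gauge forces every box of the covering to stay inside
      \<open>U\<close>.\<close>
    have "\<forall>x. \<exists>T. open T \<and> x \<in> T \<and> (x \<in> U \<longrightarrow> T \<subseteq> U)"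
    proof
      fix x show "\<exists>T. open T \<and> x \<in> T \<and> (x \<in> U \<longrightarrow> T \<subseteq> U)"
        using U by (cases "x \<in> U") (auto intro: exI[of _ U] exI[of _ UNIV])
    qed
    then obtain g where g: "\<And>x. open (g x) \<and> x \<in> g x \<and> (x \<in> U \<longrightarrow> g x \<subseteq> U)" by metis
    have "gauge g" using g by (simp add: gauge_def)
    have ne: "box (- real n) (real n) \<noteq> {}" using n by (simp add: box_real)
    note cov = covering_lemma[OF Int_lower2[of U] ne \<open>gauge g\<close>]
    obtain D where D: "countable D" "\<And>K. K \<in> D \<Longrightarrow> interior K \<noteq> {} \<and> (\<exists>c d. K = cbox c d)"
      "pairwise (\<lambda>A B. interior A \<inter> interior B = {}) D"
      "\<And>K. K \<in> D \<Longrightarrow> \<exists>x \<in> (U \<inter> cbox (- real n) (real n)) \<inter> K. K \<subseteq> g x"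
      "U \<inter> cbox (- real n) (real n) \<subseteq> \<Union>D"
      by (rule cov) (rule that; assumption)
    \<comment> \<open>The endpoints of the covering intervals: countably many points, each null by
      \<open>sing\<close>. Without them the pieces are disjoint open intervals.\<close>
    define C where "C = (\<Union>K\<in>D. K - interior K)"
    have cC: "countable C" unfolding C_def
    proof (intro countable_UN D(1))
      fix K assume "K \<in> D"
      then obtain c d where "K = {c..d}" using D(2) by (metis box_real(2))
      then have "K - interior K \<subseteq> {c, d}" by auto
      then show "countable (K - interior K)" by (rule countable_subset) auto
    qed
    have C0: "emeasure M C = 0"
    proof -
      have "(\<Union>x\<in>C. {x}) \<in> null_sets M"
        by (rule null_sets_UN') (use cC sing assms(1) in \<open>auto intro!: null_setsI\<close>)
      then show ?thesis by auto
    qed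
    have [measurable]: "C \<in> sets borel" using cC by (rule sets.countable[rotated]) auto
    have disj: "disjoint_family_on interior D" using D(3) by (auto simp: disjoint_family_on_def pairwise_def)
    have sub1: "U \<inter> cbox (- real n) (real n) \<subseteq> (\<Union>K\<in>D. interior K) \<union> C" unfolding C_def using D(5) by blast
    have mI [measurable]: "(\<Union>K\<in>D. interior K) \<in> sets borel" by (rule borel_open) auto
    have sub: "K \<subseteq> U" if "K \<in> D" for K using D(4)[OF that] g by blast
    have "emeasure M (U \<inter> cbox (- real n) (real n)) \<le> emeasure M ((\<Union>K\<in>D. interior K) \<union> C)"
      using sub1 mI assms(1) by (intro emeasure_mono) auto
    also have "\<dots> \<le> emeasure M (\<Union>K\<in>D. interior K) + emeasure M C"
      using D(1) assms(1) by (intro emeasure_subadditive) auto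
    also have "\<dots> = (\<integral>\<^sup>+K. emeasure M (interior K) \<partial>count_space D)"
      using C0 D(1) disj assms(1) by (simp add: emeasure_UN_countable)
    also have "\<dots> \<le> (\<integral>\<^sup>+K. emeasure lborel (interior K) \<partial>count_space D)"
    proof (rule nn_integral_mono)
      fix K assume "K \<in> space (count_space D)"
      then obtain c d where K: "K = {c..d}" "interior K \<noteq> {}" using D(2) by (metis box_real(2) space_count_space)
      then have "c < d" by auto
      then show "emeasure M (interior K) \<le> emeasure lborel (interior K)" using K le[of c d] by simp
    qed
    also have "\<dots> = emeasure lborel (\<Union>K\<in>D. interior K)"
      using D(1) disj by (simp add: emeasure_UN_countable)
    also have "\<dots> \<le> emeasure lborel U"
    proof (rule emeasure_mono)
      show "(\<Union>K\<in>D. interior K) \<subseteq> U" using sub interior_subset by blast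
    qed (use U in auto)
    finally show ?thesis .
  qed
  have op: "emeasure M U \<le> emeasure lborel U" if U: "open U" for U
  proof -
    have inc: "incseq (\<lambda>n. U \<inter> cbox (- real n) (real n))" by (auto simp: incseq_def)
    have "(\<Union>n. U \<inter> cbox (- real n) (real n)) = U"
    proof (rule subset_antisym; rule subsetI)
      fix x assume "x \<in> U"
      obtain n where "\<bar>x\<bar> \<le> real n" using real_arch_simple by blast
      with \<open>x \<in> U\<close> show "x \<in> (\<Union>n. U \<inter> cbox (- real n) (real n))" by (auto intro!: exI[of _ n])
    qed auto
    then have "emeasure M U = (SUP n. emeasure M (U \<inter> cbox (- real n) (real n)))"
      using SUP_emeasure_incseq[of "\<lambda>n. U \<inter> cbox (- real n) (real n)" M, OF _ inc] U assms(1)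
      by (auto simp: image_subset_iff)
    also have "\<dots> \<le> emeasure lborel U"
    proof (rule SUP_least)
      fix n :: nat
      have "emeasure M (U \<inter> cbox (- real n) (real n)) \<le> emeasure M (U \<inter> cbox (- real (Suc n)) (real (Suc n)))"
        using U assms(1) by (intro emeasure_mono) auto
      also have "\<dots> \<le> emeasure lborel U" by (rule bdd[OF U]) simp
      finally show "emeasure M (U \<inter> cbox (- real n) (real n)) \<le> emeasure lborel U" .
    qed
    finally show ?thesis .
  qed
  show ?thesis
  proof (rule ennreal_le_epsilon)
    fix e :: real assume "0 < e"
    obtain U where U: "open U" "B \<subseteq> U" "emeasure lborel (U - B) < ennreal e"
      using outer_regular_lborel[OF assms(3) \<open>0 < e\<close>] by metis
    have "emeasure M B \<le> emeasure M U" using U assms(1) by (intro emeasure_mono) auto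
    also have "\<dots> \<le> emeasure lborel U" by (rule op[OF U(1)])
    also have "\<dots> = emeasure lborel (B \<union> (U - B))" using U by (simp add: Un_absorb1)
    also have "\<dots> \<le> emeasure lborel B + emeasure lborel (U - B)"
      using U by (intro emeasure_subadditive) auto
    also have "\<dots> \<le> emeasure lborel B + ennreal e" using U by (intro add_left_mono) auto
    finally show "emeasure M B \<le> emeasure lborel B + ennreal e" .
  qed
qed

text \<open>Integrate \<open>ln (rho (Z w)) - h w \<le> exp (- h w) * rho (Z w) - 1\<close>: the domination hypothesis says that
  the image of \<open>exp (- h) M\<close> under \<open>Z\<close> is below Lebesgue measure, so the right-hand side integrates to at
  most \<open>0\<close>. No differentiability of quantile functions is needed.\<close>

lemma entropy_distr_le:
  fixes Z h :: "'a \<Rightarrow> real"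
  assumes "prob_space M" and [measurable]: "Z \<in> borel_measurable M" and Z2: "integrable M (\<lambda>w. (Z w)\<^sup>2)"
    and h: "integrable M h"
    and dom: "\<And>a b. a < b \<Longrightarrow> (\<integral>\<^sup>+w. ennreal (exp (- h w)) * indicator {a<..<b} (Z w) \<partial>M) \<le> ennreal (b - a)"
  shows "has_lebesgue_density (distr M borel Z)" (is ?A)
    and "integrable (distr M borel Z) (\<lambda>z. ln (rho (distr M borel Z) z))" (is ?B)
    and "(\<integral>z. ln (rho (distr M borel Z) z) \<partial>distr M borel Z) \<le> (\<integral>w. h w \<partial>M)" (is ?C)
proof -
  interpret prob_space M by fact
  have [measurable]: "h \<in> borel_measurable M" using h by auto
  define \<nu> where "\<nu> = distr M borel Z"
  have P: "\<nu> \<in> P2" unfolding \<nu>_def by (rule P2_distrI) fact+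
  define m where "m = distr (density M (\<lambda>w. ennreal (exp (- h w)))) borel Z"
  have [simp, measurable_cong]: "sets m = sets borel" by (simp add: m_def)
  have em: "emeasure m B = (\<integral>\<^sup>+w. ennreal (exp (- h w)) * indicator B (Z w) \<partial>M)" if [measurable]: "B \<in> sets borel" for B :: "real set"
    unfolding m_def by (subst emeasure_distr) (auto simp: emeasure_density intro!: nn_integral_cong split: split_indicator)
  have le: "emeasure m B \<le> emeasure lborel B" if "B \<in> sets borel" for B :: "real set"
    by (rule emeasure_le_lborel) (use that em dom in auto)
  \<comment> \<open>The weight \<open>exp (- h w)\<close> is positive, so null sets of
    \<open>m\<close> are null for \<open>\<nu>\<close>, and \<open>m\<close> lies below Lebesgue
    measure.\<close>
  have "absolutely_continuous lborel \<nu>"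
    unfolding absolutely_continuous_def
  proof
    fix B :: "real set" assume B: "B \<in> null_sets lborel"
    then have [measurable]: "B \<in> sets borel" by auto
    have "emeasure m B = 0" using le[of B] B by auto
    then have "AE w in M. ennreal (exp (- h w)) * indicator B (Z w) = 0"
      unfolding em[OF \<open>B \<in> sets borel\<close>] by (subst (asm) nn_integral_0_iff_AE) auto
    then have "AE w in M. Z w \<notin> B"
      by eventually_elim (auto split: split_indicator_asm)
    then have "emeasure M {w \<in> space M. Z w \<in> B} = 0"
      by (subst (asm) AE_iff_measurable[OF _ refl]) auto
    then have "emeasure \<nu> B = 0" unfolding \<nu>_def
      by (subst emeasure_distr) (auto simp: vimage_def Int_def conj_commute)
    then show "B \<in> null_sets \<nu>" by (intro null_setsI) (auto simp: \<nu>_def)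
  qed
  then show A: ?A using has_lebesgue_density_iff[of \<nu>] by (simp add: \<nu>_def)
  then have d: "has_lebesgue_density \<nu>" by (simp add: \<nu>_def)
  have "(\<integral>\<^sup>+w. ennreal (exp (- h w) * rho \<nu> (Z w)) \<partial>M) = (\<integral>\<^sup>+z. ennreal (rho \<nu> z) \<partial>m)"
    unfolding m_def by (subst nn_integral_distr) (auto simp: nn_integral_density ennreal_mult')
  also have "\<dots> \<le> (\<integral>\<^sup>+z. ennreal (rho \<nu> z) \<partial>lborel)"
    by (rule nn_integral_mono_measure) (auto simp: le_measure le)
  also have "\<dots> = emeasure (density lborel (\<lambda>z. ennreal (rho \<nu> z))) UNIV"
    by (subst emeasure_density) auto
  also have "\<dots> = 1"
    unfolding density_rho[OF P2D(1,2)[OF P] d] using prob_space.emeasure_space_1[OF P2D(1)[OF P]] P2D(3)[OF P] by simp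
  finally have le1: "(\<integral>\<^sup>+w. ennreal (exp (- h w) * rho \<nu> (Z w)) \<partial>M) \<le> 1" .
  have i1: "integrable M (\<lambda>w. exp (- h w) * rho \<nu> (Z w))"
    by (rule integrableI_nonneg) (use le1 in \<open>auto simp: le_less_trans[OF _ ennreal_one_less_top]\<close>)
  have int1: "(\<integral>w. exp (- h w) * rho \<nu> (Z w) \<partial>M) \<le> 1"
  proof -
    have "ennreal (\<integral>w. exp (- h w) * rho \<nu> (Z w) \<partial>M) \<le> ennreal 1"
      using le1 by (subst (asm) nn_integral_eq_integral[OF i1]) auto
    then show ?thesis by (subst (asm) ennreal_le_iff) auto
  qed
  have pos: "AE w in M. 0 < rho \<nu> (Z w)"
    using rho_pos_AE[OF P2D(1,2)[OF P] d] unfolding \<nu>_def by (subst (asm) AE_distr_iff) auto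
  have i2: "integrable M (\<lambda>w. exp (- (Z w)\<^sup>2) / rho \<nu> (Z w) + (Z w)\<^sup>2)"
    using P2_entropy_minorant[OF P d] unfolding \<nu>_def by (subst (asm) integrable_distr_eq) auto
  have up: "ln (rho \<nu> (Z w)) \<le> h w + (exp (- h w) * rho \<nu> (Z w) - 1)" if "0 < rho \<nu> (Z w)" for w
    using ln_le_minus_one[of "exp (- h w) * rho \<nu> (Z w)"] that by (simp add: ln_mult)
  \<comment> \<open>The logarithm is caught between \<open>up\<close> and
    \<open>neg_ln_rho_le\<close>, whose bounds are both integrable.\<close>
  have i3: "integrable M (\<lambda>w. ln (rho \<nu> (Z w)))"
  proof (rule Bochner_Integration.integrable_bound[OF Bochner_Integration.integrable_add[OF
        Bochner_Integration.integrable_add[OF integrable_abs[OF h] i1] i2]])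
    show "AE w in M. norm (ln (rho \<nu> (Z w))) \<le> norm (\<bar>h w\<bar> + exp (- h w) * rho \<nu> (Z w) + (exp (- (Z w)\<^sup>2) / rho \<nu> (Z w) + (Z w)\<^sup>2))"
      using pos
    proof eventually_elim
      case (elim w)
      have "0 \<le> exp (- h w) * rho \<nu> (Z w)" "0 \<le> exp (- (Z w)\<^sup>2) / rho \<nu> (Z w) + (Z w)\<^sup>2" by auto
      moreover have "h w \<le> \<bar>h w\<bar>" "0 \<le> \<bar>h w\<bar>" by auto
      ultimately show ?case using up[OF elim] neg_ln_rho_le[OF elim]
        unfolding real_norm_def abs_le_iff by (intro conjI order_trans[OF _ abs_ge_self]; linarith)
    qed
  qed measurable
  then show ?B unfolding \<nu>_def by (subst integrable_distr_eq) auto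
  have "(\<integral>w. ln (rho \<nu> (Z w)) \<partial>M) \<le> (\<integral>w. h w + (exp (- h w) * rho \<nu> (Z w) - 1) \<partial>M)"
    using pos up by (intro integral_mono_AE i3) (use h i1 in auto)
  also have "\<dots> \<le> (\<integral>w. h w \<partial>M)" using h i1 int1 by (simp add: prob_space)
  finally show ?C unfolding \<nu>_def by (subst integral_distr) auto
qed

definition real_energy :: "(real \<Rightarrow> real) \<Rightarrow> real \<Rightarrow> real measure \<Rightarrow> real" where
  "real_energy \<Psi> J \<mu> = energy \<Psi> \<mu> - J / 2 * (mean \<mu>)\<^sup>2"

lemma finite_energyD:
  assumes "finite_energy \<Psi> \<mu>"
  shows "\<mu> \<in> P2" "has_lebesgue_density \<mu>" "integrable \<mu> (\<lambda>z. ln (rho \<mu> z))" "integrable \<mu> \<Psi>"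
    "free_energy \<Psi> J \<mu> = ereal (real_energy \<Psi> J \<mu>)"
  using assms free_energy_eq[OF assms, of J] by (auto simp: finite_energy_def real_energy_def)

section \<open>Displacement interpolation\<close>

text \<open>Formally \<open>1 / rho \<mu> (quantile \<mu> r)\<close> is the derivative of the
  quantile function; this integrated form replaces it. Points with vanishing density are not seen,
  hence an inequality.\<close>

lemma nn_integral_inverse_rho_quantile:
  assumes "\<mu> \<in> P2" "has_lebesgue_density \<mu>" and [measurable]: "A \<in> sets borel"
  shows "(\<integral>\<^sup>+r. ennreal (1 / rho \<mu> (quantile \<mu> r)) * indicator A (quantile \<mu> r) \<partial>U01) \<le> emeasure lborel A"
proof -
  note [measurable] = quantile_measurable[OF assms(1)]
  have "(\<integral>\<^sup>+r. ennreal (1 / rho \<mu> (quantile \<mu> r)) * indicator A (quantile \<mu> r) \<partial>U01)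
      = (\<integral>\<^sup>+z. ennreal (1 / rho \<mu> z) * indicator A z \<partial>distr U01 borel (quantile \<mu>))"
    by (subst nn_integral_distr) auto
  also have "\<dots> = (\<integral>\<^sup>+z. ennreal (rho \<mu> z) * (ennreal (1 / rho \<mu> z) * indicator A z) \<partial>lborel)"
    unfolding distr_quantile[OF assms(1)] by (rule nn_integral_rho[OF P2D(1,2)[OF assms(1)] assms(2)]) measurable
  also have "\<dots> \<le> (\<integral>\<^sup>+z. indicator A z \<partial>lborel)"
    by (rule nn_integral_mono) (auto simp: ennreal_mult'[symmetric] split: split_indicator)
  finally show ?thesis by simp
qed

text \<open>Since \<open>X\<close> and \<open>Y\<close> increase together, one pair of indices, a
  maximum and a minimum, dominates the oscillations of both. The oscillation of the combination
  therefore bounds the combination of the oscillations.\<close>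

lemma comonotone_image_lengths:
  fixes X Y :: "real \<Rightarrow> real"
  assumes B: "B \<noteq> {}" and s: "0 < s" "s < 1"
    and mono: "\<And>r r'. r \<in> B \<Longrightarrow> r' \<in> B \<Longrightarrow> r \<le> r' \<Longrightarrow> X r \<le> X r' \<and> Y r \<le> Y r'"
    and Z: "\<And>r. r \<in> B \<Longrightarrow> a < (1 - s) * X r + s * Y r \<and> (1 - s) * X r + s * Y r < b"
  obtains xl xu yl yu where "xl \<le> xu" "yl \<le> yu" "X ` B \<subseteq> {xl..xu}" "Y ` B \<subseteq> {yl..yu}"
    "(1 - s) * (xu - xl) + s * (yu - yl) \<le> b - a"
proof -
  have s': "0 < 1 - s" using s by simp
  have key: "(1 - s) * (X r' - X r) + s * (Y q' - Y q) \<le> b - a"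
    if "r \<in> B" "r' \<in> B" "q \<in> B" "q' \<in> B" for r r' q q'
  proof -
    have m: "max r' q' \<in> B" "min r q \<in> B" using that by (auto simp: max_def min_def)
    have "X r' \<le> X (max r' q')" "Y q' \<le> Y (max r' q')" "X (min r q) \<le> X r" "Y (min r q) \<le> Y q"
      using mono m that by auto
    then have "(1 - s) * (X r' - X r) + s * (Y q' - Y q) \<le>
      (1 - s) * (X (max r' q') - X (min r q)) + s * (Y (max r' q') - Y (min r q))"
      using s by (intro add_mono mult_left_mono) auto
    also have "\<dots> \<le> b - a" using Z[OF m(1)] Z[OF m(2)] by (simp add: algebra_simps)
    finally show ?thesis .
  qed
  obtain r0 where r0: "r0 \<in> B" using B by auto
  have bX: "\<bar>X r - X r0\<bar> \<le> (b - a) / (1 - s)" if "r \<in> B" for r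
    using key[OF r0 that r0 r0] key[OF that r0 r0 r0] s' by (simp add: field_simps abs_le_iff)
  have bY: "\<bar>Y r - Y r0\<bar> \<le> (b - a) / s" if "r \<in> B" for r
    using key[OF r0 r0 r0 that] key[OF r0 r0 that r0] s by (simp add: field_simps abs_le_iff)
  have bdX: "bdd_above (X ` B)" "bdd_below (X ` B)"
    using bX by (auto intro!: bdd_aboveI2[where M="X r0 + (b - a) / (1 - s)"] bdd_belowI2[where m="X r0 - (b - a) / (1 - s)"] simp: abs_le_iff)
      (force simp: abs_le_iff)+
  have bdY: "bdd_above (Y ` B)" "bdd_below (Y ` B)"
    using bY by (auto intro!: bdd_aboveI2[where M="Y r0 + (b - a) / s"] bdd_belowI2[where m="Y r0 - (b - a) / s"] simp: abs_le_iff)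
      (force simp: abs_le_iff)+
  let ?xu = "Sup (X ` B)" and ?xl = "Inf (X ` B)" and ?yu = "Sup (Y ` B)" and ?yl = "Inf (Y ` B)"
  \<comment> \<open>The four indices in \<open>key\<close> are independent, so suprema and infima
    are taken one at a time.\<close>
  have 1: "?xu \<le> X r + (b - a - s * (Y q' - Y q)) / (1 - s)" if "r \<in> B" "q \<in> B" "q' \<in> B" for r q q'
    by (rule cSUP_least[OF B]) (use key[OF that(1) _ that(2,3)] s' in \<open>simp add: field_simps\<close>)
  have 2: "?xu - (b - a - s * (Y q' - Y q)) / (1 - s) \<le> ?xl" if "q \<in> B" "q' \<in> B" for q q'
    by (rule cINF_greatest[OF B]) (use 1[OF _ that] in \<open>simp add: algebra_simps\<close>)
  have 3: "s * (Y q' - Y q) \<le> b - a - (1 - s) * (?xu - ?xl)" if "q \<in> B" "q' \<in> B" for q q'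
    using 2[OF that] s' by (simp add: field_simps)
  have 4: "?yu \<le> Y q + (b - a - (1 - s) * (?xu - ?xl)) / s" if "q \<in> B" for q
    by (rule cSUP_least[OF B]) (use 3[OF that] s in \<open>simp add: field_simps\<close>)
  have 5: "?yu - (b - a - (1 - s) * (?xu - ?xl)) / s \<le> ?yl"
    by (rule cINF_greatest[OF B]) (use 4 in \<open>simp add: algebra_simps\<close>)
  show ?thesis
  proof (rule that[of ?xl ?xu ?yl ?yu])
    show "X ` B \<subseteq> {?xl..?xu}" "Y ` B \<subseteq> {?yl..?yu}"
      using bdX bdY by (auto intro: cINF_lower cSUP_upper)
    then show "?xl \<le> ?xu" "?yl \<le> ?yu" using r0 by force+
    show "(1 - s) * (?xu - ?xl) + s * (?yu - ?yl) \<le> b - a" using 5 s by (simp add: field_simps)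
  qed
qed

text \<open>Supplies the domination hypothesis of \<open>entropy_distr_le\<close> for interpolated
  quantiles. Convexity of \<open>exp\<close> bounds the weight by the arithmetic mean of the
  reciprocal densities; each reciprocal integrates to at most the length of an interval containing
  the image of \<open>B\<close>, and these lengths combine by comonotonicity.\<close>

lemma interpolation_domination:
  assumes \<mu>: "\<mu> \<in> P2" "has_lebesgue_density \<mu>" and \<nu>: "\<nu> \<in> P2" "has_lebesgue_density \<nu>"
    and s: "0 < s" "s < 1"
  shows "(\<integral>\<^sup>+r. ennreal (exp (- ((1 - s) * ln (rho \<mu> (quantile \<mu> r)) + s * ln (rho \<nu> (quantile \<nu> r))))) *
    indicator {a<..<b} ((1 - s) * quantile \<mu> r + s * quantile \<nu> r) \<partial>U01) \<le> ennreal (b - a)" (is "?I \<le> _")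
proof -
  let ?X = "quantile \<mu>" and ?Y = "quantile \<nu>"
  note [measurable] = quantile_measurable[OF \<mu>(1)] quantile_measurable[OF \<nu>(1)]
  define B where "B = {r \<in> {0<..<1}. a < (1 - s) * ?X r + s * ?Y r \<and> (1 - s) * ?X r + s * ?Y r < b}"
  have AEpos: "AE r in U01. 0 < rho \<kappa> (quantile \<kappa> r)" if "\<kappa> \<in> P2" "has_lebesgue_density \<kappa>" for \<kappa>
  proof -
    note [measurable] = quantile_measurable[OF that(1)]
    have "AE z in distr U01 borel (quantile \<kappa>). 0 < rho \<kappa> z"
      unfolding distr_quantile[OF that(1)] by (rule rho_pos_AE[OF P2D(1,2)[OF that(1)] that(2)])
    then show ?thesis by (subst (asm) AE_distr_iff) auto
  qed
  show ?thesis
  proof (cases "B = {}")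
    case True
    then have "?I = (\<integral>\<^sup>+r. 0 \<partial>U01)"
      by (intro nn_integral_cong) (auto simp: B_def split: split_indicator)
    then show ?thesis by simp
  next
    case False
    obtain xl xu yl yu where L: "xl \<le> xu" "yl \<le> yu" "?X ` B \<subseteq> {xl..xu}" "?Y ` B \<subseteq> {yl..yu}"
      "(1 - s) * (xu - xl) + s * (yu - yl) \<le> b - a"
      by (rule comonotone_image_lengths[OF False s, of ?X ?Y a b]) (auto simp: B_def quantile_mono \<mu> \<nu>)
    have "?I \<le> (\<integral>\<^sup>+r. ennreal (1 - s) * (ennreal (1 / rho \<mu> (?X r)) * indicator {xl..xu} (?X r)) +
        ennreal s * (ennreal (1 / rho \<nu> (?Y r)) * indicator {yl..yu} (?Y r)) \<partial>U01)"
    proof (rule nn_integral_mono_AE)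
      have "AE r in U01. r \<in> {0<..<1}" by (rule AE_I2) simp
      then show "AE r in U01. ennreal (exp (- ((1 - s) * ln (rho \<mu> (quantile \<mu> r)) + s * ln (rho \<nu> (quantile \<nu> r))))) *
          indicator {a<..<b} ((1 - s) * quantile \<mu> r + s * quantile \<nu> r)
        \<le> ennreal (1 - s) * (ennreal (1 / rho \<mu> (?X r)) * indicator {xl..xu} (?X r)) +
          ennreal s * (ennreal (1 / rho \<nu> (?Y r)) * indicator {yl..yu} (?Y r))"
        using AEpos[OF \<mu>] AEpos[OF \<nu>]
      proof eventually_elim
        case (elim r)
        show ?case
        proof (cases "r \<in> B")
          case True
          then have XY: "?X r \<in> {xl..xu}" "?Y r \<in> {yl..yu}" using L by auto
          have "exp ((1 - s) * (- ln (rho \<mu> (?X r))) + s * (- ln (rho \<nu> (?Y r))))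
            \<le> (1 - s) * exp (- ln (rho \<mu> (?X r))) + s * exp (- ln (rho \<nu> (?Y r)))"
            using convex_onD[OF exp_convex, of s "- ln (rho \<mu> (?X r))" "- ln (rho \<nu> (?Y r))"] s by simp
          also have "\<dots> = (1 - s) * (1 / rho \<mu> (?X r)) + s * (1 / rho \<nu> (?Y r))"
            using elim by (simp add: exp_minus inverse_eq_divide)
          finally have e: "exp (- ((1 - s) * ln (rho \<mu> (quantile \<mu> r)) + s * ln (rho \<nu> (quantile \<nu> r))))
             \<le> (1 - s) * (1 / rho \<mu> (?X r)) + s * (1 / rho \<nu> (?Y r))" by (simp add: algebra_simps)
          have "ennreal (exp (- ((1 - s) * ln (rho \<mu> (quantile \<mu> r)) + s * ln (rho \<nu> (quantile \<nu> r)))))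
             \<le> ennreal ((1 - s) * (1 / rho \<mu> (?X r)) + s * (1 / rho \<nu> (?Y r)))" by (rule ennreal_leI[OF e])
          also have "\<dots> = ennreal (1 - s) * ennreal (1 / rho \<mu> (?X r)) + ennreal s * ennreal (1 / rho \<nu> (?Y r))"
            using s by (simp add: ennreal_mult'[symmetric])
          finally show ?thesis using XY True by (simp add: B_def)
        next
          case False
          then show ?thesis using elim by (auto simp: B_def split: split_indicator)
        qed
      qed
    qed
    also have "\<dots> = ennreal (1 - s) * (\<integral>\<^sup>+r. ennreal (1 / rho \<mu> (?X r)) * indicator {xl..xu} (?X r) \<partial>U01) +
      ennreal s * (\<integral>\<^sup>+r. ennreal (1 / rho \<nu> (?Y r)) * indicator {yl..yu} (?Y r) \<partial>U01)"
      by (simp add: nn_integral_add nn_integral_cmult)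
    also have "\<dots> \<le> ennreal (1 - s) * ennreal (xu - xl) + ennreal s * ennreal (yu - yl)"
      using nn_integral_inverse_rho_quantile[OF \<mu>, of "{xl..xu}"] nn_integral_inverse_rho_quantile[OF \<nu>, of "{yl..yu}"] L(1,2)
      by (intro add_mono mult_left_mono) auto
    also have "\<dots> = ennreal ((1 - s) * (xu - xl) + s * (yu - yl))"
      using s L by (simp add: ennreal_plus ennreal_mult)
    also have "\<dots> \<le> ennreal (b - a)" by (rule ennreal_leI) fact
    finally show ?thesis .
  qed
qed

text \<open>Isolates what the metric theory of the flow uses; symmetry, superquadratic growth and
  the condition relating \<open>J\<close> to the variance enter only in
  \<open>mean_field\<close>.\<close>

locale semiconvex_potential =
  fixes \<Psi> :: "real \<Rightarrow> real" and J L C :: real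
  assumes conv: "convex_on UNIV (\<lambda>z. \<Psi> z + L / 2 * z\<^sup>2)" and J: "0 \<le> J" and L: "0 \<le> L"
    and measurable_\<Psi> [measurable]: "\<Psi> \<in> borel_measurable borel" and lb: "\<And>z. - C \<le> \<Psi> z"
begin

text \<open>The entropy contributes no error, \<open>\<Psi>\<close> contributes \<open>L\<close>
  pointwise, and the interaction contributes \<open>J\<close> times a squared difference of means.
  The distance estimate is the parallelogram identity for quantiles, followed by
  \<open>W2_square_le_coupling\<close>; its validity for every \<open>\<xi>\<close> is what the
  evolution inequality exploits.\<close>

lemma displacement_convexity:
  assumes \<mu>: "finite_energy \<Psi> \<mu>" and \<nu>: "finite_energy \<Psi> \<nu>" and s: "0 < s" "s < 1"
  obtains \<kappa> where "finite_energy \<Psi> \<kappa>"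
    "real_energy \<Psi> J \<kappa> \<le> (1 - s) * real_energy \<Psi> J \<mu> + s * real_energy \<Psi> J \<nu> + (L + J) / 2 * (s * (1 - s) * (W2 \<mu> \<nu>)\<^sup>2)"
    "\<And>\<xi>. \<xi> \<in> P2 \<Longrightarrow> (W2 \<kappa> \<xi>)\<^sup>2 \<le> (1 - s) * (W2 \<mu> \<xi>)\<^sup>2 + s * (W2 \<nu> \<xi>)\<^sup>2 - s * (1 - s) * (W2 \<mu> \<nu>)\<^sup>2"
proof -
  note M = finite_energyD[OF \<mu>] note N = finite_energyD[OF \<nu>]
  let ?X = "quantile \<mu>" and ?Y = "quantile \<nu>"
  note [measurable] = quantile_measurable[OF M(1)] quantile_measurable[OF N(1)]
  interpret prob_space U01 by (rule prob_space_U01)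
  define Z where "Z r = (1 - s) * ?X r + s * ?Y r" for r
  have [measurable]: "Z \<in> borel_measurable U01" unfolding Z_def by measurable
  have Z2: "integrable U01 (\<lambda>r. (Z r)\<^sup>2)" unfolding Z_def
    by (intro integrable_square_lincomb quantile_square_integrable M N) measurable
  define \<kappa> where "\<kappa> = distr U01 borel Z"
  have KP: "\<kappa> \<in> P2" unfolding \<kappa>_def by (intro P2_distrI prob_space_U01 Z2) measurable
  let ?h = "\<lambda>r. (1 - s) * ln (rho \<mu> (?X r)) + s * ln (rho \<nu> (?Y r))"
  have iX: "integrable U01 (\<lambda>r. ln (rho \<mu> (?X r)))" "(\<integral>r. ln (rho \<mu> (?X r)) \<partial>U01) = (\<integral>z. ln (rho \<mu> z) \<partial>\<mu>)"
    using quantile_P2_distr[OF M(1), of "\<lambda>z. ln (rho \<mu> z)"] M(3) by auto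
  have iY: "integrable U01 (\<lambda>r. ln (rho \<nu> (?Y r)))" "(\<integral>r. ln (rho \<nu> (?Y r)) \<partial>U01) = (\<integral>z. ln (rho \<nu> z) \<partial>\<nu>)"
    using quantile_P2_distr[OF N(1), of "\<lambda>z. ln (rho \<nu> z)"] N(3) by auto
  have h: "integrable U01 ?h" using iX iY by auto
  have dom: "(\<integral>\<^sup>+r. ennreal (exp (- ?h r)) * indicator {a<..<b} (Z r) \<partial>U01) \<le> ennreal (b - a)" if "a < b" for a b
    unfolding Z_def using interpolation_domination[OF M(1,2) N(1,2) s] by simp
  note ent = entropy_distr_le[OF prob_space_U01 \<open>Z \<in> borel_measurable U01\<close> Z2 h dom, folded \<kappa>_def]
  have ent_le: "(\<integral>z. ln (rho \<kappa> z) \<partial>\<kappa>) \<le> (1 - s) * (\<integral>z. ln (rho \<mu> z) \<partial>\<mu>) + s * (\<integral>z. ln (rho \<nu> z) \<partial>\<nu>)"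
    using ent(3) iX iY by simp
  have D2: "integrable U01 (\<lambda>r. (?X r - ?Y r)\<^sup>2)"
    by (intro integrable_square_diff quantile_square_integrable M N) measurable
  have pX: "integrable U01 (\<lambda>r. \<Psi> (?X r))" "(\<integral>r. \<Psi> (?X r) \<partial>U01) = (\<integral>z. \<Psi> z \<partial>\<mu>)"
    using quantile_P2_distr[OF M(1), of \<Psi>] M(4) by auto
  have pY: "integrable U01 (\<lambda>r. \<Psi> (?Y r))" "(\<integral>r. \<Psi> (?Y r) \<partial>U01) = (\<integral>z. \<Psi> z \<partial>\<nu>)"
    using quantile_P2_distr[OF N(1), of \<Psi>] N(4) by auto
  have pw: "\<Psi> (Z r) \<le> (1 - s) * \<Psi> (?X r) + s * \<Psi> (?Y r) + L / 2 * (s * (1 - s)) * (?X r - ?Y r)\<^sup>2" for r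
  proof -
    have "\<Psi> (Z r) + L / 2 * (Z r)\<^sup>2 \<le> (1 - s) * (\<Psi> (?X r) + L / 2 * (?X r)\<^sup>2) + s * (\<Psi> (?Y r) + L / 2 * (?Y r)\<^sup>2)"
      using convex_onD[OF conv, of s "?X r" "?Y r"] s by (simp add: Z_def)
    moreover have "(1 - s) * (?X r)\<^sup>2 + s * (?Y r)\<^sup>2 - (Z r)\<^sup>2 = s * (1 - s) * (?X r - ?Y r)\<^sup>2"
      unfolding Z_def by (simp add: power2_eq_square algebra_simps)
    then have "L / 2 * ((1 - s) * (?X r)\<^sup>2 + s * (?Y r)\<^sup>2 - (Z r)\<^sup>2) = L / 2 * (s * (1 - s)) * (?X r - ?Y r)\<^sup>2" by simp
    ultimately show ?thesis by (simp add: algebra_simps add_divide_distrib diff_divide_distrib)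
  qed
  have iR: "integrable U01 (\<lambda>r. (1 - s) * \<Psi> (?X r) + s * \<Psi> (?Y r) + L / 2 * (s * (1 - s)) * (?X r - ?Y r)\<^sup>2)"
    using pX pY D2 by auto
  have pZ: "integrable U01 (\<lambda>r. \<Psi> (Z r))"
  proof (rule Bochner_Integration.integrable_bound[OF Bochner_Integration.integrable_add[OF integrable_abs[OF iR] integrable_const[of "\<bar>C\<bar>"]]])
    show "AE r in U01. norm (\<Psi> (Z r)) \<le> norm (\<bar>(1 - s) * \<Psi> (?X r) + s * \<Psi> (?Y r) + L / 2 * (s * (1 - s)) * (?X r - ?Y r)\<^sup>2\<bar> + \<bar>C\<bar>)"
    proof (rule AE_I2)
      fix r show "norm (\<Psi> (Z r)) \<le> norm (\<bar>(1 - s) * \<Psi> (?X r) + s * \<Psi> (?Y r) + L / 2 * (s * (1 - s)) * (?X r - ?Y r)\<^sup>2\<bar> + \<bar>C\<bar>)"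
        using pw[of r] lb[of "Z r"] unfolding real_norm_def by linarith
    qed
  qed measurable
  have K\<Psi>: "integrable \<kappa> \<Psi>" "(\<integral>z. \<Psi> z \<partial>\<kappa>) = (\<integral>r. \<Psi> (Z r) \<partial>U01)"
    unfolding \<kappa>_def using pZ by (auto simp: integrable_distr_eq integral_distr)
  have "(\<integral>r. \<Psi> (Z r) \<partial>U01) \<le> (\<integral>r. (1 - s) * \<Psi> (?X r) + s * \<Psi> (?Y r) + L / 2 * (s * (1 - s)) * (?X r - ?Y r)\<^sup>2 \<partial>U01)"
    by (rule integral_mono[OF pZ iR pw])
  also have "\<dots> = (1 - s) * (\<integral>z. \<Psi> z \<partial>\<mu>) + s * (\<integral>z. \<Psi> z \<partial>\<nu>) + L / 2 * (s * (1 - s)) * (W2 \<mu> \<nu>)\<^sup>2"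
    using pX pY D2 by (simp add: W2_square[OF M(1) N(1)])
  finally have \<Psi>_le: "(\<integral>z. \<Psi> z \<partial>\<kappa>) \<le> \<dots>" unfolding K\<Psi>(2) .
  have fin: "finite_energy \<Psi> \<kappa>" unfolding finite_energy_def using KP ent K\<Psi> by auto
  have mi: "integrable U01 ?X" "integrable U01 ?Y"
    using quantile_P2_distr(1)[OF M(1) measurable_ident_sets[OF refl], THEN iffD1, OF P2_integrable_id[OF M(1)]]
      quantile_P2_distr(1)[OF N(1) measurable_ident_sets[OF refl], THEN iffD1, OF P2_integrable_id[OF N(1)]] by blast+
  have "mean \<kappa> = (\<integral>r. Z r \<partial>U01)" unfolding \<kappa>_def by (subst integral_distr) auto
  also have "\<dots> = (1 - s) * (\<integral>r. ?X r \<partial>U01) + s * (\<integral>r. ?Y r \<partial>U01)" unfolding Z_def using mi by simp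
  also have "\<dots> = (1 - s) * mean \<mu> + s * mean \<nu>"
    using quantile_P2_distr(2)[OF M(1) measurable_ident_sets[OF refl]] quantile_P2_distr(2)[OF N(1) measurable_ident_sets[OF refl]] by simp
  finally have mk: "mean \<kappa> = (1 - s) * mean \<mu> + s * mean \<nu>" .
  have "(mean \<mu> - mean \<nu>)\<^sup>2 \<le> (W2 \<mu> \<nu>)\<^sup>2"
    using mean_diff_le_W2[OF M(1) N(1)] by (simp add: abs_le_square_iff[symmetric])
  then have "s * (1 - s) * (mean \<mu> - mean \<nu>)\<^sup>2 \<le> s * (1 - s) * (W2 \<mu> \<nu>)\<^sup>2" using s by (intro mult_left_mono) auto
  moreover have "(1 - s) * (mean \<mu>)\<^sup>2 + s * (mean \<nu>)\<^sup>2 - (mean \<kappa>)\<^sup>2 = s * (1 - s) * (mean \<mu> - mean \<nu>)\<^sup>2"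
    unfolding mk by (simp add: power2_eq_square algebra_simps)
  ultimately have "J / 2 * ((1 - s) * (mean \<mu>)\<^sup>2 + s * (mean \<nu>)\<^sup>2 - (mean \<kappa>)\<^sup>2) \<le> J / 2 * (s * (1 - s) * (W2 \<mu> \<nu>)\<^sup>2)"
    using J by (intro mult_left_mono) auto
  then have en: "real_energy \<Psi> J \<kappa> \<le> (1 - s) * real_energy \<Psi> J \<mu> + s * real_energy \<Psi> J \<nu> + (L + J) / 2 * (s * (1 - s) * (W2 \<mu> \<nu>)\<^sup>2)"
    using ent_le \<Psi>_le unfolding real_energy_def energy_def by (simp add: algebra_simps add_divide_distrib diff_divide_distrib)
  have W: "(W2 \<kappa> \<xi>)\<^sup>2 \<le> (1 - s) * (W2 \<mu> \<xi>)\<^sup>2 + s * (W2 \<nu> \<xi>)\<^sup>2 - s * (1 - s) * (W2 \<mu> \<nu>)\<^sup>2" if X: "\<xi> \<in> P2" for \<xi>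
  proof -
    note [measurable] = quantile_measurable[OF X]
    have i: "integrable U01 (\<lambda>r. (?X r - quantile \<xi> r)\<^sup>2)" "integrable U01 (\<lambda>r. (?Y r - quantile \<xi> r)\<^sup>2)"
      by (intro integrable_square_diff quantile_square_integrable M N X; measurable)+
    have "(W2 \<kappa> \<xi>)\<^sup>2 \<le> (\<integral>r. (Z r - quantile \<xi> r)\<^sup>2 \<partial>U01)"
      unfolding \<kappa>_def by (subst (1) distr_quantile[OF X, symmetric], rule W2_square_le_coupling)
        (use Z2 quantile_square_integrable[OF X] in \<open>auto simp: prob_space_U01\<close>)
    also have "\<dots> = (\<integral>r. (1 - s) * (?X r - quantile \<xi> r)\<^sup>2 + s * (?Y r - quantile \<xi> r)\<^sup>2 - s * (1 - s) * (?X r - ?Y r)\<^sup>2 \<partial>U01)"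
      unfolding Z_def by (intro Bochner_Integration.integral_cong) (auto simp: power2_eq_square algebra_simps)
    also have "\<dots> = (1 - s) * (W2 \<mu> \<xi>)\<^sup>2 + s * (W2 \<nu> \<xi>)\<^sup>2 - s * (1 - s) * (W2 \<mu> \<nu>)\<^sup>2"
      using i D2 by (simp add: W2_square M N X)
    finally show ?thesis .
  qed
  show ?thesis by (rule that[OF fin en W])
qed

text \<open>The local bound given by the slope is tested at a point of the interpolation towards
  \<open>\<nu>\<close> at distance at most \<open>s\<close> times \<open>W2 \<mu> \<nu>\<close>.
  Convexity up to the quadratic error transports it to \<open>\<nu>\<close> after division by
  \<open>s\<close>.\<close>

lemma slope_inequality:
  assumes \<mu>: "finite_energy \<Psi> \<mu>" and \<nu>: "finite_energy \<Psi> \<nu>"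
    and slope: "metric_slope (free_energy \<Psi> J) \<mu> \<le> ereal v" and v: "0 \<le> v"
  shows "real_energy \<Psi> J \<mu> - v * W2 \<mu> \<nu> - (L + J) / 2 * (W2 \<mu> \<nu>)\<^sup>2 \<le> real_energy \<Psi> J \<nu>"
proof (cases "W2 \<mu> \<nu> = 0")
  case True
  then show ?thesis using W2_eq_0D[OF finite_energyD(1)[OF \<mu>] finite_energyD(1)[OF \<nu>]] by simp
next
  case False
  define D where "D = W2 \<mu> \<nu>"
  have D: "0 < D" using False by (simp add: D_def less_le)
  note P = finite_energyD(1)[OF \<mu>] finite_energyD(1)[OF \<nu>]
  have "real_energy \<Psi> J \<mu> - real_energy \<Psi> J \<nu> - (L + J) / 2 * D\<^sup>2 \<le> v * D + e * D" if "0 < e" for e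
  proof -
    have "Limsup (at_W2 \<mu>) (\<lambda>\<nu>. max 0 ((free_energy \<Psi> J \<mu> - free_energy \<Psi> J \<nu>) / ereal (W2 \<mu> \<nu>))) < ereal (v + e)"
    proof (rule le_less_trans)
      show "Limsup (at_W2 \<mu>) (\<lambda>\<nu>. max 0 ((free_energy \<Psi> J \<mu> - free_energy \<Psi> J \<nu>) / ereal (W2 \<mu> \<nu>))) \<le> ereal v"
        using slope finite_energyD(5)[OF \<mu>, of J] by (simp add: metric_slope_def)
    qed (use that in simp)
    then have "eventually (\<lambda>\<nu>. max 0 ((free_energy \<Psi> J \<mu> - free_energy \<Psi> J \<nu>) / ereal (W2 \<mu> \<nu>)) < ereal (v + e)) (at_W2 \<mu>)"
      by (rule Limsup_lessD)
    then obtain r where r: "r > 0" "\<And>\<nu>. \<nu> \<in> P2 \<Longrightarrow> 0 < W2 \<mu> \<nu> \<Longrightarrow> W2 \<mu> \<nu> < r \<Longrightarrow>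
        max 0 ((free_energy \<Psi> J \<mu> - free_energy \<Psi> J \<nu>) / ereal (W2 \<mu> \<nu>)) < ereal (v + e)"
      unfolding eventually_at_W2 by blast
    \<comment> \<open>The second entry keeps \<open>\<kappa>\<close> inside the ball of radius
      \<open>r\<close> from the limsup, the first keeps \<open>s\<close> below
      \<open>1\<close>.\<close>
    define s where "s = min (1/2) (r / (2 * D))"
    have s: "0 < s" "s < 1" "s * D < r" using r(1) D by (auto simp: s_def min_def field_simps)
    obtain \<kappa> where K: "finite_energy \<Psi> \<kappa>"
      "real_energy \<Psi> J \<kappa> \<le> (1 - s) * real_energy \<Psi> J \<mu> + s * real_energy \<Psi> J \<nu> + (L + J) / 2 * (s * (1 - s) * (W2 \<mu> \<nu>)\<^sup>2)"
      "\<And>\<xi>. \<xi> \<in> P2 \<Longrightarrow> (W2 \<kappa> \<xi>)\<^sup>2 \<le> (1 - s) * (W2 \<mu> \<xi>)\<^sup>2 + s * (W2 \<nu> \<xi>)\<^sup>2 - s * (1 - s) * (W2 \<mu> \<nu>)\<^sup>2"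
      using displacement_convexity[OF \<mu> \<nu> s(1,2)] by metis
    note KP = finite_energyD(1)[OF K(1)]
    have "(W2 \<kappa> \<mu>)\<^sup>2 \<le> s * D\<^sup>2 - s * (1 - s) * D\<^sup>2"
      using K(3)[OF P(1)] by (simp add: P D_def W2_sym[OF P(2,1)])
    also have "\<dots> = (s * D)\<^sup>2" by (simp add: power2_eq_square algebra_simps)
    finally have w: "W2 \<mu> \<kappa> \<le> s * D"
      using s D W2_sym[OF P(1) KP] by (metis power2_le_imp_le mult_nonneg_nonneg less_imp_le)
    have "real_energy \<Psi> J \<mu> - real_energy \<Psi> J \<kappa> \<le> (v + e) * (s * D)"
    \<comment> \<open>The filter \<open>at_W2\<close> says nothing about points at distance zero,
      hence the separate case.\<close>
    proof (cases "W2 \<mu> \<kappa> = 0")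
      case True
      then have "\<mu> = \<kappa>" by (rule W2_eq_0D[OF P(1) KP])
      then show ?thesis using \<open>0 < e\<close> s D v by simp
    next
      case False
      then have pos: "0 < W2 \<mu> \<kappa>" by (simp add: less_le)
      have "max 0 ((free_energy \<Psi> J \<mu> - free_energy \<Psi> J \<kappa>) / ereal (W2 \<mu> \<kappa>)) < ereal (v + e)"
        using r(2)[OF KP pos] w s(3) by simp
      then have "(real_energy \<Psi> J \<mu> - real_energy \<Psi> J \<kappa>) / W2 \<mu> \<kappa> < v + e" "0 < v + e"
        using pos by (auto simp: finite_energyD(5)[OF \<mu>] finite_energyD(5)[OF K(1)])
      then have "real_energy \<Psi> J \<mu> - real_energy \<Psi> J \<kappa> \<le> (v + e) * W2 \<mu> \<kappa>"
        using pos by (simp add: field_simps)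
      also have "\<dots> \<le> (v + e) * (s * D)" using w \<open>0 < v + e\<close> by (intro mult_left_mono) auto
      finally show ?thesis .
    qed
    then have "s * (real_energy \<Psi> J \<mu> - real_energy \<Psi> J \<nu> - (L + J) / 2 * ((1 - s) * D\<^sup>2)) \<le> s * ((v + e) * D)"
      using K(2) by (simp add: D_def algebra_simps)
    then have "real_energy \<Psi> J \<mu> - real_energy \<Psi> J \<nu> - (L + J) / 2 * ((1 - s) * D\<^sup>2) \<le> (v + e) * D" using s(1) by simp
    moreover have "(L + J) / 2 * ((1 - s) * D\<^sup>2) \<le> (L + J) / 2 * D\<^sup>2"
      using L J s by (intro mult_left_mono) (auto simp: algebra_simps)
    ultimately show ?thesis unfolding distrib_right[of v e D] by linarith
  qed
  then have "real_energy \<Psi> J \<mu> - real_energy \<Psi> J \<nu> - (L + J) / 2 * D\<^sup>2 \<le> v * D + e" if "0 < e" for e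
    using that D by (metis divide_pos_pos nonzero_eq_divide_eq less_irrefl)
  then have "real_energy \<Psi> J \<mu> - real_energy \<Psi> J \<nu> - (L + J) / 2 * D\<^sup>2 \<le> v * D" by (rule field_le_epsilon)
  then show ?thesis by (simp add: D_def)
qed

end

section \<open>Gradient flows\<close>

lemma sum_lengths_le_emeasure:
  fixes q :: "(real \<times> real) set"
  assumes "finite q" "\<And>l u. (l, u) \<in> q \<Longrightarrow> l < u \<and> {l..u} \<subseteq> U"
    "pairwise (\<lambda>p p'. {fst p<..<snd p} \<inter> {fst p'<..<snd p'} = {}) q" and U: "U \<in> sets borel"
  shows "ennreal (\<Sum>(l, u)\<in>q. u - l) \<le> emeasure lborel U"
proof -
  have "ennreal (\<Sum>(l, u)\<in>q. u - l) = (\<Sum>p\<in>q. ennreal (snd p - fst p))"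
    using assms(2) by (subst sum_ennreal) (force simp: case_prod_unfold less_imp_le)+
  also have "\<dots> = (\<Sum>p\<in>q. emeasure lborel {fst p<..<snd p})"
    using assms(2) by (intro sum.cong) (force simp: less_imp_le)+
  also have "\<dots> = emeasure lborel (\<Union>p\<in>q. {fst p<..<snd p})"
    using assms(1,3) by (intro sum_emeasure) (auto simp: disjoint_family_on_def pairwise_def)
  also have "\<dots> \<le> emeasure lborel U"
    using assms(2) U by (intro emeasure_mono) force+
  finally show ?thesis .
qed

text \<open>A gauge argument. At good points the gauge limits increments to \<open>e\<close> times
  the length; at exceptional points it confines intervals to an open set \<open>U\<close> of measure
  below \<open>\<delta>\<close>, where absolute continuity makes the total increment less than
  \<open>e\<close>.\<close>

lemma abs_cont_nonincreasing:
  fixes f :: "real \<Rightarrow> real"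
  assumes ac: "abs_cont_on {a..b} f" and "a \<le> b"
    and AE: "AE t in lborel. t \<in> {a<..<b} \<longrightarrow> (\<exists>d\<le>0. (f has_real_derivative d) (at t))"
  shows "f b \<le> f a"
proof -
  have "f b - f a \<le> e * (b - a) + e" if e: "0 < e" for e
  proof -
    obtain \<delta> where \<delta>: "0 < \<delta>" "\<And>I. finite I \<Longrightarrow> (\<And>l u. (l, u) \<in> I \<Longrightarrow> l < u \<and> {l..u} \<subseteq> {a..b}) \<Longrightarrow>
        pairwise (\<lambda>p q. {fst p<..<snd p} \<inter> {fst q<..<snd q} = {}) I \<Longrightarrow>
        (\<Sum>(l, u)\<in>I. u - l) < \<delta> \<Longrightarrow> (\<Sum>(l, u)\<in>I. \<bar>f u - f l\<bar>) < e"
    proof -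
      obtain \<delta> where "0 < \<delta>" "\<forall>I. finite I \<and> (\<forall>(l, u)\<in>I. l < u \<and> {l..u} \<subseteq> {a..b}) \<and>
        pairwise (\<lambda>p q. {fst p<..<snd p} \<inter> {fst q<..<snd q} = {}) I \<and>
        (\<Sum>(l, u)\<in>I. u - l) < \<delta> \<longrightarrow> (\<Sum>(l, u)\<in>I. \<bar>f u - f l\<bar>) < e"
        using ac e unfolding abs_cont_on_def by blast
      note d = this
      show thesis
      proof (rule that[OF d(1)])
        fix I :: "(real \<times> real) set"
        assume I: "finite I" "\<And>l u. (l, u) \<in> I \<Longrightarrow> l < u \<and> {l..u} \<subseteq> {a..b}"
          "pairwise (\<lambda>p q. {fst p<..<snd p} \<inter> {fst q<..<snd q} = {}) I" "(\<Sum>(l, u)\<in>I. u - l) < \<delta>"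
        have "\<forall>(l, u)\<in>I. l < u \<and> {l..u} \<subseteq> {a..b}" using I(2) by blast
        with d(2) I show "(\<Sum>(l, u)\<in>I. \<bar>f u - f l\<bar>) < e" by blast
      qed
    qed
    obtain N0 where N0: "N0 \<in> null_sets lborel"
      "{t \<in> space lborel. \<not> (t \<in> {a<..<b} \<longrightarrow> (\<exists>d\<le>0. (f has_real_derivative d) (at t)))} \<subseteq> N0"
      using AE by (auto simp: eventually_ae_filter)
    \<comment> \<open>The endpoints count as exceptional because derivatives are given only in the
      open interval.\<close>
    define N where "N = N0 \<union> {a, b}"
    have N: "N \<in> null_sets lborel" unfolding N_def using N0(1) by (intro null_sets.Un[OF _ finite_imp_null_set_lborel] null_sets.Un[OF finite_imp_null_set_lborel]) auto
    obtain U where U: "open U" "N \<subseteq> U" "emeasure lborel (U - N) < ennreal \<delta>"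
      using outer_regular_lborel[OF _ \<delta>(1)] null_setsD2[OF N] by (metis sets_lborel)
    have "emeasure lborel U = emeasure lborel (U - N)"
      using N U by (subst emeasure_Diff_null_set) auto
    with U(3) have Ulen: "emeasure lborel U < ennreal \<delta>" by simp
    have "\<exists>r>0. \<forall>x. \<bar>x - t\<bar> < r \<longrightarrow> (t \<le> x \<longrightarrow> f x - f t \<le> e * (x - t)) \<and> (x \<le> t \<longrightarrow> f t - f x \<le> e * (t - x))"
      if t: "t \<in> {a<..<b}" "t \<notin> N" for t
    proof -
      obtain d where d: "d \<le> 0" "(f has_real_derivative d) (at t)"
        using t N0(2) by (auto simp: N_def)
      have "((\<lambda>x. (f x - f t) / (x - t)) \<longlongrightarrow> d) (at t)" using d(2) by (simp add: has_field_derivative_iff)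
      then have "\<forall>\<^sub>F x in at t. (f x - f t) / (x - t) < e" by (rule order_tendstoD) (use d e in auto)
      then obtain r where r: "r > 0" "\<And>x. x \<noteq> t \<Longrightarrow> \<bar>x - t\<bar> < r \<Longrightarrow> (f x - f t) / (x - t) < e"
        unfolding eventually_at dist_real_def by auto
      show ?thesis
      proof (intro exI[of _ r] conjI allI impI r(1))
        fix x assume x: "\<bar>x - t\<bar> < r"
        { assume "t \<le> x" then show "f x - f t \<le> e * (x - t)"
            using r(2)[OF _ x] by (cases "x = t") (auto simp: pos_divide_less_eq) }
        { assume "x \<le> t" then show "f t - f x \<le> e * (t - x)"
            using r(2)[OF _ x] by (cases "x = t") (auto simp: neg_divide_less_eq algebra_simps) }
      qed
    qed
    then obtain R where R: "\<And>t. t \<in> {a<..<b} \<Longrightarrow> t \<notin> N \<Longrightarrow> R t > 0 \<and> (\<forall>x. \<bar>x - t\<bar> < R t \<longrightarrow>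
        (t \<le> x \<longrightarrow> f x - f t \<le> e * (x - t)) \<and> (x \<le> t \<longrightarrow> f t - f x \<le> e * (t - x)))"
      by metis
    define g where "g t = (if t \<in> N then U else if t \<in> {a<..<b} then ball t (R t) else UNIV)" for t
    have "gauge g" unfolding gauge_def g_def using U R by auto
    then obtain p where p: "p tagged_division_of {a..b}" "g fine p" by (rule fine_division_exists_real)
    note pd = tagged_division_ofD[OF p(1)[unfolded box_real(2)[symmetric]]]
    have K: "K = {Inf K..Sup K} \<and> Inf K \<le> Sup K \<and> a \<le> Inf K \<and> Sup K \<le> b \<and> x \<in> K \<and> K \<subseteq> g x" if xKp: "(x, K) \<in> p" for x K
    proof -
      obtain c d where cd: "K = {c..d}" using pd(4)[OF xKp] by auto
      have "x \<in> K" using pd(2)[OF xKp] .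
      then have "c \<le> d" using cd by auto
      moreover have "K \<subseteq> {a..b}" using pd(3)[OF xKp] by simp
      moreover have "K \<subseteq> g x" using p(2) xKp by (auto simp: fine_def)
      ultimately show ?thesis using cd \<open>x \<in> K\<close> by auto
    qed
    \<comment> \<open>Degenerate intervals are left out: \<open>abs_cont_on\<close> speaks of
      \<open>a < b\<close>, and nondegeneracy makes the passage to endpoint pairs injective.\<close>
    define q where "q = {(x, K). (x, K) \<in> p \<and> x \<in> N \<and> Inf K < Sup K}"
    have qp: "q \<subseteq> p" by (auto simp: q_def)
    have finp: "finite p" using pd(1) .
    then have finq: "finite q" using qp finite_subset by blast
    let ?I = "(\<lambda>(x, K). (Inf K, Sup K)) ` q"
    have disj: "{Inf K<..<Sup K} \<inter> {Inf K'<..<Sup K'} = {}" if "(x, K) \<in> p" "(x', K') \<in> p" "(x, K) \<noteq> (x', K')" for x K x' K'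
      using pd(5)[OF that] K[OF that(1)] K[OF that(2)] by (metis interior_atLeastAtMost_real)
    have inj: "inj_on (\<lambda>(x, K). (Inf K, Sup K)) q"
    proof (rule inj_onI, clarify)
      fix x K x' K' assume a: "(x, K) \<in> q" "(x', K') \<in> q" "Inf K = Inf K'" "Sup K = Sup K'"
      show "x = x' \<and> K = K'"
      proof (rule ccontr)
        assume "\<not> (x = x' \<and> K = K')"
        then have "{Inf K<..<Sup K} \<inter> {Inf K'<..<Sup K'} = {}" using a qp by (intro disj) auto
        then show False using a by (auto simp: q_def)
      qed
    qed
    have pw: "pairwise (\<lambda>p q. {fst p<..<snd p} \<inter> {fst q<..<snd q} = {}) ?I"
      unfolding pairwise_def using disj qp by fastforce
    have Iint: "l < u \<and> {l..u} \<subseteq> {a..b} \<and> {l..u} \<subseteq> U" if lu: "(l, u) \<in> ?I" for l u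
    proof -
      obtain x K' where xK: "(x, K') \<in> q" "l = Inf K'" "u = Sup K'" using lu by auto
      then have "(x, K') \<in> p" "x \<in> N" "l < u" by (auto simp: q_def)
      moreover have "{l..u} = K'" "a \<le> l" "u \<le> b" "K' \<subseteq> g x" using K[OF \<open>(x, K') \<in> p\<close>] xK(2,3) by simp_all
      ultimately show ?thesis by (auto simp: g_def)
    qed
    have "ennreal (\<Sum>(l, u)\<in>?I. u - l) \<le> emeasure lborel U"
      by (rule sum_lengths_le_emeasure) (use finq pw Iint U(1) in auto)
    also note Ulen
    finally have "(\<Sum>(l, u)\<in>?I. u - l) < \<delta>" by (metis ennreal_leI not_le)
    then have "(\<Sum>(l, u)\<in>?I. \<bar>f u - f l\<bar>) < e" using \<delta>(2)[of ?I] finq pw Iint by auto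
    then have s1: "(\<Sum>(x, K)\<in>q. f (Sup K) - f (Inf K)) \<le> e"
    proof -
      have "(\<Sum>(x, K)\<in>q. f (Sup K) - f (Inf K)) \<le> (\<Sum>(x, K)\<in>q. \<bar>f (Sup K) - f (Inf K)\<bar>)"
        by (rule sum_mono) auto
      also have "\<dots> = (\<Sum>(l, u)\<in>?I. \<bar>f u - f l\<bar>)"
        by (subst sum.reindex[OF inj]) (simp add: case_prod_unfold)
      finally show ?thesis using \<open>(\<Sum>(l, u)\<in>?I. \<bar>f u - f l\<bar>) < e\<close> by simp
    qed
    have "(\<Sum>(x, K)\<in>p - q. f (Sup K) - f (Inf K)) \<le> (\<Sum>(x, K)\<in>p - q. e * (Sup K - Inf K))"
    proof (rule sum_mono, clarify)
      fix x K' assume xK: "(x, K') \<in> p" "(x, K') \<notin> q"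
      note KK = K[OF xK(1)]
      show "f (Sup K') - f (Inf K') \<le> e * (Sup K' - Inf K')"
      proof (cases "x \<in> N")
        case True
        then have "Inf K' = Sup K'" using xK KK by (auto simp: q_def)
        then show ?thesis by simp
      next
        case False
        have xI: "Inf K' \<le> x" "x \<le> Sup K'" using KK by (metis atLeastAtMost_iff)+
        then have xab: "x \<in> {a<..<b}" using False KK by (force simp: N_def less_le)
        then have "K' \<subseteq> ball x (R x)" using KK False by (auto simp: g_def)
        then have "Inf K' \<in> ball x (R x)" "Sup K' \<in> ball x (R x)" using KK by (metis atLeastAtMost_iff order_refl subsetD)+
        then have "\<bar>Inf K' - x\<bar> < R x" "\<bar>Sup K' - x\<bar> < R x" by (auto simp: dist_real_def)
        then have "f (Sup K') - f x \<le> e * (Sup K' - x)" "f x - f (Inf K') \<le> e * (x - Inf K')"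
          using R[OF xab False] xI by auto
        then show ?thesis by (simp add: algebra_simps)
      qed
    qed
    also have "\<dots> \<le> (\<Sum>(x, K)\<in>p. e * (Sup K - Inf K))"
      using K e by (intro sum_mono2 finp) auto
    also have "\<dots> = e * (b - a)"
      using additive_tagged_division_1[OF \<open>a \<le> b\<close> p(1), of "\<lambda>x. x"] by (simp add: sum_distrib_left[symmetric] case_prod_unfold)
    finally have s2: "(\<Sum>(x, K)\<in>p - q. f (Sup K) - f (Inf K)) \<le> e * (b - a)" .
    have "f b - f a = (\<Sum>(x, K)\<in>p. f (Sup K) - f (Inf K))"
      using additive_tagged_division_1[OF \<open>a \<le> b\<close> p(1), of f] by simp
    also have "\<dots> = (\<Sum>(x, K)\<in>p - q. f (Sup K) - f (Inf K)) + (\<Sum>(x, K)\<in>q. f (Sup K) - f (Inf K))"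
      using sum.subset_diff[OF qp finp] by blast
    finally show ?thesis using s1 s2 by linarith
  qed
  \<comment> \<open>The previous estimate is applied with \<open>e / (b - a + 1)\<close>.\<close>
  then have "f b - f a \<le> 0 + e" if "0 < e" for e
    using that[THEN divide_pos_pos, of "b - a + 1"] \<open>a \<le> b\<close>
    by (metis add.commute add_0 add_nonneg_pos diff_ge_0_iff_ge distrib_left mult.right_neutral nonzero_eq_divide_eq order_less_irrefl zero_less_one)
  then have "f b - f a \<le> 0" by (rule field_le_epsilon)
  then show ?thesis by simp
qed

text \<open>Continuous induction: the last point with value at most \<open>f a\<close> cannot lie
  strictly left of \<open>b\<close>.\<close>

lemma right_local_nonincreasing:
  fixes f :: "real \<Rightarrow> real"
  assumes "continuous_on {a..b} f" "a \<le> b" and loc: "\<And>t. a \<le> t \<Longrightarrow> t < b \<Longrightarrow> \<forall>\<^sub>F x in at_right t. f x \<le> f t"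
  shows "f b \<le> f a"
proof -
  let ?S = "{t \<in> {a..b}. f t \<le> f a}"
  have cl: "closed ?S" using assms(1) by (intro continuous_on_closed_Collect_le continuous_on_const closed_atLeastAtMost)
  have ne: "?S \<noteq> {}" using \<open>a \<le> b\<close> by auto
  have bd: "bdd_above ?S" by (auto intro: bdd_aboveI[of _ b])
  define c where "c = Sup ?S"
  have c: "c \<in> ?S" unfolding c_def by (rule closed_contains_Sup[OF ne bd cl])
  have "c = b"
  proof (rule ccontr)
    assume "c \<noteq> b"
    then have cb: "a \<le> c" "c < b" using c by auto
    have "\<forall>\<^sub>F x in at_right c. f x \<le> f c \<and> x \<in> {c<..<b}"
      using loc[OF cb] eventually_at_right_real[OF cb(2)] by (rule eventually_conj)
    then obtain x where "f x \<le> f c" "c < x" "x < b"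
      using eventually_happens'[OF trivial_limit_at_right_real] by force
    then have "x \<in> ?S" using c by auto
    then have "x \<le> c" unfolding c_def by (rule cSup_upper[OF _ bd])
    then show False using \<open>c < x\<close> by simp
  qed
  then show ?thesis using c by simp
qed

lemma continuous_on_integral_modulus:
  fixes f m :: "real \<Rightarrow> real"
  assumes m: "set_integrable lborel {a..b} m"
    and f: "\<And>s t. a \<le> s \<Longrightarrow> s \<le> t \<Longrightarrow> t \<le> b \<Longrightarrow> \<bar>f t - f s\<bar> \<le> (LINT r:{s..t}|lborel. \<bar>m r\<bar>)"
  shows "continuous_on {a..b} f"
proof -
  have si: "set_integrable lborel {s..t} (\<lambda>r. \<bar>m r\<bar>)" if "a \<le> s" "t \<le> b" for s t
    by (rule set_integrable_subset[OF set_integrable_abs[OF m]]) (use that in auto)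
  define G where "G t = integral {a..t} (\<lambda>r. \<bar>m r\<bar>)" for t
  have cG: "continuous_on {a..b} G" unfolding G_def
    by (intro indefinite_integral_continuous_1 set_borel_integral_eq_integral(1) si) auto
  have le: "\<bar>f t - f s\<bar> \<le> \<bar>G t - G s\<bar>" if "a \<le> s" "s \<le> t" "t \<le> b" for s t
  proof -
    have "(LINT r:{s..t}|lborel. \<bar>m r\<bar>) = integral {s..t} (\<lambda>r. \<bar>m r\<bar>)"
      using that by (intro set_borel_integral_eq_integral si) auto
    moreover have "integral {a..s} (\<lambda>r. \<bar>m r\<bar>) + integral {s..t} (\<lambda>r. \<bar>m r\<bar>) = integral {a..t} (\<lambda>r. \<bar>m r\<bar>)"
      using that by (intro Henstock_Kurzweil_Integration.integral_combine set_borel_integral_eq_integral(1) si) auto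
    ultimately show ?thesis using f[OF that] by (simp add: G_def)
  qed
  then have le': "\<bar>f t - f s\<bar> \<le> \<bar>G t - G s\<bar>" if "s \<in> {a..b}" "t \<in> {a..b}" for s t
    using le[of s t] le[of t s] that by (cases "s \<le> t") (auto simp: abs_minus_commute)
  show ?thesis
    unfolding continuous_on_iff
  proof (intro ballI allI impI)
    fix x \<epsilon> :: real assume x: "x \<in> {a..b}" "0 < \<epsilon>"
    then obtain d where "d > 0" "\<And>y. y \<in> {a..b} \<Longrightarrow> dist y x < d \<Longrightarrow> dist (G y) (G x) < \<epsilon>"
      using cG unfolding continuous_on_iff by blast
    then show "\<exists>d>0. \<forall>y\<in>{a..b}. dist y x < d \<longrightarrow> dist (f y) (f x) < \<epsilon>"
      using le' x(1) unfolding dist_real_def by (metis le_less_trans)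
  qed
qed

text \<open>Distances to a fixed measure are controlled only to the right and only almost
  everywhere. Near the exceptional null set the growth of \<open>f\<close> is compensated by
  \<open>G\<close>, the integral of the modulus over an open neighbourhood \<open>U\<close> of that
  set with total mass below \<open>e\<close>. The corrected function \<open>\<Phi>\<close> is then
  nonincreasing to the right of every point.\<close>

lemma dini_nonincreasing:
  fixes f m :: "real \<Rightarrow> real"
  assumes m: "set_integrable lborel {a..b} m" and "a \<le> b"
    and f: "\<And>s t. a \<le> s \<Longrightarrow> s \<le> t \<Longrightarrow> t \<le> b \<Longrightarrow> \<bar>f t - f s\<bar> \<le> (LINT r:{s..t}|lborel. \<bar>m r\<bar>)"
    and AE: "AE t in lborel. t \<in> {a<..<b} \<longrightarrow> (\<forall>e>0. \<forall>\<^sub>F x in at_right t. f x \<le> f t + e * (x - t))"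
  shows "f b \<le> f a"
proof -
  define M where "M r = indicator {a..b} r * \<bar>m r\<bar>" for r
  have iM: "integrable lborel M"
    using set_integrable_abs[OF m] by (simp add: set_integrable_def M_def[abs_def])
  then have [measurable]: "M \<in> borel_measurable borel" by simp
  have M0: "0 \<le> M r" for r by (simp add: M_def)
  have f': "\<bar>f t - f s\<bar> \<le> (LINT r:{s..t}|lborel. M r)" if "a \<le> s" "s \<le> t" "t \<le> b" for s t
  proof -
    have "(LINT r:{s..t}|lborel. \<bar>m r\<bar>) = (LINT r:{s..t}|lborel. M r)"
      using that by (intro set_lebesgue_integral_cong) (auto simp: M_def)
    then show ?thesis using f[OF that] by simp
  qed
  obtain N0 where N0: "N0 \<in> null_sets lborel"
      "{t \<in> space lborel. \<not> (t \<in> {a<..<b} \<longrightarrow> (\<forall>e>0. \<forall>\<^sub>F x in at_right t. f x \<le> f t + e * (x - t)))} \<subseteq> N0"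
    using AE by (auto simp: eventually_ae_filter)
  \<comment> \<open>The left endpoint joins the null set since the hypothesis covers only the open
    interval, while continuous induction starts at \<open>a\<close>.\<close>
  define N where "N = insert a N0"
  have N: "N \<in> null_sets lborel" unfolding N_def using N0(1) by (subst insert_is_Un, intro null_sets.Un[OF _ finite_imp_null_set_lborel] null_sets.Un[OF finite_imp_null_set_lborel]) auto
  have "f b - f a \<le> e * (b - a) + e" if e: "0 < e" for e
  proof -
    let ?\<nu> = "density lborel (\<lambda>r. ennreal (M r))"
    have "emeasure ?\<nu> (space ?\<nu>) = (\<integral>\<^sup>+r. ennreal (M r) \<partial>lborel)" by (subst emeasure_density) auto
    also have "\<dots> < \<infinity>" using iM M0 by (simp add: nn_integral_eq_integral)
    finally have fin: "emeasure ?\<nu> (space ?\<nu>) \<noteq> \<infinity>" by simp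
    have "emeasure ?\<nu> N = 0"
      using N by (subst emeasure_density) (auto simp: nn_integral_0_iff_AE null_sets_def intro!: nn_integral_null_set)
    \<comment> \<open>Outer regularity is applied to the finite measure with density
      \<open>M\<close> rather than to Lebesgue measure, because it is the integral of
      \<open>M\<close> over \<open>U\<close> that must be small.\<close>
    moreover have "emeasure ?\<nu> N = (INF U\<in>{U. N \<subseteq> U \<and> open U}. emeasure ?\<nu> U)"
      by (rule outer_regular) (use N fin in auto)
    ultimately have "(INF U\<in>{U. N \<subseteq> U \<and> open U}. emeasure ?\<nu> U) < ennreal e" using e by simp
    then obtain U where U: "open U" "N \<subseteq> U" "emeasure ?\<nu> U < ennreal e"
      unfolding INF_less_iff by auto
    have [measurable]: "U \<in> sets borel" using U by auto
    define MU where "MU r = indicator U r * M r" for r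
    have iMU: "integrable lborel MU"
      unfolding MU_def using iM by (rule Bochner_Integration.integrable_bound) (auto split: split_indicator)
    have "ennreal (\<integral>r. MU r \<partial>lborel) = (\<integral>\<^sup>+r. ennreal (MU r) \<partial>lborel)"
      using M0 by (intro nn_integral_eq_integral[symmetric] iMU) (auto simp: MU_def)
    also have "\<dots> = emeasure ?\<nu> U"
      by (subst emeasure_density) (auto simp: MU_def intro!: nn_integral_cong split: split_indicator)
    finally have intMU: "(\<integral>r. MU r \<partial>lborel) < e" using U(3) e by (metis ennreal_leI not_le)
    define G where "G t = (LINT r:{a..t}|lborel. MU r)" for t
    have si: "set_integrable lborel A MU" "set_integrable lborel A M" if "A \<in> sets borel" for A
      unfolding set_integrable_def using that iMU iM by (intro integrable_mult_indicator; simp)+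
    have split: "G t = G s + (LINT r:{s..t}|lborel. MU r)" if "a \<le> s" "s \<le> t" for s t
    proof -
      have "G t = integral {a..t} MU" for t
        unfolding G_def by (intro set_borel_integral_eq_integral si) auto
      moreover have "(LINT r:{s..t}|lborel. MU r) = integral {s..t} MU"
        by (intro set_borel_integral_eq_integral si) auto
      moreover have "integral {a..s} MU + integral {s..t} MU = integral {a..t} MU"
        using that by (intro Henstock_Kurzweil_Integration.integral_combine set_borel_integral_eq_integral(1) si) auto
      ultimately show ?thesis by simp
    qed
    have cG: "continuous_on {a..b} G"
    proof -
      have "G = (\<lambda>t. integral {a..t} MU)"
        unfolding G_def by (intro ext set_borel_integral_eq_integral si) auto
      then show ?thesis
        by (auto intro!: indefinite_integral_continuous_1 set_borel_integral_eq_integral(1) si)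
    qed
    have cf: "continuous_on {a..b} f" by (rule continuous_on_integral_modulus[OF m f])
    define \<Phi> where "\<Phi> t = f t - e * (t - a) - G t" for t
    have "\<Phi> b \<le> \<Phi> a"
    proof (rule right_local_nonincreasing[OF _ \<open>a \<le> b\<close>])
      show "continuous_on {a..b} \<Phi>" unfolding \<Phi>_def by (intro continuous_intros cf cG)
      fix t assume t: "a \<le> t" "t < b"
      have Gmono: "G t \<le> G x" if "t \<le> x" for x
      proof -
        have "0 \<le> (LINT r:{t..x}|lborel. MU r)"
          unfolding set_lebesgue_integral_def using M0 by (intro integral_nonneg_AE) (auto simp: MU_def)
        then show ?thesis using split[OF t(1) that] by simp
      qed
      show "\<forall>\<^sub>F x in at_right t. \<Phi> x \<le> \<Phi> t"
      proof (cases "t \<in> N")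
        case False
        then have "t \<in> {a<..<b}" using t by (auto simp: N_def)
        then have "\<forall>\<^sub>F x in at_right t. f x \<le> f t + e * (x - t)" using N0(2) False e by (auto simp: N_def)
        moreover have "\<forall>\<^sub>F x in at_right t. t < x" by (rule eventually_at_right_less)
        ultimately show ?thesis
        proof eventually_elim
          case (elim x)
          then show ?case using Gmono[of x] by (simp add: \<Phi>_def algebra_simps)
        qed
      next
        case True
        then obtain d where d: "d > 0" "ball t d \<subseteq> U" using U openE by blast
        have "\<forall>\<^sub>F x in at_right t. x \<in> {t<..<min b (t + d)}"
          by (rule eventually_at_right_real) (use t d in auto)
        then show ?thesis
        proof eventually_elim
          case (elim x)
          have "{t..x} \<subseteq> U" using d(2) elim by (auto simp: dist_real_def subset_iff)
          then have "(LINT r:{t..x}|lborel. M r) = (LINT r:{t..x}|lborel. MU r)"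
            by (intro set_lebesgue_integral_cong) (auto simp: MU_def)
          then have "f x - f t \<le> G x - G t" using f'[of t x] split[of t x] t elim by auto
          then show ?case using e elim by (simp add: \<Phi>_def algebra_simps) (smt (verit) mult_left_mono)
        qed
      qed
    qed
    moreover have "G b \<le> (\<integral>r. MU r \<partial>lborel)"
      unfolding G_def set_lebesgue_integral_def using M0 si(1)[of "{a..b}"]
      by (intro integral_mono iMU) (auto simp: MU_def set_integrable_def split: split_indicator)
    moreover have "0 \<le> G a" unfolding G_def set_lebesgue_integral_def using M0 by (intro integral_nonneg_AE) (auto simp: MU_def)
    ultimately show ?thesis using intMU by (simp add: \<Phi>_def)
  qed
  then have "f b - f a \<le> 0 + e" if "0 < e" for e
    using that[THEN divide_pos_pos, of "b - a + 1"] \<open>a \<le> b\<close>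
    by (metis add.commute add_0 add_nonneg_pos diff_ge_0_iff_ge distrib_left mult.right_neutral nonzero_eq_divide_eq order_less_irrefl zero_less_one)
  then have "f b - f a \<le> 0" by (rule field_le_epsilon)
  then show ?thesis by simp
qed

section \<open>The evolution variational inequality\<close>

text \<open>The arithmetic of \<open>evi_step\<close>: \<open>h\<close> is the time increment,
  \<open>d\<close> the distance from \<open>S t\<close> to the interpolated point, \<open>dd\<close>
  and \<open>D2\<close> are the squared distances to \<open>y\<close> at the later and the earlier
  time, and \<open>w\<close> is the speed quotient. Young's inequality replaces \<open>v * d\<close>
  by \<open>h * v\<^sup>2 / 2 + d\<^sup>2 / (2 * h)\<close>, so that \<open>B\<close>
  applies.\<close>

lemma evi_algebra:
  fixes h \<eta> K v d w D2 dd Ex Et Ey :: real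
  assumes h: "0 < h" and \<eta>: "0 < \<eta>" "\<eta> * h < 1" and K: "0 \<le> K" and dd: "0 \<le> dd"
    and A: "Et - v * d - K / 2 * d\<^sup>2 \<le> (1 - \<eta> * h) * Ex + \<eta> * h * Ey + K / 2 * (\<eta> * h * (1 - \<eta> * h) * dd)"
    and B: "d\<^sup>2 \<le> (1 - \<eta> * h) * (w * h)\<^sup>2 + \<eta> * h * D2 - \<eta> * h * (1 - \<eta> * h) * dd"
  shows "(dd - D2) / h * (1 + K * h) \<le> 2 / \<eta> * ((Ex - Et) / h + v\<^sup>2 / 2 + (1 + K * h) * (1 - \<eta> * h) * w\<^sup>2 / 2)
     + 2 * (Ey - Ex) + K * dd + \<eta> * (1 + K * h) * dd" (is "?l \<le> ?r")
proof -
  \<comment> \<open>The total coefficient of \<open>d\<^sup>2\<close>: one part from Young's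
    inequality, one from the semiconvexity error.\<close>
  define c where "c = 1 / (2 * h) + K / 2"
  have c: "0 \<le> c" using h K by (simp add: c_def)
  have "0 \<le> (v * h - d)\<^sup>2 / (2 * h)" using h by simp
  then have "v * d \<le> h * v\<^sup>2 / 2 + d\<^sup>2 / (2 * h)"
    using h by (simp add: field_simps power2_eq_square)
  then have 1: "Et - h * v\<^sup>2 / 2 - c * d\<^sup>2 \<le> Et - v * d - K / 2 * d\<^sup>2"
    by (simp add: c_def algebra_simps)
  have 2: "c * d\<^sup>2 \<le> c * ((1 - \<eta> * h) * (w * h)\<^sup>2 + \<eta> * h * D2 - \<eta> * h * (1 - \<eta> * h) * dd)"
    using B c by (rule mult_left_mono)
  have "\<eta> * h * (1 - \<eta> * h) * dd \<le> \<eta> * h * 1 * dd"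
    using h \<eta> dd by (intro mult_right_mono mult_left_mono) auto
  then have 3: "K / 2 * (\<eta> * h * (1 - \<eta> * h) * dd) \<le> K / 2 * (\<eta> * h * dd)" using K by (intro mult_left_mono) auto
  have ch: "c * h = (1 + K * h) / 2" using h by (simp add: c_def field_simps)
  have "(\<eta> * h / 2) * ?l = c * h * \<eta> * (dd - D2)" using h unfolding ch by (simp add: field_simps)
  also have "\<dots> = c * (\<eta> * h * (1 - \<eta> * h) * dd - \<eta> * h * D2) + c * h * \<eta> * \<eta> * h * dd" by (simp add: algebra_simps)
  also have "\<dots> \<le> (1 - \<eta> * h) * Ex + \<eta> * h * Ey - Et + K / 2 * (\<eta> * h * dd) + h * v\<^sup>2 / 2 + c * ((1 - \<eta> * h) * (w * h)\<^sup>2) + c * h * \<eta> * \<eta> * h * dd"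
    using 1 2 3 A by (simp add: algebra_simps)
  also have "c * ((1 - \<eta> * h) * (w * h)\<^sup>2) = c * h * ((1 - \<eta> * h) * w\<^sup>2 * h)" by (simp add: power2_eq_square algebra_simps)
  also have "(1 - \<eta> * h) * Ex + \<eta> * h * Ey - Et + K / 2 * (\<eta> * h * dd) + h * v\<^sup>2 / 2 + c * h * ((1 - \<eta> * h) * w\<^sup>2 * h) + c * h * \<eta> * \<eta> * h * dd = (\<eta> * h / 2) * ?r"
    unfolding ch using h \<eta> by (simp add: field_simps)
  finally show ?thesis using h \<eta> by (simp only: mult_le_cancel_left_pos[of "\<eta> * h / 2"] mult_pos_pos divide_pos_pos zero_less_numeral)
qed

context semiconvex_potential
begin

text \<open>The point at parameter \<open>\<eta> * (x - t)\<close> on the interpolation from \<open>S x\<close> to \<open>y\<close> is inserted into the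
  slope inequality at \<open>S t\<close>, and \<open>x \<rightarrow> t\<close> for a fixed small \<open>\<eta>\<close>.\<close>

lemma evi_step:
  assumes fin: "\<And>x. t \<le> x \<Longrightarrow> finite_energy \<Psi> (S x)" and y: "finite_energy \<Psi> y"
    and slope: "metric_slope (free_energy \<Psi> J) (S t) \<le> ereal v" and v: "0 \<le> v"
    and der: "((\<lambda>t. real_of_ereal (free_energy \<Psi> J (S t))) has_real_derivative - v\<^sup>2) (at t)"
    and md: "has_metric_derivative S v t"
    and neg: "2 * (real_energy \<Psi> J y - real_energy \<Psi> J (S t)) + (L + J) * (W2 (S t) y)\<^sup>2 < 0"
  shows "\<forall>\<^sub>F x in at_right t. W2 (S x) y \<le> W2 (S t) y"
proof -
  define E where "E x = real_of_ereal (free_energy \<Psi> J (S x))" for x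
  have E: "E x = real_energy \<Psi> J (S x)" if "t \<le> x" for x
    using finite_energyD(5)[OF fin[OF that], of J] by (simp add: E_def)
  note P = finite_energyD(1)[OF fin] and Py = finite_energyD(1)[OF y]
  define D where "D = W2 (S t) y"
  define Ey where "Ey = real_energy \<Psi> J y"
  \<comment> \<open>The margin in the hypothesis \<open>neg\<close>. The choice of
    \<open>\<eta>\<close> keeps the remaining error \<open>\<eta> * D\<^sup>2\<close> below this
    margin; the \<open>+ 1\<close> in its denominator covers \<open>D = 0\<close>.\<close>
  define a where "a = - (2 * (Ey - E t) + (L + J) * D\<^sup>2)"
  have a: "0 < a" using neg E[of t] by (simp add: a_def D_def Ey_def)
  define \<eta> where "\<eta> = a / (2 * (D\<^sup>2 + 1))"
  have \<eta>: "0 < \<eta>" using a by (auto simp: \<eta>_def intro!: divide_pos_pos add_nonneg_pos)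
  have \<eta>D: "\<eta> * D\<^sup>2 < a"
  proof -
    have "0 < D\<^sup>2 + 1" by (simp add: add_nonneg_pos)
    then have "\<eta> * (D\<^sup>2 + 1) = a / 2" by (simp add: \<eta>_def field_simps)
    then show ?thesis using \<eta> a by (simp add: algebra_simps)
  qed
  define w where "w x = W2 (S x) (S t) / \<bar>x - t\<bar>" for x
  define dd where "dd x = (W2 (S x) y)\<^sup>2" for x
  let ?F = "at_right t"
  have h0: "((\<lambda>x. x - t) \<longlongrightarrow> 0) ?F" by (auto intro!: tendsto_eq_intros)
  have wv: "(w \<longlongrightarrow> v) ?F" using md unfolding has_metric_derivative_def w_def
    by (rule tendsto_within_subset) auto
  have dE: "((\<lambda>x. (E x - E t) / (x - t)) \<longlongrightarrow> - v\<^sup>2) ?F"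
    using der unfolding has_field_derivative_iff E_def by (rule tendsto_within_subset) auto
  have gt: "\<forall>\<^sub>F x in ?F. t < x" by (rule eventually_at_right_less)
  have E0: "(E \<longlongrightarrow> E t) ?F"
  proof -
    have "(E \<longlongrightarrow> E t) (at t)" using DERIV_isCont[OF der] by (simp add: isCont_def E_def[abs_def])
    then show ?thesis by (rule tendsto_within_subset) auto
  qed
  have W0: "((\<lambda>x. W2 (S x) y) \<longlongrightarrow> D) ?F"
  proof (rule Lim_transform)
    show "((\<lambda>x. D) \<longlongrightarrow> D) ?F" by simp
    have "((\<lambda>x. w x * (x - t)) \<longlongrightarrow> v * 0) ?F" by (intro tendsto_intros wv h0)
    then have z: "((\<lambda>x. w x * (x - t)) \<longlongrightarrow> 0) ?F" by simp
    show "((\<lambda>x. W2 (S x) y - D) \<longlongrightarrow> 0) ?F"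
    proof (rule tendsto_0_le[OF z, of _ 1])
      show "\<forall>\<^sub>F x in ?F. norm (W2 (S x) y - D) \<le> norm (w x * (x - t)) * 1"
        using gt
      proof eventually_elim
        case (elim x)
        have "w x * (x - t) = W2 (S x) (S t)" using elim by (simp add: w_def)
        moreover have "W2 (S x) y \<le> W2 (S x) (S t) + D" "D \<le> W2 (S x) (S t) + W2 (S x) y"
          unfolding D_def using W2_triangle[of "S x" "S t" y] W2_triangle[of "S t" "S x" y] W2_sym[of "S x" "S t"] P elim Py by auto
        ultimately show ?case by (simp add: abs_le_iff)
      qed
    qed
  qed
  then have dd0: "(dd \<longlongrightarrow> D\<^sup>2) ?F" unfolding dd_def by (rule tendsto_power)
  define K where "K = L + J"
  have K: "0 \<le> K" using L J by (simp add: K_def)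
  define R where "R x = 2 / \<eta> * ((E x - E t) / (x - t) + v\<^sup>2 / 2 + (1 + K * (x - t)) * (1 - \<eta> * (x - t)) * (w x)\<^sup>2 / 2)
     + 2 * (Ey - E x) + K * dd x + \<eta> * (1 + K * (x - t)) * dd x" for x
  have "(R \<longlongrightarrow> 2 / \<eta> * (- v\<^sup>2 + v\<^sup>2 / 2 + (1 + K * 0) * (1 - \<eta> * 0) * v\<^sup>2 / 2)
     + 2 * (Ey - E t) + K * D\<^sup>2 + \<eta> * (1 + K * 0) * D\<^sup>2) ?F"
    unfolding R_def by (intro tendsto_intros dE h0 wv E0 dd0) simp
  \<comment> \<open>The large factor \<open>2 / \<eta>\<close> is harmless: energy dissipation
    contributes \<open>- v\<^sup>2\<close>, slope and speed contribute half of
    \<open>v\<^sup>2\<close> each, and they cancel exactly. This is where equality of slope and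
    speed matters.\<close>
  moreover have "2 / \<eta> * (- v\<^sup>2 + v\<^sup>2 / 2 + (1 + K * 0) * (1 - \<eta> * 0) * v\<^sup>2 / 2)
     + 2 * (Ey - E t) + K * D\<^sup>2 + \<eta> * (1 + K * 0) * D\<^sup>2 = - a + \<eta> * D\<^sup>2" by (simp add: a_def K_def)
  ultimately have R0: "\<forall>\<^sub>F x in ?F. R x < 0" using \<eta>D by (intro order_tendstoD) auto
  have small: "\<forall>\<^sub>F x in ?F. \<eta> * (x - t) < 1"
  proof -
    have "((\<lambda>x. \<eta> * (x - t)) \<longlongrightarrow> \<eta> * 0) ?F" by (intro tendsto_intros h0)
    then show ?thesis by (intro order_tendstoD) auto
  qed
  show ?thesis
    using R0 small gt
  proof eventually_elim
    case (elim x)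
    define \<epsilon> where "\<epsilon> = \<eta> * (x - t)"
    have h: "0 < x - t" using elim by simp
    have \<epsilon>: "0 < \<epsilon>" "\<epsilon> < 1" using elim \<eta> by (auto simp: \<epsilon>_def)
    have fx: "finite_energy \<Psi> (S x)" using fin elim by simp
    obtain \<kappa> where K1: "finite_energy \<Psi> \<kappa>"
      "real_energy \<Psi> J \<kappa> \<le> (1 - \<epsilon>) * real_energy \<Psi> J (S x) + \<epsilon> * real_energy \<Psi> J y + (L + J) / 2 * (\<epsilon> * (1 - \<epsilon>) * (W2 (S x) y)\<^sup>2)"
      "\<And>\<xi>. \<xi> \<in> P2 \<Longrightarrow> (W2 \<kappa> \<xi>)\<^sup>2 \<le> (1 - \<epsilon>) * (W2 (S x) \<xi>)\<^sup>2 + \<epsilon> * (W2 y \<xi>)\<^sup>2 - \<epsilon> * (1 - \<epsilon>) * (W2 (S x) y)\<^sup>2"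
      using displacement_convexity[OF fx y \<epsilon>] by metis
    note PK = finite_energyD(1)[OF K1(1)] and Pt = P[OF order_refl]
    have A: "E t - v * W2 (S t) \<kappa> - K / 2 * (W2 (S t) \<kappa>)\<^sup>2 \<le> (1 - \<epsilon>) * E x + \<epsilon> * Ey + K / 2 * (\<epsilon> * (1 - \<epsilon>) * dd x)"
      using slope_inequality[OF fin[OF order_refl] K1(1) slope v] K1(2) E[of t] E[of x] elim
      by (simp add: K_def Ey_def dd_def)
    have B: "(W2 (S t) \<kappa>)\<^sup>2 \<le> (1 - \<epsilon>) * (w x * (x - t))\<^sup>2 + \<epsilon> * D\<^sup>2 - \<epsilon> * (1 - \<epsilon>) * dd x"
      using K1(3)[OF Pt] h W2_sym[OF Pt PK] W2_sym[OF Pt Py] by (simp add: w_def dd_def D_def)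
    have "(dd x - D\<^sup>2) / (x - t) * (1 + K * (x - t)) \<le> R x"
      unfolding R_def by (rule evi_algebra[OF h \<eta> _ K _ A[unfolded \<epsilon>_def] B[unfolded \<epsilon>_def]]) (use elim in \<open>auto simp: dd_def\<close>)
    then have "(dd x - D\<^sup>2) / (x - t) * (1 + K * (x - t)) < 0" using elim by simp
    moreover have "0 < 1 + K * (x - t)" using K h by (simp add: add_pos_nonneg)
    ultimately have "(dd x - D\<^sup>2) / (x - t) < 0"
      using mult_less_0_iff[of "(dd x - D\<^sup>2) / (x - t)" "1 + K * (x - t)"] by linarith
    then have "dd x < D\<^sup>2" using h by (simp add: divide_less_0_iff)
    then show ?case by (simp add: dd_def D_def power2_less_imp_less less_imp_le)
  qed
qed

section \<open>Consequences for a given flow\<close>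

context
  fixes \<mu> :: "real measure" and S :: "real \<Rightarrow> real measure"
  assumes flow: "gradient_flow (free_energy \<Psi> J) \<mu> S" and \<mu>P: "\<mu> \<in> P2"
begin

lemma flow_P2: "0 \<le> t \<Longrightarrow> S t \<in> P2"
  using flow by (simp add: gradient_flow_def ac_curve_def)

lemma flow_finite: "0 < t \<Longrightarrow> finite_energy \<Psi> (S t)"
  using flow by (intro free_energy_finiteD[OF flow_P2 measurable_\<Psi> lb, of _ J]) (auto simp: gradient_flow_def less_top abs_eq_infinity_cases)

lemma flow_energy: "0 < t \<Longrightarrow> free_energy \<Psi> J (S t) = ereal (real_energy \<Psi> J (S t))"
  using finite_energyD(5)[OF flow_finite] .

text \<open>The defining equations fix the slope only up to sign. A limsup of nonnegative values is
  negative only over the trivial filter, where it is \<open>- \<infinity>\<close> and so not real;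
  infinite slopes contradict the finite energy derivative.\<close>

lemma flow_ae:
  "AE t in lborel. t > 0 \<longrightarrow> (\<exists>v\<ge>0. metric_slope (free_energy \<Psi> J) (S t) = ereal v \<and> has_metric_derivative S v t \<and>
     ((\<lambda>t. real_of_ereal (free_energy \<Psi> J (S t))) has_real_derivative - v\<^sup>2) (at t))"
proof -
  have "AE t in lborel. t > 0 \<longrightarrow>
        (\<exists>d v. ((\<lambda>t. real_of_ereal (free_energy \<Psi> J (S t))) has_real_derivative d) (at t) \<and>
           has_metric_derivative S v t \<and>
           ereal d = - (metric_slope (free_energy \<Psi> J) (S t))\<^sup>2 \<and> d = - v\<^sup>2)"
    using flow by (simp add: gradient_flow_def)
  then show ?thesis
  proof eventually_elim
    case (elim t)
    show ?case
    proof
      assume t: "0 < t"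
      then obtain d v where dv: "((\<lambda>t. real_of_ereal (free_energy \<Psi> J (S t))) has_real_derivative d) (at t)"
        "has_metric_derivative S v t" "ereal d = - (metric_slope (free_energy \<Psi> J) (S t))\<^sup>2" "d = - v\<^sup>2"
        using elim by blast
      let ?m = "metric_slope (free_energy \<Psi> J) (S t)"
      have v: "0 \<le> v"
        by (rule tendsto_lowerbound[OF dv(2)[unfolded has_metric_derivative_def]]) auto
      show "\<exists>v\<ge>0. metric_slope (free_energy \<Psi> J) (S t) = ereal v \<and> has_metric_derivative S v t \<and>
         ((\<lambda>t. real_of_ereal (free_energy \<Psi> J (S t))) has_real_derivative - v\<^sup>2) (at t)"
      proof (cases ?m)
        case (real r)
        then have "r\<^sup>2 = v\<^sup>2" using dv(3,4) by (simp add: power2_eq_square)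
        show ?thesis
        proof (cases "0 \<le> r")
          case True
          then have "r = v" using \<open>r\<^sup>2 = v\<^sup>2\<close> v by (simp add: power2_eq_iff_nonneg)
          then show ?thesis using real dv v by auto
        next
          case False
          have F: "free_energy \<Psi> J (S t) < \<infinity>" using flow_energy[OF t] by simp
          have "Limsup (at_W2 (S t)) (\<lambda>\<nu>. max 0 ((free_energy \<Psi> J (S t) - free_energy \<Psi> J \<nu>) / ereal (W2 (S t) \<nu>))) < 0"
            using F False real by (simp add: metric_slope_def)
          then have "\<forall>\<^sub>F \<nu> in at_W2 (S t). max 0 ((free_energy \<Psi> J (S t) - free_energy \<Psi> J \<nu>) / ereal (W2 (S t) \<nu>)) < 0"
            by (rule Limsup_lessD)
          then have "\<forall>\<^sub>F \<nu> in at_W2 (S t). False" by eventually_elim (simp add: max_less_iff_conj)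
          then have "at_W2 (S t) = bot" by (simp add: trivial_limit_def)
          then have "?m = - \<infinity>" using F by (simp add: metric_slope_def bot_ereal_def)
          then show ?thesis using real by simp
        qed
      qed (use dv in \<open>auto simp: power2_eq_square\<close>)
    qed
  qed
qed

lemma flow_energy_antimono:
  assumes "0 < s" "s \<le> t"
  shows "real_energy \<Psi> J (S t) \<le> real_energy \<Psi> J (S s)"
proof (cases "s = t")
  case False
  have "real_of_ereal (free_energy \<Psi> J (S t)) \<le> real_of_ereal (free_energy \<Psi> J (S s))"
  proof (rule abs_cont_nonincreasing[where f="\<lambda>t. real_of_ereal (free_energy \<Psi> J (S t))"])
    show "abs_cont_on {s..t} (\<lambda>t. real_of_ereal (free_energy \<Psi> J (S t)))"
      using flow assms False by (auto simp: gradient_flow_def locally_abs_cont_def)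
    show "AE x in lborel. x \<in> {s<..<t} \<longrightarrow> (\<exists>d\<le>0. ((\<lambda>t. real_of_ereal (free_energy \<Psi> J (S t))) has_real_derivative d) (at x))"
      using flow_ae
    proof eventually_elim
      case (elim x)
      show ?case
      proof
        assume "x \<in> {s<..<t}"
        then obtain v where "((\<lambda>t. real_of_ereal (free_energy \<Psi> J (S t))) has_real_derivative - v\<^sup>2) (at x)"
          using elim assms by auto
        then show "\<exists>d\<le>0. ((\<lambda>t. real_of_ereal (free_energy \<Psi> J (S t))) has_real_derivative d) (at x)"
          by (intro exI[of _ "- v\<^sup>2"]) simp
      qed
    qed
  qed fact
  then show ?thesis using flow_energy assms by simp
qed simp

text \<open>Local square integrability gives local integrability through
  \<open>\<bar>m\<bar> \<le> 1 + m\<^sup>2\<close>. The absolute value enters because the given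
  \<open>m\<close> need not be nonnegative.\<close>

lemma flow_speed:
  obtains m where "\<And>a b. 0 < a \<Longrightarrow> set_integrable lborel {a..b} m"
    "\<And>s t. 0 < s \<Longrightarrow> s \<le> t \<Longrightarrow> W2 (S s) (S t) \<le> (LINT r:{s..t}|lborel. \<bar>m r\<bar>)"
proof -
  obtain m where m: "L2_loc m" "\<And>s t. 0 < s \<Longrightarrow> s < t \<Longrightarrow> W2 (S s) (S t) \<le> set_lebesgue_integral lborel {s..t} m"
    using flow by (auto simp: gradient_flow_def ac_curve_def)
  have i: "set_integrable lborel {a..b} m" if "0 < a" for a b
  proof (cases "a < b")
    case True
    have mm: "(\<lambda>x. indicator {a..b} x *\<^sub>R m x) \<in> borel_measurable lborel"
    proof -
      have "(\<lambda>x. indicator {0<..} x *\<^sub>R m x) \<in> borel_measurable lborel"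
        using m(1) by (simp add: L2_loc_def set_borel_measurable_def)
      then have "(\<lambda>x. indicator {a..b} x *\<^sub>R (indicator {0<..} x *\<^sub>R m x)) \<in> borel_measurable lborel" by measurable
      also have "(\<lambda>x. indicator {a..b} x *\<^sub>R (indicator {0<..} x *\<^sub>R m x)) = (\<lambda>x. indicator {a..b} x *\<^sub>R m x)"
        using \<open>0 < a\<close> by (auto split: split_indicator)
      finally show ?thesis .
    qed
    have 1: "set_integrable lborel {a..b} (\<lambda>r. (m r)\<^sup>2)" using m(1) True that by (simp add: L2_loc_def)
    have "set_integrable lborel {a..b} (\<lambda>r. 1 + (m r)\<^sup>2)"
      by (intro set_integral_add(1) 1) (simp add: set_integrable_def integrable_indicator_iff emeasure_lborel_Icc_eq)
    then show ?thesis unfolding set_integrable_def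
      by (rule Bochner_Integration.integrable_bound)
        (use mm abs_le_1_plus_square in \<open>auto simp: abs_mult split: split_indicator\<close>)
  next
    case False
    then have "{a..b} = {} \<or> {a..b} = {a}" by auto
    then show ?thesis
    proof
      assume "{a..b} = {a}"
      have "(\<lambda>x. indicator {a..b} x *\<^sub>R m x) = (\<lambda>x. indicator {a} x *\<^sub>R m a)"
        unfolding \<open>{a..b} = {a}\<close> by (auto split: split_indicator)
      then show ?thesis unfolding set_integrable_def by simp
    qed (simp add: set_integrable_def)
  qed
  have "W2 (S s) (S t) \<le> (LINT r:{s..t}|lborel. \<bar>m r\<bar>)" if "0 < s" "s \<le> t" for s t
  proof (cases "s = t")
    case False
    then have "W2 (S s) (S t) \<le> set_lebesgue_integral lborel {s..t} m" using m(2) that by simp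
    also have "\<dots> \<le> (LINT r:{s..t}|lborel. \<bar>m r\<bar>)"
      using i[OF that(1)] by (intro set_integral_mono set_integrable_abs) auto
    finally show ?thesis .
  next
    case True
    then show ?thesis using flow_P2[of t] that by (simp add: set_lebesgue_integral_def integral_nonneg_AE)
  qed
  with i show ?thesis using that by blast
qed

lemma flow_W2_diff:
  assumes "y \<in> P2" "0 \<le> s" "0 \<le> t"
  shows "\<bar>W2 (S t) y - W2 (S s) y\<bar> \<le> W2 (S s) (S t)"
  using W2_triangle[of "S s" "S t" y] W2_triangle[of "S t" "S s" y] W2_sym[of "S s" "S t"] flow_P2 assms
  by (simp add: abs_le_iff)

lemma flow_dist_nonincreasing:
  assumes y: "y \<in> P2" and ab: "0 < a" "a \<le> b"
    and AE: "AE t in lborel. t \<in> {a<..<b} \<longrightarrow> (\<forall>e>0. \<forall>\<^sub>F x in at_right t. W2 (S x) y \<le> W2 (S t) y + e * (x - t))"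
  shows "W2 (S b) y \<le> W2 (S a) y"
proof -
  obtain m where m: "\<And>a b. 0 < a \<Longrightarrow> set_integrable lborel {a..b} m"
    "\<And>s t. 0 < s \<Longrightarrow> s \<le> t \<Longrightarrow> W2 (S s) (S t) \<le> (LINT r:{s..t}|lborel. \<bar>m r\<bar>)" using flow_speed by metis
  show ?thesis
  proof (rule dini_nonincreasing[OF m(1)[OF ab(1)] ab(2) _ AE])
    fix s t assume "a \<le> s" "s \<le> t" "t \<le> b"
    then show "\<bar>W2 (S t) y - W2 (S s) y\<bar> \<le> (LINT r:{s..t}|lborel. \<bar>m r\<bar>)"
      using flow_W2_diff[OF y, of s t] m(2)[of s t] ab by simp
  qed
qed

text \<open>Constant energy forces the energy derivative, hence the metric speed, to vanish almost
  everywhere; then the distance to \<open>S a\<close> cannot grow.\<close>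

lemma flow_constant:
  assumes ab: "0 < a" "a \<le> b" and eq: "real_energy \<Psi> J (S a) \<le> real_energy \<Psi> J (S b)"
  shows "S b = S a"
proof -
  have const: "real_energy \<Psi> J (S x) = real_energy \<Psi> J (S a)" if "a \<le> x" "x \<le> b" for x
    using flow_energy_antimono[of a x] flow_energy_antimono[of x b] eq that ab by auto
  have "W2 (S b) (S a) \<le> W2 (S a) (S a)"
  proof (rule flow_dist_nonincreasing)
    show "AE t in lborel. t \<in> {a<..<b} \<longrightarrow> (\<forall>e>0. \<forall>\<^sub>F x in at_right t. W2 (S x) (S a) \<le> W2 (S t) (S a) + e * (x - t))"
      using flow_ae
    proof eventually_elim
      case (elim t)
      show ?case
      proof (intro impI allI)
        fix e :: real assume t: "t \<in> {a<..<b}" and e: "0 < e"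
        then obtain v where v: "0 \<le> v" "has_metric_derivative S v t"
          "((\<lambda>t. real_of_ereal (free_energy \<Psi> J (S t))) has_real_derivative - v\<^sup>2) (at t)" using elim ab by auto
        have "((\<lambda>t. real_energy \<Psi> J (S a)) has_real_derivative - v\<^sup>2) (at t)"
        proof (rule has_field_derivative_transform_within_open[OF v(3), of "{a<..<b}"])
          fix x assume "x \<in> {a<..<b}"
          then show "real_of_ereal (free_energy \<Psi> J (S x)) = real_energy \<Psi> J (S a)"
            using const[of x] flow_energy[of x] ab by simp
        qed (use t in auto)
        then have "- v\<^sup>2 = 0" by (rule DERIV_unique) (rule DERIV_const)
        then have "v = 0" by simp
        then have "((\<lambda>s. W2 (S s) (S t) / \<bar>s - t\<bar>) \<longlongrightarrow> 0) (at_right t)"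
          using v(2) unfolding has_metric_derivative_def by (metis tendsto_within_subset subset_UNIV)
        then have "\<forall>\<^sub>F x in at_right t. W2 (S x) (S t) / \<bar>x - t\<bar> < e" by (rule order_tendstoD) fact
        moreover have "\<forall>\<^sub>F x in at_right t. t < x" by (rule eventually_at_right_less)
        ultimately show "\<forall>\<^sub>F x in at_right t. W2 (S x) (S a) \<le> W2 (S t) (S a) + e * (x - t)"
        proof eventually_elim
          case (elim x)
          then have "W2 (S x) (S t) \<le> e * (x - t)" by (simp add: pos_divide_less_eq)
          moreover have "W2 (S x) (S a) \<le> W2 (S x) (S t) + W2 (S t) (S a)"
            using elim t ab by (intro W2_triangle flow_P2) auto
          ultimately show ?case by simp
        qed
      qed
    qed
  qed (use ab flow_P2 in auto)
  also have "\<dots> = 0" using flow_P2 ab by simp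
  finally have "W2 (S b) (S a) = 0" using W2_nonneg[of "S b" "S a"] by linarith
  then show ?thesis using W2_eq_0D flow_P2 ab by simp
qed

lemma flow_initial: "((\<lambda>t. W2 (S t) \<mu>) \<longlongrightarrow> 0) (at_right 0)"
  using flow by (simp add: gradient_flow_def)

text \<open>If the energy jumped above its initial value by \<open>\<delta>\<close>, then shortly
  after time \<open>0\<close> the evolution inequality with target \<open>\<mu>\<close> would make
  the distance to \<open>\<mu>\<close> nonincreasing in time. As this distance tends to
  \<open>0\<close> at time \<open>0\<close>, it would vanish, and so would the jump.\<close>

lemma flow_energy_le_initial:
  assumes fin: "finite_energy \<Psi> \<mu>" and t: "0 < t"
  shows "real_energy \<Psi> J (S t) \<le> real_energy \<Psi> J \<mu>"
proof (rule ccontr)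
  assume contra: "\<not> ?thesis"
  define \<delta> where "\<delta> = real_energy \<Psi> J (S t) - real_energy \<Psi> J \<mu>"
  have \<delta>: "0 < \<delta>" using contra by (simp add: \<delta>_def)
  have low: "\<delta> \<le> real_energy \<Psi> J (S s) - real_energy \<Psi> J \<mu>" if "0 < s" "s \<le> t" for s
    using flow_energy_antimono[OF that] by (simp add: \<delta>_def)
  have "((\<lambda>s. (L + J) * (W2 (S s) \<mu>)\<^sup>2) \<longlongrightarrow> (L + J) * 0\<^sup>2) (at_right 0)" by (intro tendsto_intros flow_initial)
  then have "\<forall>\<^sub>F s in at_right 0. (L + J) * (W2 (S s) \<mu>)\<^sup>2 < 2 * \<delta>" by (rule order_tendstoD) (use \<delta> in simp)
  then obtain r where r: "0 < r" "\<And>s. 0 < s \<Longrightarrow> s < r \<Longrightarrow> (L + J) * (W2 (S s) \<mu>)\<^sup>2 < 2 * \<delta>"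
    unfolding eventually_at_right_field by auto
  \<comment> \<open>Before \<open>r\<close> the quadratic error is below
    \<open>2 * \<delta>\<close>, as the strict hypothesis of \<open>evi_step\<close> demands; up to
    \<open>t\<close> the jump persists by monotonicity.\<close>
  define T where "T = min t (r / 2)"
  have T: "0 < T" "T \<le> t" "T < r" using t r(1) by (auto simp: T_def)
  have dec: "W2 (S T) \<mu> \<le> W2 (S a) \<mu>" if a: "0 < a" "a \<le> T" for a
  proof (rule flow_dist_nonincreasing[OF \<mu>P a])
    show "AE s in lborel. s \<in> {a<..<T} \<longrightarrow> (\<forall>e>0. \<forall>\<^sub>F x in at_right s. W2 (S x) \<mu> \<le> W2 (S s) \<mu> + e * (x - s))"
      using flow_ae
    proof eventually_elim
      case (elim s)
      show ?case
      proof (intro impI allI)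
        fix e :: real assume s: "s \<in> {a<..<T}" and e: "0 < e"
        then have s0: "0 < s" "s \<le> t" "s < r" using a T by auto
        then obtain v where v: "0 \<le> v" "metric_slope (free_energy \<Psi> J) (S s) = ereal v" "has_metric_derivative S v s"
          "((\<lambda>t. real_of_ereal (free_energy \<Psi> J (S t))) has_real_derivative - v\<^sup>2) (at s)" using elim by auto
        have "\<forall>\<^sub>F x in at_right s. W2 (S x) \<mu> \<le> W2 (S s) \<mu>"
        proof (rule evi_step[OF _ fin _ v(1) v(4,3)])
          show "2 * (real_energy \<Psi> J \<mu> - real_energy \<Psi> J (S s)) + (L + J) * (W2 (S s) \<mu>)\<^sup>2 < 0"
            using low[OF s0(1,2)] r(2)[OF s0(1,3)] by simp
        qed (use s0 v flow_finite in auto)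
        moreover have "\<forall>\<^sub>F x in at_right s. s < x" by (rule eventually_at_right_less)
        ultimately show "\<forall>\<^sub>F x in at_right s. W2 (S x) \<mu> \<le> W2 (S s) \<mu> + e * (x - s)"
          by eventually_elim (use e in \<open>simp add: add_increasing2\<close>)
      qed
    qed
  qed
  have "W2 (S T) \<mu> \<le> 0"
  proof (rule tendsto_lowerbound[OF flow_initial])
    show "\<forall>\<^sub>F a in at_right 0. W2 (S T) \<mu> \<le> W2 (S a) \<mu>"
      unfolding eventually_at_right_field using dec T(1) by (auto intro!: exI[of _ T])
  qed simp
  then have "S T = \<mu>" using W2_eq_0D[of "S T" \<mu>] flow_P2[of T] T(1) \<mu>P W2_nonneg[of "S T" \<mu>] by fastforce
  then show False using low[OF T(1,2)] \<delta> by simp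
qed

text \<open>All energies on \<open>(0, t]\<close> are squeezed to one value, so the flow is constant
  there; its limit at time \<open>0\<close> identifies the constant.\<close>

lemma flow_constant_initial:
  assumes fin: "finite_energy \<Psi> \<mu>" and t: "0 < t" and eq: "real_energy \<Psi> J \<mu> \<le> real_energy \<Psi> J (S t)"
  shows "S t = \<mu>"
proof -
  have "W2 (S t) \<mu> \<le> 0"
  proof (rule tendsto_lowerbound[OF flow_initial])
    have "W2 (S t) \<mu> \<le> W2 (S a) \<mu>" if "0 < a" "a \<le> t" for a
      using flow_constant[OF that] flow_energy_le_initial[OF fin that(1)] eq by simp
    then show "\<forall>\<^sub>F a in at_right 0. W2 (S t) \<mu> \<le> W2 (S a) \<mu>"
      unfolding eventually_at_right_field using t by (auto intro!: exI[of _ t])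
  qed simp
  then show ?thesis using W2_eq_0D[of "S t" \<mu>] flow_P2[of t] t \<mu>P W2_nonneg[of "S t" \<mu>] by fastforce
qed

lemma flow_mean_continuous:
  assumes "0 < a" shows "continuous_on {a..b} (\<lambda>t. mean (S t))"
proof -
  obtain m where m: "\<And>a b. 0 < a \<Longrightarrow> set_integrable lborel {a..b} m"
    "\<And>s t. 0 < s \<Longrightarrow> s \<le> t \<Longrightarrow> W2 (S s) (S t) \<le> (LINT r:{s..t}|lborel. \<bar>m r\<bar>)" using flow_speed by metis
  show ?thesis
  proof (rule continuous_on_integral_modulus[OF m(1)[OF assms]])
    fix s t assume "a \<le> s" "s \<le> t" "t \<le> b"
    then show "\<bar>mean (S t) - mean (S s)\<bar> \<le> (LINT r:{s..t}|lborel. \<bar>m r\<bar>)"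
      using mean_diff_le_W2[of "S s" "S t"] flow_P2 m(2)[of s t] assms by (simp add: abs_minus_commute)
  qed
qed

lemma flow_mean_initial: "((\<lambda>t. mean (S t)) \<longlongrightarrow> mean \<mu>) (at_right 0)"
proof (rule Lim_transform[OF tendsto_const[of "mean \<mu>"]])
  show "((\<lambda>t. mean (S t) - mean \<mu>) \<longlongrightarrow> 0) (at_right 0)"
  proof (rule tendsto_0_le[OF flow_initial, of _ 1])
    show "\<forall>\<^sub>F t in at_right 0. norm (mean (S t) - mean \<mu>) \<le> norm (W2 (S t) \<mu>) * 1"
      unfolding eventually_at_right_field using mean_diff_le_W2[OF flow_P2 \<mu>P]
      by (auto intro!: exI[of _ 1] simp: abs_minus_commute)
  qed
qed

lemma flow_mean_pos:
  assumes m0: "0 < mean \<mu>" and nz: "\<And>t. 0 < t \<Longrightarrow> mean (S t) \<noteq> 0" and t: "0 < t"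
  shows "0 < mean (S t)"
proof (rule ccontr)
  assume "\<not> ?thesis"
  then have neg: "mean (S t) \<le> 0" by simp
  have "\<forall>\<^sub>F s in at_right 0. 0 < mean (S s)" by (rule order_tendstoD(1)[OF flow_mean_initial m0])
  moreover have "\<forall>\<^sub>F s in at_right 0. s \<in> {0<..<t}" by (rule eventually_at_right_real[OF t])
  ultimately have "\<forall>\<^sub>F s in at_right 0. 0 < mean (S s) \<and> s \<in> {0<..<t}" by (rule eventually_conj)
  then obtain s where s: "0 < mean (S s)" "0 < s" "s < t"
    using eventually_happens'[OF trivial_limit_at_right_real] by force
  obtain x where "s \<le> x" "x \<le> t" "mean (S x) = 0"
    using IVT2'[of "\<lambda>x. mean (S x)" t 0 s] s neg flow_mean_continuous[OF s(2)] by auto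
  then show False using nz[of x] s by simp
qed

lemma flow_mean_neg:
  assumes m0: "mean \<mu> < 0" and nz: "\<And>t. 0 < t \<Longrightarrow> mean (S t) \<noteq> 0" and t: "0 < t"
  shows "mean (S t) < 0"
proof (rule ccontr)
  assume "\<not> ?thesis"
  then have neg: "0 \<le> mean (S t)" by simp
  have "\<forall>\<^sub>F s in at_right 0. mean (S s) < 0" by (rule order_tendstoD(2)[OF flow_mean_initial m0])
  moreover have "\<forall>\<^sub>F s in at_right 0. s \<in> {0<..<t}" by (rule eventually_at_right_real[OF t])
  ultimately have "\<forall>\<^sub>F s in at_right 0. mean (S s) < 0 \<and> s \<in> {0<..<t}" by (rule eventually_conj)
  then obtain s where s: "mean (S s) < 0" "0 < s" "s < t"
    using eventually_happens'[OF trivial_limit_at_right_real] by force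
  obtain x where "s \<le> x" "x \<le> t" "mean (S x) = 0"
    using IVT'[of "\<lambda>x. mean (S x)" s 0 t] s neg flow_mean_continuous[OF s(2)] by auto
  then show False using nz[of x] s by simp
qed

text \<open>A slope of at least \<open>e\<close> from time \<open>T\<close> on would make the energy
  decrease at rate \<open>e\<^sup>2\<close> and eventually fall below \<open>B\<close>.\<close>

lemma flow_slope_small:
  assumes lbd: "\<And>t. 0 < t \<Longrightarrow> B \<le> real_energy \<Psi> J (S t)" and e: "0 < e" and T: "0 < T"
  obtains t v where "T < t" "0 \<le> v" "v < e" "metric_slope (free_energy \<Psi> J) (S t) = ereal v"
proof (rule ccontr)
  assume "\<not> thesis"
  note no = this that
  have big: "e \<le> v" if "T < t" "0 \<le> v" "metric_slope (free_energy \<Psi> J) (S t) = ereal v" for t v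
    using no that by force
  \<comment> \<open>By this time a loss at rate \<open>e\<^sup>2\<close> exceeds the available drop
    by \<open>1\<close>.\<close>
  define U where "U = T + (real_energy \<Psi> J (S T) - B + 1) / e\<^sup>2"
  have TU: "T < U" using lbd[OF T] e by (simp add: U_def)
  let ?f = "\<lambda>t. real_of_ereal (free_energy \<Psi> J (S t)) + e\<^sup>2 * t"
  have "?f U \<le> ?f T"
  proof -
    define g where "g t = real_of_ereal (free_energy \<Psi> J (S t))" for t
    have ac: "abs_cont_on {T..U} g"
      using flow T TU unfolding g_def by (auto simp: gradient_flow_def locally_abs_cont_def)
    have "abs_cont_on {T..U} (\<lambda>t. g t + e\<^sup>2 * t)"
      unfolding abs_cont_on_def
    proof (intro allI impI)
      fix \<epsilon> :: real assume \<epsilon>: "0 < \<epsilon>"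
      then have "0 < \<epsilon> / 2" by simp
      then obtain d where d: "d > 0" "\<forall>I. finite I \<and> (\<forall>(a, b)\<in>I. a < b \<and> {a..b} \<subseteq> {T..U}) \<and>
        pairwise (\<lambda>p q. {fst p<..<snd p} \<inter> {fst q<..<snd q} = {}) I \<and>
        (\<Sum>(a, b)\<in>I. b - a) < d \<longrightarrow> (\<Sum>(a, b)\<in>I. \<bar>g b - g a\<bar>) < \<epsilon> / 2"
        using ac[unfolded abs_cont_on_def, rule_format, OF \<open>0 < \<epsilon> / 2\<close>] by auto
      let ?d = "min d (\<epsilon> / 2 / e\<^sup>2)"
      have "(\<Sum>(a, b)\<in>I. \<bar>g b + e\<^sup>2 * b - (g a + e\<^sup>2 * a)\<bar>) < \<epsilon>"
        if I: "finite I \<and> (\<forall>(a, b)\<in>I. a < b \<and> {a..b} \<subseteq> {T..U}) \<and>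
        pairwise (\<lambda>p q. {fst p<..<snd p} \<inter> {fst q<..<snd q} = {}) I \<and> (\<Sum>(a, b)\<in>I. b - a) < ?d" for I
      proof -
        have "(\<Sum>(a, b)\<in>I. \<bar>g b + e\<^sup>2 * b - (g a + e\<^sup>2 * a)\<bar>) \<le> (\<Sum>(a, b)\<in>I. \<bar>g b - g a\<bar> + e\<^sup>2 * (b - a))"
        proof (rule sum_mono, clarify)
          fix a b assume "(a, b) \<in> I"
          then have "a < b" using I by auto
          then have "0 \<le> e\<^sup>2 * (b - a)" by simp
          then show "\<bar>g b + e\<^sup>2 * b - (g a + e\<^sup>2 * a)\<bar> \<le> \<bar>g b - g a\<bar> + e\<^sup>2 * (b - a)"
            unfolding right_diff_distrib by linarith
        qed
        also have "\<dots> = (\<Sum>(a, b)\<in>I. \<bar>g b - g a\<bar>) + e\<^sup>2 * (\<Sum>(a, b)\<in>I. b - a)"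
          by (simp add: case_prod_unfold sum.distrib sum_distrib_left)
        also have "\<dots> < \<epsilon> / 2 + e\<^sup>2 * (\<epsilon> / 2 / e\<^sup>2)"
        proof (rule add_strict_mono)
          show "(\<Sum>(a, b)\<in>I. \<bar>g b - g a\<bar>) < \<epsilon> / 2" using d(2) I by auto
          show "e\<^sup>2 * (\<Sum>(a, b)\<in>I. b - a) < e\<^sup>2 * (\<epsilon> / 2 / e\<^sup>2)" using I e by (intro mult_strict_left_mono) auto
        qed
        also have "\<dots> = \<epsilon>" using e by simp
        finally show ?thesis .
      qed
      then show "\<exists>d>0. \<forall>I. finite I \<and> (\<forall>(a, b)\<in>I. a < b \<and> {a..b} \<subseteq> {T..U}) \<and>
        pairwise (\<lambda>p q. {fst p<..<snd p} \<inter> {fst q<..<snd q} = {}) I \<and>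
        (\<Sum>(a, b)\<in>I. b - a) < d \<longrightarrow> (\<Sum>(a, b)\<in>I. \<bar>g b + e\<^sup>2 * b - (g a + e\<^sup>2 * a)\<bar>) < \<epsilon>"
        using d(1) e \<epsilon> by (intro exI[of _ ?d]) auto
    qed
    moreover have "AE t in lborel. t \<in> {T<..<U} \<longrightarrow> (\<exists>d\<le>0. ((\<lambda>t. g t + e\<^sup>2 * t) has_real_derivative d) (at t))"
      using flow_ae
    proof eventually_elim
      case (elim t)
      show ?case
      proof
        assume t: "t \<in> {T<..<U}"
        then obtain v where v: "0 \<le> v" "metric_slope (free_energy \<Psi> J) (S t) = ereal v" "(g has_real_derivative - v\<^sup>2) (at t)"
          using elim T unfolding g_def by auto
        have "e\<^sup>2 \<le> v\<^sup>2" using big[of t v] t v e by (intro power_mono) auto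
        moreover have "((\<lambda>t. g t + e\<^sup>2 * t) has_real_derivative (- v\<^sup>2 + e\<^sup>2)) (at t)"
          using v(3) by (auto intro!: derivative_eq_intros)
        ultimately show "\<exists>d\<le>0. ((\<lambda>t. g t + e\<^sup>2 * t) has_real_derivative d) (at t)" by (intro exI[of _ "- v\<^sup>2 + e\<^sup>2"]) auto
      qed
    qed
    ultimately show ?thesis using abs_cont_nonincreasing[of T U "\<lambda>t. g t + e\<^sup>2 * t"] TU by (simp add: g_def)
  qed
  then have "real_energy \<Psi> J (S U) + e\<^sup>2 * (U - T) \<le> real_energy \<Psi> J (S T)"
    using flow_energy[of U] flow_energy[of T] T TU by (simp add: algebra_simps)
  moreover have "e\<^sup>2 * (U - T) = real_energy \<Psi> J (S T) - B + 1" using e by (simp add: U_def)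
  moreover have "B \<le> real_energy \<Psi> J (S U)" using lbd T TU by simp
  ultimately show False by simp
qed

end

end

section \<open>The potential and the critical points of the reduced energy\<close>

lemma integral_pos_if_pos_on_interval:
  fixes f :: "real \<Rightarrow> real"
  assumes f: "integrable lborel f" and nn: "\<And>z. 0 \<le> f z" and ab: "a < b" and pos: "\<And>z. a < z \<Longrightarrow> z < b \<Longrightarrow> 0 < f z"
  shows "0 < integral\<^sup>L lborel f"
proof -
  have "integral\<^sup>L lborel f \<noteq> 0"
  proof
    assume "integral\<^sup>L lborel f = 0"
    then have "AE z in lborel. f z = 0" using integral_nonneg_eq_0_iff_AE[OF f] nn by simp
    then have "AE z in lborel. z \<notin> {a<..<b}" by eventually_elim (use pos in force)
    then have "{a<..<b} \<in> null_sets lborel" by (subst AE_iff_null_sets) auto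
    then show False using ab by (auto simp: null_sets_def)
  qed
  then show ?thesis using nn Bochner_Integration.integral_nonneg[of lborel f] by (simp add: less_le)
qed

lemma integral_reflect: "(\<integral>z. f (- z) \<partial>lborel) = (\<integral>z. f z \<partial>lborel)" for f :: "real \<Rightarrow> real"
  using lborel_integral_real_affine[of "-1" f 0] by simp

lemma exp_second_order_bound: "\<bar>exp x - 1 - x\<bar> \<le> x\<^sup>2 * exp \<bar>x\<bar>" for x :: real
proof -
  have 0: "0 \<le> exp x - 1 - x" using exp_ge_add_one_self[of x] by linarith
  have "(1 - x) * exp x \<le> exp (- x) * exp x" using exp_ge_add_one_self[of "- x"] by (intro mult_right_mono) auto
  then have 1: "exp x - 1 \<le> x * exp x" by (simp add: exp_minus algebra_simps)
  have "x * (exp x - 1) \<le> x\<^sup>2 * exp \<bar>x\<bar>"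
  proof (cases "0 \<le> x")
    case True
    then show ?thesis using mult_left_mono[OF 1 True] by (simp add: power2_eq_square mult.assoc)
  next
    case False
    have "x * (exp x - 1) = (- x) * (1 - exp x)" by (simp add: algebra_simps)
    also have "\<dots> \<le> (- x) * (- x)" using exp_ge_add_one_self[of x] False by (intro mult_left_mono) linarith+
    also have "\<dots> \<le> x\<^sup>2 * exp \<bar>x\<bar>" using mult_left_mono[of 1 "exp \<bar>x\<bar>" "x\<^sup>2"] by (simp add: power2_eq_square)
    finally show ?thesis .
  qed
  moreover have "exp x - 1 - x \<le> x * (exp x - 1)" using 1 by (simp add: algebra_simps)
  ultimately show ?thesis using 0 by linarith
qed

text \<open>The monotone likelihood ratio of the weights. The numerator \<open>N\<close> of the
  derivative of the quotient vanishes at \<open>0\<close> and has the positive derivative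
  \<open>(\<tau>\<^sup>2 - \<sigma>\<^sup>2) * sinh (\<tau> * u) * sinh (\<sigma> *
  u)\<close>.\<close>

lemma sinh_ratio_increasing:
  fixes \<sigma> \<tau> x y :: real
  assumes "0 < \<sigma>" "\<sigma> < \<tau>" "0 < x" "x < y"
  shows "sinh (\<tau> * x) * sinh (\<sigma> * y) < sinh (\<tau> * y) * sinh (\<sigma> * x)"
proof -
  define N where "N z = \<tau> * cosh (\<tau> * z) * sinh (\<sigma> * z) - \<sigma> * sinh (\<tau> * z) * cosh (\<sigma> * z)" for z
  have N: "0 < N z" if "0 < z" for z
  proof -
    have "N 0 < N z"
    proof (rule DERIV_pos_imp_increasing_open[OF that])
      fix u assume u: "0 < u" "u < z"
      have "(N has_real_derivative (\<tau>\<^sup>2 - \<sigma>\<^sup>2) * (sinh (\<tau> * u) * sinh (\<sigma> * u))) (at u)"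
        unfolding N_def by (auto intro!: derivative_eq_intros simp: power2_eq_square algebra_simps)
      moreover have "0 < (\<tau>\<^sup>2 - \<sigma>\<^sup>2) * (sinh (\<tau> * u) * sinh (\<sigma> * u))"
        using assms u by (intro mult_pos_pos) (auto simp: power_strict_mono)
      ultimately show "\<exists>y. (N has_real_derivative y) (at u) \<and> 0 < y" by blast
    qed (auto simp: N_def intro!: continuous_intros)
    then show ?thesis by (simp add: N_def)
  qed
  have "sinh (\<tau> * x) / sinh (\<sigma> * x) < sinh (\<tau> * y) / sinh (\<sigma> * y)"
  proof (rule DERIV_pos_imp_increasing[OF assms(4)])
    fix u assume u: "x \<le> u" "u \<le> y"
    then have s: "sinh (\<sigma> * u) > 0" using assms by simp
    have "((\<lambda>z. sinh (\<tau> * z) / sinh (\<sigma> * z)) has_real_derivative N u / (sinh (\<sigma> * u))\<^sup>2) (at u)"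
      unfolding N_def using s by (auto intro!: derivative_eq_intros simp: power2_eq_square field_simps)
    moreover have "0 < N u / (sinh (\<sigma> * u))\<^sup>2" using N[of u] u assms s by simp
    ultimately show "\<exists>y. ((\<lambda>z. sinh (\<tau> * z) / sinh (\<sigma> * z)) has_real_derivative y) (at u) \<and> 0 < y" by blast
  qed
  then show ?thesis using assms by (simp add: divide_less_eq less_divide_eq mult_ac)
qed

locale mean_field =
  fixes \<Psi> :: "real \<Rightarrow> real" and J :: real
  assumes standing: "standing_assumptions \<Psi> J"
begin

section \<open>Regularity and growth of the potential\<close>

lemma J_pos: "0 < J"
  using standing by (simp add: standing_assumptions_def)

lemma \<Psi>_regular:
  obtains L where "0 \<le> L" "\<And>z. - L \<le> deriv (deriv \<Psi>) z"
    "\<And>z. (\<Psi> has_real_derivative deriv \<Psi> z) (at z)"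
    "\<And>z. (deriv \<Psi> has_real_derivative deriv (deriv \<Psi>) z) (at z)"
    "continuous_on UNIV (deriv (deriv \<Psi>))"
proof -
  obtain \<Psi>c \<Psi>b c c' where \<Psi>: "\<Psi> = (\<lambda>z. \<Psi>c z + \<Psi>b z)" and C: "C2 \<Psi>c" "C2 \<Psi>b" and c: "0 < c" "0 < c'"
    and cc: "\<And>z. deriv (deriv \<Psi>c) z \<ge> c" and cb: "\<And>z. \<bar>\<Psi>b z\<bar> + \<bar>deriv \<Psi>b z\<bar> + \<bar>deriv (deriv \<Psi>b) z\<bar> \<le> c'"
    using standing unfolding standing_assumptions_def by blast
  have D: "(f has_real_derivative deriv f z) (at z)" "(deriv f has_real_derivative deriv (deriv f) z) (at z)"
    if "C2 f" for f z using that by (auto simp: C2_def DERIV_deriv_iff_field_differentiable)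
  have d1: "(\<Psi> has_real_derivative (deriv \<Psi>c z + deriv \<Psi>b z)) (at z)" for z
    unfolding \<Psi> by (intro derivative_intros D C)
  then have e1: "deriv \<Psi> = (\<lambda>z. deriv \<Psi>c z + deriv \<Psi>b z)" by (intro ext DERIV_imp_deriv)
  have d2: "(deriv \<Psi> has_real_derivative (deriv (deriv \<Psi>c) z + deriv (deriv \<Psi>b) z)) (at z)" for z
    unfolding e1 by (intro derivative_intros D C)
  then have e2: "deriv (deriv \<Psi>) = (\<lambda>z. deriv (deriv \<Psi>c) z + deriv (deriv \<Psi>b) z)" by (intro ext DERIV_imp_deriv)
  show ?thesis
  proof (rule that[of c'])
    fix z
    show "- c' \<le> deriv (deriv \<Psi>) z" unfolding e2 using cc[of z] cb[of z] c by linarith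
    show "(\<Psi> has_real_derivative deriv \<Psi> z) (at z)" using d1 e1 by simp
    show "(deriv \<Psi> has_real_derivative deriv (deriv \<Psi>) z) (at z)" using d2 e2 by simp
    show "continuous_on UNIV (deriv (deriv \<Psi>))" unfolding e2 using C by (auto simp: C2_def intro!: continuous_intros)
  qed (use c in auto)
qed

lemma \<Psi>_DERIV: "(\<Psi> has_real_derivative deriv \<Psi> z) (at z)"
  and \<Psi>'_DERIV: "(deriv \<Psi> has_real_derivative deriv (deriv \<Psi>) z) (at z)"
  and \<Psi>''_continuous: "continuous_on UNIV (deriv (deriv \<Psi>))"
  using \<Psi>_regular by metis+

lemma \<Psi>_continuous: "continuous_on A \<Psi>"
  by (rule DERIV_continuous_on) (rule has_field_derivative_at_within[OF \<Psi>_DERIV])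

lemma \<Psi>'_continuous: "continuous_on A (deriv \<Psi>)"
  by (rule DERIV_continuous_on) (rule has_field_derivative_at_within[OF \<Psi>'_DERIV])

lemma \<Psi>_measurable [measurable]: "\<Psi> \<in> borel_measurable borel" "deriv \<Psi> \<in> borel_measurable borel"
  by (intro borel_measurable_continuous_onI \<Psi>_continuous \<Psi>'_continuous)+

lemma \<Psi>_even: "\<Psi> (- z) = \<Psi> z"
  using standing by (simp add: standing_assumptions_def)

lemma \<Psi>'_odd: "deriv \<Psi> (- z) = - deriv \<Psi> z"
proof -
  have "((\<lambda>z. \<Psi> (- z)) has_real_derivative (- deriv \<Psi> (- z))) (at z)"
    using DERIV_chain2[OF \<Psi>_DERIV[of "- z"] DERIV_minus[OF DERIV_ident]] by simp
  then have "(\<Psi> has_real_derivative (- deriv \<Psi> (- z))) (at z)" by (simp add: \<Psi>_even)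
  then have "- deriv \<Psi> (- z) = deriv \<Psi> z" using \<Psi>_DERIV DERIV_unique by blast
  then show ?thesis by simp
qed

lemma \<Psi>'_0: "deriv \<Psi> 0 = 0"
  using \<Psi>'_odd[of 0] by simp

text \<open>Convexity on the chord from \<open>0\<close>, where the odd function
  \<open>deriv \<Psi>\<close> vanishes.\<close>

lemma \<Psi>'_ratio_mono:
  assumes "0 < x" "x \<le> y"
  shows "deriv \<Psi> x / x \<le> deriv \<Psi> y / y"
proof -
  have cv: "convex_on {0..} (deriv \<Psi>)" using standing by (simp add: standing_assumptions_def)
  have "deriv \<Psi> ((1 - x / y) *\<^sub>R 0 + (x / y) *\<^sub>R y) \<le> (1 - x / y) * deriv \<Psi> 0 + (x / y) * deriv \<Psi> y"
    by (rule convex_onD[OF cv]) (use assms in auto)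
  then show ?thesis using assms by (simp add: \<Psi>'_0 field_simps)
qed

lemma superquadratic:
  obtains p c where "2 < p" "0 < c" "\<And>z. c * (\<bar>z\<bar> powr p - 1) \<le> \<Psi> z"
proof -
  obtain \<epsilon> c'' where "0 < \<epsilon>" "0 < c''" "\<forall>z. \<Psi> z \<ge> c'' * (\<bar>z\<bar> powr (2 + \<epsilon>) - 1)"
    using standing by (auto simp: standing_assumptions_def)
  then show ?thesis using that[of "2 + \<epsilon>" c''] by auto
qed

lemma powr_dominates_square:
  fixes A c p :: real
  assumes "2 < p" "0 < c" "0 \<le> A"
  obtains B where "\<And>z :: real. A * z\<^sup>2 - B \<le> c * \<bar>z\<bar> powr p"
proof -
  \<comment> \<open>Beyond this threshold \<open>\<bar>z\<bar> powr (p - 2)\<close> is at least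
    \<open>A / c\<close>; the lower bound \<open>1\<close> keeps it positive when
    \<open>A = 0\<close>.\<close>
  define M where "M = max 1 ((A / c) powr (1 / (p - 2)))"
  have M: "1 \<le> M" by (simp add: M_def)
  have "A * z\<^sup>2 - A * M\<^sup>2 \<le> c * \<bar>z\<bar> powr p" for z :: real
  proof (cases "\<bar>z\<bar> \<le> M")
    case True
    then have "z\<^sup>2 \<le> M\<^sup>2" by (metis abs_ge_zero power2_abs power_mono)
    then have "A * z\<^sup>2 \<le> A * M\<^sup>2" using assms by (intro mult_left_mono) auto
    then show ?thesis using assms by (smt (verit) mult_nonneg_nonneg powr_ge_zero)
  next
    case False
    then have z: "M < \<bar>z\<bar>" "0 < \<bar>z\<bar>" using M by auto
    have "A / c \<le> \<bar>z\<bar> powr (p - 2)"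
    proof (cases "A = 0")
      case False
      then have "0 < A / c" using assms by simp
      then have "A / c = ((A / c) powr (1 / (p - 2))) powr (p - 2)" using assms by (simp add: powr_powr)
      also have "\<dots> \<le> \<bar>z\<bar> powr (p - 2)" using assms z by (intro powr_mono2) (auto simp: M_def)
      finally show ?thesis .
    qed simp
    then have "A \<le> c * \<bar>z\<bar> powr (p - 2)" using assms by (simp add: field_simps)
    then have "A * z\<^sup>2 \<le> c * \<bar>z\<bar> powr (p - 2) * z\<^sup>2" by (intro mult_right_mono) auto
    also have "\<dots> = c * (\<bar>z\<bar> powr (p - 2) * \<bar>z\<bar> powr 2)" by simp
    also have "\<bar>z\<bar> powr (p - 2) * \<bar>z\<bar> powr 2 = \<bar>z\<bar> powr p" by (simp only: powr_add[symmetric]) simp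
    finally show ?thesis using assms by (smt (verit) mult_nonneg_nonneg zero_le_power2)
  qed
  then show ?thesis by (rule that)
qed

lemma \<Psi>_ge_square:
  assumes "0 \<le> A"
  obtains B where "\<And>z. A * z\<^sup>2 - B \<le> \<Psi> z"
proof -
  obtain p c where pc: "2 < p" "0 < c" "\<And>z. c * (\<bar>z\<bar> powr p - 1) \<le> \<Psi> z" using superquadratic by metis
  obtain B where "\<And>z :: real. A * z\<^sup>2 - B \<le> c * \<bar>z\<bar> powr p" using powr_dominates_square[OF pc(1,2) assms] by metis
  note B = this
  have "A * z\<^sup>2 - (B + c) \<le> \<Psi> z" for z using pc(3)[of z] B[of z] by (simp add: algebra_simps)
  then show ?thesis by (rule that)
qed

lemma \<Psi>_bounded_below:
  obtains C where "\<And>z. - C \<le> \<Psi> z"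
  using \<Psi>_ge_square[of 0] by auto

lemma semiconvex:
  obtains L C where "semiconvex_potential \<Psi> J L C"
proof -
  obtain L where L: "0 \<le> L" "\<And>z. - L \<le> deriv (deriv \<Psi>) z" using \<Psi>_regular by metis
  obtain C where C: "\<And>z. - C \<le> \<Psi> z" using \<Psi>_bounded_below by metis
  have "convex_on UNIV (\<lambda>z. \<Psi> z + L / 2 * z\<^sup>2)"
  proof (rule f''_ge0_imp_convex[where f' = "\<lambda>z. deriv \<Psi> z + L * z" and f'' = "\<lambda>z. deriv (deriv \<Psi>) z + L"])
    fix z
    show "((\<lambda>z. \<Psi> z + L / 2 * z\<^sup>2) has_real_derivative deriv \<Psi> z + L * z) (at z)"
      by (auto intro!: derivative_eq_intros \<Psi>_DERIV)
    show "((\<lambda>z. deriv \<Psi> z + L * z) has_real_derivative deriv (deriv \<Psi>) z + L) (at z)"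
      by (auto intro!: derivative_eq_intros \<Psi>'_DERIV)
    show "0 \<le> deriv (deriv \<Psi>) z + L" using L(2)[of z] by linarith
  qed simp
  then have "semiconvex_potential \<Psi> J L C"
    using J_pos L C by unfold_locales auto
  then show ?thesis by (rule that)
qed

section \<open>Exponentially tilted integrals\<close>

lemma mult_le_sum_squares: "\<sigma> * z \<le> \<sigma>\<^sup>2 + z\<^sup>2" for \<sigma> z :: real
  using zero_le_power2[of "\<sigma> - z"] zero_le_power2[of \<sigma>] zero_le_power2[of z] unfolding power2_diff by linarith

text \<open>Superquadratic growth absorbs any Gaussian factor and any tilt, so one Gaussian majorant
  serves all integrals of this kind.\<close>

lemma tilt_le_gauss:
  obtains C where "0 < C" "\<And>z. exp (a * z\<^sup>2) * exp (\<sigma> * z - \<Psi> z) \<le> C * exp (- z\<^sup>2)"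
proof -
  \<comment> \<open>Of the coefficient, \<open>\<bar>a\<bar>\<close> pays for the factor,
    \<open>1\<close> for the tilt and \<open>1\<close> for the surviving Gaussian.\<close>
  obtain B where B: "\<And>z. (\<bar>a\<bar> + 2) * z\<^sup>2 - B \<le> \<Psi> z" using \<Psi>_ge_square[of "\<bar>a\<bar> + 2"] by auto
  have "exp (a * z\<^sup>2) * exp (\<sigma> * z - \<Psi> z) \<le> exp (\<sigma>\<^sup>2 + B) * exp (- z\<^sup>2)" for z
  proof -
    have "a * z\<^sup>2 \<le> \<bar>a\<bar> * z\<^sup>2" by (intro mult_right_mono) auto
    then show ?thesis using B[of z] mult_le_sum_squares[of \<sigma> z] by (simp add: exp_add[symmetric] algebra_simps)
  qed
  then show ?thesis by (rule that[rotated]) simp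
qed

lemma integrable_tilt:
  assumes [measurable]: "f \<in> borel_measurable borel" and f: "\<And>z. \<bar>f z\<bar> \<le> K * exp (a * z\<^sup>2)"
  shows "integrable lborel (\<lambda>z. f z * exp (\<sigma> * z - \<Psi> z))"
proof -
  obtain C where C: "0 < C" "\<And>z. exp (a * z\<^sup>2) * exp (\<sigma> * z - \<Psi> z) \<le> C * exp (- z\<^sup>2)" using tilt_le_gauss by metis
  have K: "0 \<le> K" using f[of 0] by simp
  show ?thesis
  proof (rule Bochner_Integration.integrable_bound[OF integrable_mult_right[OF integrable_gauss, of "K * C"]])
    show "AE z in lborel. norm (f z * exp (\<sigma> * z - \<Psi> z)) \<le> norm (K * C * exp (- z\<^sup>2))"
    proof (rule AE_I2)
      fix z
      have "norm (f z * exp (\<sigma> * z - \<Psi> z)) \<le> K * exp (a * z\<^sup>2) * exp (\<sigma> * z - \<Psi> z)"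
        using f[of z] by (simp add: abs_mult)
      also have "\<dots> = K * (exp (a * z\<^sup>2) * exp (\<sigma> * z - \<Psi> z))" by simp
      also have "\<dots> \<le> K * (C * exp (- z\<^sup>2))" by (intro mult_left_mono C K)
      finally show "norm (f z * exp (\<sigma> * z - \<Psi> z)) \<le> norm (K * C * exp (- z\<^sup>2))" using K C(1) by simp
    qed
  qed measurable
qed

text \<open>The Taylor remainder of \<open>exp (h * z)\<close> is at most \<open>h\<^sup>2\<close>
  times a fixed integrable function for all \<open>\<bar>h\<bar> \<le> 1\<close>, so the difference
  quotient has error of order \<open>\<bar>h\<bar>\<close>.\<close>

lemma tilt_DERIV:
  assumes [measurable]: "f \<in> borel_measurable borel" and f: "\<And>z. \<bar>f z\<bar> \<le> K * exp (a * z\<^sup>2)"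
  shows "((\<lambda>\<sigma>. \<integral>z. f z * exp (\<sigma> * z - \<Psi> z) \<partial>lborel) has_real_derivative
     (\<integral>z. z * f z * exp (\<sigma> * z - \<Psi> z) \<partial>lborel)) (at \<sigma>)"
proof -
  have K: "0 \<le> K" using f[of 0] by simp
  define G where "G z = \<bar>f z\<bar> * z\<^sup>2 * exp \<bar>z\<bar>" for z
  have [measurable]: "G \<in> borel_measurable borel" unfolding G_def by measurable
  have z2: "z\<^sup>2 \<le> exp (z\<^sup>2)" for z :: real using exp_ge_add_one_self[of "z\<^sup>2"] by linarith
  have z1: "exp \<bar>z\<bar> \<le> exp (1 + z\<^sup>2)" for z :: real using abs_le_1_plus_square[of z] by simp
  have G: "\<bar>G z\<bar> \<le> (K * exp 1) * exp ((a + 2) * z\<^sup>2)" for z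
  proof -
    have "\<bar>G z\<bar> = \<bar>f z\<bar> * z\<^sup>2 * exp \<bar>z\<bar>" by (simp add: G_def)
    also have "\<dots> \<le> (K * exp (a * z\<^sup>2)) * exp (z\<^sup>2) * exp (1 + z\<^sup>2)"
      by (intro mult_mono f z2 z1) (use K in auto)
    also have "\<dots> = (K * exp 1) * exp ((a + 2) * z\<^sup>2)" by (simp add: exp_add[symmetric] algebra_simps)
    finally show ?thesis .
  qed
  have zf: "\<bar>z * f z\<bar> \<le> (K * exp 1) * exp ((a + 1) * z\<^sup>2)" for z
  proof -
    have "\<bar>z\<bar> \<le> exp \<bar>z\<bar>" using exp_ge_add_one_self[of "\<bar>z\<bar>"] by linarith
    also note z1
    finally have "\<bar>z * f z\<bar> \<le> exp (1 + z\<^sup>2) * (K * exp (a * z\<^sup>2))"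
      unfolding abs_mult by (intro mult_mono f) auto
    also have "\<dots> = (K * exp 1) * exp ((a + 1) * z\<^sup>2)" by (simp add: exp_add[symmetric] algebra_simps)
    finally show ?thesis .
  qed
  note iG = integrable_tilt[OF \<open>G \<in> borel_measurable borel\<close> G, of \<sigma>]
  have izf: "integrable lborel (\<lambda>z. z * f z * exp (\<sigma> * z - \<Psi> z))" by (rule integrable_tilt[OF _ zf]) measurable
  note iff = integrable_tilt[OF assms]
  define W where "W s = (\<integral>z. f z * exp (s * z - \<Psi> z) \<partial>lborel)" for s
  define W' where "W' = (\<integral>z. z * f z * exp (\<sigma> * z - \<Psi> z) \<partial>lborel)"
  define CG where "CG = (\<integral>z. G z * exp (\<sigma> * z - \<Psi> z) \<partial>lborel)"
  have main: "\<bar>W (\<sigma> + h) - W \<sigma> - h * W'\<bar> \<le> h\<^sup>2 * CG" if h: "\<bar>h\<bar> \<le> 1" for h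
  proof -
    have "\<bar>W (\<sigma> + h) - W \<sigma> - h * W'\<bar> = \<bar>\<integral>z. f z * exp ((\<sigma> + h) * z - \<Psi> z) - f z * exp (\<sigma> * z - \<Psi> z) - h * (z * f z * exp (\<sigma> * z - \<Psi> z)) \<partial>lborel\<bar>"
      unfolding W_def W'_def using iff[of "\<sigma> + h"] iff[of \<sigma>] izf by simp
    also have "\<dots> \<le> (\<integral>z. h\<^sup>2 * (G z * exp (\<sigma> * z - \<Psi> z)) \<partial>lborel)"
    proof (rule integral_abs_bound_integral)
      fix z
      have e: "f z * exp ((\<sigma> + h) * z - \<Psi> z) - f z * exp (\<sigma> * z - \<Psi> z) - h * (z * f z * exp (\<sigma> * z - \<Psi> z))
        = f z * exp (\<sigma> * z - \<Psi> z) * (exp (h * z) - 1 - h * z)"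
      proof -
        have "exp ((\<sigma> + h) * z - \<Psi> z) = exp (h * z) * exp (\<sigma> * z - \<Psi> z)" by (simp add: exp_add[symmetric] algebra_simps)
        then show ?thesis by (simp add: algebra_simps)
      qed
      have "\<bar>f z * exp (\<sigma> * z - \<Psi> z) * (exp (h * z) - 1 - h * z)\<bar> = \<bar>f z\<bar> * exp (\<sigma> * z - \<Psi> z) * \<bar>exp (h * z) - 1 - h * z\<bar>"
        by (simp add: abs_mult)
      also have "\<dots> \<le> \<bar>f z\<bar> * exp (\<sigma> * z - \<Psi> z) * ((h * z)\<^sup>2 * exp \<bar>h * z\<bar>)"
        by (rule mult_left_mono[OF exp_second_order_bound]) simp
      also have "\<dots> \<le> \<bar>f z\<bar> * exp (\<sigma> * z - \<Psi> z) * ((h * z)\<^sup>2 * exp \<bar>z\<bar>)"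
        using h by (intro mult_left_mono) (auto simp: abs_mult mult_left_le_one_le)
      also have "\<dots> = h\<^sup>2 * (G z * exp (\<sigma> * z - \<Psi> z))" by (simp add: G_def power_mult_distrib)
      finally show "\<bar>f z * exp ((\<sigma> + h) * z - \<Psi> z) - f z * exp (\<sigma> * z - \<Psi> z) - h * (z * f z * exp (\<sigma> * z - \<Psi> z))\<bar>
        \<le> h\<^sup>2 * (G z * exp (\<sigma> * z - \<Psi> z))" unfolding e .
    qed (use iff[of "\<sigma> + h"] iff[of \<sigma>] izf iG in auto)
    also have "\<dots> = h\<^sup>2 * CG" by (simp add: CG_def)
    finally show ?thesis .
  qed
  have "(\<lambda>h. (W (\<sigma> + h) - W \<sigma>) / h) \<midarrow>0\<rightarrow> W'"
  proof (rule LIM_zero_cancel)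
    have z: "((\<lambda>h. \<bar>h\<bar> * CG) \<longlongrightarrow> 0) (at 0)" by (auto intro!: tendsto_eq_intros)
    show "(\<lambda>h. (W (\<sigma> + h) - W \<sigma>) / h - W') \<midarrow>0\<rightarrow> 0"
    proof (rule tendsto_0_le[OF z, of _ 1])
      show "\<forall>\<^sub>F h in at 0. norm ((W (\<sigma> + h) - W \<sigma>) / h - W') \<le> norm (\<bar>h\<bar> * CG) * 1"
        unfolding eventually_at
      proof (intro exI[of _ 1] conjI ballI impI)
        fix h :: real assume h: "h \<noteq> 0 \<and> dist h 0 < 1"
        then have "(W (\<sigma> + h) - W \<sigma>) / h - W' = (W (\<sigma> + h) - W \<sigma> - h * W') / h" by (simp add: field_simps)
        then have "norm ((W (\<sigma> + h) - W \<sigma>) / h - W') \<le> h\<^sup>2 * CG / \<bar>h\<bar>"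
          using main[of h] h by (simp add: divide_right_mono)
        also have "\<dots> = \<bar>h\<bar> * CG" using h by (simp add: power2_eq_square abs_if)
        also have "\<dots> \<le> \<bar>\<bar>h\<bar> * CG\<bar>" by (rule abs_ge_self)
        finally show "norm ((W (\<sigma> + h) - W \<sigma>) / h - W') \<le> norm (\<bar>h\<bar> * CG) * 1" by simp
      qed simp
    qed
  qed
  then show ?thesis unfolding W_def W'_def DERIV_def .
qed

section \<open>The log-partition function and its Legendre transform\<close>

text \<open>The partition function; \<open>M1\<close> is its derivative, and
  \<open>tilted_mean\<close> is the derivative of \<open>phi_star\<close> as well as the mean of
  \<open>gibbs \<Psi> \<sigma>\<close>.\<close>

definition Zp :: "real \<Rightarrow> real" where "Zp \<sigma> = (\<integral>z. exp (\<sigma> * z - \<Psi> z) \<partial>lborel)"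
definition M1 :: "real \<Rightarrow> real" where "M1 \<sigma> = (\<integral>z. z * exp (\<sigma> * z - \<Psi> z) \<partial>lborel)"
definition tilted_mean :: "real \<Rightarrow> real" where "tilted_mean \<sigma> = M1 \<sigma> / Zp \<sigma>"

lemma const_bound: "\<bar>1 :: real\<bar> \<le> 1 * exp (0 * z\<^sup>2)" by simp

lemma id_bound: "\<bar>z\<bar> \<le> exp 1 * exp (1 * z\<^sup>2)" for z :: real
  using exp_ge_add_one_self[of "1 + z\<^sup>2"] abs_le_1_plus_square[of z] unfolding exp_add[symmetric] by simp

lemma square_bound: "\<bar>z\<^sup>2\<bar> \<le> 1 * exp (1 * z\<^sup>2)" for z :: real
  unfolding abs_power2 mult_1 using exp_ge_add_one_self[of "z\<^sup>2"] by linarith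

lemma integrable_Zp: "integrable lborel (\<lambda>z. exp (\<sigma> * z - \<Psi> z))"
  using integrable_tilt[OF _ const_bound, of \<sigma>] by simp

lemma integrable_M1: "integrable lborel (\<lambda>z. z * exp (\<sigma> * z - \<Psi> z))"
  by (rule integrable_tilt[OF _ id_bound]) simp

lemma integrable_M2: "integrable lborel (\<lambda>z. z\<^sup>2 * exp (\<sigma> * z - \<Psi> z))"
  by (rule integrable_tilt[OF _ square_bound]) simp

lemma Zp_DERIV: "(Zp has_real_derivative M1 \<sigma>) (at \<sigma>)"
  using tilt_DERIV[OF _ const_bound, of \<sigma>] unfolding Zp_def[abs_def] M1_def by simp

lemma M1_DERIV: "(M1 has_real_derivative (\<integral>z. z\<^sup>2 * exp (\<sigma> * z - \<Psi> z) \<partial>lborel)) (at \<sigma>)"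
  using tilt_DERIV[OF _ id_bound, of \<sigma>] unfolding M1_def[abs_def] by (simp add: power2_eq_square)

lemma Zp_pos: "0 < Zp \<sigma>"
  unfolding Zp_def by (rule integral_pos_if_pos_on_interval[OF integrable_Zp, where a=0 and b=1]) auto

lemma M1_eq: "M1 \<sigma> = tilted_mean \<sigma> * Zp \<sigma>"
  using Zp_pos[of \<sigma>] by (simp add: tilted_mean_def)

lemma tilted_mean_continuous: "isCont tilted_mean \<sigma>"
  unfolding tilted_mean_def[abs_def] using Zp_pos[of \<sigma>]
  by (intro continuous_divide DERIV_isCont[OF Zp_DERIV] DERIV_isCont[OF M1_DERIV]) auto

lemma phi_star_Zp: "phi_star \<Psi> \<sigma> = ln (Zp \<sigma>)"
  by (simp add: phi_star_def Zp_def)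

lemma phi_star_DERIV: "(phi_star \<Psi> has_real_derivative tilted_mean \<sigma>) (at \<sigma>)"
proof -
  have "((\<lambda>\<sigma>. ln (Zp \<sigma>)) has_real_derivative tilted_mean \<sigma>) (at \<sigma>)"
    unfolding tilted_mean_def using Zp_pos[of \<sigma>] by (auto intro!: derivative_eq_intros Zp_DERIV)
  then show ?thesis by (simp add: phi_star_Zp[abs_def])
qed

lemma Zp_even: "Zp (- \<sigma>) = Zp \<sigma>"
  unfolding Zp_def using integral_reflect[of "\<lambda>z. exp (\<sigma> * z - \<Psi> z)"] by (simp add: \<Psi>_even)

lemma M1_odd: "M1 (- \<sigma>) = - M1 \<sigma>"
  unfolding M1_def using integral_reflect[of "\<lambda>z. z * exp (\<sigma> * z - \<Psi> z)"] by (simp add: \<Psi>_even)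

lemma tilted_mean_odd: "tilted_mean (- \<sigma>) = - tilted_mean \<sigma>"
  by (simp add: tilted_mean_def Zp_even M1_odd)

lemma tilted_mean_0: "tilted_mean 0 = 0"
  using tilted_mean_odd[of 0] by simp

text \<open>Correlation of increasing functions: \<open>z - m\<close> and
  \<open>exp (\<delta> * z) - exp (\<delta> * m)\<close> have the same sign. After integration
  against the \<open>\<sigma>\<close>-tilt the constant part drops out because \<open>m\<close> is
  the mean there.\<close>

lemma tilted_mean_strict_mono: "strict_mono tilted_mean"
proof (rule strict_monoI)
  fix \<sigma> \<tau> :: real assume "\<sigma> < \<tau>"
  define m where "m = tilted_mean \<sigma>"
  define \<delta> where "\<delta> = \<tau> - \<sigma>"
  have \<delta>: "0 < \<delta>" using \<open>\<sigma> < \<tau>\<close> by (simp add: \<delta>_def)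
  let ?f = "\<lambda>z. (z - m) * (exp (\<delta> * z) - exp (\<delta> * m)) * exp (\<sigma> * z - \<Psi> z)"
  have eq: "?f z = (z * exp (\<tau> * z - \<Psi> z) - m * exp (\<tau> * z - \<Psi> z)) - exp (\<delta> * m) * (z * exp (\<sigma> * z - \<Psi> z) - m * exp (\<sigma> * z - \<Psi> z))" for z
  proof -
    have "exp (\<tau> * z - \<Psi> z) = exp (\<delta> * z) * exp (\<sigma> * z - \<Psi> z)" by (simp add: exp_add[symmetric] \<delta>_def algebra_simps)
    then show ?thesis by (simp add: algebra_simps)
  qed
  have i: "integrable lborel ?f" unfolding eq using integrable_Zp integrable_M1 by auto
  have pos: "0 < (z - m) * (exp (\<delta> * z) - exp (\<delta> * m))" if "z \<noteq> m" for z
    using that \<delta> by (cases "z < m") (auto simp: zero_less_mult_iff)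
  have "0 < integral\<^sup>L lborel ?f"
  proof (rule integral_pos_if_pos_on_interval[OF i, of m "m + 1"])
    fix z show "0 \<le> ?f z" using pos[of z] by (cases "z = m") auto
  next
    fix z assume "m < z" then show "0 < ?f z" using pos[of z] by auto
  qed simp
  also have "integral\<^sup>L lborel ?f = (M1 \<tau> - m * Zp \<tau>) - exp (\<delta> * m) * (M1 \<sigma> - m * Zp \<sigma>)"
    unfolding eq M1_def Zp_def using integrable_Zp integrable_M1 by simp
  also have "M1 \<sigma> - m * Zp \<sigma> = 0" using M1_eq by (simp add: m_def)
  finally have "0 < M1 \<tau> - m * Zp \<tau>" by simp
  then have "0 < (tilted_mean \<tau> - m) * Zp \<tau>" by (simp add: M1_eq algebra_simps)
  then show "tilted_mean \<sigma> < tilted_mean \<tau>" using Zp_pos[of \<tau>] by (simp add: m_def zero_less_mult_iff)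
qed

lemma phi_star_tangent: "phi_star \<Psi> \<sigma> + tilted_mean \<sigma> * (\<tau> - \<sigma>) \<le> phi_star \<Psi> \<tau>"
proof (cases \<sigma> \<tau> rule: linorder_cases)
  case less
  then obtain z where z: "\<sigma> < z" "z < \<tau>" "phi_star \<Psi> \<tau> - phi_star \<Psi> \<sigma> = (\<tau> - \<sigma>) * tilted_mean z"
    using MVT2[OF less, of "phi_star \<Psi>" tilted_mean] phi_star_DERIV by blast
  have "(\<tau> - \<sigma>) * tilted_mean \<sigma> \<le> (\<tau> - \<sigma>) * tilted_mean z"
    using less z strict_monoD[OF tilted_mean_strict_mono z(1)] by (intro mult_left_mono) auto
  then show ?thesis using z(3) by (simp add: algebra_simps)
next
  case greater
  then obtain z where z: "\<tau> < z" "z < \<sigma>" "phi_star \<Psi> \<sigma> - phi_star \<Psi> \<tau> = (\<sigma> - \<tau>) * tilted_mean z"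
    using MVT2[OF greater, of "phi_star \<Psi>" tilted_mean] phi_star_DERIV by blast
  have "(\<sigma> - \<tau>) * tilted_mean z \<le> (\<sigma> - \<tau>) * tilted_mean \<sigma>"
    using greater z strict_monoD[OF tilted_mean_strict_mono z(2)] by (intro mult_left_mono) auto
  then show ?thesis using z(3) by (simp add: algebra_simps)
qed simp

text \<open>A bound \<open>M\<close> on the slope gives \<open>phi_star\<close> growth at most
  \<open>M * \<sigma>\<close>, whereas the mass on \<open>[M + 1, M + 2]\<close> alone produces
  growth of at least \<open>(M + 1) * \<sigma>\<close>, up to constants.\<close>

lemma tilted_mean_unbounded: "\<exists>\<sigma>>0. M < tilted_mean \<sigma>"
proof (rule ccontr)
  assume "\<not> ?thesis"
  then have le: "tilted_mean \<sigma> \<le> M" if "0 < \<sigma>" for \<sigma> using that by force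
  define k where "k = (\<integral>z. indicator {M + 1..M + 2} z * exp (- \<Psi> z) \<partial>lborel)"
  have ik: "integrable lborel (\<lambda>z. indicator {M + 1..M + 2} z * exp (- \<Psi> z))"
    using integrable_tilt[of "indicator {M + 1..M + 2}" 1 0 0] by (auto split: split_indicator)
  have k: "0 < k" unfolding k_def
    by (rule integral_pos_if_pos_on_interval[OF ik, of "M + 1" "M + 2"]) auto
  have 1: "exp (\<sigma> * (M + 1)) * k \<le> Zp \<sigma>" if "0 < \<sigma>" for \<sigma>
  proof -
    have "(\<integral>z. exp (\<sigma> * (M + 1)) * (indicator {M + 1..M + 2} z * exp (- \<Psi> z)) \<partial>lborel) \<le> Zp \<sigma>"
      unfolding Zp_def
    proof (intro integral_mono integrable_Zp integrable_mult_right ik)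
      fix z show "exp (\<sigma> * (M + 1)) * (indicator {M + 1..M + 2} z * exp (- \<Psi> z)) \<le> exp (\<sigma> * z - \<Psi> z)"
        using that by (auto split: split_indicator simp: exp_add[symmetric])
    qed
    then show ?thesis by (simp add: k_def)
  qed
  have 2: "phi_star \<Psi> \<sigma> \<le> phi_star \<Psi> 0 + M * \<sigma>" if "0 < \<sigma>" for \<sigma>
  proof -
    have "tilted_mean \<sigma> * \<sigma> \<le> M * \<sigma>" using le[OF that] that by (intro mult_right_mono) auto
    then show ?thesis using phi_star_tangent[of \<sigma> 0] unfolding right_diff_distrib by linarith
  qed
  have 3: "\<sigma> \<le> phi_star \<Psi> 0 - ln k" if "0 < \<sigma>" for \<sigma>
  proof -
    have "ln (exp (\<sigma> * (M + 1)) * k) \<le> phi_star \<Psi> \<sigma>"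
      unfolding phi_star_Zp using 1[OF that] k Zp_pos by (intro ln_mono) auto
    then show ?thesis using 2[OF that] k by (simp add: ln_mult algebra_simps)
  qed
  show False using 3[of "\<bar>phi_star \<Psi> 0 - ln k\<bar> + 1"] by linarith
qed

lemma tilted_mean_surj: obtains \<sigma> where "tilted_mean \<sigma> = m"
proof -
  obtain \<sigma> where \<sigma>: "0 < \<sigma>" "\<bar>m\<bar> < tilted_mean \<sigma>" using tilted_mean_unbounded by metis
  have "\<exists>x\<ge>- \<sigma>. x \<le> \<sigma> \<and> tilted_mean x = m"
    by (rule IVT) (use \<sigma> tilted_mean_continuous in \<open>auto simp: tilted_mean_odd\<close>)
  then show ?thesis using that by blast
qed

lemma tilted_mean_less_iff: "tilted_mean \<sigma> < tilted_mean \<tau> \<longleftrightarrow> \<sigma> < \<tau>"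
  using tilted_mean_strict_mono by (rule strict_mono_less)

lemma tilted_mean_eq_iff: "tilted_mean \<sigma> = tilted_mean \<tau> \<longleftrightarrow> \<sigma> = \<tau>"
  using tilted_mean_strict_mono by (rule strict_mono_eq)

lemma phi_ge: "\<sigma> * m - phi_star \<Psi> \<sigma> \<le> phi \<Psi> m"
  and phi_tilted_mean: "phi \<Psi> (tilted_mean \<tau>) = \<tau> * tilted_mean \<tau> - phi_star \<Psi> \<tau>"
proof -
  have up: "\<sigma> * tilted_mean \<tau> - phi_star \<Psi> \<sigma> \<le> \<tau> * tilted_mean \<tau> - phi_star \<Psi> \<tau>" for \<sigma> \<tau>
    using phi_star_tangent[of \<tau> \<sigma>] by (simp add: algebra_simps)
  show "phi \<Psi> (tilted_mean \<tau>) = \<tau> * tilted_mean \<tau> - phi_star \<Psi> \<tau>"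
    unfolding phi_def by (rule cSup_eq_maximum) (use up in auto)
  obtain \<tau> where \<tau>: "tilted_mean \<tau> = m" by (rule tilted_mean_surj)
  show "\<sigma> * m - phi_star \<Psi> \<sigma> \<le> phi \<Psi> m"
    unfolding phi_def by (rule cSUP_upper) (use up[of _ \<tau>] \<tau> in \<open>auto intro!: bdd_aboveI2[where M="\<tau> * tilted_mean \<tau> - phi_star \<Psi> \<tau>"]\<close>)
qed

text \<open>Two subgradient inequalities squeeze the difference quotient towards
  \<open>m' = tilted_mean \<tau>\<close> between \<open>\<sigma>\<close> and \<open>\<tau>\<close>,
  and strict monotonicity makes \<open>\<tau>\<close> close to \<open>\<sigma>\<close> when
  \<open>m'\<close> is close to \<open>m\<close>. No differentiability of the inverse of
  \<open>tilted_mean\<close> enters.\<close>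

lemma phi_DERIV: "(phi \<Psi> has_real_derivative \<sigma>) (at (tilted_mean \<sigma>))"
proof -
  define m where "m = tilted_mean \<sigma>"
  have sub: "\<bar>(phi \<Psi> m' - phi \<Psi> m) / (m' - m) - \<sigma>\<bar> \<le> \<bar>\<tau> - \<sigma>\<bar>" if \<tau>: "m' = tilted_mean \<tau>" and ne: "m' \<noteq> m" for m' \<tau>
  proof -
    have 1: "phi \<Psi> m + \<sigma> * (m' - m) \<le> phi \<Psi> m'"
      using phi_ge[of \<sigma> m'] phi_tilted_mean[of \<sigma>] by (simp add: m_def algebra_simps)
    have 2: "phi \<Psi> m' + \<tau> * (m - m') \<le> phi \<Psi> m"
      using phi_ge[of \<tau> m] phi_tilted_mean[of \<tau>] by (simp add: \<tau> algebra_simps)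
    have "\<bar>phi \<Psi> m' - phi \<Psi> m - \<sigma> * (m' - m)\<bar> \<le> \<bar>(\<tau> - \<sigma>) * (m' - m)\<bar>"
      using 1 2 by (simp add: algebra_simps)
    then have "\<bar>phi \<Psi> m' - phi \<Psi> m - \<sigma> * (m' - m)\<bar> / \<bar>m' - m\<bar> \<le> \<bar>\<tau> - \<sigma>\<bar>"
      using ne by (simp add: abs_mult pos_divide_le_eq)
    moreover have "(phi \<Psi> m' - phi \<Psi> m) / (m' - m) - \<sigma> = (phi \<Psi> m' - phi \<Psi> m - \<sigma> * (m' - m)) / (m' - m)"
      using ne by (simp add: field_simps)
    ultimately show ?thesis by simp
  qed
  have "((\<lambda>m'. (phi \<Psi> m' - phi \<Psi> m) / (m' - m)) \<longlongrightarrow> \<sigma>) (at m)"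
    unfolding tendsto_iff
  proof (intro allI impI)
    fix e :: real assume e: "0 < e"
    have "tilted_mean (\<sigma> - e) < m" "m < tilted_mean (\<sigma> + e)" using e by (auto simp: m_def tilted_mean_less_iff)
    then have "\<forall>\<^sub>F m' in at m. m' \<in> {tilted_mean (\<sigma> - e)<..<tilted_mean (\<sigma> + e)}"
      by (intro eventually_at_in_open') auto
    moreover have "\<forall>\<^sub>F m' in at m. m' \<noteq> m" by (simp add: eventually_at_filter)
    ultimately show "\<forall>\<^sub>F m' in at m. dist ((phi \<Psi> m' - phi \<Psi> m) / (m' - m)) \<sigma> < e"
    proof eventually_elim
      case (elim m')
      obtain \<tau> where \<tau>: "m' = tilted_mean \<tau>" using tilted_mean_surj by metis
      then have "\<bar>\<tau> - \<sigma>\<bar> < e" using elim by (auto simp: tilted_mean_less_iff abs_less_iff)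
      then show ?case using sub[OF \<tau> elim(2)] by (simp add: dist_real_def)
    qed
  qed
  then show ?thesis by (simp add: has_field_derivative_iff m_def)
qed

lemma deriv_phi: "deriv (phi \<Psi>) (tilted_mean \<sigma>) = \<sigma>"
  by (rule DERIV_imp_deriv[OF phi_DERIV])

lemma H_bar_DERIV: "(H_bar \<Psi> J has_real_derivative (\<sigma> - J * tilted_mean \<sigma>)) (at (tilted_mean \<sigma>))"
  unfolding H_bar_def[abs_def] by (auto intro!: derivative_eq_intros phi_DERIV)

lemma H_bar_even: "H_bar \<Psi> J (- m) = H_bar \<Psi> J m"
proof -
  obtain \<sigma> where \<sigma>: "m = tilted_mean \<sigma>" using tilted_mean_surj by metis
  have "phi_star \<Psi> (- \<sigma>) = phi_star \<Psi> \<sigma>" by (simp add: phi_star_Zp Zp_even)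
  then have "phi \<Psi> (- m) = phi \<Psi> m" using phi_tilted_mean[of \<sigma>] phi_tilted_mean[of "- \<sigma>"] by (simp add: \<sigma> tilted_mean_odd)
  then show ?thesis by (simp add: H_bar_def)
qed

lemma H_bar_continuous: "isCont (H_bar \<Psi> J) m"
  using DERIV_isCont[OF H_bar_DERIV] tilted_mean_surj by metis

section \<open>Integration by parts against the tilted weight\<close>

text \<open>If \<open>deriv \<Psi>\<close> stayed below \<open>A' * z\<close> throughout,
  \<open>\<Psi>\<close> would grow at most half as fast as \<open>\<Psi>_ge_square\<close> demands.
  One good point suffices, since the ratio is monotone.\<close>

lemma \<Psi>'_superlinear:
  obtains z0 where "0 < z0" "\<And>z. z0 \<le> z \<Longrightarrow> A * z \<le> deriv \<Psi> z"
proof -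
  define A' where "A' = \<bar>A\<bar> + 1"
  have A': "0 < A'" "A \<le> A'" by (auto simp: A'_def)
  have "\<exists>z>0. A' * z \<le> deriv \<Psi> z"
  proof (rule ccontr)
    assume "\<not> ?thesis"
    then have less: "deriv \<Psi> z < A' * z" if "0 < z" for z using that by force
    obtain B where B: "\<And>z. A' * z\<^sup>2 - B \<le> \<Psi> z" using \<Psi>_ge_square[of A'] A' by auto
    \<comment> \<open>Chosen so that \<open>A' / 2 * z\<^sup>2\<close> exceeds
      \<open>\<Psi> 0 + B\<close>.\<close>
    define z where "z = sqrt (2 * (\<bar>\<Psi> 0 + B\<bar> + 1) / A')"
    have "0 < \<bar>\<Psi> 0 + B\<bar> + 1" by linarith
    then have "0 < 2 * (\<bar>\<Psi> 0 + B\<bar> + 1) / A'" using A'(1) by (intro divide_pos_pos mult_pos_pos) auto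
    then have z: "0 < z" "z\<^sup>2 = 2 * (\<bar>\<Psi> 0 + B\<bar> + 1) / A'" by (simp_all add: z_def del: zero_less_divide_iff)
    have "\<Psi> z - A' / 2 * z\<^sup>2 \<le> \<Psi> 0 - A' / 2 * 0\<^sup>2"
    proof (rule DERIV_nonpos_imp_nonincreasing[of 0 z "\<lambda>z. \<Psi> z - A' / 2 * z\<^sup>2"])
      fix x assume "0 \<le> x" "x \<le> z"
      have "((\<lambda>z. \<Psi> z - A' / 2 * z\<^sup>2) has_real_derivative deriv \<Psi> x - A' * x) (at x)"
        by (auto intro!: derivative_eq_intros \<Psi>_DERIV)
      moreover have "deriv \<Psi> x - A' * x \<le> 0" using less[of x] \<open>0 \<le> x\<close> \<Psi>'_0 by (cases "x = 0") auto
      ultimately show "\<exists>y. ((\<lambda>z. \<Psi> z - A' / 2 * z\<^sup>2) has_real_derivative y) (at x) \<and> y \<le> 0" by blast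
    qed (use z in simp)
    then have "A' / 2 * z\<^sup>2 \<le> \<Psi> 0 + B" using B[of z] by simp
    moreover have "A' / 2 * z\<^sup>2 = \<bar>\<Psi> 0 + B\<bar> + 1" using z(2) A' by simp
    ultimately show False by linarith
  qed
  then obtain z0 where z0: "0 < z0" "A' * z0 \<le> deriv \<Psi> z0" by blast
  have "A * z \<le> deriv \<Psi> z" if "z0 \<le> z" for z
  proof -
    have "A' \<le> deriv \<Psi> z0 / z0" using z0 by (simp add: field_simps)
    also have "\<dots> \<le> deriv \<Psi> z / z" by (rule \<Psi>'_ratio_mono[OF z0(1) that])
    finally have "A' * z \<le> deriv \<Psi> z" using z0 that by (simp add: field_simps)
    moreover have "A * z \<le> A' * z" using A' z0 that by (intro mult_right_mono) auto
    ultimately show ?thesis by linarith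
  qed
  with z0(1) show ?thesis using that by blast
qed

lemma tilt_tendsto_0: "((\<lambda>z. exp (\<sigma> * z - \<Psi> z)) \<longlongrightarrow> 0) at_top" "((\<lambda>z. exp (\<sigma> * z - \<Psi> z)) \<longlongrightarrow> 0) at_bot"
proof -
  have top: "((\<lambda>z. exp (\<sigma> * z - \<Psi> z)) \<longlongrightarrow> 0) at_top" for \<sigma>
  proof -
    obtain C where C: "0 < C" "\<And>z. exp (0 * z\<^sup>2) * exp (\<sigma> * z - \<Psi> z) \<le> C * exp (- z\<^sup>2)" using tilt_le_gauss by metis
    have "filterlim (\<lambda>z::real. 1 - z) at_bot at_top"
      using filterlim_tendsto_add_at_top[OF tendsto_const[of "-1::real"] filterlim_ident] by (simp add: filterlim_uminus_at_bot)
    then have e: "((\<lambda>z::real. exp (1 - z)) \<longlongrightarrow> 0) at_top" by (rule filterlim_compose[OF exp_at_bot])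
    show ?thesis
    proof (rule tendsto_0_le[OF e, of _ C])
      have "norm (exp (\<sigma> * z - \<Psi> z)) \<le> norm (exp (1 - z)) * C" for z
      proof -
        have "exp (- z\<^sup>2) \<le> exp (1 - z)" using abs_le_1_plus_square[of z] by simp
        then have "C * exp (- z\<^sup>2) \<le> C * exp (1 - z)" using C(1) by simp
        then show ?thesis using C(2)[of z] by (simp add: mult.commute)
      qed
      then show "\<forall>\<^sub>F z in at_top. norm (exp (\<sigma> * z - \<Psi> z)) \<le> norm (exp (1 - z)) * C" by simp
    qed
  qed
  show "((\<lambda>z. exp (\<sigma> * z - \<Psi> z)) \<longlongrightarrow> 0) at_top" by (rule top)
  show "((\<lambda>z. exp (\<sigma> * z - \<Psi> z)) \<longlongrightarrow> 0) at_bot"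
    unfolding filterlim_at_bot_mirror using top[of "- \<sigma>"] by (simp add: \<Psi>_even)
qed

lemma tilt_has_derivative: "((\<lambda>z. exp (\<sigma> * z - \<Psi> z)) has_real_derivative (\<sigma> - deriv \<Psi> z) * exp (\<sigma> * z - \<Psi> z)) (at z)"
  by (auto intro!: derivative_eq_intros \<Psi>_DERIV)

text \<open>No upper bound on the growth of \<open>deriv \<Psi>\<close> is available, hence no
  explicit majorant. But far out the integrand has constant sign and is a derivative, so the
  fundamental theorem for nonnegative integrands yields integrability.\<close>

lemma integrable_tilt_derivative: "integrable lborel (\<lambda>z. (\<sigma> - deriv \<Psi> z) * exp (\<sigma> * z - \<Psi> z))"
proof -
  obtain z0 where z0: "0 < z0" "\<And>z. z0 \<le> z \<Longrightarrow> 1 * z \<le> deriv \<Psi> z" using \<Psi>'_superlinear by metis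
  define z1 where "z1 = max z0 \<bar>\<sigma>\<bar>"
  have z1: "0 < z1" "\<And>z. z1 \<le> z \<Longrightarrow> \<bar>\<sigma>\<bar> \<le> deriv \<Psi> z" using z0 by (force simp: z1_def)+
  have right: "integrable lborel (\<lambda>z. indicator {z1..} z * ((s - deriv \<Psi> z) * exp (s * z - \<Psi> z)))" if s: "\<bar>s\<bar> \<le> \<bar>\<sigma>\<bar>" for s
  proof -
    have "(\<integral>\<^sup>+z. ennreal ((deriv \<Psi> z - s) * exp (s * z - \<Psi> z)) * indicator {z1..} z \<partial>lborel) = ennreal (- 0 - (- exp (s * z1 - \<Psi> z1)))"
    proof (rule nn_integral_FTC_atLeast)
      fix z assume "z1 \<le> z"
      then show "0 \<le> (deriv \<Psi> z - s) * exp (s * z - \<Psi> z)" using z1(2)[of z] s by simp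
      show "((\<lambda>z. - exp (s * z - \<Psi> z)) has_real_derivative (deriv \<Psi> z - s) * exp (s * z - \<Psi> z)) (at z)"
        by (auto intro!: derivative_eq_intros \<Psi>_DERIV simp: algebra_simps)
    qed (use tendsto_minus[OF tilt_tendsto_0(1)[of s]] in auto)
    then have "integrable lborel (\<lambda>z. (deriv \<Psi> z - s) * exp (s * z - \<Psi> z) * indicator {z1..} z)"
    proof (intro integrableI_nonneg)
      assume I: "(\<integral>\<^sup>+z. ennreal ((deriv \<Psi> z - s) * exp (s * z - \<Psi> z)) * indicator {z1..} z \<partial>lborel) = ennreal (- 0 - (- exp (s * z1 - \<Psi> z1)))"
      show "AE z in lborel. 0 \<le> (deriv \<Psi> z - s) * exp (s * z - \<Psi> z) * indicator {z1..} z"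
      proof (rule AE_I2)
        fix z show "0 \<le> (deriv \<Psi> z - s) * exp (s * z - \<Psi> z) * indicator {z1..} z"
          using z1(2)[of z] s by (auto split: split_indicator)
      qed
      have "(\<integral>\<^sup>+z. ennreal ((deriv \<Psi> z - s) * exp (s * z - \<Psi> z) * indicator {z1..} z) \<partial>lborel) =
        (\<integral>\<^sup>+z. ennreal ((deriv \<Psi> z - s) * exp (s * z - \<Psi> z)) * indicator {z1..} z \<partial>lborel)"
        by (intro nn_integral_cong) (auto split: split_indicator)
      then show "(\<integral>\<^sup>+z. ennreal ((deriv \<Psi> z - s) * exp (s * z - \<Psi> z) * indicator {z1..} z) \<partial>lborel) < \<infinity>"
        unfolding I by simp
    qed measurable
    then have "integrable lborel (\<lambda>z. - ((deriv \<Psi> z - s) * exp (s * z - \<Psi> z) * indicator {z1..} z))" by simp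
    also have "(\<lambda>z. - ((deriv \<Psi> z - s) * exp (s * z - \<Psi> z) * indicator {z1..} z)) =
      (\<lambda>z. indicator {z1..} z * ((s - deriv \<Psi> z) * exp (s * z - \<Psi> z)))" by (auto split: split_indicator simp: algebra_simps)
    finally show ?thesis .
  qed
  \<comment> \<open>The reflection of the right tail for the opposite tilt; this is why
    \<open>right\<close> was proved for all \<open>s\<close> with
    \<open>\<bar>s\<bar> \<le> \<bar>\<sigma>\<bar>\<close>.\<close>
  have left: "integrable lborel (\<lambda>z. indicator {..- z1} z * ((\<sigma> - deriv \<Psi> z) * exp (\<sigma> * z - \<Psi> z)))"
  proof -
    have "integrable lborel (\<lambda>z. - (indicator {z1..} (- z) * ((- \<sigma> - deriv \<Psi> (- z)) * exp (- \<sigma> * (- z) - \<Psi> (- z)))))"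
      using lborel_integrable_real_affine[OF right[of "- \<sigma>"], of "-1" 0] by simp
    also have "(\<lambda>z. - (indicator {z1..} (- z) * ((- \<sigma> - deriv \<Psi> (- z)) * exp (- \<sigma> * (- z) - \<Psi> (- z))))) =
      (\<lambda>z. indicator {..- z1} z * ((\<sigma> - deriv \<Psi> z) * exp (\<sigma> * z - \<Psi> z)))"
      by (auto simp: \<Psi>_even \<Psi>'_odd algebra_simps split: split_indicator)
    finally show ?thesis .
  qed
  have mid: "set_integrable lborel {- z1<..<z1} (\<lambda>z. (\<sigma> - deriv \<Psi> z) * exp (\<sigma> * z - \<Psi> z))"
    by (rule set_integrable_subset[OF borel_integrable_atLeastAtMost'[of "- z1" z1]])
      (auto intro!: continuous_intros \<Psi>_continuous \<Psi>'_continuous)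
  have "integrable lborel (\<lambda>z. indicator {..- z1} z * ((\<sigma> - deriv \<Psi> z) * exp (\<sigma> * z - \<Psi> z)) +
    indicator {- z1<..<z1} z *\<^sub>R ((\<sigma> - deriv \<Psi> z) * exp (\<sigma> * z - \<Psi> z)) +
    indicator {z1..} z * ((\<sigma> - deriv \<Psi> z) * exp (\<sigma> * z - \<Psi> z)))"
    by (intro Bochner_Integration.integrable_add left right mid[unfolded set_integrable_def]) simp
  also have "(\<lambda>z. indicator {..- z1} z * ((\<sigma> - deriv \<Psi> z) * exp (\<sigma> * z - \<Psi> z)) +
    indicator {- z1<..<z1} z *\<^sub>R ((\<sigma> - deriv \<Psi> z) * exp (\<sigma> * z - \<Psi> z)) +
    indicator {z1..} z * ((\<sigma> - deriv \<Psi> z) * exp (\<sigma> * z - \<Psi> z))) = (\<lambda>z. (\<sigma> - deriv \<Psi> z) * exp (\<sigma> * z - \<Psi> z))"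
    using z1(1) by (auto split: split_indicator)
  finally show ?thesis .
qed

lemma integral_tilt_derivative: "(\<integral>z. (\<sigma> - deriv \<Psi> z) * exp (\<sigma> * z - \<Psi> z) \<partial>lborel) = 0"
proof -
  have "(LBINT z=-\<infinity>..\<infinity>. (\<sigma> - deriv \<Psi> z) * exp (\<sigma> * z - \<Psi> z)) = 0 - 0"
  proof (rule interval_integral_FTC_integrable)
    fix z
    show "((\<lambda>z. exp (\<sigma> * z - \<Psi> z)) has_vector_derivative (\<sigma> - deriv \<Psi> z) * exp (\<sigma> * z - \<Psi> z)) (at z)"
      using tilt_has_derivative[of \<sigma> z] by (simp add: has_real_derivative_iff_has_vector_derivative)
    show "isCont (\<lambda>z. (\<sigma> - deriv \<Psi> z) * exp (\<sigma> * z - \<Psi> z)) z"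
      by (intro continuous_intros DERIV_isCont[OF \<Psi>_DERIV] DERIV_isCont[OF \<Psi>'_DERIV])
  next
    show "set_integrable lborel (einterval (- \<infinity>) \<infinity>) (\<lambda>z. (\<sigma> - deriv \<Psi> z) * exp (\<sigma> * z - \<Psi> z))"
      using integrable_tilt_derivative by (simp add: set_integrable_def einterval_def)
    show "(((\<lambda>z. exp (\<sigma> * z - \<Psi> z)) \<circ> real_of_ereal) \<longlongrightarrow> 0) (at_right (- \<infinity>))"
      "(((\<lambda>z. exp (\<sigma> * z - \<Psi> z)) \<circ> real_of_ereal) \<longlongrightarrow> 0) (at_left \<infinity>)"
      using tilt_tendsto_0 by (simp_all add: ereal_tendsto_simps)
  qed simp
  then show ?thesis by (simp add: interval_lebesgue_integral_def einterval_def set_lebesgue_integral_def)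
qed

section \<open>Uniqueness of the positive critical point\<close>

text \<open>Since \<open>\<sigma> = \<phi>'(m)\<close> iff \<open>m = \<phi>*'(\<sigma>)\<close>, the zeros of \<open>gap\<close> correspond to the critical points of \<open>H_bar\<close>.\<close>

definition gap :: "real \<Rightarrow> real" where "gap \<sigma> = \<sigma> * Zp \<sigma> - J * M1 \<sigma>"

lemma gap_eq: "gap \<sigma> = (\<sigma> - J * tilted_mean \<sigma>) * Zp \<sigma>"
  by (simp add: gap_def M1_eq algebra_simps)

lemma gap_odd: "gap (- \<sigma>) = - gap \<sigma>"
  by (simp add: gap_def Zp_even M1_odd)

text \<open>By parts, \<open>\<sigma> * Zp \<sigma>\<close> equals the tilted integral of
  \<open>deriv \<Psi>\<close>; both terms of \<open>gap\<close> then share one weight.\<close>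

lemma gap_exp:
  "integrable lborel (\<lambda>z. (deriv \<Psi> z - J * z) * exp (\<sigma> * z - \<Psi> z))"
  "(\<integral>z. (deriv \<Psi> z - J * z) * exp (\<sigma> * z - \<Psi> z) \<partial>lborel) = gap \<sigma>"
proof -
  have eq: "(\<lambda>z. (deriv \<Psi> z - J * z) * exp (\<sigma> * z - \<Psi> z)) =
    (\<lambda>z. \<sigma> * exp (\<sigma> * z - \<Psi> z) - (\<sigma> - deriv \<Psi> z) * exp (\<sigma> * z - \<Psi> z) - J * (z * exp (\<sigma> * z - \<Psi> z)))"
    by (simp add: algebra_simps)
  show "integrable lborel (\<lambda>z. (deriv \<Psi> z - J * z) * exp (\<sigma> * z - \<Psi> z))"
    unfolding eq by (intro Bochner_Integration.integrable_diff integrable_mult_right integrable_Zp integrable_M1 integrable_tilt_derivative)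
  have "(\<integral>z. (deriv \<Psi> z - J * z) * exp (\<sigma> * z - \<Psi> z) \<partial>lborel) =
    (\<integral>z. \<sigma> * exp (\<sigma> * z - \<Psi> z) \<partial>lborel) - (\<integral>z. (\<sigma> - deriv \<Psi> z) * exp (\<sigma> * z - \<Psi> z) \<partial>lborel) - (\<integral>z. J * (z * exp (\<sigma> * z - \<Psi> z)) \<partial>lborel)"
    unfolding eq using integrable_Zp integrable_M1 integrable_tilt_derivative
    by (subst Bochner_Integration.integral_diff; (subst Bochner_Integration.integral_diff)?) auto
  then show "(\<integral>z. (deriv \<Psi> z - J * z) * exp (\<sigma> * z - \<Psi> z) \<partial>lborel) = gap \<sigma>"
    unfolding integral_tilt_derivative gap_def Zp_def M1_def by simp
qed

text \<open>Antisymmetrisation in \<open>\<sigma>\<close>. The result is an even integrand with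
  weights that are positive on the positive half-line, to which sign arguments apply.\<close>

lemma gap_sinh:
  "integrable lborel (\<lambda>z. (deriv \<Psi> z - J * z) * sinh (\<sigma> * z) * exp (- \<Psi> z))"
  "(\<integral>z. (deriv \<Psi> z - J * z) * sinh (\<sigma> * z) * exp (- \<Psi> z) \<partial>lborel) = gap \<sigma>"
proof -
  have eq: "(\<lambda>z. (deriv \<Psi> z - J * z) * sinh (\<sigma> * z) * exp (- \<Psi> z)) =
    (\<lambda>z. ((deriv \<Psi> z - J * z) * exp (\<sigma> * z - \<Psi> z) - (deriv \<Psi> z - J * z) * exp (- \<sigma> * z - \<Psi> z)) / 2)"
  proof
    fix z
    have "exp (\<sigma> * z - \<Psi> z) = exp (\<sigma> * z) * exp (- \<Psi> z)" "exp (- \<sigma> * z - \<Psi> z) = exp (- (\<sigma> * z)) * exp (- \<Psi> z)"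
      by (simp_all add: exp_add[symmetric])
    then show "(deriv \<Psi> z - J * z) * sinh (\<sigma> * z) * exp (- \<Psi> z) =
      ((deriv \<Psi> z - J * z) * exp (\<sigma> * z - \<Psi> z) - (deriv \<Psi> z - J * z) * exp (- \<sigma> * z - \<Psi> z)) / 2"
      by (simp only: sinh_field_def) (simp add: algebra_simps)
  qed
  show "integrable lborel (\<lambda>z. (deriv \<Psi> z - J * z) * sinh (\<sigma> * z) * exp (- \<Psi> z))"
    unfolding eq by (intro integrable_divide Bochner_Integration.integrable_diff gap_exp)
  have "(\<integral>z. (deriv \<Psi> z - J * z) * sinh (\<sigma> * z) * exp (- \<Psi> z) \<partial>lborel) = (gap \<sigma> - gap (- \<sigma>)) / 2"
    unfolding eq using gap_exp(1)[of \<sigma>] gap_exp(1)[of "- \<sigma>"] gap_exp(2)[of \<sigma>] gap_exp(2)[of "- \<sigma>"] by simp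
  then show "(\<integral>z. (deriv \<Psi> z - J * z) * sinh (\<sigma> * z) * exp (- \<Psi> z) \<partial>lborel) = gap \<sigma>" by (simp add: gap_odd)
qed

text \<open>The ratio \<open>\<Psi>'(z) / z\<close> is nondecreasing by convexity, so \<open>\<Psi>'(z) - J z\<close> changes sign
  once on the positive half-line; at a zero of \<^term>\<open>gap\<close> it must do so at some \<open>z0\<close>.\<close>

lemma sign_change:
  assumes "0 < \<sigma>" "gap \<sigma> = 0"
  obtains z0 where "0 < z0" "\<And>z. 0 < z \<Longrightarrow> z < z0 \<Longrightarrow> deriv \<Psi> z - J * z \<le> 0" "\<And>z. z0 < z \<Longrightarrow> 0 < deriv \<Psi> z - J * z"
proof -
  define q where "q z = deriv \<Psi> z - J * z" for z
  let ?S = "{z. 0 < z \<and> q z \<le> 0}"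
  \<comment> \<open>Otherwise the integrand of \<open>gap_sinh\<close> would be positive off
    \<open>0\<close>, and \<open>gap \<sigma>\<close> could not vanish.\<close>
  have "?S \<noteq> {}"
  proof
    assume "?S = {}"
    then have pos: "0 < q z" if "0 < z" for z using that by (force simp: not_le)
    have qodd: "q (- z) = - q z" for z by (simp add: q_def \<Psi>'_odd)
    have "0 < (\<integral>z. q z * sinh (\<sigma> * z) * exp (- \<Psi> z) \<partial>lborel)"
    proof (rule integral_pos_if_pos_on_interval[OF gap_sinh(1)[folded q_def], where a=0 and b=1])
      fix z :: real
      show "0 \<le> q z * sinh (\<sigma> * z) * exp (- \<Psi> z)"
      proof (cases z "0 :: real" rule: linorder_cases)
        case less
        then have "0 < q (- z)" "sinh (\<sigma> * z) < 0" using pos assms by (auto simp: mult_pos_neg)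
        then show ?thesis by (simp add: qodd zero_le_mult_iff)
      next
        case greater
        then show ?thesis using pos[of z] assms by simp
      qed simp
    next
      fix z :: real assume "0 < z" then show "0 < q z * sinh (\<sigma> * z) * exp (- \<Psi> z)" using pos[of z] assms by simp
    qed simp
    then show False using gap_sinh(2)[of \<sigma>] assms by (simp add: q_def)
  qed
  then obtain z1 where z1: "0 < z1" "q z1 \<le> 0" by auto
  \<comment> \<open>The slope \<open>J + 1\<close> makes \<open>q\<close> at least \<open>z\<close>
    beyond \<open>zb\<close>, which bounds the set whose supremum is the sign change.\<close>
  obtain zb where zb: "0 < zb" "\<And>z. zb \<le> z \<Longrightarrow> (J + 1) * z \<le> deriv \<Psi> z" using \<Psi>'_superlinear by metis
  have "z \<le> zb" if "z \<in> ?S" for z using zb(2)[of z] that by (force simp: q_def algebra_simps)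
  then have bd: "bdd_above ?S" by (rule bdd_aboveI)
  define z0 where "z0 = Sup ?S"
  have "z1 \<le> z0" unfolding z0_def by (rule cSup_upper[OF _ bd]) (use z1 in auto)
  show ?thesis
  proof (rule that[of z0])
    show "0 < z0" using \<open>z1 \<le> z0\<close> z1 by simp
    fix z
    { assume z: "0 < z" "z < z0"
      then obtain y where y: "y \<in> ?S" "z < y" using less_cSup_iff[OF \<open>?S \<noteq> {}\<close> bd] by (auto simp: z0_def)
      have "deriv \<Psi> z / z \<le> deriv \<Psi> y / y" by (rule \<Psi>'_ratio_mono) (use z y in auto)
      also have "\<dots> \<le> J" using y by (simp add: q_def field_simps)
      finally show "deriv \<Psi> z - J * z \<le> 0" using z by (simp add: field_simps) }
    { assume z: "z0 < z"
      then have "z \<notin> ?S" using cSup_upper[OF _ bd, of z] by (auto simp: z0_def)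
      then show "0 < deriv \<Psi> z - J * z" using z \<open>0 < z0\<close> by (auto simp: q_def) }
  qed
qed

text \<open>The combination \<open>k\<close> of the two weights vanishes at \<open>z0\<close> and,
  by \<open>sinh_ratio_increasing\<close>, changes sign there exactly as \<open>q\<close> does. The
  product is nonnegative, and positive beyond \<open>z0\<close>.\<close>

lemma gap_cross:
  assumes z0: "0 < z0" "\<And>z. 0 < z \<Longrightarrow> z < z0 \<Longrightarrow> deriv \<Psi> z - J * z \<le> 0" "\<And>z. z0 < z \<Longrightarrow> 0 < deriv \<Psi> z - J * z"
    and ab: "0 < a" "a < b"
  shows "0 < sinh (a * z0) * gap b - sinh (b * z0) * gap a"
proof -
  define q where "q z = deriv \<Psi> z - J * z" for z
  define k where "k z = sinh (a * z0) * sinh (b * z) - sinh (b * z0) * sinh (a * z)" for z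
  have qodd: "q (- z) = - q z" for z by (simp add: q_def \<Psi>'_odd)
  have kodd: "k (- z) = - k z" for z by (simp add: k_def)
  have eq: "(\<lambda>z. q z * k z * exp (- \<Psi> z)) = (\<lambda>z. sinh (a * z0) * (q z * sinh (b * z) * exp (- \<Psi> z)) - sinh (b * z0) * (q z * sinh (a * z) * exp (- \<Psi> z)))"
    by (simp add: k_def algebra_simps)
  have i: "integrable lborel (\<lambda>z. q z * k z * exp (- \<Psi> z))"
    unfolding eq using gap_sinh(1)[of a] gap_sinh(1)[of b] by (auto simp: q_def)
  have kpos: "0 < k z" if "z0 < z" for z
    using sinh_ratio_increasing[OF ab z0(1) that] by (simp add: k_def mult_ac)
  have kneg: "k z < 0" if "0 < z" "z < z0" for z
    using sinh_ratio_increasing[OF ab that] by (simp add: k_def mult_ac)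
  have nn: "0 \<le> q z * k z" if "0 < z" for z
  proof (cases z z0 rule: linorder_cases)
    case less
    then show ?thesis using z0(2)[OF that less] kneg[OF that less] by (simp add: q_def mult_nonpos_nonpos)
  next
    case equal
    then show ?thesis by (simp add: k_def)
  next
    case greater
    then show ?thesis using z0(3)[OF greater] kpos[OF greater] by (simp add: q_def)
  qed
  have "0 < (\<integral>z. q z * k z * exp (- \<Psi> z) \<partial>lborel)"
  proof (rule integral_pos_if_pos_on_interval[OF i, of z0 "z0 + 1"])
    fix z
    show "0 \<le> q z * k z * exp (- \<Psi> z)"
    proof (cases z "0 :: real" rule: linorder_cases)
      case less
      then show ?thesis using nn[of "- z"] by (simp add: qodd kodd)
    next
      case greater
      then show ?thesis using nn[of z] by simp
    qed (simp add: k_def)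
  next
    fix z assume "z0 < z"
    then show "0 < q z * k z * exp (- \<Psi> z)" using z0(3) kpos by (simp add: q_def)
  qed simp
  also have "(\<integral>z. q z * k z * exp (- \<Psi> z) \<partial>lborel) = sinh (a * z0) * gap b - sinh (b * z0) * gap a"
    unfolding eq using gap_sinh[of a] gap_sinh[of b] by (simp add: q_def)
  finally show ?thesis .
qed

text \<open>At a zero of \<open>gap\<close> one term of \<open>gap_cross\<close> drops out. So there
  is at most one positive zero, with \<open>gap\<close> negative before it and positive after
  it.\<close>

lemma gap_sign:
  assumes "0 < \<sigma>" "gap \<sigma> = 0" "0 < \<tau>"
  shows "\<sigma> < \<tau> \<Longrightarrow> 0 < gap \<tau>" "\<tau> < \<sigma> \<Longrightarrow> gap \<tau> < 0"
proof -
  obtain z0 where z0: "0 < z0" "\<And>z. 0 < z \<Longrightarrow> z < z0 \<Longrightarrow> deriv \<Psi> z - J * z \<le> 0" "\<And>z. z0 < z \<Longrightarrow> 0 < deriv \<Psi> z - J * z"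
    by (rule sign_change[OF assms(1,2)]) (rule that; assumption)
  have s: "0 < sinh (x * z0)" if "0 < x" for x using that z0(1) by simp
  { assume "\<sigma> < \<tau>"
    then have "0 < sinh (\<sigma> * z0) * gap \<tau>" using gap_cross[OF z0 assms(1), of \<tau>] assms(2) by simp
    then show "0 < gap \<tau>" using s[OF assms(1)] zero_less_mult_pos by blast }
  { assume "\<tau> < \<sigma>"
    then have "0 < sinh (\<sigma> * z0) * (- gap \<tau>)" using gap_cross[OF z0 assms(3), of \<sigma>] assms(2) by simp
    then have "0 < - gap \<tau>" using s[OF assms(1)] zero_less_mult_pos by blast
    then show "gap \<tau> < 0" by simp }
qed

text \<open>The coefficient is half of the \<open>1 / (2 * J)\<close> at which
  \<open>phi_star\<close> would balance the interaction. This surplus is used for the existence of a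
  critical point and for coercivity of the energy.\<close>

lemma phi_star_upper:
  obtains C where "\<And>\<sigma>. phi_star \<Psi> \<sigma> \<le> \<sigma>\<^sup>2 / (4 * J) + C"
proof -
  \<comment> \<open>The part \<open>J\<close> completes the square with \<open>\<sigma> * z\<close>,
    the extra \<open>1\<close> leaves a Gaussian.\<close>
  obtain B where B: "\<And>z. (J + 1) * z\<^sup>2 - B \<le> \<Psi> z" using \<Psi>_ge_square[of "J + 1"] J_pos by auto
  define G where "G = (\<integral>z. exp (- z\<^sup>2) \<partial>lborel :: real)"
  have G: "0 < G" unfolding G_def by (rule integral_pos_if_pos_on_interval[OF integrable_gauss, of 0 1]) auto
  have "phi_star \<Psi> \<sigma> \<le> \<sigma>\<^sup>2 / (4 * J) + (B + ln G)" for \<sigma>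
  proof -
    have "Zp \<sigma> \<le> (\<integral>z. exp (\<sigma>\<^sup>2 / (4 * J) + B) * exp (- z\<^sup>2) \<partial>lborel)"
      unfolding Zp_def
    proof (intro integral_mono integrable_Zp integrable_mult_right integrable_gauss)
      fix z
      have "0 \<le> (\<sigma> - 2 * J * z)\<^sup>2 / (4 * J)" using J_pos by simp
      also have "\<dots> = \<sigma>\<^sup>2 / (4 * J) - \<sigma> * z + J * z\<^sup>2" using J_pos by (simp add: power2_eq_square field_simps)
      finally show "exp (\<sigma> * z - \<Psi> z) \<le> exp (\<sigma>\<^sup>2 / (4 * J) + B) * exp (- z\<^sup>2)"
        using B[of z] by (simp add: exp_add[symmetric] algebra_simps)
    qed
    also have "\<dots> = exp (\<sigma>\<^sup>2 / (4 * J) + B) * G" by (simp add: G_def)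
    finally have "ln (Zp \<sigma>) \<le> ln (exp (\<sigma>\<^sup>2 / (4 * J) + B) * G)" using Zp_pos G by (intro ln_mono) auto
    then show ?thesis using G by (simp add: phi_star_Zp ln_mult)
  qed
  then show ?thesis by (rule that)
qed

text \<open>The variance condition says that \<open>gap\<close> has negative derivative at
  \<open>0\<close>. If it stayed negative, \<open>tilted_mean \<sigma>\<close> would be at least
  \<open>\<sigma> / J\<close> and \<open>phi_star\<close> would grow like
  \<open>\<sigma>\<^sup>2 / (2 * J)\<close>, against \<open>phi_star_upper\<close>.\<close>

lemma gap_root: "\<exists>\<sigma>>0. gap \<sigma> = 0"
proof -
  have cont: "isCont gap x" for x
    unfolding gap_def[abs_def] by (intro continuous_intros DERIV_isCont[OF Zp_DERIV] DERIV_isCont[OF M1_DERIV])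
  have "1 / J < (\<integral>z. z\<^sup>2 * exp (- \<Psi> z) \<partial>lborel) / Zp 0"
    using standing by (simp add: standing_assumptions_def Zp_def)
  then have var: "Zp 0 < J * (\<integral>z. z\<^sup>2 * exp (0 * z - \<Psi> z) \<partial>lborel)"
    using J_pos Zp_pos[of 0] by (simp add: field_simps)
  have "(gap has_real_derivative (Zp 0 - J * (\<integral>z. z\<^sup>2 * exp (0 * z - \<Psi> z) \<partial>lborel))) (at 0)"
    unfolding gap_def[abs_def] by (auto intro!: derivative_eq_intros Zp_DERIV M1_DERIV)
  from DERIV_neg_dec_right[OF this] var
  obtain d where d: "0 < d" "\<And>h. 0 < h \<Longrightarrow> h < d \<Longrightarrow> gap (0 + h) < gap 0" by auto
  define a where "a = d / 2"
  have a: "0 < a" "gap a < 0" using d(1) d(2)[of a] M1_odd[of 0] by (auto simp: a_def gap_def)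
  have "\<exists>b\<ge>a. 0 \<le> gap b"
  proof (rule ccontr)
    assume "\<not> ?thesis"
    then have neg: "gap \<sigma> < 0" if "a \<le> \<sigma>" for \<sigma> using that by force
    have tm: "\<sigma> / J \<le> tilted_mean \<sigma>" if "a \<le> \<sigma>" for \<sigma>
    proof -
      have "(\<sigma> - J * tilted_mean \<sigma>) * Zp \<sigma> < 0" using neg[OF that] by (simp add: gap_eq)
      then have "\<sigma> - J * tilted_mean \<sigma> < 0" using Zp_pos[of \<sigma>] by (simp add: mult_less_0_iff)
      then show ?thesis using J_pos by (simp add: field_simps)
    qed
    obtain C where C: "\<And>\<sigma>. phi_star \<Psi> \<sigma> \<le> \<sigma>\<^sup>2 / (4 * J) + C" using phi_star_upper by metis
    define K where "K = C - phi_star \<Psi> a + a\<^sup>2 / (2 * J)"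
    \<comment> \<open>Makes \<open>b\<^sup>2 / (4 * J)\<close> at least
      \<open>\<bar>K\<bar> + 1\<close>.\<close>
    define b where "b = a + sqrt (4 * J * (\<bar>K\<bar> + 1))"
    have b: "a \<le> b" using J_pos by (simp add: b_def)
    have "phi_star \<Psi> a - a\<^sup>2 / (2 * J) \<le> phi_star \<Psi> b - b\<^sup>2 / (2 * J)"
    proof (rule DERIV_nonneg_imp_nondecreasing[OF b, of "\<lambda>x. phi_star \<Psi> x - x\<^sup>2 / (2 * J)"])
      fix x assume "a \<le> x" "x \<le> b"
      have "((\<lambda>x. phi_star \<Psi> x - x\<^sup>2 / (2 * J)) has_real_derivative tilted_mean x - x / J) (at x)"
        using J_pos by (auto intro!: derivative_eq_intros phi_star_DERIV simp: field_simps)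
      moreover have "0 \<le> tilted_mean x - x / J" using tm[OF \<open>a \<le> x\<close>] by simp
      ultimately show "\<exists>y. ((\<lambda>x. phi_star \<Psi> x - x\<^sup>2 / (2 * J)) has_real_derivative y) (at x) \<and> 0 \<le> y" by blast
    qed
    then have "b\<^sup>2 / (2 * J) - b\<^sup>2 / (4 * J) \<le> K" using C[of b] by (simp add: K_def)
    then have le: "b\<^sup>2 / (4 * J) \<le> K" using J_pos by (simp add: field_simps)
    have "(sqrt (4 * J * (\<bar>K\<bar> + 1)))\<^sup>2 \<le> b\<^sup>2" unfolding b_def using a J_pos by (intro power_mono) auto
    then have "\<bar>K\<bar> + 1 \<le> b\<^sup>2 / (4 * J)" using J_pos by (simp add: field_simps)
    then show False using le by linarith
  qed
  then obtain b where b: "a \<le> b" "0 \<le> gap b" by blast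
  have "\<exists>x\<ge>a. x \<le> b \<and> gap x = 0" by (rule IVT) (use a b cont in auto)
  then obtain x where "a \<le> x" "gap x = 0" by blast
  then show ?thesis using a(1) by (intro exI[of _ x]) auto
qed

text \<open>By \<open>gap_sign\<close> there is only one candidate, so the choice is
  canonical.\<close>

definition sigma_star :: real where "sigma_star = (SOME \<sigma>. 0 < \<sigma> \<and> gap \<sigma> = 0)"

lemma sigma_star: "0 < sigma_star" "gap sigma_star = 0"
  using someI_ex[OF gap_root] by (auto simp: sigma_star_def)

lemma gap_zero_iff: "gap \<sigma> = 0 \<longleftrightarrow> \<sigma> \<in> {- sigma_star, 0, sigma_star}"
proof
  assume g: "gap \<sigma> = 0"
  show "\<sigma> \<in> {- sigma_star, 0, sigma_star}"
  proof (cases \<sigma> "0 :: real" rule: linorder_cases)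
    case less
    then have "gap (- \<sigma>) = 0" using g by (simp add: gap_odd)
    then show ?thesis using gap_sign[OF sigma_star, of "- \<sigma>"] less by (cases "- \<sigma>" sigma_star rule: linorder_cases) auto
  next
    case greater
    then show ?thesis using gap_sign[OF sigma_star, of \<sigma>] g by (cases \<sigma> sigma_star rule: linorder_cases) auto
  qed simp
qed (use sigma_star in \<open>auto simp: gap_odd gap_def[of 0] M1_eq tilted_mean_0\<close>)

lemma critical_iff: "\<sigma> = J * tilted_mean \<sigma> \<longleftrightarrow> \<sigma> \<in> {- sigma_star, 0, sigma_star}"
  using Zp_pos[of \<sigma>] unfolding gap_zero_iff[symmetric] gap_eq by simp

lemma critical_points: "{x. (H_bar \<Psi> J has_real_derivative 0) (at x)} = {- tilted_mean sigma_star, 0, tilted_mean sigma_star}"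
proof -
  have "(H_bar \<Psi> J has_real_derivative 0) (at (tilted_mean \<sigma>)) \<longleftrightarrow> \<sigma> \<in> {- sigma_star, 0, sigma_star}" for \<sigma>
  proof -
    have "(H_bar \<Psi> J has_real_derivative 0) (at (tilted_mean \<sigma>)) \<longleftrightarrow> \<sigma> - J * tilted_mean \<sigma> = 0"
      using H_bar_DERIV[of \<sigma>] DERIV_unique by metis
    then show ?thesis using critical_iff[of \<sigma>] by simp
  qed
  note iff = this
  show ?thesis
  proof (intro set_eqI)
    fix x
    obtain \<sigma> where x: "x = tilted_mean \<sigma>" using tilted_mean_surj by metis
    have "x \<in> {- tilted_mean sigma_star, 0, tilted_mean sigma_star} \<longleftrightarrow> \<sigma> \<in> {- sigma_star, 0, sigma_star}"
      using tilted_mean_eq_iff[of \<sigma> "- sigma_star"] tilted_mean_eq_iff[of \<sigma> 0] tilted_mean_eq_iff[of \<sigma> sigma_star] by (simp add: x tilted_mean_odd tilted_mean_0)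
    then show "x \<in> {x. (H_bar \<Psi> J has_real_derivative 0) (at x)} \<longleftrightarrow> x \<in> {- tilted_mean sigma_star, 0, tilted_mean sigma_star}"
      using iff[of \<sigma>] by (simp add: x)
  qed
qed

lemma tilted_mean_sigma_star_pos: "0 < tilted_mean sigma_star"
  using tilted_mean_less_iff[of 0 sigma_star] sigma_star(1) by (simp add: tilted_mean_0)

lemma m_star_eq: "m_star \<Psi> J = tilted_mean sigma_star"
  unfolding m_star_def critical_points
proof (rule the_equality)
  fix m assume "0 < m \<and> {- tilted_mean sigma_star, 0, tilted_mean sigma_star} = {- m, 0, m}"
  then show "m = tilted_mean sigma_star" using tilted_mean_sigma_star_pos by (auto simp: set_eq_iff)
qed (use tilted_mean_sigma_star_pos in auto)

lemma mu_plus_eq: "mu_plus \<Psi> J = gibbs \<Psi> sigma_star"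
  by (simp add: mu_plus_def m_star_eq deriv_phi)

lemma mu_minus_eq: "mu_minus \<Psi> J = gibbs \<Psi> (- sigma_star)"
  by (simp add: mu_minus_def m_star_eq deriv_phi tilted_mean_odd[symmetric])

lemma mu_zero_eq: "mu_zero \<Psi> = gibbs \<Psi> 0"
  using deriv_phi[of 0] by (simp add: mu_zero_def tilted_mean_0)

section \<open>Shape of the reduced energy\<close>

text \<open>The derivative at \<open>tilted_mean \<sigma>\<close> is
  \<open>gap \<sigma> / Zp \<sigma>\<close>, so the sign pattern of \<open>gap\<close>
  transfers.\<close>

lemma H_bar_decreasing:
  assumes "0 \<le> x" "x < y" "y \<le> tilted_mean sigma_star"
  shows "H_bar \<Psi> J y < H_bar \<Psi> J x"
proof (rule DERIV_neg_imp_decreasing_open[OF assms(2)])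
  fix u assume u: "x < u" "u < y"
  obtain \<sigma> where \<sigma>: "u = tilted_mean \<sigma>" using tilted_mean_surj by metis
  have "0 < \<sigma>" "\<sigma> < sigma_star" using u assms tilted_mean_less_iff[of 0 \<sigma>] tilted_mean_less_iff[of \<sigma> sigma_star] by (auto simp: \<sigma> tilted_mean_0)
  then have "gap \<sigma> < 0" using gap_sign(2)[OF sigma_star] by simp
  then have "\<sigma> - J * tilted_mean \<sigma> < 0" using Zp_pos[of \<sigma>] by (simp add: gap_eq mult_less_0_iff)
  then show "\<exists>d. (H_bar \<Psi> J has_real_derivative d) (at u) \<and> d < 0" using H_bar_DERIV[of \<sigma>] by (auto simp: \<sigma>)
qed (auto intro: continuous_at_imp_continuous_on H_bar_continuous)

lemma H_bar_increasing:
  assumes "tilted_mean sigma_star \<le> x" "x < y"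
  shows "H_bar \<Psi> J x < H_bar \<Psi> J y"
proof (rule DERIV_pos_imp_increasing_open[OF assms(2)])
  fix u assume u: "x < u" "u < y"
  obtain \<sigma> where \<sigma>: "u = tilted_mean \<sigma>" using tilted_mean_surj by metis
  have "0 < \<sigma>" "sigma_star < \<sigma>" using u assms tilted_mean_less_iff[of 0 \<sigma>] tilted_mean_less_iff[of sigma_star \<sigma>] tilted_mean_sigma_star_pos by (auto simp: \<sigma> tilted_mean_0)
  then have "0 < gap \<sigma>" using gap_sign(1)[OF sigma_star] by simp
  then have "0 < \<sigma> - J * tilted_mean \<sigma>" using Zp_pos[of \<sigma>] by (simp add: gap_eq zero_less_mult_iff)
  then show "\<exists>d. (H_bar \<Psi> J has_real_derivative d) (at u) \<and> 0 < d" using H_bar_DERIV[of \<sigma>] by (auto simp: \<sigma>)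
qed (auto intro: continuous_at_imp_continuous_on H_bar_continuous)

lemma H_bar_min: "H_bar \<Psi> J (tilted_mean sigma_star) \<le> H_bar \<Psi> J m"
proof -
  have "H_bar \<Psi> J (tilted_mean sigma_star) \<le> H_bar \<Psi> J m" if "0 \<le> m" for m
    using H_bar_decreasing[OF that, of "tilted_mean sigma_star"] H_bar_increasing[of "tilted_mean sigma_star" m]
    by (cases m "tilted_mean sigma_star" rule: linorder_cases) auto
  from this[of m] this[of "- m"] show ?thesis using H_bar_even[of m] by (cases "0 \<le> m") auto
qed

text \<open>Strict monotonicity on either side traps positive points with nearly minimal value near
  the minimiser. Positivity selects the branch, as \<open>H_bar\<close> is even.\<close>

lemma H_bar_tendsto_min:
  assumes lim: "((\<lambda>x. H_bar \<Psi> J (g x)) \<longlongrightarrow> H_bar \<Psi> J (tilted_mean sigma_star)) F" and pos: "\<forall>\<^sub>F x in F. 0 < g x"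
  shows "(g \<longlongrightarrow> tilted_mean sigma_star) F"
  unfolding tendsto_iff
proof (intro allI impI)
  fix e :: real assume "0 < e"
  define d where "d = min e (tilted_mean sigma_star / 2)"
  have d: "0 < d" "d \<le> e" "d < tilted_mean sigma_star" using \<open>0 < e\<close> tilted_mean_sigma_star_pos by (auto simp: d_def min_def)
  let ?m = "tilted_mean sigma_star" and ?H = "H_bar \<Psi> J"
  have "?H ?m < min (?H (?m - d)) (?H (?m + d))" using H_bar_decreasing[of "?m - d" ?m] H_bar_increasing[of ?m "?m + d"] d by auto
  then have "\<forall>\<^sub>F x in F. ?H (g x) < min (?H (?m - d)) (?H (?m + d))" by (rule order_tendstoD(2)[OF lim])
  then show "\<forall>\<^sub>F x in F. dist (g x) ?m < e" using pos
  proof eventually_elim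
    case (elim x)
    have "?m - d < g x" using H_bar_decreasing[of "g x" "?m - d"] elim d by (cases "g x" "?m - d" rule: linorder_cases) auto
    moreover have "g x < ?m + d" using H_bar_increasing[of "?m + d" "g x"] elim d by (cases "g x" "?m + d" rule: linorder_cases) auto
    ultimately show ?case using d by (simp add: dist_real_def abs_less_iff)
  qed
qed

end

section \<open>Gibbs measures\<close>

text \<open>Skorohod's representation provides a coupling with pointwise convergence, and bounded
  moments of order above two make the squared differences uniformly integrable.\<close>

lemma W2_tendsto_0_if_weak_conv:
  assumes \<nu>: "\<And>n. \<nu> n \<in> P2" and M: "M \<in> P2" and wc: "weak_conv_m \<nu> M" and p: "2 < p"
    and mom: "\<And>n. integrable (\<nu> n) (\<lambda>z. \<bar>z\<bar> powr p)" "\<And>n. (\<integral>z. \<bar>z\<bar> powr p \<partial>\<nu> n) \<le> K"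
    and momM: "integrable M (\<lambda>z. \<bar>z\<bar> powr p)"
  shows "(\<lambda>n. W2 (\<nu> n) M) \<longlonglongrightarrow> 0"
proof -
  obtain \<Omega> :: "real measure" and Yn Y where S: "prob_space \<Omega> \<and> (\<forall>n. Yn n \<in> measurable \<Omega> borel) \<and> (\<forall>n. distr \<Omega> borel (Yn n) = \<nu> n) \<and>
      Y \<in> measurable \<Omega> lborel \<and> distr \<Omega> borel Y = M \<and> (\<forall>x \<in> space \<Omega>. (\<lambda>n. Yn n x) \<longlonglongrightarrow> Y x)"
    using Skorohod[OF P2D(5)[OF \<nu>] P2D(5)[OF M] wc] by (elim exE)
  then have ps: "prob_space \<Omega>" and Yn[measurable]: "\<And>n. Yn n \<in> borel_measurable \<Omega>" and dYn: "\<And>n. distr \<Omega> borel (Yn n) = \<nu> n"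
    and Y[measurable]: "Y \<in> borel_measurable \<Omega>" and dY: "distr \<Omega> borel Y = M"
    and lim: "\<And>x. x \<in> space \<Omega> \<Longrightarrow> (\<lambda>n. Yn n x) \<longlonglongrightarrow> Y x"
    by simp_all
  interpret prob_space \<Omega> by (rule ps)
  define K' where "K' = (\<integral>z. \<bar>z\<bar> powr p \<partial>M)"
  have iYn: "integrable \<Omega> (\<lambda>x. \<bar>Yn n x\<bar> powr p)" "(\<integral>x. \<bar>Yn n x\<bar> powr p \<partial>\<Omega>) \<le> K" for n
    using mom[of n] unfolding dYn[symmetric] by (simp_all add: integrable_distr_eq integral_distr)
  have iY: "integrable \<Omega> (\<lambda>x. \<bar>Y x\<bar> powr p)" "(\<integral>x. \<bar>Y x\<bar> powr p \<partial>\<Omega>) = K'"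
    using momM unfolding K'_def dY[symmetric] by (simp_all add: integrable_distr_eq integral_distr)
  have sYn: "integrable \<Omega> (\<lambda>x. (Yn n x)\<^sup>2)" for n
    using P2D(4)[OF \<nu>[of n]] unfolding dYn[symmetric] by (simp add: integrable_distr_eq)
  have sY: "integrable \<Omega> (\<lambda>x. (Y x)\<^sup>2)"
    using P2D(4)[OF M] unfolding dY[symmetric] by (simp add: integrable_distr_eq)
  define D where "D n x = (Yn n x - Y x)\<^sup>2" for n x
  have [measurable]: "D n \<in> borel_measurable \<Omega>" for n unfolding D_def by measurable
  have iD: "integrable \<Omega> (D n)" for n unfolding D_def by (intro integrable_square_diff sYn sY) measurable
  have W: "(W2 (\<nu> n) M)\<^sup>2 \<le> (\<integral>x. D n x \<partial>\<Omega>)" for n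
    using W2_square_le_coupling[OF ps Yn Y sYn sY, of n] unfolding dYn dY D_def .
  \<comment> \<open>Bounds the contribution of \<open>D n > R\<close>: there \<open>D n\<close> is
    at most \<open>\<bar>Yn n x - Y x\<bar> powr p\<close> times
    \<open>R powr (- (p - 2) / 2)\<close>. The threshold is on the square, hence the halved
    exponent.\<close>
  define T where "T R = 2 powr p * (K + K') * R powr (- (p - 2) / 2)" for R

  have bound: "(\<integral>x. D n x \<partial>\<Omega>) \<le> (\<integral>x. min (D n x) R \<partial>\<Omega>) + T R" if R: "0 < R" for n R
  proof -
    have pw: "D n x \<le> min (D n x) R + (2 powr p * (\<bar>Yn n x\<bar> powr p + \<bar>Y x\<bar> powr p)) * R powr (- (p - 2) / 2)" for x
    proof (cases "D n x \<le> R")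
      case True
      then show ?thesis by (auto intro!: mult_nonneg_nonneg add_nonneg_nonneg)
    next
      case False
      define d where "d = \<bar>Yn n x - Y x\<bar>"
      have d2: "d\<^sup>2 = D n x" by (simp add: d_def D_def)
      then have dR: "R < d\<^sup>2" using False by simp
      then have d0: "0 < d" using R by (cases "d = 0") (auto simp: d_def)
      have "d\<^sup>2 = d powr p * d powr (- (p - 2))" using d0 by (simp add: powr_add[symmetric])
      also have "d powr (- (p - 2)) = (d\<^sup>2) powr (- (p - 2) / 2)"
      proof -
        have "(d\<^sup>2) powr (- (p - 2) / 2) = (d powr 2) powr (- (p - 2) / 2)" using d0 by simp
        also have "\<dots> = d powr (2 * (- (p - 2) / 2))" by (rule powr_powr)
        also have "2 * (- (p - 2) / 2) = - (p - 2)" by simp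
        finally show ?thesis by (rule sym)
      qed
      also have "\<dots> \<le> R powr (- (p - 2) / 2)" using R dR p by (intro powr_mono2') auto
      finally have 1: "d\<^sup>2 \<le> d powr p * R powr (- (p - 2) / 2)" by (simp add: mult_left_mono)
      have "d \<le> 2 * max \<bar>Yn n x\<bar> \<bar>Y x\<bar>" by (simp add: d_def)
      then have "d powr p \<le> (2 * max \<bar>Yn n x\<bar> \<bar>Y x\<bar>) powr p" using d0 p by (intro powr_mono2) auto
      also have "\<dots> = 2 powr p * (max \<bar>Yn n x\<bar> \<bar>Y x\<bar>) powr p" by (simp add: powr_mult)
      also have "\<dots> \<le> 2 powr p * (\<bar>Yn n x\<bar> powr p + \<bar>Y x\<bar> powr p)" by (intro mult_left_mono) (auto simp: max_def)
      finally have "d powr p * R powr (- (p - 2) / 2) \<le> (2 powr p * (\<bar>Yn n x\<bar> powr p + \<bar>Y x\<bar> powr p)) * R powr (- (p - 2) / 2)"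
        by (intro mult_right_mono) auto
      with 1 have "d\<^sup>2 \<le> \<dots>" by linarith
      then show ?thesis using R False unfolding d2 by (simp add: min_def)
    qed
    have im: "integrable \<Omega> (\<lambda>x. min (D n x) R)"
      by (rule Bochner_Integration.integrable_bound[OF iD[of n]]) (use R in \<open>auto simp: D_def\<close>)
    have "(\<integral>x. D n x \<partial>\<Omega>) \<le> (\<integral>x. min (D n x) R + (2 powr p * (\<bar>Yn n x\<bar> powr p + \<bar>Y x\<bar> powr p)) * R powr (- (p - 2) / 2) \<partial>\<Omega>)"
      by (rule integral_mono[OF iD _ pw]) (use im iYn iY in auto)
    also have "\<dots> = (\<integral>x. min (D n x) R \<partial>\<Omega>) + (2 powr p * ((\<integral>x. \<bar>Yn n x\<bar> powr p \<partial>\<Omega>) + K')) * R powr (- (p - 2) / 2)"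
      using im iYn iY by simp
    also have "\<dots> \<le> (\<integral>x. min (D n x) R \<partial>\<Omega>) + T R"
      unfolding T_def using iYn(2)[of n] by (intro add_left_mono mult_right_mono mult_left_mono add_mono) auto
    finally show ?thesis .
  qed
  have minlim: "(\<lambda>n. \<integral>x. min (D n x) R \<partial>\<Omega>) \<longlonglongrightarrow> 0" if R: "0 < R" for R
  proof -
    have "(\<lambda>n. \<integral>x. min (D n x) R \<partial>\<Omega>) \<longlonglongrightarrow> (\<integral>x. 0 \<partial>\<Omega>)"
    proof (rule integral_dominated_convergence[where w="\<lambda>_. R"])
      show "AE x in \<Omega>. (\<lambda>n. min (D n x) R) \<longlonglongrightarrow> 0"
      proof (rule AE_I2)
        fix x assume x: "x \<in> space \<Omega>"
        have "(\<lambda>n. min (D n x) R) \<longlonglongrightarrow> min ((Y x - Y x)\<^sup>2) R" unfolding D_def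
          by (intro tendsto_min tendsto_intros lim[OF x])
        then show "(\<lambda>n. min (D n x) R) \<longlonglongrightarrow> 0" using R by simp
      qed
      show "AE x in \<Omega>. norm (min (D n x) R) \<le> R" for n using R by (auto simp: D_def min_def)
    qed auto
    then show ?thesis by simp
  qed
  have "(\<lambda>n. \<integral>x. D n x \<partial>\<Omega>) \<longlonglongrightarrow> 0"
  proof (rule LIMSEQ_I)
    fix r :: real assume r: "0 < r"
    have "((\<lambda>R. T R) \<longlongrightarrow> 2 powr p * (K + K') * 0) at_top" unfolding T_def
      using p by (intro tendsto_intros tendsto_neg_powr filterlim_ident) auto
    then have "\<forall>\<^sub>F R in at_top. T R < r / 2" by (intro order_tendstoD(2)) (use r in auto)
    then obtain R0 where "\<And>R. R0 \<le> R \<Longrightarrow> T R < r / 2" unfolding eventually_at_top_linorder by auto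
    then have R: "0 < max R0 1" "T (max R0 1) < r / 2" by auto
    define R where "R = max R0 1"
    note R = R[folded R_def]
    have "\<forall>\<^sub>F n in sequentially. (\<integral>x. min (D n x) R \<partial>\<Omega>) < r / 2" by (rule order_tendstoD(2)[OF minlim[OF R(1)]]) (use r in auto)
    then obtain N where N: "\<And>n. N \<le> n \<Longrightarrow> (\<integral>x. min (D n x) R \<partial>\<Omega>) < r / 2" by (auto simp: eventually_sequentially)
    have "norm ((\<integral>x. D n x \<partial>\<Omega>) - 0) < r" if "N \<le> n" for n
    proof -
      have "0 \<le> (\<integral>x. D n x \<partial>\<Omega>)" by (intro Bochner_Integration.integral_nonneg) (simp add: D_def)
      then show ?thesis using bound[OF R(1), of n] N[OF that] R(2) by simp
    qed
    then show "\<exists>no. \<forall>n\<ge>no. norm ((\<integral>x. D n x \<partial>\<Omega>) - 0) < r" by blast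
  qed
  then have "(\<lambda>n. (W2 (\<nu> n) M)\<^sup>2) \<longlonglongrightarrow> 0"
    by (rule tendsto_0_le[of _ _ _ 1]) (use W in \<open>auto intro!: always_eventually intro: order_trans[OF _ abs_ge_self]\<close>)
  then have "(\<lambda>n. sqrt ((W2 (\<nu> n) M)\<^sup>2)) \<longlonglongrightarrow> sqrt 0" by (rule tendsto_real_sqrt)
  then show ?thesis by simp
qed

context mean_field
begin

section \<open>The Gibbs variational principle\<close>

lemma gibbs_density: "gibbs \<Psi> \<sigma> = density lborel (\<lambda>z. ennreal (exp (\<sigma> * z - \<Psi> z) / Zp \<sigma>))"
proof -
  have "exp (- phi_star \<Psi> \<sigma> + \<sigma> * z - \<Psi> z) = exp (\<sigma> * z - \<Psi> z) / Zp \<sigma>" for z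
    using Zp_pos[of \<sigma>] by (simp add: phi_star_Zp exp_diff exp_add exp_minus field_simps)
  then show ?thesis by (simp add: gibbs_def)
qed

lemma gibbs_prob: "prob_space (gibbs \<Psi> \<sigma>)"
proof
  have "(\<integral>\<^sup>+z. ennreal (exp (\<sigma> * z - \<Psi> z) / Zp \<sigma>) \<partial>lborel) = ennreal (\<integral>z. exp (\<sigma> * z - \<Psi> z) / Zp \<sigma> \<partial>lborel)"
    using integrable_Zp[of \<sigma>] Zp_pos[of \<sigma>] by (intro nn_integral_eq_integral) (auto simp: less_imp_le)
  also have "\<dots> = 1" using Zp_pos[of \<sigma>] by (simp add: Zp_def[symmetric])
  finally show "emeasure (gibbs \<Psi> \<sigma>) (space (gibbs \<Psi> \<sigma>)) = 1"
    unfolding gibbs_density by (subst emeasure_density) auto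
qed

lemma sets_gibbs [simp]: "sets (gibbs \<Psi> \<sigma>) = sets borel"
  by (simp add: gibbs_def)

lemma gibbs_integral:
  assumes "f \<in> borel_measurable borel" "integrable lborel (\<lambda>z. f z * exp (\<sigma> * z - \<Psi> z))"
  shows "integrable (gibbs \<Psi> \<sigma>) f" "(\<integral>z. f z \<partial>gibbs \<Psi> \<sigma>) = (\<integral>z. f z * exp (\<sigma> * z - \<Psi> z) \<partial>lborel) / Zp \<sigma>"
proof -
  have eq: "(\<lambda>z. (exp (\<sigma> * z - \<Psi> z) / Zp \<sigma>) *\<^sub>R f z) = (\<lambda>z. f z * exp (\<sigma> * z - \<Psi> z) / Zp \<sigma>)" by auto
  show "integrable (gibbs \<Psi> \<sigma>) f" unfolding gibbs_density
    using assms Zp_pos[of \<sigma>] by (subst integrable_density) (auto simp: less_imp_le mult.commute)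
  show "(\<integral>z. f z \<partial>gibbs \<Psi> \<sigma>) = (\<integral>z. f z * exp (\<sigma> * z - \<Psi> z) \<partial>lborel) / Zp \<sigma>" unfolding gibbs_density
    using assms(1) Zp_pos[of \<sigma>] by (subst integral_density) (auto simp: eq less_imp_le simp del: scaleR_conv_of_real real_scaleR_def)
qed

lemma gibbs_P2: "gibbs \<Psi> \<sigma> \<in> P2"
  using gibbs_prob gibbs_integral(1)[where f="\<lambda>z. z\<^sup>2", OF _ integrable_M2] by (simp add: P2_def)

lemma gibbs_mean: "mean (gibbs \<Psi> \<sigma>) = tilted_mean \<sigma>" "integrable (gibbs \<Psi> \<sigma>) (\<lambda>z. z)"
proof -
  have m: "(\<lambda>z. z) \<in> borel_measurable (borel :: real measure)" by simp
  show "mean (gibbs \<Psi> \<sigma>) = tilted_mean \<sigma>" unfolding tilted_mean_def M1_def by (rule gibbs_integral(2)[OF m integrable_M1])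
  show "integrable (gibbs \<Psi> \<sigma>) (\<lambda>z. z)" by (rule gibbs_integral(1)[OF m integrable_M1])
qed

text \<open>The growth of \<open>\<Psi>\<close> is unbounded from above, so it is paid for by half
  of the weight: \<open>\<Psi> z \<le> 2 * exp (\<Psi> z / 2)\<close>.\<close>

lemma integrable_\<Psi>_tilt: "integrable lborel (\<lambda>z. \<Psi> z * exp (\<sigma> * z - \<Psi> z))"
proof -
  \<comment> \<open>Half of \<open>4\<close> remains; one unit absorbs the tilt and one gives the
    Gaussian.\<close>
  obtain B where B: "\<And>z. 4 * z\<^sup>2 - B \<le> \<Psi> z" using \<Psi>_ge_square[of 4] by auto
  define K where "K = exp (\<sigma>\<^sup>2 + B / 2) * 2"
  have le: "\<bar>\<Psi> z * exp (\<sigma> * z - \<Psi> z)\<bar> \<le> K * exp (- z\<^sup>2) + \<bar>B\<bar> * exp (\<sigma> * z - \<Psi> z)" for z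
  proof -
    have "\<Psi> z \<le> 2 * exp (\<Psi> z / 2)" using exp_ge_add_one_self[of "\<Psi> z / 2"] by linarith
    moreover have "- \<Psi> z \<le> \<bar>B\<bar>" using B[of z] zero_le_power2[of z] by linarith
    moreover have "0 < exp (\<Psi> z / 2)" by simp
    ultimately have "\<bar>\<Psi> z\<bar> \<le> 2 * exp (\<Psi> z / 2) + \<bar>B\<bar>" by linarith
    then have "\<bar>\<Psi> z\<bar> * exp (\<sigma> * z - \<Psi> z) \<le> (2 * exp (\<Psi> z / 2) + \<bar>B\<bar>) * exp (\<sigma> * z - \<Psi> z)" by (intro mult_right_mono) auto
    also have "\<dots> = 2 * exp (\<sigma> * z - \<Psi> z / 2) + \<bar>B\<bar> * exp (\<sigma> * z - \<Psi> z)"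
      by (simp add: distrib_right exp_add[symmetric])
    also have "2 * exp (\<sigma> * z - \<Psi> z / 2) \<le> K * exp (- z\<^sup>2)"
    proof -
      have "\<sigma> * z - \<Psi> z / 2 \<le> (\<sigma>\<^sup>2 + B / 2) - z\<^sup>2" using B[of z] mult_le_sum_squares[of \<sigma> z] by argo
      then show ?thesis by (simp add: K_def exp_add[symmetric] exp_diff[symmetric] exp_minus[symmetric] mult.commute)
    qed
    finally show ?thesis by (simp add: abs_mult)
  qed
  show ?thesis
    by (rule Bochner_Integration.integrable_bound[OF Bochner_Integration.integrable_add[OF
        integrable_mult_right[OF integrable_gauss, of K] integrable_mult_right[OF integrable_Zp, of "\<bar>B\<bar>" \<sigma>]]])
      (use le in \<open>auto intro!: AE_I2 order_trans[OF le]\<close>)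
qed

lemma gibbs_energy:
  shows "finite_energy \<Psi> (gibbs \<Psi> \<sigma>)" "energy \<Psi> (gibbs \<Psi> \<sigma>) = \<sigma> * tilted_mean \<sigma> - phi_star \<Psi> \<sigma>"
    "real_energy \<Psi> J (gibbs \<Psi> \<sigma>) = H_bar \<Psi> J (tilted_mean \<sigma>)"
proof -
  let ?g = "gibbs \<Psi> \<sigma>"
  interpret prob_space ?g by (rule gibbs_prob)
  have Zp: "0 < Zp \<sigma>" by (rule Zp_pos)
  have r: "has_lebesgue_density ?g" "AE z in ?g. rho ?g z = exp (\<sigma> * z - \<Psi> z) / Zp \<sigma>"
    using rho_unique_AE[OF gibbs_prob gibbs_density, of \<sigma>] Zp by (auto simp: less_imp_le)
  have i\<Psi>: "integrable ?g \<Psi>" by (rule gibbs_integral(1)[OF _ integrable_\<Psi>_tilt]) simp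
  have ln: "AE z in ?g. ln (rho ?g z) = \<sigma> * z - \<Psi> z - phi_star \<Psi> \<sigma>"
    using r(2) by eventually_elim (use Zp in \<open>simp add: ln_div phi_star_Zp\<close>)
  have i: "integrable ?g (\<lambda>z. \<sigma> * z - \<Psi> z - phi_star \<Psi> \<sigma>)" using gibbs_mean(2) i\<Psi> by auto
  have [measurable_cong]: "sets ?g = sets borel" by simp
  have il: "integrable ?g (\<lambda>z. ln (rho ?g z))"
    by (rule integrable_cong_AE_imp[OF i]) (use ln in \<open>auto elim: eventually_mono\<close>)
  show fin: "finite_energy \<Psi> ?g" unfolding finite_energy_def using gibbs_P2 r(1) il i\<Psi> by simp
  have "(\<integral>z. ln (rho ?g z) \<partial>?g) = (\<integral>z. \<sigma> * z - \<Psi> z - phi_star \<Psi> \<sigma> \<partial>?g)"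
    by (rule integral_cong_AE) (use ln in auto)
  also have "\<dots> = \<sigma> * tilted_mean \<sigma> - (\<integral>z. \<Psi> z \<partial>?g) - phi_star \<Psi> \<sigma>"
    using gibbs_mean i\<Psi> by (simp add: prob_space)
  finally show e: "energy \<Psi> ?g = \<sigma> * tilted_mean \<sigma> - phi_star \<Psi> \<sigma>" by (simp add: energy_def)
  show "real_energy \<Psi> J ?g = H_bar \<Psi> J (tilted_mean \<sigma>)"
    by (simp add: real_energy_def e gibbs_mean H_bar_def phi_tilted_mean)
qed

text \<open>The Donsker-Varadhan inequality, that is, nonnegativity of the relative entropy with
  respect to the normalised weight \<open>exp (g - \<Psi>)\<close>, again from
  \<open>ln x \<le> x - 1\<close>.\<close>

lemma gibbs_variational:
  assumes \<nu>: "finite_energy \<Psi> \<nu>" and g[measurable]: "g \<in> borel_measurable borel" and ig: "integrable \<nu> g"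
    and ie: "integrable lborel (\<lambda>z. exp (g z - \<Psi> z))"
  shows "(\<integral>z. g z \<partial>\<nu>) - energy \<Psi> \<nu> \<le> ln (\<integral>z. exp (g z - \<Psi> z) \<partial>lborel)"
proof -
  note N = finite_energyD[OF \<nu>]
  interpret prob_space \<nu> using P2D(1)[OF N(1)] .
  define Z where "Z = (\<integral>z. exp (g z - \<Psi> z) \<partial>lborel)"
  have Z: "0 < Z" unfolding Z_def by (rule integral_pos_if_pos_on_interval[OF ie, of 0 1]) auto
  have iz: "integrable lborel (\<lambda>z. exp (g z - \<Psi> z) / Z)" using ie by simp
  note ov = integrable_over_rho[OF P2D(1,2)[OF N(1)] N(2) _ _ iz]
  have "(\<integral>z. g z - \<Psi> z - ln (rho \<nu> z) - ln Z \<partial>\<nu>) \<le> (\<integral>z. exp (g z - \<Psi> z) / Z / rho \<nu> z - 1 \<partial>\<nu>)"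
  proof (rule integral_mono_AE)
    show "integrable \<nu> (\<lambda>z. g z - \<Psi> z - ln (rho \<nu> z) - ln Z)" using ig N by auto
    show "integrable \<nu> (\<lambda>z. exp (g z - \<Psi> z) / Z / rho \<nu> z - 1)" using ov(1) Z by (auto simp: less_imp_le)
    show "AE z in \<nu>. g z - \<Psi> z - ln (rho \<nu> z) - ln Z \<le> exp (g z - \<Psi> z) / Z / rho \<nu> z - 1"
      using rho_pos_AE[OF P2D(1,2)[OF N(1)] N(2)]
    proof eventually_elim
      case (elim z)
      have "ln (exp (g z - \<Psi> z) / Z / rho \<nu> z) \<le> exp (g z - \<Psi> z) / Z / rho \<nu> z - 1"
        by (rule ln_le_minus_one) (use Z elim in simp)
      moreover have "ln (exp (g z - \<Psi> z) / Z / rho \<nu> z) = g z - \<Psi> z - ln Z - ln (rho \<nu> z)"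
        using Z elim by (simp add: ln_div ln_mult)
      ultimately show ?case by simp
    qed
  qed
  also have "\<dots> = (\<integral>z. exp (g z - \<Psi> z) / Z / rho \<nu> z \<partial>\<nu>) - 1" using ov(1) Z by (simp add: prob_space less_imp_le)
  also have "\<dots> \<le> (\<integral>z. exp (g z - \<Psi> z) / Z \<partial>lborel) - 1" using ov(2) Z by (simp add: less_imp_le)
  also have "\<dots> = 0" using Z by (simp add: Z_def[symmetric])
  also have "(\<integral>z. g z - \<Psi> z - ln (rho \<nu> z) - ln Z \<partial>\<nu>) = (\<integral>z. g z \<partial>\<nu>) - energy \<Psi> \<nu> - ln Z"
    using ig N by (simp add: prob_space energy_def)
  finally show ?thesis by (simp add: Z_def)
qed

lemma energy_ge_phi:
  assumes "finite_energy \<Psi> \<nu>" shows "phi \<Psi> (mean \<nu>) \<le> energy \<Psi> \<nu>"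
proof -
  obtain \<sigma> where \<sigma>: "tilted_mean \<sigma> = mean \<nu>" by (rule tilted_mean_surj)
  have i: "integrable \<nu> (\<lambda>z. z)" by (rule P2_integrable_id[OF finite_energyD(1)[OF assms]])
  have "(\<integral>z. \<sigma> * z \<partial>\<nu>) - energy \<Psi> \<nu> \<le> ln (\<integral>z. exp (\<sigma> * z - \<Psi> z) \<partial>lborel)"
    by (rule gibbs_variational[where g="\<lambda>z. \<sigma> * z", OF assms _ integrable_mult_right[OF i] integrable_Zp]) measurable
  then show ?thesis using phi_tilted_mean[of \<sigma>] by (simp add: \<sigma> phi_star_def)
qed

lemma real_energy_ge_H_bar:
  assumes "finite_energy \<Psi> \<nu>" shows "H_bar \<Psi> J (mean \<nu>) \<le> real_energy \<Psi> J \<nu>"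
  using energy_ge_phi[OF assms] by (simp add: H_bar_def real_energy_def)

text \<open>Coercivity: the Legendre bound at \<open>2 * J * mean \<nu>\<close> gives
  \<open>phi \<Psi> m \<ge> J * m\<^sup>2 - C\<close>, so the interaction consumes at most half of
  the energy, up to a constant.\<close>

lemma energy_le_real_energy:
  obtains C where "\<And>\<nu>. finite_energy \<Psi> \<nu> \<Longrightarrow> energy \<Psi> \<nu> \<le> 2 * real_energy \<Psi> J \<nu> + C"
proof -
  obtain C where C: "\<And>\<sigma>. phi_star \<Psi> \<sigma> \<le> \<sigma>\<^sup>2 / (4 * J) + C" using phi_star_upper by metis
  have "energy \<Psi> \<nu> \<le> 2 * real_energy \<Psi> J \<nu> + C" if \<nu>: "finite_energy \<Psi> \<nu>" for \<nu>
  proof -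
    let ?m = "mean \<nu>"
    have "2 * J * ?m * ?m - phi_star \<Psi> (2 * J * ?m) \<le> phi \<Psi> ?m" by (rule phi_ge)
    moreover have "(2 * J * ?m)\<^sup>2 / (4 * J) = J * ?m\<^sup>2" using J_pos by (simp add: power2_eq_square)
    ultimately have "J * ?m\<^sup>2 - C \<le> phi \<Psi> ?m" using C[of "2 * J * ?m"] by (simp add: power2_eq_square)
    also note energy_ge_phi[OF \<nu>]
    finally show ?thesis by (simp add: real_energy_def)
  qed
  then show ?thesis by (rule that)
qed

text \<open>Integrability of \<open>\<Psi>\<close> gives finiteness of the moment but no uniform
  bound. The bound comes from the variational inequality with half of the guaranteed growth of
  \<open>\<Psi>\<close> as test function.\<close>

lemma moment_bound:
  obtains p a C where "2 < p" "0 < a"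
    "\<And>\<nu>. finite_energy \<Psi> \<nu> \<Longrightarrow> integrable \<nu> (\<lambda>z. \<bar>z\<bar> powr p) \<and> a * (\<integral>z. \<bar>z\<bar> powr p \<partial>\<nu>) \<le> energy \<Psi> \<nu> + C"
proof -
  obtain p c where pc: "2 < p" "0 < c" "\<And>z. c * (\<bar>z\<bar> powr p - 1) \<le> \<Psi> z" using superquadratic by metis
  have "0 < c / 2" using pc by simp
  obtain B where B: "\<And>z :: real. 1 * z\<^sup>2 - B \<le> (c / 2) * \<bar>z\<bar> powr p"
    using powr_dominates_square[OF pc(1) \<open>0 < c / 2\<close>, of 1] by auto
  define g where "g z = (c / 2) * \<bar>z\<bar> powr p" for z :: real
  have [measurable]: "g \<in> borel_measurable borel" unfolding g_def by measurable
  have ie: "integrable lborel (\<lambda>z. exp (g z - \<Psi> z))"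
  proof (rule Bochner_Integration.integrable_bound[OF integrable_mult_right[OF integrable_gauss, of "exp (c + B)"]])
    have "exp (g z - \<Psi> z) \<le> exp (c + B) * exp (- z\<^sup>2)" for z
      using pc(3)[of z] B[of z] by (simp add: g_def exp_add[symmetric] algebra_simps)
    then show "AE z in lborel. norm (exp (g z - \<Psi> z)) \<le> norm (exp (c + B) * exp (- z\<^sup>2))" by simp
  qed measurable
  define C where "C = ln (\<integral>z. exp (g z - \<Psi> z) \<partial>lborel)"
  have "integrable \<nu> (\<lambda>z. \<bar>z\<bar> powr p) \<and> (c / 2) * (\<integral>z. \<bar>z\<bar> powr p \<partial>\<nu>) \<le> energy \<Psi> \<nu> + C" if \<nu>: "finite_energy \<Psi> \<nu>" for \<nu>
  proof -
    note N = finite_energyD[OF \<nu>]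
    interpret prob_space \<nu> using P2D(1)[OF N(1)] .
    have [measurable_cong]: "sets \<nu> = sets borel" using P2D(2)[OF N(1)] .
    have ip: "integrable \<nu> (\<lambda>z. \<bar>z\<bar> powr p)"
    proof (rule Bochner_Integration.integrable_bound)
      show "integrable \<nu> (\<lambda>z. \<Psi> z / c + 1)" using N(4) by auto
      show "AE z in \<nu>. norm (\<bar>z\<bar> powr p) \<le> norm (\<Psi> z / c + 1)"
      proof (rule AE_I2)
        fix z
        have "\<bar>z\<bar> powr p \<le> \<Psi> z / c + 1" using pc(3)[of z] pc(2) by (simp add: field_simps)
        then show "norm (\<bar>z\<bar> powr p) \<le> norm (\<Psi> z / c + 1)" by simp
      qed
    qed measurable
    then have "integrable \<nu> g" unfolding g_def by simp
    from gibbs_variational[OF \<nu> _ this ie] have "(\<integral>z. g z \<partial>\<nu>) - energy \<Psi> \<nu> \<le> C" by (simp add: C_def)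
    with ip show ?thesis by (simp add: g_def)
  qed
  with pc(1) \<open>0 < c / 2\<close> show ?thesis by (rule that)
qed

text \<open>The quantity in the hypothesis is the relative entropy with respect to
  \<open>gibbs \<Psi> \<sigma>\<close>. Perturbing the linear test function by \<open>a\<close>
  times plus or minus an indicator gives the Pinsker-type bound \<open>a * exp 1 + E n / a\<close>
  for the difference of the distribution functions; \<open>a\<close> is fixed before
  \<open>n\<close>.\<close>

lemma cdf_conv_if_entropy_tendsto:
  assumes \<nu>: "\<And>n. finite_energy \<Psi> (\<nu> n)"
    and lim: "(\<lambda>n. energy \<Psi> (\<nu> n) - (\<sigma> * mean (\<nu> n) - phi_star \<Psi> \<sigma>)) \<longlonglongrightarrow> 0"
  shows "weak_conv_m \<nu> (gibbs \<Psi> \<sigma>)"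
proof -
  interpret G: prob_space "gibbs \<Psi> \<sigma>" by (rule gibbs_prob)
  have GS: "space (gibbs \<Psi> \<sigma>) = UNIV" using P2D(3)[OF gibbs_P2] .
  define E where "E n = energy \<Psi> (\<nu> n) - (\<sigma> * mean (\<nu> n) - phi_star \<Psi> \<sigma>)" for n
  have key: "(\<integral>z. s * indicator {..x} z \<partial>\<nu> n) \<le> s * cdf (gibbs \<Psi> \<sigma>) x + a * exp 1 + E n / a"
    if a: "0 < a" "a \<le> 1" and s: "\<bar>s\<bar> = 1" for n and x a s :: real
  proof -
    note N = finite_energyD[OF \<nu>[of n]]
    interpret prob_space "\<nu> n" using P2D(1)[OF N(1)] .
    have [measurable_cong]: "sets (\<nu> n) = sets borel" using P2D(2)[OF N(1)] .
    let ?g = "\<lambda>z. \<sigma> * z + a * (s * indicator {..x} z)"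
    let ?c = "cdf (gibbs \<Psi> \<sigma>) x"
    have ind: "\<bar>a * (s * indicator {..x} z)\<bar> \<le> a" for z using a s by (auto split: split_indicator simp: abs_mult)
    have "integrable (\<nu> n) (\<lambda>z. \<sigma> * z)" using P2_integrable_id[OF N(1)] by simp
    moreover have ii: "integrable (\<nu> n) (\<lambda>z. s * indicator {..x} z)"
      by (intro integrable_mult_right integrable_real_indicator) (auto simp: emeasure_eq_measure)
    ultimately have ig: "integrable (\<nu> n) ?g" by auto
    have eb: "\<bar>exp (a * (s * indicator {..x} z))\<bar> \<le> exp a * exp (0 * z\<^sup>2)" for z using ind[of z] by (simp add: abs_le_iff)
    have it: "integrable lborel (\<lambda>z. exp (a * (s * indicator {..x} z)) * exp (\<sigma> * z - \<Psi> z))"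
      by (rule integrable_tilt[OF _ eb]) measurable
    have eq: "exp (?g z - \<Psi> z) = exp (a * (s * indicator {..x} z)) * exp (\<sigma> * z - \<Psi> z)" for z
      by (simp add: exp_add[symmetric] algebra_simps)
    have "(\<integral>z. ?g z \<partial>\<nu> n) - energy \<Psi> (\<nu> n) \<le> ln (\<integral>z. exp (?g z - \<Psi> z) \<partial>lborel)"
      by (rule gibbs_variational[OF \<nu> _ ig]) (use it in \<open>simp_all add: eq\<close>)
    also have "(\<integral>z. ?g z \<partial>\<nu> n) = \<sigma> * mean (\<nu> n) + a * (\<integral>z. s * indicator {..x} z \<partial>\<nu> n)"
      using P2_integrable_id[OF N(1)] ii by simp
    also have "(\<integral>z. exp (?g z - \<Psi> z) \<partial>lborel) = Zp \<sigma> * (\<integral>z. exp (a * (s * indicator {..x} z)) \<partial>gibbs \<Psi> \<sigma>)"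
      using gibbs_integral(2)[OF _ it] Zp_pos[of \<sigma>] unfolding eq by simp
    also have "ln \<dots> = phi_star \<Psi> \<sigma> + ln (\<integral>z. exp (a * (s * indicator {..x} z)) \<partial>gibbs \<Psi> \<sigma>)"
    proof -
      have "0 < (\<integral>z. exp (a * (s * indicator {..x} z)) * exp (\<sigma> * z - \<Psi> z) \<partial>lborel)"
        by (rule integral_pos_if_pos_on_interval[OF it, of 0 1]) auto
      then have "0 < (\<integral>z. exp (a * (s * indicator {..x} z)) \<partial>gibbs \<Psi> \<sigma>)"
        using gibbs_integral(2)[OF _ it] Zp_pos[of \<sigma>] by simp
      then show ?thesis using Zp_pos[of \<sigma>] by (simp add: ln_mult phi_star_Zp)
    qed
    \<comment> \<open>The exponent is at most \<open>a \<le> 1\<close> in absolute value, so the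
      second-order remainder is at most \<open>a\<^sup>2 * exp 1\<close>; the linear term carries
      the distribution function.\<close>
    also have "ln (\<integral>z. exp (a * (s * indicator {..x} z)) \<partial>gibbs \<Psi> \<sigma>) \<le> a * (s * ?c) + a\<^sup>2 * exp 1"
    proof -
      have iG: "integrable (gibbs \<Psi> \<sigma>) (\<lambda>z. exp (a * (s * indicator {..x} z)))" by (rule gibbs_integral(1)[OF _ it]) measurable
      have iGi: "integrable (gibbs \<Psi> \<sigma>) (\<lambda>z. s * indicator {..x} z)"
        by (intro integrable_mult_right integrable_real_indicator) (auto simp: G.emeasure_eq_measure)
      have "(\<integral>z. exp (a * (s * indicator {..x} z)) \<partial>gibbs \<Psi> \<sigma>) \<le> (\<integral>z. 1 + a * (s * indicator {..x} z) + a\<^sup>2 * exp 1 \<partial>gibbs \<Psi> \<sigma>)"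
      proof (rule integral_mono[OF iG])
        fix z
        let ?u = "a * (s * indicator {..x} z)"
        have "?u\<^sup>2 * exp \<bar>?u\<bar> \<le> a\<^sup>2 * exp 1"
        proof (intro mult_mono)
          show "?u\<^sup>2 \<le> a\<^sup>2" using ind[of z] a by (metis abs_of_pos power2_le_iff_abs_le less_imp_le)
          show "exp \<bar>?u\<bar> \<le> exp 1" using ind[of z] a by simp
        qed auto
        then show "exp ?u \<le> 1 + ?u + a\<^sup>2 * exp 1" using exp_second_order_bound[of ?u] by linarith
      qed (use iGi in auto)
      also have "\<dots> = 1 + a * (s * ?c) + a\<^sup>2 * exp 1"
        using iGi G.prob_space GS by (simp add: cdf_def)
      finally have "(\<integral>z. exp (a * (s * indicator {..x} z)) \<partial>gibbs \<Psi> \<sigma>) \<le> 1 + (a * (s * ?c) + a\<^sup>2 * exp 1)" by simp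
      moreover have "0 < (\<integral>z. exp (a * (s * indicator {..x} z)) \<partial>gibbs \<Psi> \<sigma>)"
      proof -
        have "0 < (\<integral>z. exp (a * (s * indicator {..x} z)) * exp (\<sigma> * z - \<Psi> z) \<partial>lborel)"
          by (rule integral_pos_if_pos_on_interval[OF it, of 0 1]) auto
        then show ?thesis using gibbs_integral(2)[OF _ it] Zp_pos[of \<sigma>] by simp
      qed
      ultimately show ?thesis using ln_le_minus_one[of "\<integral>z. exp (a * (s * indicator {..x} z)) \<partial>gibbs \<Psi> \<sigma>"] by linarith
    qed
    finally have "a * (\<integral>z. s * indicator {..x} z \<partial>\<nu> n) \<le> a * (s * ?c) + a\<^sup>2 * exp 1 + E n"
      by (simp add: E_def)
    also have "\<dots> = a * (s * ?c + a * exp 1 + E n / a)" using a by (simp add: power2_eq_square distrib_left)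
    finally show ?thesis using a by simp
  qed
  have close: "\<bar>cdf (\<nu> n) x - cdf (gibbs \<Psi> \<sigma>) x\<bar> \<le> a * exp 1 + E n / a" if a: "0 < a" "a \<le> 1" for n x a
  proof -
    have [measurable_cong]: "sets (\<nu> n) = sets borel" using P2D(2)[OF finite_energyD(1)[OF \<nu>[of n]]] .
    have "(\<integral>z. s * indicator {..x} z \<partial>\<nu> n) = s * cdf (\<nu> n) x" for s :: real by (simp add: cdf_def)
    from key[OF a, of 1 n x, unfolded this] key[OF a, of "-1" n x, unfolded this] show ?thesis by (simp add: abs_le_iff)
  qed
  have "(\<lambda>n. cdf (\<nu> n) x) \<longlonglongrightarrow> cdf (gibbs \<Psi> \<sigma>) x" for x
  proof (rule LIMSEQ_I)
    fix r :: real assume r: "0 < r"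
    define a where "a = min 1 (r / (2 * exp 1))"
    have a: "0 < a" "a \<le> 1" using r by (auto simp: a_def)
    have ae: "a * exp 1 \<le> r / 2" 
    proof -
      have "a * exp 1 \<le> r / (2 * exp 1) * exp 1" by (intro mult_right_mono) (auto simp: a_def)
      then show ?thesis by simp
    qed
    have "\<forall>\<^sub>F n in sequentially. E n < a * (r / 2)"
      by (rule order_tendstoD(2)[OF lim[folded E_def]]) (use a r in auto)
    then obtain N where N: "\<And>n. N \<le> n \<Longrightarrow> E n < a * (r / 2)" by (auto simp: eventually_sequentially)
    have "norm (cdf (\<nu> n) x - cdf (gibbs \<Psi> \<sigma>) x) < r" if "N \<le> n" for n
    proof -
      have "E n / a < r / 2" using N[OF that] a by (simp add: pos_divide_less_eq mult.commute)
      then show ?thesis using close[OF a, of n x] ae unfolding real_norm_def by linarith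
    qed
    then show "\<exists>no. \<forall>n\<ge>no. norm (cdf (\<nu> n) x - cdf (gibbs \<Psi> \<sigma>) x) < r" by blast
  qed
  then show ?thesis by (simp add: weak_conv_m_def weak_conv_def)
qed

end

section \<open>First variation of the free energy\<close>

text \<open>The lower bound \<open>c\<close> on the derivative makes \<open>T\<close> increasing and
  onto, so the preimage of an interval is an interval and the fundamental theorem evaluates the
  integral.\<close>

lemma interval_change_of_variables_le:
  fixes T T' :: "real \<Rightarrow> real"
  assumes T: "\<And>z. (T has_real_derivative T' z) (at z)" and T': "continuous_on UNIV T'" and pos: "\<And>z. c \<le> T' z" and c: "0 < c"
    and ab: "a < b"
  shows "(\<integral>\<^sup>+z. ennreal (T' z) * indicator {a<..<b} (T z) \<partial>lborel) \<le> ennreal (b - a)"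
proof -
  have [measurable]: "T' \<in> borel_measurable borel" by (rule borel_measurable_continuous_onI[OF T'])
  have cont: "isCont T z" for z using DERIV_isCont[OF T] .
  have growth: "T x + c * (y - x) \<le> T y" if "x \<le> y" for x y
  proof -
    have "T x - c * x \<le> T y - c * y"
      by (rule DERIV_nonneg_imp_nondecreasing[OF that, of "\<lambda>z. T z - c * z"])
        (use pos in \<open>auto intro!: exI[of _ "T' _ - c"] derivative_eq_intros T\<close>)
    then show ?thesis by (simp add: algebra_simps)
  qed
  have surj: "\<exists>x. T x = y" for y
  proof -
    define l where "l = - (\<bar>y - T 0\<bar> / c)" define u where "u = \<bar>y - T 0\<bar> / c"
    have "0 \<le> u" using c by (simp add: u_def)
    have "T l \<le> y" using growth[of l 0] c \<open>0 \<le> u\<close> by (simp add: l_def u_def)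
    moreover have "y \<le> T u" using growth[of 0 u] c \<open>0 \<le> u\<close> by (simp add: u_def)
    ultimately show ?thesis using IVT[of T l y u] cont \<open>0 \<le> u\<close> by (auto simp: l_def u_def)
  qed
  obtain \<alpha> \<beta> where \<alpha>\<beta>: "T \<alpha> = a" "T \<beta> = b" using surj by metis
  have lt: "x < y" if "T x < T y" for x y
  proof (rule ccontr)
    assume "\<not> x < y"
    then have "0 \<le> c * (x - y)" "T y + c * (x - y) \<le> T x" using growth[of y x] c by auto
    then show False using that by linarith
  qed
  have "(\<integral>\<^sup>+z. ennreal (T' z) * indicator {a<..<b} (T z) \<partial>lborel) \<le> (\<integral>\<^sup>+z. ennreal (T' z) * indicator {\<alpha>..\<beta>} z \<partial>lborel)"
  proof (rule nn_integral_mono)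
    fix z
    show "ennreal (T' z) * indicator {a<..<b} (T z) \<le> ennreal (T' z) * indicator {\<alpha>..\<beta>} z"
      using lt[of \<alpha> z] lt[of z \<beta>] \<alpha>\<beta> by (auto split: split_indicator intro: less_imp_le)
  qed
  also have "\<dots> = ennreal (T \<beta> - T \<alpha>)"
  proof (rule nn_integral_FTC_Icc)
    show "\<alpha> \<le> \<beta>" using lt[of \<alpha> \<beta>] \<alpha>\<beta> ab by simp
    fix z show "0 \<le> T' z" using pos[of z] c by simp
  qed (auto intro: T)
  finally show ?thesis by (simp add: \<alpha>\<beta>)
qed

lemma neg_ln_one_plus_le: "\<bar>u\<bar> \<le> 1 / 2 \<Longrightarrow> - ln (1 + u) \<le> - u + 2 * u\<^sup>2" for u :: real
  using abs_ln_one_plus_x_minus_x_bound[of u] by linarith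

context mean_field
begin

lemma \<Psi>_taylor:
  obtains K where "0 \<le> K" "\<And>z d. \<bar>z\<bar> \<le> R \<Longrightarrow> \<bar>d\<bar> \<le> B \<Longrightarrow> \<bar>\<Psi> (z + d) - \<Psi> z - deriv \<Psi> z * d\<bar> \<le> K * d\<^sup>2"
proof -
  have "compact (deriv (deriv \<Psi>) ` {- (R + B)..R + B})"
    by (intro compact_continuous_image continuous_on_subset[OF \<Psi>''_continuous]) auto
  then obtain K where K: "0 < K" "\<And>y. y \<in> {- (R + B)..R + B} \<Longrightarrow> \<bar>deriv (deriv \<Psi>) y\<bar> \<le> K"
    using compact_imp_bounded bounded_pos by (metis imageI real_norm_def)
  have Lip: "\<bar>deriv \<Psi> x - deriv \<Psi> y\<bar> \<le> K * \<bar>x - y\<bar>" if "x \<in> {- (R + B)..R + B}" "y \<in> {- (R + B)..R + B}" for x y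
    using field_differentiable_bound[of "{- (R + B)..R + B}" "deriv \<Psi>" "deriv (deriv \<Psi>)" K x y] K that
      has_field_derivative_at_within[OF \<Psi>'_DERIV] by auto
  have "\<bar>\<Psi> (z + d) - \<Psi> z - deriv \<Psi> z * d\<bar> \<le> K * d\<^sup>2" if z: "\<bar>z\<bar> \<le> R" and d: "\<bar>d\<bar> \<le> B" for z d
  proof -
    let ?f = "\<lambda>y. \<Psi> y - deriv \<Psi> z * y"
    have mvt: "\<bar>?f (z + d) - ?f z\<bar> \<le> K * \<bar>d\<bar> * \<bar>(z + d) - z\<bar>"
    proof -
      have "norm (?f (z + d) - ?f z) \<le> (K * \<bar>d\<bar>) * norm ((z + d) - z)"
      proof (rule field_differentiable_bound[of "cball z \<bar>d\<bar>" ?f "\<lambda>y. deriv \<Psi> y - deriv \<Psi> z"])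
        fix y assume y: "y \<in> cball z \<bar>d\<bar>"
        show "(?f has_real_derivative deriv \<Psi> y - deriv \<Psi> z) (at y within cball z \<bar>d\<bar>)"
          by (rule has_field_derivative_at_within) (auto intro!: derivative_eq_intros \<Psi>_DERIV)
        have "\<bar>deriv \<Psi> y - deriv \<Psi> z\<bar> \<le> K * \<bar>y - z\<bar>" by (rule Lip) (use y z d in \<open>auto simp: dist_real_def\<close>)
        also have "\<dots> \<le> K * \<bar>d\<bar>" using y K by (intro mult_left_mono) (auto simp: dist_real_def)
        finally show "norm (deriv \<Psi> y - deriv \<Psi> z) \<le> K * \<bar>d\<bar>" by simp
      qed (auto simp: dist_real_def)
      then show ?thesis by simp
    qed
    have "\<Psi> (z + d) - \<Psi> z - deriv \<Psi> z * d = ?f (z + d) - ?f z" by (simp add: algebra_simps)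
    then show ?thesis using mvt by (simp add: power2_eq_square)
  qed
  with K(1) show ?thesis using that[of K] by simp
qed

text \<open>Moving mass by \<open>T z = z + \<epsilon> * \<xi> z\<close> changes the energy by at
  most \<open>\<epsilon> * I\<close> plus a quadratic error, while \<open>slope_inequality\<close>
  limits any decrease to \<open>v * \<bar>\<epsilon>\<bar> * B\<close> plus a quadratic error. Both
  signs of a small \<open>\<epsilon>\<close> bound \<open>\<bar>I\<bar>\<close>.\<close>

lemma first_variation_bound:
  assumes \<nu>: "finite_energy \<Psi> \<nu>" and slope: "metric_slope (free_energy \<Psi> J) \<nu> \<le> ereal v" and v: "0 \<le> v"
    and \<xi>: "\<And>z. (\<xi> has_real_derivative \<xi>' z) (at z)" and c\<xi>': "continuous_on UNIV \<xi>'"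
    and B: "\<And>z. \<bar>\<xi> z\<bar> \<le> B" "\<And>z. \<bar>\<xi>' z\<bar> \<le> B" and R: "\<And>z. R < \<bar>z\<bar> \<Longrightarrow> \<xi> z = 0"
  shows "\<bar>(\<integral>z. - \<xi>' z + (deriv \<Psi> z - J * mean \<nu>) * \<xi> z \<partial>\<nu>)\<bar> \<le> v * B"
proof -
  obtain L C where "semiconvex_potential \<Psi> J L C" using semiconvex by metis
  then interpret SP: semiconvex_potential \<Psi> J L C .
  note N = finite_energyD[OF \<nu>]
  interpret prob_space \<nu> using P2D(1)[OF N(1)] .
  have [measurable_cong]: "sets \<nu> = sets borel" using P2D(2)[OF N(1)] .
  have [measurable]: "\<xi>' \<in> borel_measurable borel" by (rule borel_measurable_continuous_onI[OF c\<xi>'])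
  have [measurable]: "\<xi> \<in> borel_measurable borel"
    by (intro borel_measurable_continuous_onI continuous_at_imp_continuous_on ballI DERIV_isCont[OF \<xi>])
  have B0: "0 \<le> B" using B(1)[of 0] by linarith
  define R' where "R' = max R 0"
  have R': "R' < \<bar>z\<bar> \<Longrightarrow> \<xi> z = 0" for z using R by (simp add: R'_def)
  obtain K where K: "0 \<le> K" "\<And>z d. \<bar>z\<bar> \<le> R' \<Longrightarrow> \<bar>d\<bar> \<le> B \<Longrightarrow> \<bar>\<Psi> (z + d) - \<Psi> z - deriv \<Psi> z * d\<bar> \<le> K * d\<^sup>2"
    using \<Psi>_taylor[of R' B] by metis
  have "compact (deriv \<Psi> ` {- R'..R'})" by (intro compact_continuous_image \<Psi>'_continuous) auto
  then obtain Q where Q: "0 < Q" "\<And>z. z \<in> {- R'..R'} \<Longrightarrow> \<bar>deriv \<Psi> z\<bar> \<le> Q"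
    using compact_imp_bounded bounded_pos by (metis imageI real_norm_def)
  have bd\<Psi>\<xi>: "\<bar>deriv \<Psi> z * \<xi> z\<bar> \<le> Q * B" for z
  proof (cases "\<bar>z\<bar> \<le> R'")
    case True
    then show ?thesis unfolding abs_mult using Q B(1)[of z] B0 by (intro mult_mono) (auto simp: abs_le_iff)
  next
    case False
    then show ?thesis using R'[of z] Q B0 by simp
  qed
  have ibd: "integrable \<nu> f" if "f \<in> borel_measurable borel" "\<And>z. \<bar>f z\<bar> \<le> b" for f :: "real \<Rightarrow> real" and b
    using that by (intro integrable_const_bound[of _ b]) auto
  have i\<xi>: "integrable \<nu> \<xi>" by (rule ibd[of _ B]) (use B in auto)
  have i\<xi>': "integrable \<nu> \<xi>'" by (rule ibd[of _ B]) (use B in auto)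
  have i\<Psi>\<xi>: "integrable \<nu> (\<lambda>z. deriv \<Psi> z * \<xi> z)" by (rule ibd[of _ "Q * B"]) (use bd\<Psi>\<xi> in auto)
  define s where "s = (\<integral>z. \<xi> z \<partial>\<nu>)"
  define I where "I = - (\<integral>z. \<xi>' z \<partial>\<nu>) + (\<integral>z. deriv \<Psi> z * \<xi> z \<partial>\<nu>) - J * mean \<nu> * s"
  have I_eq: "(\<integral>z. - \<xi>' z + (deriv \<Psi> z - J * mean \<nu>) * \<xi> z \<partial>\<nu>) = I"
  proof -
    have "(\<integral>z. - \<xi>' z + (deriv \<Psi> z - J * mean \<nu>) * \<xi> z \<partial>\<nu>) = (\<integral>z. - \<xi>' z + deriv \<Psi> z * \<xi> z - J * mean \<nu> * \<xi> z \<partial>\<nu>)"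
      by (intro Bochner_Integration.integral_cong) (auto simp: algebra_simps)
    also have "\<dots> = I" using i\<xi> i\<xi>' i\<Psi>\<xi> by (simp add: I_def s_def)
    finally show ?thesis .
  qed
  \<comment> \<open>The three quadratic errors: the logarithm of the Jacobian, the Taylor remainder
    of \<open>\<Psi>\<close>, and the slope inequality.\<close>
  define C2 where "C2 = 2 * B\<^sup>2 + K * B\<^sup>2 + (L + J) / 2 * B\<^sup>2"
  have var: "- v * \<bar>\<epsilon>\<bar> * B \<le> \<epsilon> * I + C2 * \<epsilon>\<^sup>2" if \<epsilon>: "\<bar>\<epsilon>\<bar> * B \<le> 1 / 2" "\<bar>\<epsilon>\<bar> \<le> 1" for \<epsilon>
  proof -
    define T where "T z = z + \<epsilon> * \<xi> z" for z
    define u where "u z = \<epsilon> * \<xi>' z" for z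
    have u: "\<bar>u z\<bar> \<le> 1 / 2" for z
    proof -
      have "\<bar>u z\<bar> \<le> \<bar>\<epsilon>\<bar> * B" unfolding u_def abs_mult by (intro mult_left_mono B) auto
      then show ?thesis using \<epsilon> by linarith
    qed
    have u1: "1 / 2 \<le> 1 + u z" for z using u[of z] by (simp add: abs_le_iff)
    have d\<epsilon>: "\<bar>\<epsilon> * \<xi> z\<bar> \<le> B" for z
      using mult_mono[OF \<epsilon>(2) B(1)[of z]] by (simp add: abs_mult)
    have [measurable]: "T \<in> borel_measurable borel" "u \<in> borel_measurable borel" unfolding T_def u_def by measurable
    have T: "(T has_real_derivative 1 + u z) (at z)" for z
      unfolding T_def u_def by (auto intro!: derivative_eq_intros \<xi>)
    have T2: "integrable \<nu> (\<lambda>z. (T z)\<^sup>2)"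
    proof -
      have "integrable \<nu> (\<lambda>z. (1 * z + \<epsilon> * \<xi> z)\<^sup>2)"
      proof (rule integrable_square_lincomb[OF P2D(4)[OF N(1)]])
        have "\<bar>(\<xi> z)\<^sup>2\<bar> \<le> B\<^sup>2" for z using B(1)[of z] by (simp add: abs_le_square_iff[symmetric] B0)
        then show "integrable \<nu> (\<lambda>z. (\<xi> z)\<^sup>2)" by (intro ibd[of _ "B\<^sup>2"]) auto
      qed measurable
      then show ?thesis by (simp add: T_def)
    qed
    \<comment> \<open>The formal logarithm of the density of the image at \<open>T z\<close>, with
      Jacobian \<open>1 + u z\<close>.\<close>
    let ?h = "\<lambda>z. ln (rho \<nu> z) - ln (1 + u z)"
    have lnu: "\<bar>ln (1 + u z)\<bar> \<le> 1" for z
      using abs_ln_one_plus_x_minus_x_bound[OF u[of z]] u[of z] power_mono[OF u[of z] abs_ge_zero, of 2]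
      by (simp add: power2_abs power_divide abs_le_iff) linarith
    have ilnu: "integrable \<nu> (\<lambda>z. ln (1 + u z))" by (rule ibd[of _ 1]) (use lnu in auto)
    have ih: "integrable \<nu> ?h" using N(3) ilnu by auto
    have dom: "(\<integral>\<^sup>+z. ennreal (exp (- ?h z)) * indicator {a<..<b} (T z) \<partial>\<nu>) \<le> ennreal (b - a)" if ab: "a < b" for a b
    proof -
      have "(\<integral>\<^sup>+z. ennreal (exp (- ?h z)) * indicator {a<..<b} (T z) \<partial>\<nu>) =
        (\<integral>\<^sup>+z. ennreal (rho \<nu> z) * (ennreal (exp (- ?h z)) * indicator {a<..<b} (T z)) \<partial>lborel)"
        by (rule nn_integral_rho[OF P2D(1,2)[OF N(1)] N(2)]) measurable
      also have "\<dots> \<le> (\<integral>\<^sup>+z. ennreal (1 + u z) * indicator {a<..<b} (T z) \<partial>lborel)"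
      proof (rule nn_integral_mono)
        fix z
        show "ennreal (rho \<nu> z) * (ennreal (exp (- ?h z)) * indicator {a<..<b} (T z)) \<le> ennreal (1 + u z) * indicator {a<..<b} (T z)"
        proof (cases "rho \<nu> z = 0")
          case False
          then have r: "0 < rho \<nu> z" by (simp add: less_le)
          have "rho \<nu> z * exp (- ?h z) = 1 + u z"
            using r u1[of z] by (simp add: exp_diff)
          then show ?thesis by (simp add: mult.assoc[symmetric] ennreal_mult'[symmetric])
        qed simp
      qed
      also have "\<dots> \<le> ennreal (b - a)"
        by (rule interval_change_of_variables_le[OF T _ u1 _ ab]) (auto simp: u_def intro!: continuous_intros c\<xi>')
      finally show ?thesis .
    qed
    define \<kappa> where "\<kappa> = distr \<nu> borel T"
    have Tm: "T \<in> borel_measurable \<nu>" by measurable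
    note ent = entropy_distr_le[OF prob_space_axioms Tm T2 ih dom, folded \<kappa>_def]
    have KP: "\<kappa> \<in> P2" unfolding \<kappa>_def by (rule P2_distrI[OF prob_space_axioms Tm T2])
    have ent_le: "(\<integral>z. ln (rho \<kappa> z) \<partial>\<kappa>) \<le> (\<integral>z. ln (rho \<nu> z) \<partial>\<nu>) - \<epsilon> * (\<integral>z. \<xi>' z \<partial>\<nu>) + 2 * B\<^sup>2 * \<epsilon>\<^sup>2"
    proof -
      have pw: "- ln (1 + u z) \<le> - (\<epsilon> * \<xi>' z) + 2 * B\<^sup>2 * \<epsilon>\<^sup>2" for z
      proof -
        have "(\<xi>' z)\<^sup>2 \<le> B\<^sup>2" using B(2)[of z] by (simp add: abs_le_square_iff[symmetric] B0)
        then have "(\<xi>' z)\<^sup>2 * \<epsilon>\<^sup>2 \<le> B\<^sup>2 * \<epsilon>\<^sup>2" by (rule mult_right_mono) simp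
        then have "2 * (u z)\<^sup>2 \<le> 2 * B\<^sup>2 * \<epsilon>\<^sup>2" by (simp add: u_def power_mult_distrib mult.commute)
        then show ?thesis using neg_ln_one_plus_le[OF u[of z]] by (simp add: u_def)
      qed
      have "(\<integral>z. ?h z \<partial>\<nu>) \<le> (\<integral>z. ln (rho \<nu> z) - \<epsilon> * \<xi>' z + 2 * B\<^sup>2 * \<epsilon>\<^sup>2 \<partial>\<nu>)"
      proof (rule integral_mono[OF ih])
        fix z show "?h z \<le> ln (rho \<nu> z) - \<epsilon> * \<xi>' z + 2 * B\<^sup>2 * \<epsilon>\<^sup>2" using pw[of z] by linarith
      qed (use N(3) i\<xi>' in auto)
      also have "\<dots> = (\<integral>z. ln (rho \<nu> z) \<partial>\<nu>) - \<epsilon> * (\<integral>z. \<xi>' z \<partial>\<nu>) + 2 * B\<^sup>2 * \<epsilon>\<^sup>2"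
        using N(3) i\<xi>' by (simp add: prob_space)
      finally show ?thesis using ent(3) by simp
    qed
    have \<Psi>T: "\<Psi> (T z) - \<Psi> z \<le> \<epsilon> * (deriv \<Psi> z * \<xi> z) + K * B\<^sup>2 * \<epsilon>\<^sup>2" "\<bar>\<Psi> (T z) - \<Psi> z\<bar> \<le> Q * B + K * B\<^sup>2" for z
    proof -
      have t: "\<bar>\<Psi> (T z) - \<Psi> z - deriv \<Psi> z * (\<epsilon> * \<xi> z)\<bar> \<le> K * (\<epsilon> * \<xi> z)\<^sup>2"
        using K(2)[of z "\<epsilon> * \<xi> z"] d\<epsilon>[of z] R'[of z] by (cases "\<bar>z\<bar> \<le> R'") (auto simp: T_def)
      have x2: "(\<xi> z)\<^sup>2 \<le> B\<^sup>2" using B(1)[of z] by (simp add: abs_le_square_iff[symmetric] B0)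
      have "(\<epsilon> * \<xi> z)\<^sup>2 \<le> B\<^sup>2 * \<epsilon>\<^sup>2" using mult_right_mono[OF x2, of "\<epsilon>\<^sup>2"] by (simp add: power_mult_distrib mult.commute)
      then have t2: "K * (\<epsilon> * \<xi> z)\<^sup>2 \<le> K * B\<^sup>2 * \<epsilon>\<^sup>2" using K(1) by (simp add: mult_left_mono mult.assoc)
      show "\<Psi> (T z) - \<Psi> z \<le> \<epsilon> * (deriv \<Psi> z * \<xi> z) + K * B\<^sup>2 * \<epsilon>\<^sup>2" using t t2 by (simp add: abs_le_iff algebra_simps)
      have "\<bar>\<epsilon> * (deriv \<Psi> z * \<xi> z)\<bar> \<le> 1 * (Q * B)" unfolding abs_mult[of \<epsilon>] by (intro mult_mono \<epsilon> bd\<Psi>\<xi>) auto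
      moreover have "deriv \<Psi> z * (\<epsilon> * \<xi> z) = \<epsilon> * (deriv \<Psi> z * \<xi> z)" by simp
      moreover have "K * B\<^sup>2 * \<epsilon>\<^sup>2 \<le> K * B\<^sup>2 * 1" using \<epsilon>(2) K(1) by (intro mult_left_mono) (auto simp: abs_square_le_1)
      ultimately show "\<bar>\<Psi> (T z) - \<Psi> z\<bar> \<le> Q * B + K * B\<^sup>2" using t t2 by linarith
    qed
    have id: "integrable \<nu> (\<lambda>z. \<Psi> (T z) - \<Psi> z)" by (rule ibd[OF _ \<Psi>T(2)]) measurable
    have i\<Psi>T: "integrable \<nu> (\<lambda>z. \<Psi> (T z))" using Bochner_Integration.integrable_add[OF id N(4)] by simp
    have "(\<integral>z. \<Psi> (T z) - \<Psi> z \<partial>\<nu>) \<le> (\<integral>z. \<epsilon> * (deriv \<Psi> z * \<xi> z) + K * B\<^sup>2 * \<epsilon>\<^sup>2 \<partial>\<nu>)"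
      by (rule integral_mono[OF id _ \<Psi>T(1)]) (use i\<Psi>\<xi> in auto)
    then have \<Psi>_le: "(\<integral>z. \<Psi> (T z) \<partial>\<nu>) \<le> (\<integral>z. \<Psi> z \<partial>\<nu>) + \<epsilon> * (\<integral>z. deriv \<Psi> z * \<xi> z \<partial>\<nu>) + K * B\<^sup>2 * \<epsilon>\<^sup>2"
      using i\<Psi>T N(4) i\<Psi>\<xi> by (simp add: prob_space)
    have K\<Psi>: "integrable \<kappa> \<Psi>" "(\<integral>z. \<Psi> z \<partial>\<kappa>) = (\<integral>z. \<Psi> (T z) \<partial>\<nu>)"
      unfolding \<kappa>_def using i\<Psi>T by (auto simp: integrable_distr_eq integral_distr)
    have mk: "mean \<kappa> = mean \<nu> + \<epsilon> * s"
    proof -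
      have "mean \<kappa> = (\<integral>z. T z \<partial>\<nu>)" unfolding \<kappa>_def by (subst integral_distr) auto
      also have "\<dots> = mean \<nu> + \<epsilon> * s" unfolding T_def using P2_integrable_id[OF N(1)] i\<xi> by (simp add: s_def)
      finally show ?thesis .
    qed
    have fin: "finite_energy \<Psi> \<kappa>" unfolding finite_energy_def using KP ent K\<Psi> by auto
    have W: "W2 \<nu> \<kappa> \<le> \<bar>\<epsilon>\<bar> * B"
    proof -
      have dn: "distr \<nu> borel (\<lambda>z. z) = \<nu>" using distr_id2[of borel \<nu>] by (simp add: \<open>sets \<nu> = sets borel\<close>)
      have "(W2 (distr \<nu> borel (\<lambda>z. z)) (distr \<nu> borel T))\<^sup>2 \<le> (\<integral>z. (z - T z)\<^sup>2 \<partial>\<nu>)"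
        by (rule W2_square_le_coupling[OF prob_space_axioms _ Tm P2D(4)[OF N(1)] T2]) measurable
      also have "\<dots> \<le> (\<integral>z. (\<bar>\<epsilon>\<bar> * B)\<^sup>2 \<partial>\<nu>)"
      proof (rule integral_mono)
        show "integrable \<nu> (\<lambda>z. (z - T z)\<^sup>2)" by (rule integrable_square_diff[OF P2D(4)[OF N(1)] T2 _ Tm]) measurable
        fix z
        have "\<bar>z - T z\<bar> \<le> \<bar>\<bar>\<epsilon>\<bar> * B\<bar>" using mult_left_mono[OF B(1)[of z], of "\<bar>\<epsilon>\<bar>"] B0 by (simp add: T_def abs_mult)
        then show "(z - T z)\<^sup>2 \<le> (\<bar>\<epsilon>\<bar> * B)\<^sup>2" by (rule abs_le_square_iff[THEN iffD1])
      qed simp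
      also have "\<dots> = (\<bar>\<epsilon>\<bar> * B)\<^sup>2" by (simp only: lebesgue_integral_const prob_space scaleR_one)
      finally have "(W2 \<nu> \<kappa>)\<^sup>2 \<le> (\<bar>\<epsilon>\<bar> * B)\<^sup>2" unfolding dn \<kappa>_def[symmetric] .
      then show ?thesis by (rule power2_le_imp_le) (use B0 in simp)
    qed
    \<comment> \<open>The second-order part of the interaction is nonpositive and is
      dropped.\<close>
    have "- J / 2 * (mean \<kappa>)\<^sup>2 \<le> - J / 2 * (mean \<nu>)\<^sup>2 - \<epsilon> * (J * mean \<nu> * s)"
    proof -
      have "- J / 2 * (mean \<kappa>)\<^sup>2 = - J / 2 * (mean \<nu>)\<^sup>2 - \<epsilon> * (J * mean \<nu> * s) - J / 2 * (\<epsilon> * s)\<^sup>2"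
        unfolding mk by (simp add: power2_eq_square field_simps)
      then show ?thesis using J_pos by simp
    qed
    then have E: "real_energy \<Psi> J \<kappa> \<le> real_energy \<Psi> J \<nu> + \<epsilon> * I + (2 * B\<^sup>2 + K * B\<^sup>2) * \<epsilon>\<^sup>2"
      using ent_le \<Psi>_le unfolding real_energy_def energy_def I_def K\<Psi>(2) by (simp add: algebra_simps)
    have "v * W2 \<nu> \<kappa> \<le> v * (\<bar>\<epsilon>\<bar> * B)" using W v by (rule mult_left_mono)
    moreover have "(L + J) / 2 * (W2 \<nu> \<kappa>)\<^sup>2 \<le> (L + J) / 2 * (\<bar>\<epsilon>\<bar> * B)\<^sup>2"
      using W SP.L SP.J by (intro mult_left_mono power_mono) auto
    moreover have "real_energy \<Psi> J \<nu> - v * W2 \<nu> \<kappa> - (L + J) / 2 * (W2 \<nu> \<kappa>)\<^sup>2 \<le> real_energy \<Psi> J \<kappa>"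
      by (rule SP.slope_inequality[OF \<nu> fin slope v])
    ultimately have "- (v * (\<bar>\<epsilon>\<bar> * B)) - (L + J) / 2 * (\<bar>\<epsilon>\<bar> * B)\<^sup>2 \<le> \<epsilon> * I + (2 * B\<^sup>2 + K * B\<^sup>2) * \<epsilon>\<^sup>2" using E by linarith
    moreover have "(\<bar>\<epsilon>\<bar> * B)\<^sup>2 = B\<^sup>2 * \<epsilon>\<^sup>2" by (simp add: power_mult_distrib mult.commute)
    ultimately show ?thesis unfolding C2_def by (simp add: algebra_simps)
  qed
  have C20: "0 \<le> C2" using K(1) SP.L SP.J by (simp add: C2_def)
  have "\<bar>I\<bar> \<le> v * B + e" if e: "0 < e" for e
  proof -
    define h where "h = min (1 / (2 * (B + 1))) (e / (C2 + 1))"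
    have h0: "0 < h" using B0 C20 e by (simp add: h_def)
    have h1: "h * B \<le> 1 / 2" "h \<le> 1"
    proof -
      have "h * (B + 1) \<le> 1 / (2 * (B + 1)) * (B + 1)" using B0 by (intro mult_right_mono) (auto simp: h_def)
      also have "\<dots> = 1 / 2" using B0 by (simp add: divide_simps)
      finally have hb: "h * (B + 1) \<le> 1 / 2" .
      have "h * B \<le> h * (B + 1)" using h0 by (intro mult_left_mono) auto
      then show "h * B \<le> 1 / 2" using hb by linarith
      have "h * 1 \<le> h * (B + 1)" using h0 B0 by (intro mult_left_mono) auto
      then show "h \<le> 1" using hb by linarith
    qed
    have "C2 * h \<le> (C2 + 1) * (e / (C2 + 1))" using h0 C20 by (intro mult_mono) (auto simp: h_def)
    then have h2: "C2 * h \<le> e" using C20 by simp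
    have "- (v * B) - C2 * h \<le> I"
    proof -
      have "h * (- (v * B) - C2 * h) \<le> h * I" using var[of h] h0 h1 by (simp add: power2_eq_square algebra_simps)
      then show ?thesis using h0 by simp
    qed
    moreover have "I \<le> v * B + C2 * h"
    proof -
      have "h * I \<le> h * (v * B + C2 * h)" using var[of "- h"] h0 h1 by (simp add: power2_eq_square algebra_simps)
      then show ?thesis using h0 by simp
    qed
    ultimately show ?thesis using h2 by (simp add: abs_le_iff)
  qed
  then have "\<bar>I\<bar> \<le> v * B" by (rule field_le_epsilon)
  then show ?thesis unfolding I_eq .
qed

end

section \<open>The Stein equation\<close>

text \<open>Integration starts left of the support; the vanishing total integral makes the primitive
  vanish to the right as well.\<close>

lemma compactly_supported_antiderivative:
  fixes g :: "real \<Rightarrow> real"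
  assumes g: "continuous_on UNIV g" and R: "0 < R" and supp: "\<And>z. R < \<bar>z\<bar> \<Longrightarrow> g z = 0" and 0: "(\<integral>z. g z \<partial>lborel) = 0"
  obtains \<eta> where "\<And>z. (\<eta> has_real_derivative g z) (at z)" "\<And>z. R < \<bar>z\<bar> \<Longrightarrow> \<eta> z = 0"
proof -
  define \<eta> where "\<eta> z = (LBINT t=ereal (- R - 1)..ereal z. g t)" for z :: real
  have d: "(\<eta> has_real_derivative g z) (at z)" for z
  proof -
    let ?a = "min z (- R - 1) - 1" and ?b = "max z (- R - 1) + 1"
    have "(\<eta> has_vector_derivative g z) (at z within {?a..?b})"
      unfolding \<eta>_def by (rule interval_integral_FTC2) (use continuous_on_subset[OF g] in auto)
    moreover have "at z within {?a..?b} = at z" by (rule at_within_interior) auto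
    ultimately show ?thesis by (simp add: has_real_derivative_iff_has_vector_derivative)
  qed
  have const: "\<eta> x = \<eta> y" if A: "convex A" "\<And>z. z \<in> A \<Longrightarrow> R < \<bar>z\<bar>" and xy: "x \<in> A" "y \<in> A" for A x y
  proof -
    have "\<exists>c. \<forall>x\<in>A. \<eta> x = c"
      by (rule has_field_derivative_zero_constant[OF A(1)])
        (use d supp A(2) in \<open>metis has_field_derivative_at_within\<close>)
    then show ?thesis using xy by auto
  qed
  have l: "\<eta> (- R - 1) = 0" by (simp add: \<eta>_def interval_integral_endpoints_same)
  have r: "\<eta> (R + 1) = 0"
  proof -
    have "\<eta> (R + 1) = (LBINT t:{- R - 1..R + 1}. g t)" unfolding \<eta>_def by (rule interval_integral_Icc) (use R in simp)
    also have "\<dots> = (\<integral>z. g z \<partial>lborel)" unfolding set_lebesgue_integral_def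
      by (intro Bochner_Integration.integral_cong) (use supp in \<open>force split: split_indicator\<close>)+
    finally show ?thesis using 0 by simp
  qed
  have "\<eta> z = 0" if "R < \<bar>z\<bar>" for z
  proof (cases "0 \<le> z")
    case True
    then show ?thesis using const[of "{R<..}" z "R + 1"] that R r by auto
  next
    case False
    then show ?thesis using const[of "{..<- R}" z "- R - 1"] that R l by auto
  qed
  with d show ?thesis by (rule that)
qed

lemma compactly_supported_bounded:
  fixes f :: "real \<Rightarrow> real"
  assumes "continuous_on UNIV f" "\<And>z. R < \<bar>z\<bar> \<Longrightarrow> f z = 0"
  obtains B where "\<And>z. \<bar>f z\<bar> \<le> B"
proof -
  have "compact (f ` {- R..R})" by (intro compact_continuous_image continuous_on_subset[OF assms(1)]) auto
  then obtain B where B: "0 < B" "\<And>z. z \<in> {- R..R} \<Longrightarrow> \<bar>f z\<bar> \<le> B"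
    using compact_imp_bounded bounded_pos by (metis imageI real_norm_def)
  have "\<bar>f z\<bar> \<le> B" for z using B assms(2)[of z] by (cases "\<bar>z\<bar> \<le> R") (auto simp: abs_le_iff)
  then show ?thesis by (rule that)
qed

text \<open>The step function sandwiches the distribution functions of \<open>M\<close> at
  \<open>x\<close> and of \<open>N\<close> at \<open>y\<close>; then \<open>y\<close> decreases to
  \<open>x\<close>.\<close>

lemma cdf_le_if_cts_step_eq:
  assumes M: "real_distribution M" and N: "real_distribution N"
    and eq: "\<And>x y. x < y \<Longrightarrow> integral\<^sup>L M (cts_step x y) = integral\<^sup>L N (cts_step x y)"
  shows "cdf M x \<le> cdf N x"
proof -
  interpret M: real_distribution M by fact
  interpret N: real_distribution N by fact
  have lim: "(cdf N \<longlongrightarrow> cdf N x) (at_right x)" using N.cdf_is_right_cont[of x] by (simp add: continuous_within)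
  show ?thesis
  proof (rule tendsto_lowerbound[OF lim])
    show "\<forall>\<^sub>F y in at_right x. cdf M x \<le> cdf N y"
      using eventually_at_right_less[of x]
    proof eventually_elim
      case (elim y)
      show ?case using M.cdf_cts_step(1)[OF elim] N.cdf_cts_step(2)[OF elim] eq[OF elim] by linarith
    qed
  qed simp
qed

definition bump :: "nat \<Rightarrow> real \<Rightarrow> real" where
  "bump n z = max 0 (min 1 (real n + 1 - \<bar>z\<bar>))"

lemma bump: "continuous_on A (bump n)" "0 \<le> bump n z" "bump n z \<le> 1" "real n + 1 < \<bar>z\<bar> \<Longrightarrow> bump n z = 0"
  unfolding bump_def[abs_def] by (auto intro!: continuous_intros)

lemma bump_measurable [measurable]: "bump n \<in> borel_measurable borel"
  by (rule borel_measurable_continuous_onI[OF bump(1)])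

lemma bump_tendsto_1: "(\<lambda>n. bump n z) \<longlonglongrightarrow> 1"
proof (rule tendsto_eventually)
  obtain N where N: "\<bar>z\<bar> \<le> real N" using real_arch_simple by blast
  show "\<forall>\<^sub>F n in sequentially. bump n z = 1"
    using eventually_ge_at_top[of N] by eventually_elim (use N in \<open>auto simp: bump_def\<close>)
qed

lemma integral_bump_tendsto:
  fixes f :: "real \<Rightarrow> real"
  assumes "real_distribution M" and [measurable]: "f \<in> borel_measurable borel" and f: "\<And>z. \<bar>f z\<bar> \<le> 1"
  shows "(\<lambda>n. \<integral>z. f z * bump n z \<partial>M) \<longlonglongrightarrow> (\<integral>z. f z \<partial>M)"
proof -
  interpret real_distribution M by fact
  show ?thesis
  proof (rule integral_dominated_convergence[where w="\<lambda>_. 1"])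
    show "AE z in M. (\<lambda>n. f z * bump n z) \<longlonglongrightarrow> f z"
      using tendsto_mult[OF tendsto_const bump_tendsto_1] by (intro AE_I2) (metis mult.right_neutral)
    show "AE z in M. norm (f z * bump n z) \<le> 1" for n
      using f bump(2,3) by (intro AE_I2) (simp add: abs_mult mult_le_one)
  qed auto
qed

context mean_field
begin

text \<open>Stein characterisation: the test function \<open>\<xi> = exp (\<Psi> - \<sigma> z) \<eta>\<close> turns the weak equation into
  \<open>\<integral> exp (\<Psi> - \<sigma> z) \<eta>' \<partial>M = 0\<close>.\<close>

lemma stein_identifies_gibbs:
  assumes M: "real_distribution M"
    and stein: "\<And>\<xi> \<xi>' B R. (\<And>z. (\<xi> has_real_derivative \<xi>' z) (at z)) \<Longrightarrow> continuous_on UNIV \<xi>' \<Longrightarrow>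
      (\<And>z. \<bar>\<xi> z\<bar> \<le> B) \<Longrightarrow> (\<And>z. \<bar>\<xi>' z\<bar> \<le> B) \<Longrightarrow> (\<And>z. R < \<bar>z\<bar> \<Longrightarrow> \<xi> z = 0) \<Longrightarrow> (\<And>z. R < \<bar>z\<bar> \<Longrightarrow> \<xi>' z = 0) \<Longrightarrow>
      (\<integral>z. - \<xi>' z + (deriv \<Psi> z - \<sigma>) * \<xi> z \<partial>M) = 0"
  shows "M = gibbs \<Psi> \<sigma>"
proof -
  let ?G = "gibbs \<Psi> \<sigma>"
  interpret M: real_distribution M by fact
  have G: "real_distribution ?G" by (rule P2D(5)[OF gibbs_P2])
  interpret G: real_distribution ?G by fact
  \<comment> \<open>Weighted by the tilted integrals of \<open>k\<close> and \<open>f\<close>, the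
    difference \<open>g\<close> has integral zero, so its primitive is an admissible
    \<open>\<eta>\<close>. This determines \<open>M\<close> on compactly supported functions up to a
    common factor.\<close>
  have ratio: "(\<integral>z. f z \<partial>M) * (\<integral>z. k z \<partial>?G) = (\<integral>z. k z \<partial>M) * (\<integral>z. f z \<partial>?G)"
    if f: "continuous_on UNIV f" and k: "continuous_on UNIV k" and R: "0 < R"
      and f0: "\<And>z. R < \<bar>z\<bar> \<Longrightarrow> f z = 0" and k0: "\<And>z. R < \<bar>z\<bar> \<Longrightarrow> k z = 0" for f k :: "real \<Rightarrow> real" and R
  proof -
    have [measurable]: "f \<in> borel_measurable borel" "k \<in> borel_measurable borel"
      by (intro borel_measurable_continuous_onI f k)+
    obtain Bf where Bf: "\<And>z. \<bar>f z\<bar> \<le> Bf" using compactly_supported_bounded[OF f f0] by metis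
    obtain Bk where Bk: "\<And>z. \<bar>k z\<bar> \<le> Bk" using compactly_supported_bounded[OF k k0] by metis
    have ifw: "integrable lborel (\<lambda>z. f z * exp (\<sigma> * z - \<Psi> z))" by (rule integrable_tilt[where K=Bf and a=0]) (use Bf in auto)
    have ik': "integrable lborel (\<lambda>z. k z * exp (\<sigma> * z - \<Psi> z))" by (rule integrable_tilt[where K=Bk and a=0]) (use Bk in auto)
    define F where "F = (\<integral>z. f z * exp (\<sigma> * z - \<Psi> z) \<partial>lborel)"
    define K where "K = (\<integral>z. k z * exp (\<sigma> * z - \<Psi> z) \<partial>lborel)"
    define g where "g z = (f z * K - k z * F) * exp (\<sigma> * z - \<Psi> z)" for z
    have cg: "continuous_on UNIV g" unfolding g_def by (intro continuous_intros f k \<Psi>_continuous)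
    have g0: "g z = 0" if "R < \<bar>z\<bar>" for z using that by (simp add: g_def f0 k0)
    have "(\<integral>z. g z \<partial>lborel) = (\<integral>z. K * (f z * exp (\<sigma> * z - \<Psi> z)) - F * (k z * exp (\<sigma> * z - \<Psi> z)) \<partial>lborel)"
      unfolding g_def by (intro Bochner_Integration.integral_cong) (auto simp: algebra_simps)
    also have "\<dots> = 0" using ifw ik' by (simp add: F_def K_def)
    finally obtain \<eta> where \<eta>: "\<And>z. (\<eta> has_real_derivative g z) (at z)" "\<And>z. R < \<bar>z\<bar> \<Longrightarrow> \<eta> z = 0"
      using compactly_supported_antiderivative[OF cg R g0] by metis
    define \<xi> where "\<xi> z = \<eta> z * exp (\<Psi> z - \<sigma> * z)" for z
    define \<xi>' where "\<xi>' z = g z * exp (\<Psi> z - \<sigma> * z) + \<eta> z * ((deriv \<Psi> z - \<sigma>) * exp (\<Psi> z - \<sigma> * z))" for z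
    have d\<xi>: "(\<xi> has_real_derivative \<xi>' z) (at z)" for z
      unfolding \<xi>_def \<xi>'_def by (auto intro!: derivative_eq_intros \<eta>(1) \<Psi>_DERIV)
    have c\<eta>: "continuous_on UNIV \<eta>" by (intro continuous_at_imp_continuous_on ballI DERIV_isCont[OF \<eta>(1)])
    have c\<xi>': "continuous_on UNIV \<xi>'" unfolding \<xi>'_def by (intro continuous_intros cg c\<eta> \<Psi>_continuous \<Psi>'_continuous)
    have c\<xi>: "continuous_on UNIV \<xi>" unfolding \<xi>_def by (intro continuous_intros c\<eta> \<Psi>_continuous)
    have \<xi>0: "\<xi> z = 0" "\<xi>' z = 0" if "R < \<bar>z\<bar>" for z using that by (simp_all add: \<xi>_def \<xi>'_def \<eta>(2) g0)
    obtain B1 where B1: "\<And>z. \<bar>\<xi> z\<bar> \<le> B1" using compactly_supported_bounded[OF c\<xi> \<xi>0(1)] by metis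
    obtain B2 where B2: "\<And>z. \<bar>\<xi>' z\<bar> \<le> B2" using compactly_supported_bounded[OF c\<xi>' \<xi>0(2)] by metis
    have "(\<integral>z. - \<xi>' z + (deriv \<Psi> z - \<sigma>) * \<xi> z \<partial>M) = 0"
      by (rule stein[OF d\<xi> c\<xi>', of "max B1 B2" R]) (use B1 B2 \<xi>0 in \<open>auto simp: le_max_iff_disj\<close>)
    moreover have "- \<xi>' z + (deriv \<Psi> z - \<sigma>) * \<xi> z = F * k z - K * f z" for z
    proof -
      have "exp (\<sigma> * z - \<Psi> z) * exp (\<Psi> z - \<sigma> * z) = 1" by (simp add: exp_add[symmetric])
      then have "g z * exp (\<Psi> z - \<sigma> * z) = f z * K - k z * F" by (simp add: g_def mult.assoc)
      then show ?thesis by (simp add: \<xi>_def \<xi>'_def algebra_simps)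
    qed
    moreover have "integrable M f" "integrable M k"
      by (rule M.integrable_const_bound[where B=Bf], use Bf in auto, rule M.integrable_const_bound[where B=Bk], use Bk in auto)
    ultimately have "F * (\<integral>z. k z \<partial>M) = K * (\<integral>z. f z \<partial>M)" by simp
    moreover have "F = Zp \<sigma> * (\<integral>z. f z \<partial>?G)" "K = Zp \<sigma> * (\<integral>z. k z \<partial>?G)"
      using gibbs_integral(2)[OF _ ifw] gibbs_integral(2)[OF _ ik'] Zp_pos[of \<sigma>] by (simp_all add: F_def K_def)
    ultimately have "Zp \<sigma> * ((\<integral>z. k z \<partial>M) * (\<integral>z. f z \<partial>?G)) = Zp \<sigma> * ((\<integral>z. f z \<partial>M) * (\<integral>z. k z \<partial>?G))"
      by (simp add: mult_ac)
    then show ?thesis using Zp_pos[of \<sigma>] by simp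
  qed
  have 1: "(\<lambda>n. \<integral>z. bump n z \<partial>M) \<longlonglongrightarrow> 1" "(\<lambda>n. \<integral>z. bump n z \<partial>?G) \<longlonglongrightarrow> 1"
    using integral_bump_tendsto[OF M, of "\<lambda>_. 1"] integral_bump_tendsto[OF G, of "\<lambda>_. 1"] M.prob_space G.prob_space by simp_all
  have eq: "(\<integral>z. f z \<partial>M) = (\<integral>z. f z \<partial>?G)"
    if f: "continuous_on UNIV f" and f0: "\<And>z. R < \<bar>z\<bar> \<Longrightarrow> f z = 0" for f :: "real \<Rightarrow> real" and R
  proof (rule LIMSEQ_unique)
    \<comment> \<open>The cutoff serves as second test function; its integrals tend to
      \<open>1\<close> under both measures, which fixes the factor.\<close>
    have p: "(\<integral>z. f z \<partial>M) * (\<integral>z. bump n z \<partial>?G) = (\<integral>z. bump n z \<partial>M) * (\<integral>z. f z \<partial>?G)" for n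
      by (rule ratio[OF f bump(1), of "max (real n + 1) R"]) (auto intro: f0 bump(4))
    have "(\<lambda>n. (\<integral>z. f z \<partial>M) * (\<integral>z. bump n z \<partial>?G)) \<longlonglongrightarrow> (\<integral>z. f z \<partial>M) * 1" by (intro tendsto_intros 1)
    then show "(\<lambda>n. (\<integral>z. f z \<partial>M) * (\<integral>z. bump n z \<partial>?G)) \<longlonglongrightarrow> (\<integral>z. f z \<partial>M)" by simp
    have "(\<lambda>n. (\<integral>z. bump n z \<partial>M) * (\<integral>z. f z \<partial>?G)) \<longlonglongrightarrow> 1 * (\<integral>z. f z \<partial>?G)" by (intro tendsto_intros 1)
    then show "(\<lambda>n. (\<integral>z. f z \<partial>M) * (\<integral>z. bump n z \<partial>?G)) \<longlonglongrightarrow> (\<integral>z. f z \<partial>?G)" unfolding p by simp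
  qed
  have step: "integral\<^sup>L M (cts_step x y) = integral\<^sup>L ?G (cts_step x y)" if xy: "x < y" for x y
  proof (rule LIMSEQ_unique)
    have c: "continuous_on UNIV (cts_step x y)"
      by (rule uniformly_continuous_imp_continuous[OF cts_step_uniformly_continuous[OF xy]])
    then have [measurable]: "cts_step x y \<in> borel_measurable borel" by (rule borel_measurable_continuous_onI)
    have b: "\<bar>cts_step x y z\<bar> \<le> 1" for z using xy by (auto simp: cts_step_def)
    have p: "(\<integral>z. cts_step x y z * bump n z \<partial>M) = (\<integral>z. cts_step x y z * bump n z \<partial>?G)" for n
      by (rule eq[of _ "real n + 1"]) (auto intro!: continuous_intros c bump(1) simp: bump(4))
    show "(\<lambda>n. \<integral>z. cts_step x y z * bump n z \<partial>M) \<longlonglongrightarrow> integral\<^sup>L M (cts_step x y)"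
      by (rule integral_bump_tendsto[OF M _ b]) measurable
    show "(\<lambda>n. \<integral>z. cts_step x y z * bump n z \<partial>M) \<longlonglongrightarrow> integral\<^sup>L ?G (cts_step x y)"
      unfolding p by (rule integral_bump_tendsto[OF G _ b]) measurable
  qed
  have "cdf M = cdf ?G"
    by (intro ext antisym cdf_le_if_cts_step_eq[OF M G step] cdf_le_if_cts_step_eq[OF G M step[symmetric]])
  then show ?thesis by (rule cdf_unique[OF M G])
qed

end

section \<open>Convergence of the flow\<close>

lemma tendsto_at_top_decreasing:
  fixes f :: "real \<Rightarrow> real"
  assumes dec: "\<And>s t. 0 < s \<Longrightarrow> s \<le> t \<Longrightarrow> f t \<le> f s" and bd: "\<And>t. 0 < t \<Longrightarrow> B \<le> f t"
  obtains l where "(f \<longlongrightarrow> l) at_top" "\<And>t. 0 < t \<Longrightarrow> l \<le> f t"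
proof -
  define l where "l = (INF t\<in>{0<..}. f t)"
  have bb: "bdd_below (f ` {0<..})" using bd by (auto intro!: bdd_belowI2)
  have l: "l \<le> f t" if "0 < t" for t unfolding l_def by (rule cINF_lower[OF bb]) (use that in simp)
  have "(f \<longlongrightarrow> l) at_top"
  proof (rule order_tendstoI)
    fix a assume a: "a < l"
    show "\<forall>\<^sub>F t in at_top. a < f t"
      using eventually_gt_at_top[of 0] by eventually_elim (use l a in force)
  next
    fix a assume "l < a"
    then obtain t0 where t0: "0 < t0" "f t0 < a" unfolding l_def using cINF_less_iff[OF _ bb, of a] by auto
    show "\<forall>\<^sub>F t in at_top. f t < a"
      using eventually_ge_at_top[of t0] by eventually_elim (use dec[OF t0(1)] t0(2) in force)
  qed
  then show ?thesis using l by (rule that)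
qed

context mean_field
begin

section \<open>Compactness and identification of limits\<close>

lemma moments_bounded:
  obtains p where "2 < p" "\<And>\<nu>. finite_energy \<Psi> \<nu> \<Longrightarrow> integrable \<nu> (\<lambda>z. \<bar>z\<bar> powr p)"
    "\<And>E. \<exists>K. \<forall>\<nu>. finite_energy \<Psi> \<nu> \<longrightarrow> real_energy \<Psi> J \<nu> \<le> E \<longrightarrow> (\<integral>z. \<bar>z\<bar> powr p \<partial>\<nu>) \<le> K"
proof -
  obtain p a C where pa: "2 < p" "0 < a"
    "\<And>\<nu>. finite_energy \<Psi> \<nu> \<Longrightarrow> integrable \<nu> (\<lambda>z. \<bar>z\<bar> powr p) \<and> a * (\<integral>z. \<bar>z\<bar> powr p \<partial>\<nu>) \<le> energy \<Psi> \<nu> + C"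
    using moment_bound by metis
  obtain C' where C': "\<And>\<nu>. finite_energy \<Psi> \<nu> \<Longrightarrow> energy \<Psi> \<nu> \<le> 2 * real_energy \<Psi> J \<nu> + C'"
    using energy_le_real_energy by metis
  have "(\<integral>z. \<bar>z\<bar> powr p \<partial>\<nu>) \<le> (2 * E + C' + C) / a" if "finite_energy \<Psi> \<nu>" "real_energy \<Psi> J \<nu> \<le> E" for \<nu> E
    using pa(3)[OF that(1)] C'[OF that(1)] that(2) pa(2) by (simp add: pos_le_divide_eq mult.commute)
  then show ?thesis using that[OF pa(1)] pa(3) by blast
qed

lemma W2_gibbs_tendsto_0_if_weak_conv:
  assumes \<nu>: "\<And>n. finite_energy \<Psi> (\<nu> n)" and E: "\<And>n. real_energy \<Psi> J (\<nu> n) \<le> E"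
    and wc: "weak_conv_m \<nu> (gibbs \<Psi> \<sigma>)"
  shows "(\<lambda>n. W2 (\<nu> n) (gibbs \<Psi> \<sigma>)) \<longlonglongrightarrow> 0"
proof -
  obtain p where p: "2 < p" "\<And>\<nu>. finite_energy \<Psi> \<nu> \<Longrightarrow> integrable \<nu> (\<lambda>z. \<bar>z\<bar> powr p)"
    "\<And>E. \<exists>K. \<forall>\<nu>. finite_energy \<Psi> \<nu> \<longrightarrow> real_energy \<Psi> J \<nu> \<le> E \<longrightarrow> (\<integral>z. \<bar>z\<bar> powr p \<partial>\<nu>) \<le> K"
    by (rule moments_bounded) (rule that; assumption)
  obtain K where K: "\<forall>\<nu>. finite_energy \<Psi> \<nu> \<longrightarrow> real_energy \<Psi> J \<nu> \<le> E \<longrightarrow> (\<integral>z. \<bar>z\<bar> powr p \<partial>\<nu>) \<le> K"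
    using p(3)[of E] by (elim exE)
  show ?thesis
  proof (rule W2_tendsto_0_if_weak_conv[OF _ gibbs_P2 wc p(1)])
    show "(\<integral>z. \<bar>z\<bar> powr p \<partial>\<nu> n) \<le> K" for n using K \<nu> E by simp
  qed (use \<nu> finite_energyD(1) gibbs_energy(1) p(2) in auto)
qed

lemma W2_gibbs_tendsto_0_if_energy:
  assumes \<nu>: "\<And>n. finite_energy \<Psi> (\<nu> n)"
    and m: "(\<lambda>n. mean (\<nu> n)) \<longlonglongrightarrow> tilted_mean \<sigma>"
    and e: "(\<lambda>n. real_energy \<Psi> J (\<nu> n)) \<longlonglongrightarrow> H_bar \<Psi> J (tilted_mean \<sigma>)"
  shows "(\<lambda>n. W2 (\<nu> n) (gibbs \<Psi> \<sigma>)) \<longlonglongrightarrow> 0"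
proof -
  have "(\<lambda>n. real_energy \<Psi> J (\<nu> n) + J / 2 * (mean (\<nu> n))\<^sup>2 - (\<sigma> * mean (\<nu> n) - phi_star \<Psi> \<sigma>)) \<longlonglongrightarrow>
    H_bar \<Psi> J (tilted_mean \<sigma>) + J / 2 * (tilted_mean \<sigma>)\<^sup>2 - (\<sigma> * tilted_mean \<sigma> - phi_star \<Psi> \<sigma>)"
    by (intro tendsto_intros m e)
  then have "(\<lambda>n. energy \<Psi> (\<nu> n) - (\<sigma> * mean (\<nu> n) - phi_star \<Psi> \<sigma>)) \<longlonglongrightarrow> 0"
    by (simp add: real_energy_def H_bar_def phi_tilted_mean)
  then have wc: "weak_conv_m \<nu> (gibbs \<Psi> \<sigma>)" by (rule cdf_conv_if_entropy_tendsto[OF \<nu>])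
  obtain E where "\<And>n. real_energy \<Psi> J (\<nu> n) \<le> E"
    using convergent_imp_Bseq[OF convergentI[OF e]] unfolding Bseq_def real_norm_def by (metis abs_le_D1)
  then show ?thesis by (rule W2_gibbs_tendsto_0_if_weak_conv[OF \<nu> _ wc])
qed

lemma moment_tight:
  assumes \<nu>: "\<And>n. \<nu> n \<in> P2" and p: "2 < p" and i: "\<And>n. integrable (\<nu> n) (\<lambda>z. \<bar>z\<bar> powr p)"
    and K: "\<And>n. (\<integral>z. \<bar>z\<bar> powr p \<partial>\<nu> n) \<le> K"
  shows "tight \<nu>" "\<And>n. \<bar>mean (\<nu> n)\<bar> \<le> 1 + K"
proof -
  have pw: "\<bar>z\<bar> \<le> 1 + \<bar>z\<bar> powr p" for z :: real
  proof (cases "1 \<le> \<bar>z\<bar>")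
    case True
    then have "\<bar>z\<bar> powr 1 \<le> \<bar>z\<bar> powr p" using p by (intro powr_mono) auto
    then show ?thesis using True by simp
  qed (use powr_ge_zero[of "\<bar>z\<bar>" p] in linarith)
  show m: "\<bar>mean (\<nu> n)\<bar> \<le> 1 + K" for n
  proof -
    interpret prob_space "\<nu> n" using P2D(1)[OF \<nu>] .
    have "\<bar>mean (\<nu> n)\<bar> \<le> (\<integral>z. 1 + \<bar>z\<bar> powr p \<partial>\<nu> n)"
      by (rule integral_abs_bound_integral) (use P2_integrable_id[OF \<nu>] i pw in auto)
    also have "\<dots> = 1 + (\<integral>z. \<bar>z\<bar> powr p \<partial>\<nu> n)" using i by (simp add: prob_space)
    finally show ?thesis using K[of n] by linarith
  qed
  show "tight \<nu>"
    unfolding tight_def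
  proof (intro conjI allI impI)
    show "real_distribution (\<nu> n)" for n by (rule P2D(5)[OF \<nu>])
    fix \<epsilon> :: real assume \<epsilon>: "0 < \<epsilon>"
    define R where "R = max 1 ((\<bar>K\<bar> + 1) / \<epsilon>)"
    have R: "1 \<le> R" "(\<bar>K\<bar> + 1) / \<epsilon> \<le> R" by (auto simp: R_def)
    have "1 - \<epsilon> < measure (\<nu> n) {- R<..R}" for n
    proof -
      interpret prob_space "\<nu> n" using P2D(1)[OF \<nu>] .
      have S: "sets (\<nu> n) = sets borel" using P2D(2)[OF \<nu>] .
      have "1 - measure (\<nu> n) {- R<..R} = measure (\<nu> n) (- {- R<..R})"
        using prob_compl[of "{- R<..R}"] P2D(3)[OF \<nu>, of n] by (simp add: S Compl_eq_Diff_UNIV)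
      also have "\<dots> = (\<integral>z. indicator (- {- R<..R}) z \<partial>\<nu> n)" using P2D(3)[OF \<nu>, of n] by simp
      also have "\<dots> \<le> (\<integral>z. \<bar>z\<bar> powr p / R \<partial>\<nu> n)"
      proof (rule integral_mono)
        fix z :: real
        show "indicator (- {- R<..R}) z \<le> \<bar>z\<bar> powr p / R"
        proof (cases "z \<in> {- R<..R}")
          case False
          then have z: "R \<le> \<bar>z\<bar>" by auto
          have "\<bar>z\<bar> powr 1 \<le> \<bar>z\<bar> powr p" using p z R by (intro powr_mono) auto
          then have "R \<le> \<bar>z\<bar> powr p" using z R by simp
          then show ?thesis using R False by simp
        qed (use R in simp)
      qed (use i in \<open>auto simp: emeasure_eq_measure S\<close>)
      also have "\<dots> \<le> K / R" using K[of n] R by (simp add: divide_right_mono)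
      also have "\<dots> < \<epsilon>"
      proof -
        have "K < (\<bar>K\<bar> + 1) / \<epsilon> * \<epsilon>" using \<epsilon> by simp
        also have "\<dots> \<le> R * \<epsilon>" using R \<epsilon> by (intro mult_right_mono) auto
        finally show ?thesis using R by (simp add: pos_divide_less_eq mult.commute)
      qed
      finally show ?thesis by linarith
    qed
    moreover have "- R < R" using R by linarith
    ultimately show "\<exists>a b. a < b \<and> (\<forall>n. 1 - \<epsilon> < measure (\<nu> n) {a<..b})" by blast
  qed
qed

text \<open>The Stein equation involves the means, so their limit \<open>m\<close> is extracted
  before the weak limit is taken. That \<open>m\<close> is the mean of the limiting measure is
  learnt only at the end, from convergence in \<open>W2\<close>; this turns
  \<open>\<sigma> = J * m\<close> into the critical point equation.\<close>

lemma vanishing_slope_limit: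
  assumes \<nu>: "\<And>n. finite_energy \<Psi> (\<nu> n)" and E: "\<And>n. real_energy \<Psi> J (\<nu> n) \<le> E"
    and slope: "\<And>n. metric_slope (free_energy \<Psi> J) (\<nu> n) = ereal (v n)" and v: "\<And>n. 0 \<le> v n" "v \<longlonglongrightarrow> 0"
  obtains r \<sigma> where "strict_mono r" "\<sigma> = J * tilted_mean \<sigma>" "(\<lambda>n. mean (\<nu> (r n))) \<longlonglongrightarrow> tilted_mean \<sigma>"
    "(\<lambda>n. W2 (\<nu> (r n)) (gibbs \<Psi> \<sigma>)) \<longlonglongrightarrow> 0"
proof -
  obtain p where p: "2 < p" "\<And>\<nu>. finite_energy \<Psi> \<nu> \<Longrightarrow> integrable \<nu> (\<lambda>z. \<bar>z\<bar> powr p)"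
    "\<And>E. \<exists>K. \<forall>\<nu>. finite_energy \<Psi> \<nu> \<longrightarrow> real_energy \<Psi> J \<nu> \<le> E \<longrightarrow> (\<integral>z. \<bar>z\<bar> powr p \<partial>\<nu>) \<le> K"
    by (rule moments_bounded) (rule that; assumption)
  obtain K where K: "\<forall>\<nu>. finite_energy \<Psi> \<nu> \<longrightarrow> real_energy \<Psi> J \<nu> \<le> E \<longrightarrow> (\<integral>z. \<bar>z\<bar> powr p \<partial>\<nu>) \<le> K"
    using p(3)[of E] by (elim exE)
  note P = finite_energyD(1)[OF \<nu>]
  have mom: "(\<integral>z. \<bar>z\<bar> powr p \<partial>\<nu> n) \<le> K" for n using K \<nu> E by blast
  note tm = moment_tight[of \<nu>, OF P p(1) p(2)[OF \<nu>] mom]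
  have "bounded (range (\<lambda>n. mean (\<nu> n)))" using tm(2) by (intro boundedI[where B="1 + K"]) auto
  then obtain m s where s: "strict_mono (s :: nat \<Rightarrow> nat)" "((\<lambda>n. mean (\<nu> n)) \<circ> s) \<longlonglongrightarrow> m"
    using bounded_imp_convergent_subsequence by blast
  obtain r' M where r': "strict_mono (r' :: nat \<Rightarrow> nat)" "real_distribution M" "weak_conv_m (\<nu> \<circ> s \<circ> r') M"
    using tight_imp_convergent_subsubsequence[OF tm(1) s(1)] by (elim exE conjE) (rule that; assumption)
  define r where "r = s \<circ> r'"
  have r: "strict_mono r" unfolding r_def by (rule strict_mono_o[OF s(1) r'(1)])
  have wc: "weak_conv_m (\<lambda>n. \<nu> (r n)) M" using r'(3) by (simp add: r_def comp_def)
  have ml: "(\<lambda>n. mean (\<nu> (r n))) \<longlonglongrightarrow> m"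
    using LIMSEQ_subseq_LIMSEQ[OF s(2) r'(1)] by (simp add: r_def comp_def)
  have vl: "(\<lambda>n. v (r n)) \<longlonglongrightarrow> 0" using LIMSEQ_subseq_LIMSEQ[OF v(2) r] by (simp add: comp_def)
  define \<sigma> where "\<sigma> = J * m"
  interpret M: real_distribution M by (rule r'(2))
  have conv: "(\<lambda>n. \<integral>z. f z \<partial>\<nu> (r n)) \<longlonglongrightarrow> (\<integral>z. f z \<partial>M)" if "\<And>z. isCont f z" "\<And>z. \<bar>f z\<bar> \<le> b" for f :: "real \<Rightarrow> real" and b
    using weak_conv_imp_integral_bdd_continuous_conv[OF P2D(5)[OF P] r'(2) wc, of f b] that by simp
  have "M = gibbs \<Psi> \<sigma>"
  proof (rule stein_identifies_gibbs[OF r'(2)])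
    fix \<xi> \<xi>' B R
    assume d: "\<And>z. (\<xi> has_real_derivative \<xi>' z) (at z)" and c\<xi>': "continuous_on UNIV \<xi>'"
      and B: "\<And>z. \<bar>\<xi> z\<bar> \<le> B" "\<And>z. \<bar>\<xi>' z\<bar> \<le> B" and R: "\<And>z. R < \<bar>z\<bar> \<Longrightarrow> \<xi> z = 0" "\<And>z. R < \<bar>z\<bar> \<Longrightarrow> \<xi>' z = 0"
    define f where "f z = - \<xi>' z + deriv \<Psi> z * \<xi> z" for z
    have c\<xi>: "continuous_on UNIV \<xi>" by (intro continuous_at_imp_continuous_on ballI DERIV_isCont[OF d])
    have cf: "continuous_on UNIV f" unfolding f_def by (intro continuous_intros c\<xi>' c\<xi> \<Psi>'_continuous)
    have f0: "f z = 0" if "R < \<bar>z\<bar>" for z using R[OF that] by (simp add: f_def)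
    obtain Bf where Bf: "\<And>z. \<bar>f z\<bar> \<le> Bf" using compactly_supported_bounded[OF cf f0] by metis
    have [measurable]: "f \<in> borel_measurable borel" "\<xi> \<in> borel_measurable borel"
      by (intro borel_measurable_continuous_onI cf c\<xi>)+
    have split: "(\<integral>z. - \<xi>' z + (deriv \<Psi> z - c) * \<xi> z \<partial>N) = (\<integral>z. f z \<partial>N) - c * (\<integral>z. \<xi> z \<partial>N)" if "real_distribution N" for N c
    proof -
      interpret N: real_distribution N by fact
      have "integrable N f" "integrable N \<xi>"
        by (rule N.integrable_const_bound[where B=Bf], use Bf in auto, rule N.integrable_const_bound[where B=B], use B in auto)
      moreover have "(\<integral>z. - \<xi>' z + (deriv \<Psi> z - c) * \<xi> z \<partial>N) = (\<integral>z. f z - c * \<xi> z \<partial>N)"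
        by (intro Bochner_Integration.integral_cong) (auto simp: f_def algebra_simps)
      ultimately show ?thesis by simp
    qed
    have "(\<lambda>n. (\<integral>z. f z \<partial>\<nu> (r n)) - J * mean (\<nu> (r n)) * (\<integral>z. \<xi> z \<partial>\<nu> (r n))) \<longlonglongrightarrow> (\<integral>z. f z \<partial>M) - J * m * (\<integral>z. \<xi> z \<partial>M)"
      by (intro tendsto_intros ml conv[OF _ Bf] conv[OF _ B(1)])
        (use cf c\<xi> in \<open>auto simp: continuous_on_eq_continuous_at\<close>)
    moreover have "(\<lambda>n. (\<integral>z. f z \<partial>\<nu> (r n)) - J * mean (\<nu> (r n)) * (\<integral>z. \<xi> z \<partial>\<nu> (r n))) \<longlonglongrightarrow> 0"
    proof (rule tendsto_0_le[OF vl, of _ B])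
      have "norm ((\<integral>z. f z \<partial>\<nu> (r n)) - J * mean (\<nu> (r n)) * (\<integral>z. \<xi> z \<partial>\<nu> (r n))) \<le> norm (v (r n)) * B" for n
      proof -
        have "\<bar>(\<integral>z. - \<xi>' z + (deriv \<Psi> z - J * mean (\<nu> (r n))) * \<xi> z \<partial>\<nu> (r n))\<bar> \<le> v (r n) * B"
          by (rule first_variation_bound[OF \<nu> eq_refl[OF slope] v(1) d c\<xi>' B R(1)])
        then show ?thesis unfolding split[OF P2D(5)[OF P]] using v(1)[of "r n"] by simp
      qed
      then show "\<forall>\<^sub>F n in sequentially. norm ((\<integral>z. f z \<partial>\<nu> (r n)) - J * mean (\<nu> (r n)) * (\<integral>z. \<xi> z \<partial>\<nu> (r n))) \<le> norm (v (r n)) * B"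
        by simp
    qed
    ultimately have "(\<integral>z. f z \<partial>M) - J * m * (\<integral>z. \<xi> z \<partial>M) = 0" by (rule LIMSEQ_unique)
    then show "(\<integral>z. - \<xi>' z + (deriv \<Psi> z - \<sigma>) * \<xi> z \<partial>M) = 0" unfolding split[OF r'(2)] \<sigma>_def .
  qed
  with wc have W: "(\<lambda>n. W2 (\<nu> (r n)) (gibbs \<Psi> \<sigma>)) \<longlonglongrightarrow> 0"
    by (intro W2_gibbs_tendsto_0_if_weak_conv[OF \<nu> E]) simp
  have mt: "(\<lambda>n. mean (\<nu> (r n))) \<longlonglongrightarrow> tilted_mean \<sigma>"
  proof (rule Lim_transform[OF tendsto_const[of "tilted_mean \<sigma>"]])
    show "(\<lambda>n. mean (\<nu> (r n)) - tilted_mean \<sigma>) \<longlonglongrightarrow> 0"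
      by (rule tendsto_0_le[OF W, of _ 1])
        (use mean_diff_le_W2[OF P gibbs_P2] in \<open>simp add: gibbs_mean\<close>)
  qed
  then have "m = tilted_mean \<sigma>" using LIMSEQ_unique[OF ml] by simp
  then have "\<sigma> = J * tilted_mean \<sigma>" by (simp add: \<sigma>_def)
  then show ?thesis using that[OF r _ mt W] by simp
qed

end

theorem proposition1:
  fixes \<Psi> :: "real \<Rightarrow> real" and J :: real
    and \<mu> :: "real measure" and S :: "real \<Rightarrow> real measure"
  assumes "standing_assumptions \<Psi> J"
    and "\<mu> \<in> P2"
    and "(\<integral>z. z \<partial>\<mu>) \<noteq> 0"
    and "free_energy \<Psi> J \<mu> \<le> free_energy \<Psi> J (mu_zero \<Psi>)"
    and "gradient_flow (free_energy \<Psi> J) \<mu> S"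
  shows "((\<lambda>t. free_energy \<Psi> J (S t)) \<longlongrightarrow> free_energy \<Psi> J (mu_minus \<Psi> J)) at_top \<and>
    free_energy \<Psi> J (mu_minus \<Psi> J) = free_energy \<Psi> J (mu_plus \<Psi> J) \<and>
    ((\<integral>z. z \<partial>\<mu>) < 0 \<longrightarrow> ((\<lambda>t. W2 (S t) (mu_minus \<Psi> J)) \<longlongrightarrow> 0) at_top) \<and>
    ((\<integral>z. z \<partial>\<mu>) > 0 \<longrightarrow> ((\<lambda>t. W2 (S t) (mu_plus \<Psi> J)) \<longlongrightarrow> 0) at_top)"
proof -
  interpret mean_field \<Psi> J by standard (rule assms(1))
  obtain L C where "semiconvex_potential \<Psi> J L C" using semiconvex by metis
  then interpret SP: semiconvex_potential \<Psi> J L C .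
  note flow = assms(5) and \<mu>P = assms(2)
  let ?H = "H_bar \<Psi> J" and ?m = "tilted_mean sigma_star"
  have Fg: "free_energy \<Psi> J (gibbs \<Psi> \<sigma>) = ereal (?H (tilted_mean \<sigma>))" for \<sigma>
    using finite_energyD(5)[OF gibbs_energy(1), of J \<sigma>] by (simp add: gibbs_energy(3))
  have fin\<mu>: "finite_energy \<Psi> \<mu>"
    by (rule free_energy_finiteD[OF \<mu>P \<Psi>_measurable(1) SP.lb, of J])
      (use assms(4) in \<open>auto simp: mu_zero_eq Fg intro: le_less_trans\<close>)
  have e\<mu>: "real_energy \<Psi> J \<mu> \<le> ?H 0"
    using assms(4) finite_energyD(5)[OF fin\<mu>, of J] by (simp add: mu_zero_eq Fg tilted_mean_0)
  note fin = SP.flow_finite[OF flow \<mu>P]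
  define e where "e t = real_energy \<Psi> J (S t)" for t
  have eH: "?H (mean (S t)) \<le> e t" if "0 < t" for t unfolding e_def by (rule real_energy_ge_H_bar[OF fin[OF that]])
  have emin: "?H ?m \<le> e t" if "0 < t" for t using eH[OF that] H_bar_min order_trans by blast
  have dec: "e t \<le> e s" if "0 < s" "s \<le> t" for s t unfolding e_def by (rule SP.flow_energy_antimono[OF flow \<mu>P that])
  have e0: "e t \<le> real_energy \<Psi> J \<mu>" if "0 < t" for t
    unfolding e_def by (rule SP.flow_energy_le_initial[OF flow \<mu>P fin\<mu> that])
  have const: "S t = \<mu>" if "0 < t" "?H 0 \<le> e t" for t
    by (rule SP.flow_constant_initial[OF flow \<mu>P fin\<mu> that(1)]) (use e\<mu> that(2) in \<open>simp add: e_def\<close>)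
  \<comment> \<open>A zero mean would give \<open>?H 0 \<le> e t\<close>, so \<open>S t\<close>
    would be \<open>\<mu>\<close>, whose mean is not zero.\<close>
  have nz: "mean (S t) \<noteq> 0" if "0 < t" for t
    using const[OF that] eH[OF that] assms(3) by auto
  obtain l where l: "(e \<longlongrightarrow> l) at_top" "\<And>t. 0 < t \<Longrightarrow> l \<le> e t"
    by (rule tendsto_at_top_decreasing[of e "?H ?m"]) (use dec emin in auto)
  have "\<exists>t v. real n + 1 < t \<and> 0 \<le> v \<and> v < 1 / (real n + 1) \<and> metric_slope (free_energy \<Psi> J) (S t) = ereal v" for n
    using SP.flow_slope_small[OF flow \<mu>P, of "?H ?m" "1 / (real n + 1)" "real n + 1"] emin unfolding e_def by (metis add_nonneg_pos of_nat_0_le_iff zero_less_divide_1_iff zero_less_one)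
  then obtain T v where Tv: "\<And>n. real n + 1 < T n" "\<And>n. 0 \<le> v n" "\<And>n. v n < 1 / (real n + 1)"
    "\<And>n. metric_slope (free_energy \<Psi> J) (S (T n)) = ereal (v n)" by metis
  have T0: "0 < T n" for n using Tv(1)[of n] by linarith
  have v0: "v \<longlonglongrightarrow> 0"
  proof (rule real_tendsto_sandwich[where f="\<lambda>_. 0" and h="\<lambda>n. 1 / (real n + 1)"])
    show "(\<lambda>n. 1 / (real n + 1)) \<longlonglongrightarrow> 0" using LIMSEQ_inverse_real_of_nat by (simp add: inverse_eq_divide add.commute)
    show "(\<lambda>n. 0 :: real) \<longlonglongrightarrow> 0" by simp
  qed (use Tv(2,3) in \<open>auto intro!: always_eventually less_imp_le\<close>)
  have Ttop: "filterlim T at_top sequentially"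
  proof (rule filterlim_at_top_mono[OF filterlim_real_sequentially])
    have "real n \<le> T n" for n using Tv(1)[of n] by linarith
    then show "\<forall>\<^sub>F n in sequentially. real n \<le> T n" by simp
  qed
  obtain r \<sigma> where r: "strict_mono r" "\<sigma> = J * tilted_mean \<sigma>" "(\<lambda>n. mean (S (T (r n)))) \<longlonglongrightarrow> tilted_mean \<sigma>"
    "(\<lambda>n. W2 (S (T (r n))) (gibbs \<Psi> \<sigma>)) \<longlonglongrightarrow> 0"
    using vanishing_slope_limit[of "\<lambda>n. S (T n)" "real_energy \<Psi> J \<mu>" v] fin[OF T0] e0[OF T0] Tv(2,4) v0 unfolding e_def by metis
  have eT: "(\<lambda>n. e (T (r n))) \<longlonglongrightarrow> l"
    by (intro filterlim_compose[OF l(1)] filterlim_compose[OF Ttop] filterlim_subseq r(1))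
  have vr: "(\<lambda>n. v (r n)) \<longlonglongrightarrow> 0" using LIMSEQ_subseq_LIMSEQ[OF v0 r(1)] by (simp add: comp_def)
  \<comment> \<open>Convergence in \<open>W2\<close> alone would not bound the limiting energy from
    above. The slope inequality with the limit as target does, since slopes and distances both tend
    to zero.\<close>
  have "l \<le> ?H (tilted_mean \<sigma>)"
  proof (rule LIMSEQ_le_const2)
    let ?w = "\<lambda>n. W2 (S (T (r n))) (gibbs \<Psi> \<sigma>)"
    have "(\<lambda>n. e (T (r n)) - v (r n) * ?w n - (L + J) / 2 * (?w n)\<^sup>2) \<longlonglongrightarrow> l - 0 * 0 - (L + J) / 2 * 0\<^sup>2"
      by (intro tendsto_intros eT vr r(4))
    then show "(\<lambda>n. e (T (r n)) - v (r n) * ?w n - (L + J) / 2 * (?w n)\<^sup>2) \<longlonglongrightarrow> l" by simp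
    have "e (T (r n)) - v (r n) * ?w n - (L + J) / 2 * (?w n)\<^sup>2 \<le> ?H (tilted_mean \<sigma>)" for n
      using SP.slope_inequality[OF fin[OF T0] gibbs_energy(1) eq_refl[OF Tv(4)] Tv(2)] by (simp add: e_def gibbs_energy(3))
    then show "\<exists>N. \<forall>n\<ge>N. e (T (r n)) - v (r n) * ?w n - (L + J) / 2 * (?w n)\<^sup>2 \<le> ?H (tilted_mean \<sigma>)" by blast
  qed
  moreover have "?H (tilted_mean \<sigma>) \<le> l"
    by (rule LIMSEQ_le[OF isCont_tendsto_compose[OF H_bar_continuous r(3)] eT]) (use eH[OF T0] in blast)
  ultimately have l_eq: "l = ?H (tilted_mean \<sigma>)" by simp
  have "\<sigma> \<noteq> 0"
  proof
    assume "\<sigma> = 0"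
    then have "?H 0 \<le> e t" if "0 < t" for t using l(2)[OF that] l_eq by (simp add: tilted_mean_0)
    then have "S (T (r n)) = \<mu>" for n using const[OF T0] T0 by blast
    then have "(\<lambda>n :: nat. mean \<mu>) \<longlonglongrightarrow> 0" using r(3) \<open>\<sigma> = 0\<close> by (simp add: tilted_mean_0)
    then show False using assms(3) LIMSEQ_unique[OF tendsto_const] by blast
  qed
  then have lm: "l = ?H ?m" using r(2) critical_iff[of \<sigma>] l_eq by (auto simp: tilted_mean_odd H_bar_even)
  have Hlim: "((\<lambda>t. ?H (mean (S t))) \<longlongrightarrow> ?H ?m) at_top"
  proof (rule real_tendsto_sandwich[OF _ _ tendsto_const l(1)[unfolded lm]])
    show "\<forall>\<^sub>F t in at_top. ?H ?m \<le> ?H (mean (S t))" using H_bar_min by simp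
    show "\<forall>\<^sub>F t in at_top. ?H (mean (S t)) \<le> e t" using eventually_gt_at_top[of 0] by eventually_elim (rule eH)
  qed
  have W: "((\<lambda>t. W2 (S t) (gibbs \<Psi> \<tau>)) \<longlongrightarrow> 0) at_top"
    if \<tau>: "((\<lambda>t. mean (S t)) \<longlongrightarrow> tilted_mean \<tau>) at_top" "?H (tilted_mean \<tau>) = ?H ?m" for \<tau>
  proof (rule tendsto_at_topI_sequentially)
    fix X :: "nat \<Rightarrow> real" assume X: "filterlim X at_top sequentially"
    \<comment> \<open>Energies are known to be finite only at positive times; moving the sequence to
      \<open>[1, \<infinity>)\<close> leaves its tail unchanged.\<close>
    define Y where "Y n = max 1 (X n)" for n
    have Y: "filterlim Y at_top sequentially"
      by (rule filterlim_at_top_mono[OF X]) (simp add: Y_def)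
    have "(\<lambda>n. W2 (S (Y n)) (gibbs \<Psi> \<tau>)) \<longlonglongrightarrow> 0"
    proof (rule W2_gibbs_tendsto_0_if_energy)
      show "finite_energy \<Psi> (S (Y n))" for n by (rule fin) (simp add: Y_def)
      show "(\<lambda>n. mean (S (Y n))) \<longlonglongrightarrow> tilted_mean \<tau>" by (rule filterlim_compose[OF \<tau>(1) Y])
      show "(\<lambda>n. real_energy \<Psi> J (S (Y n))) \<longlonglongrightarrow> ?H (tilted_mean \<tau>)"
        using filterlim_compose[OF l(1) Y] by (simp add: e_def \<tau>(2) lm)
    qed
    moreover have "\<forall>\<^sub>F n in sequentially. W2 (S (Y n)) (gibbs \<Psi> \<tau>) = W2 (S (X n)) (gibbs \<Psi> \<tau>)"
      using filterlim_at_top[THEN iffD1, OF X, rule_format, of 1] by eventually_elim (simp add: Y_def max_def)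
    ultimately show "(\<lambda>n. W2 (S (X n)) (gibbs \<Psi> \<tau>)) \<longlonglongrightarrow> 0" by (rule Lim_transform_eventually)
  qed
  have "((\<lambda>t. free_energy \<Psi> J (S t)) \<longlongrightarrow> free_energy \<Psi> J (mu_minus \<Psi> J)) at_top"
  proof -
    have "((\<lambda>t. ereal (e t)) \<longlongrightarrow> ereal (?H ?m)) at_top" using l(1) lm by (simp add: tendsto_ereal)
    moreover have "\<forall>\<^sub>F t in at_top. ereal (e t) = free_energy \<Psi> J (S t)"
      using eventually_gt_at_top[of 0] by eventually_elim (simp add: e_def SP.flow_energy[OF flow \<mu>P])
    ultimately show ?thesis unfolding mu_minus_eq Fg tilted_mean_odd H_bar_even by (rule Lim_transform_eventually)
  qed
  moreover have "free_energy \<Psi> J (mu_minus \<Psi> J) = free_energy \<Psi> J (mu_plus \<Psi> J)"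
    by (simp add: mu_minus_eq mu_plus_eq Fg tilted_mean_odd H_bar_even)
  moreover have "((\<lambda>t. W2 (S t) (mu_plus \<Psi> J)) \<longlongrightarrow> 0) at_top" if "0 < mean \<mu>"
  proof -
    have "\<forall>\<^sub>F t in at_top. 0 < mean (S t)"
      using eventually_gt_at_top[of 0] by eventually_elim (rule SP.flow_mean_pos[OF flow \<mu>P that nz])
    from H_bar_tendsto_min[OF Hlim this] show ?thesis unfolding mu_plus_eq by (rule W) simp
  qed
  moreover have "((\<lambda>t. W2 (S t) (mu_minus \<Psi> J)) \<longlongrightarrow> 0) at_top" if "mean \<mu> < 0"
  proof -
    have "\<forall>\<^sub>F t in at_top. 0 < - mean (S t)"
      using eventually_gt_at_top[of 0] by eventually_elim (use SP.flow_mean_neg[OF flow \<mu>P that nz] in auto)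
    moreover have "((\<lambda>t. ?H (- mean (S t))) \<longlongrightarrow> ?H ?m) at_top" using Hlim by (simp add: H_bar_even)
    ultimately have "((\<lambda>t. - mean (S t)) \<longlongrightarrow> ?m) at_top" by (intro H_bar_tendsto_min)
    then have "((\<lambda>t. mean (S t)) \<longlongrightarrow> tilted_mean (- sigma_star)) at_top"
      using tendsto_minus[of "\<lambda>t. - mean (S t)" ?m at_top] by (simp add: tilted_mean_odd)
    then show ?thesis unfolding mu_minus_eq by (rule W) (simp add: tilted_mean_odd H_bar_even)
  qed
  ultimately show ?thesis by blast
qed

end
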